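(* Let $\underline{L}_1$ and $\underline{L}_2$ be two integral positive definite lattices of rank $n_1$ and $n_2$, respectively, whose associated bilinear modules $B_{\underline{L}_1}$ and $B_{\underline{L}_2}$ are isomorphic. Then for every $k\in\frac12\mathbb{Z}$ and every integer $h$ there is a natural isomorphism of complex vector spaces $$J_{k+\frac{n_1}2,\underline{L}_1}\bigl(\varepsilon^{h+3n_1}\bigr)\;\cong\;J_{k+\frac{n_2}2,\underline{L}_2}\bigl(\varepsilon^{h+3n_2}\bigr).$$
   Context: Notation: $e(x)=e^{2\pi i x}$, $\mathbb{H}$ is the upper half plane, $q^a=e(a\tau)$ for $\tau\in\mathbb{H}$. $G=\mathrm{Mp}(2,\mathbb{Z})$ is the group of pairs $(A,w)$ with $A=\begin{pmatrix}a&b\\c&d\end{pmatrix}\in\mathrm{SL}(2,\mathbb{Z})$ and $w$ a holomorphic function on $\mathbb{H}$ with $w(\tau)^2=c\tau+d$, with product $(A,w)(B,v)=(AB,\,w(B\tau)v(\tau))$. With $\eta(\tau)=q^{1/24}\prod_{m\ge1}(1-q^m)$, the linear character $\varepsilon$ of $G$ is $\varepsilon(A,w)=\eta(A\tau)/(\eta(\tau)w(\tau))$ (a constant). An integral lattice of rank $n$ is $\underline{L}=(L,\beta)$ with $L$ a free $\mathbb{Z}$-module of rank $n$ and $\beta$ a $\mathbb{Z}$-valued symmetric bilinear form on $L$; put $\beta(x)=\frac12\beta(x,x)$; $\beta$ is extended bilinearly to $R\otimes L$ for rings $R\supseteq\mathbb{Z}$. The shadow is $L^\bullet=\{r\in\mathbb{Q}\otimes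 L:\beta(r,x)\equiv\beta(x)\bmod\mathbb{Z}\text{ for all }x\in L\}$, and the dual is $L^\sharp=\{r\in\mathbb{Q}\otimes L:\beta(r,L)\subseteq\mathbb{Z}\}$. The associated bilinear module is $B_{\underline{L}}=(L^\sharp/L,\beta')$, the finite abelian group $L^\sharp/L$ with the bilinear map $\beta':L^\sharp/L\times L^\sharp/L\to\mathbb{Q}/\mathbb{Z}$, $\beta'(x+L,y+L)=\beta(x,y)+\mathbb{Z}$; isomorphisms of bilinear modules are group isomorphisms preserving the bilinear maps. $J_{k,\underline{L}}(\varepsilon^h)$ ($k\in\frac12\mathbb{Z}$, $h\in\mathbb{Z}$, $\underline{L}$ positive definite integral) is the space of holomorphic functions $\phi(\tau,z)$ on $\mathbb{H}\times(\mathbb{C}\otimes L)$ such that: (i) for all $\alpha=(A,w)\in G$ with $A=\begin{pmatrix}a&b\\c&d\end{pmatrix}$: $\phi\bigl(A\tau,\frac{z}{c\tau+d}\bigr)e\bigl(\frac{-c\beta(z)}{c\tau+d}\bigr)w(\tau)^{-2k}=\varepsilon^h(\alpha)\phi(\tau,z)$; (ii) for all $x,y\in L$: $\phi(\tau,z+x\tau+y)\,e(\tau\beta(x)+\beta(x,z))=e(\beta(x+y))\,\phi(\tau,z)$; (iii) $\phi$ has a Fourier expansion $\phi=\sum_{m\in\frac h{24}+\mathbb{Z}}\sum_{r\in L^\bullet,\,m\ge\beta(r)}c(m,r)\,q^m e(\beta(z,r))$. *)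

theory Defs
  imports
    "HOL-Analysis.Analysis"
    "HOL-Algebra.Coset"
begin

definition ee :: "complex \<Rightarrow> complex" where
  "ee x = exp (2 * of_real pi * \<i> * x)"


section \<open>Integral lattices\<close>

text \<open>
  After the choice of a basis, a free \<open>\<int>\<close>-module of rank \<open>n\<close> is \<open>\<int>\<^sup>n\<close> and a symmetric bilinear form
  on it is a symmetric Gram matrix. The basis is indexed by a subset \<open>idx L\<close> of a finite type
  rather than by a whole type, so that rank \<open>0\<close> is not excluded. \<open>R \<otimes> L\<close> then consists of the
  vectors over \<open>R\<close> supported on \<open>idx L\<close>; the entries of \<open>gram L\<close> outside \<open>idx L\<close> play no role.
\<close>

record 'n int_lattice =
  idx :: "'n set"
  gram :: "'n \<Rightarrow> 'n \<Rightarrow> int"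

definition rank_of :: "'n int_lattice \<Rightarrow> nat" where
  "rank_of L = card (idx L)"

definition scalars :: "'n::finite int_lattice \<Rightarrow> ('r::zero ^ 'n) set" where
  "scalars L = {x. \<forall>i. i \<notin> idx L \<longrightarrow> x $ i = 0}"

definition bil :: "'n::finite int_lattice \<Rightarrow> 'r::comm_ring_1 ^ 'n \<Rightarrow> 'r ^ 'n \<Rightarrow> 'r" where
  "bil L x y = (\<Sum>i\<in>idx L. \<Sum>j\<in>idx L. of_int (gram L i j) * x $ i * y $ j)"

definition qf :: "'n::finite int_lattice \<Rightarrow> 'r::field ^ 'n \<Rightarrow> 'r" where
  "qf L x = bil L x x / 2"

text \<open>\<open>L\<close> itself is taken as a subset of \<open>\<rat> \<otimes> L\<close>.\<close>

definition points :: "'n::finite int_lattice \<Rightarrow> (rat ^ 'n) set" where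
  "points L = {x \<in> scalars L. \<forall>i. x $ i \<in> \<int>}"

definition symmetric_form :: "'n int_lattice \<Rightarrow> bool" where
  "symmetric_form L \<longleftrightarrow> (\<forall>i\<in>idx L. \<forall>j\<in>idx L. gram L i j = gram L j i)"

definition positive_definite :: "'n::finite int_lattice \<Rightarrow> bool" where
  "positive_definite L \<longleftrightarrow> (\<forall>x\<in>points L. x \<noteq> 0 \<longrightarrow> bil L x x > 0)"

definition shadow :: "'n::finite int_lattice \<Rightarrow> (rat ^ 'n) set" where
  "shadow L = {r \<in> scalars L. \<forall>x\<in>points L. bil L r x - qf L x \<in> \<int>}"

definition dual :: "'n::finite int_lattice \<Rightarrow> (rat ^ 'n) set" where
  "dual L = {r \<in> scalars L. \<forall>x\<in>points L. bil L r x \<in> \<int>}"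


section \<open>The associated bilinear module\<close>

definition dual_group :: "'n::finite int_lattice \<Rightarrow> (rat ^ 'n) monoid" where
  "dual_group L = \<lparr>carrier = dual L, monoid.mult = (+), one = 0\<rparr>"

definition disc_group :: "'n::finite int_lattice \<Rightarrow> (rat ^ 'n) set monoid" where
  "disc_group L = dual_group L Mod points L"

text \<open>An element of \<open>\<rat>/\<int>\<close> is a coset of \<open>\<int>\<close>: for \<open>X = x + L\<close> and \<open>Y = y + L\<close> the following is
  \<open>\<beta>(x, y) + \<int>\<close>.\<close>

definition disc_form :: "'n::finite int_lattice \<Rightarrow> (rat ^ 'n) set \<Rightarrow> (rat ^ 'n) set \<Rightarrow> rat set" where
  "disc_form L X Y = {q. \<exists>x\<in>X. \<exists>y\<in>Y. q - bil L x y \<in> \<int>}"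

definition bilinear_module_iso ::
  "'m::finite int_lattice \<Rightarrow> 'n::finite int_lattice \<Rightarrow> ((rat ^ 'm) set \<Rightarrow> (rat ^ 'n) set) \<Rightarrow> bool" where
  "bilinear_module_iso L M \<gamma> \<longleftrightarrow>
     \<gamma> \<in> iso (disc_group L) (disc_group M) \<and>
     (\<forall>X\<in>carrier (disc_group L). \<forall>Y\<in>carrier (disc_group L).
        disc_form M (\<gamma> X) (\<gamma> Y) = disc_form L X Y)"


section \<open>The metaplectic group and its character\<close>

definition upper_half_plane :: "complex set" where
  "upper_half_plane = {\<tau>. Im \<tau> > 0}"

definition cocycle :: "int^2^2 \<Rightarrow> complex \<Rightarrow> complex" where
  "cocycle A \<tau> = of_int (A $ 2 $ 1) * \<tau> + of_int (A $ 2 $ 2)"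

definition moebius :: "int^2^2 \<Rightarrow> complex \<Rightarrow> complex" where
  "moebius A \<tau> = (of_int (A $ 1 $ 1) * \<tau> + of_int (A $ 1 $ 2)) / cocycle A \<tau>"

definition Mp2Z :: "((int^2^2) \<times> (complex \<Rightarrow> complex)) set" where
  "Mp2Z = {(A, w). det A = 1 \<and> w holomorphic_on upper_half_plane \<and>
                   (\<forall>\<tau>\<in>upper_half_plane. (w \<tau>)\<^sup>2 = cocycle A \<tau>)}"

definition dedekind_eta :: "complex \<Rightarrow> complex" where
  "dedekind_eta \<tau> = ee (\<tau> / 24) * (\<Prod>m. 1 - ee (of_nat (Suc m) * \<tau>))"

definition eps :: "int^2^2 \<Rightarrow> (complex \<Rightarrow> complex) \<Rightarrow> complex" where
  "eps A w = (THE c. \<forall>\<tau>\<in>upper_half_plane.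
      dedekind_eta (moebius A \<tau>) / (dedekind_eta \<tau> * w \<tau>) = c)"


section \<open>Jacobi forms of lattice index\<close>

definition complexify :: "(rat ^ 'n) \<Rightarrow> (complex ^ 'n)" where
  "complexify x = (\<chi> i. of_rat (x $ i))"

definition jacobi_domain :: "'n::finite int_lattice \<Rightarrow> (complex \<times> (complex ^ 'n)) set" where
  "jacobi_domain L = upper_half_plane \<times> scalars L"

text \<open>Complex differentiability in several variables. The domain is open in
  \<open>\<complex> \<times> (\<complex> \<otimes> L)\<close>, not necessarily in the ambient type, hence the derivative within \<open>S\<close>.\<close>

definition holomorphic_in :: "(complex \<times> (complex ^ 'n::finite) \<Rightarrow> complex) \<Rightarrow>
    (complex \<times> (complex ^ 'n)) set \<Rightarrow> bool" where
  "holomorphic_in \<phi> S \<longleftrightarrow>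
     (\<forall>p\<in>S. \<exists>D. (\<phi> has_derivative D) (at p within S) \<and>
               (\<forall>c \<tau> z. D (c * \<tau>, c *s z) = c * D (\<tau>, z)))"

definition fourier_index :: "'n::finite int_lattice \<Rightarrow> int \<Rightarrow> (rat \<times> (rat ^ 'n)) set" where
  "fourier_index L h = {(m, r). m - of_int h / 24 \<in> \<int> \<and> r \<in> shadow L \<and> m \<ge> qf L r}"

definition fourier_expansion :: "'n::finite int_lattice \<Rightarrow> int \<Rightarrow>
    (complex \<times> (complex ^ 'n) \<Rightarrow> complex) \<Rightarrow> (rat \<Rightarrow> (rat ^ 'n) \<Rightarrow> complex) \<Rightarrow> bool" where
  "fourier_expansion L h \<phi> c \<longleftrightarrow>
     (\<forall>(\<tau>, z)\<in>jacobi_domain L.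
        ((\<lambda>(m, r). c m r * ee (of_rat m * \<tau>) * ee (bil L z (complexify r)))
           has_sum \<phi> (\<tau>, z)) (fourier_index L h))"

text \<open>The weight \<open>k\<close> is meant to be a half-integer, so that \<open>\<lfloor>2 * k\<rfloor> = 2 * k\<close>. Functions on
  \<open>\<H> \<times> (\<complex> \<otimes> L)\<close> are represented by total functions that vanish off this domain.\<close>

definition jacobi_forms :: "'n::finite int_lattice \<Rightarrow> rat \<Rightarrow> int \<Rightarrow>
    (complex \<times> (complex ^ 'n) \<Rightarrow> complex) set" where
  "jacobi_forms L k h = {\<phi>.
     (\<forall>p. p \<notin> jacobi_domain L \<longrightarrow> \<phi> p = 0) \<and>
     holomorphic_in \<phi> (jacobi_domain L) \<and>
     (\<forall>(A, w)\<in>Mp2Z. \<forall>(\<tau>, z)\<in>jacobi_domain L.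
        \<phi> (moebius A \<tau>, (1 / cocycle A \<tau>) *s z)
          * ee (- of_int (A $ 2 $ 1) * qf L z / cocycle A \<tau>) * w \<tau> powi (- \<lfloor>2 * k\<rfloor>)
        = eps A w powi h * \<phi> (\<tau>, z)) \<and>
     (\<forall>x\<in>points L. \<forall>y\<in>points L. \<forall>(\<tau>, z)\<in>jacobi_domain L.
        \<phi> (\<tau>, z + \<tau> *s complexify x + complexify y)
          * ee (\<tau> * of_rat (qf L x) + bil L (complexify x) z)
        = ee (of_rat (qf L (x + y))) * \<phi> (\<tau>, z)) \<and>
     (\<exists>c. fourier_expansion L h \<phi> c)}"


section \<open>Natural isomorphisms\<close>

definition complex_linear_iso ::
  "('a \<Rightarrow> complex) set \<Rightarrow> ('b \<Rightarrow> complex) set \<Rightarrow> (('a \<Rightarrow> complex) \<Rightarrow> 'b \<Rightarrow> complex) \<Rightarrow> bool" where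
  "complex_linear_iso V W \<Phi> \<longleftrightarrow>
     bij_betw \<Phi> V W \<and>
     (\<forall>f\<in>V. \<forall>g\<in>V. \<Phi> (\<lambda>p. f p + g p) = (\<lambda>p. \<Phi> f p + \<Phi> g p)) \<and>
     (\<forall>a. \<forall>f\<in>V. \<Phi> (\<lambda>p. a * f p) = (\<lambda>p. a * \<Phi> f p))"

text \<open>
  The graph of an isomorphism \<open>\<gamma>\<close> of the bilinear modules of \<open>L\<close> and \<open>M\<close> defines a unimodular
  lattice \<open>U \<supseteq> L \<oplus> M\<close> with respect to the form \<open>\<beta>\<^sub>L - \<beta>\<^sub>M\<close>; its shadow is contained in
  \<open>L\<^sup>\<bullet> \<times> M\<^sup>\<bullet>\<close> and is a coset \<open>\<rho> + U\<close>.
\<close>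

definition glue :: "'m::finite int_lattice \<Rightarrow> 'n::finite int_lattice \<Rightarrow>
    ((rat ^ 'm) set \<Rightarrow> (rat ^ 'n) set) \<Rightarrow> ((rat ^ 'm) \<times> (rat ^ 'n)) set" where
  "glue L M \<gamma> = {(x, y). x \<in> dual L \<and> y \<in> dual M \<and>
     \<gamma> (points L #>\<^bsub>dual_group L\<^esub> x) = points M #>\<^bsub>dual_group M\<^esub> y}"

definition glue_shadow :: "'m::finite int_lattice \<Rightarrow> 'n::finite int_lattice \<Rightarrow>
    ((rat ^ 'm) set \<Rightarrow> (rat ^ 'n) set) \<Rightarrow> ((rat ^ 'm) \<times> (rat ^ 'n)) set" where
  "glue_shadow L M \<gamma> = {(r, s). r \<in> scalars L \<and> s \<in> scalars M \<and>
     (\<forall>(x, y)\<in>glue L M \<gamma>. (bil L r x - bil M s y) - (qf L x - qf M y) \<in> \<int>)}"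

text \<open>
  By the theta decomposition, \<open>c(D + \<beta>(r), r)\<close>, for fixed \<open>D\<close>, depends up to an explicit sign
  only on \<open>r\<close> modulo the lattice. The isomorphism attached to \<open>\<gamma>\<close> identifies these coefficients
  along the shadow \<open>\<rho> + U\<close>; another choice of \<open>\<rho>\<close> changes it at most by a sign.
\<close>

definition induced_by :: "'m::finite int_lattice \<Rightarrow> 'n::finite int_lattice \<Rightarrow>
    ((rat ^ 'm) set \<Rightarrow> (rat ^ 'n) set) \<Rightarrow> (rat ^ 'm) \<times> (rat ^ 'n) \<Rightarrow> rat \<Rightarrow> int \<Rightarrow> int \<Rightarrow>
    ((complex \<times> (complex ^ 'm) \<Rightarrow> complex) \<Rightarrow> complex \<times> (complex ^ 'n) \<Rightarrow> complex) \<Rightarrow> bool" where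
  "induced_by L M \<gamma> \<rho> k h h' \<Phi> \<longleftrightarrow>
     (\<forall>\<phi>\<in>jacobi_forms L k h. \<forall>c c'.
        fourier_expansion L h \<phi> c \<longrightarrow> fourier_expansion M h' (\<Phi> \<phi>) c' \<longrightarrow>
        (\<forall>(x, y)\<in>glue L M \<gamma>. \<forall>D.
           let r = fst \<rho> + x; s = snd \<rho> + y in
           (D + qf L r, r) \<in> fourier_index L h \<longrightarrow>
           c' (D + qf M s) s = ee (of_rat (qf L x - qf M y)) * c (D + qf L r) r))"

end

theory Submission
  imports Defs "HOL-Complex_Analysis.Complex_Analysis" "HOL-Probability.Characteristic_Functions"
begin

text \<open>
  A Jacobi form \<open>\<phi>\<close> of lattice index is the same thing as its family of theta
  coefficients. The translation law forces \<open>\<phi>(\<tau>, z) = \<Sum>\<^sub>r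
  h\<^sub>r(\<tau>) q\<^bsup>\<beta>(r)\<^esup> e(\<beta>(z, r))\<close>, the sum running over
  the shadow, with \<open>h\<^bsub>r+x\<^esub> = e(\<beta>(x)) h\<^sub>r\<close> for
  \<open>x\<close> in the lattice. The metaplectic group is generated by \<open>T\<close>,
  \<open>S\<close> and \<open>(1, -1)\<close>, so the modular law amounts to three conditions on
  the \<open>h\<^sub>r\<close>: the exponents \<open>D\<close> of \<open>h\<^sub>r\<close>
  satisfy \<open>D + \<beta>(r) - h/24 \<in> \<int>\<close>; the inversion \<open>\<tau>
  \<mapsto> -1/\<tau>\<close> acts on the family by the finite Fourier transform with kernel
  \<open>e(-\<beta>(r, s))\<close> on the shadow modulo the lattice; and \<open>2k\<close> and
  \<open>h\<close> have the same parity unless \<open>\<phi> = 0\<close>. This equivalence is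
  the content of \<open>jacobi_series_in_jacobi_forms\<close> and
  \<open>jacobi_form_coeffs\<close>.

  These conditions see the lattice only through its shadow modulo the lattice and through its
  rank. An isomorphism of bilinear modules glues the two lattices to a unimodular lattice
  \<open>U\<close> for the form \<open>\<beta>\<^sub>L - \<beta>\<^sub>M\<close>. Its shadow
  \<open>\<rho> + U\<close> pairs the classes of the two shadows (\<open>partners\<close>), and
  the theta coefficients are transported along these pairs with the sign \<open>e(\<beta>(x) -
  \<beta>(y))\<close> at \<open>\<rho> + (x, y)\<close> (\<open>transfer\<close>). What has to
  be matched are two constants: the exponents of the coefficients change by \<open>\<beta>(r) -
  \<beta>(s)\<close>, and the Fourier kernels by \<open>e(-2(\<beta>(r\<^sub>0) -
  \<beta>(s\<^sub>0)))\<close>. The congruence \<open>\<beta>(r) - \<beta>(s) \<equiv>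
  (n\<^sub>1 - n\<^sub>2)/8\<close> modulo \<open>1\<close> for partners
  (\<open>van_der_blij\<close>, \<open>qf_shadow_difference\<close>) settles both: \<open>3n/24
  = n/8\<close> explains the power \<open>3n\<close> of the character, and the shifts of weight
  and character together absorb the factor \<open>csqrt(\<tau>/\<i>)\<^sup>n\<close> of the
  inversion formula up to \<open>e(-n/4)\<close> (\<open>inversion_law_reduced\<close>), which
  the change of the Fourier kernel compensates.

  The congruence follows by comparing, for both lattices, the formula of Milgram for the Gauss
  sum \<open>\<Sum> e(\<beta>(r))\<close> over the shadow modulo the lattice. Milgram's formula
  itself comes from the relation \<open>S T S = T\<^sup>-\<^sup>1 S T\<^sup>-\<^sup>1\<close>
  applied to a theta series at one point. The inversion formula for theta series is Poisson
  summation over the shadow; in rational coordinates that diagonalise the form it is a product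
  of one-dimensional formulas. Its positive constant (in truth the inverse square root of a
  discriminant) is never computed: Milgram's formula fixes its product with the absolute value
  of the Gauss sum, and so it agrees for the two lattices.

  The values of the character at the generators come from the two transformation laws of the
  Dedekind eta function. The inversion law is obtained from Euler's pentagonal number theorem,
  in the finite form due to Shanks, and again from the one-dimensional Poisson formula.
\<close>

section \<open>Sums of exponentials\<close>

lemma has_sum_finite_sum:
  fixes f :: "'j \<Rightarrow> 'i \<Rightarrow> complex"
  assumes "finite A" "\<And>j. j \<in> A \<Longrightarrow> (f j has_sum F j) S"
  shows "((\<lambda>s. \<Sum>j\<in>A. f j s) has_sum (\<Sum>j\<in>A. F j)) S"
  using assms by (induction A rule: finite_induct) (auto intro: has_sum_add)

lemma has_sum_minus:
  fixes f g :: "'i \<Rightarrow> complex"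
  assumes "(f has_sum a) S" "(g has_sum b) S"
  shows "((\<lambda>x. f x - g x) has_sum (a - b)) S"
  using has_sum_add[OF assms(1), of "\<lambda>x. - g x" "- b"] assms(2) by (simp add: has_sum_uminus)

lemma summable_on_norm_bound:
  fixes f :: "'i \<Rightarrow> complex"
  assumes "g summable_on S" "\<And>i. i \<in> S \<Longrightarrow> norm (f i) \<le> g i"
  shows "f summable_on S"
  using Infinite_Sum.abs_summable_on_comparison_test'[OF assms] by (rule abs_summable_summable)

lemma ee_add: "ee (x + y) = ee x * ee y"
  by (simp add: ee_def exp_add distrib_left)

lemma ee_0 [simp]: "ee 0 = 1"
  by (simp add: ee_def)

lemma ee_minus: "ee (- x) = inverse (ee x)"
  by (simp add: ee_def exp_minus)

lemma ee_diff: "ee (x - y) = ee x / ee y"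
  by (simp add: ee_def exp_diff right_diff_distrib)

lemma ee_nonzero [simp]: "ee x \<noteq> 0"
  by (simp add: ee_def)

lemma ee_of_int [simp]: "ee (of_int n) = 1"
  by (simp add: ee_def exp_eq_1)

lemma ee_Ints: "x \<in> \<int> \<Longrightarrow> ee x = 1"
  by (auto elim!: Ints_cases)

lemma ee_eq_1_iff: "ee x = 1 \<longleftrightarrow> x \<in> \<int>"
proof
  assume "ee x = 1"
  then obtain n :: int where n: "2 * of_real pi * \<i> * x = of_real (of_int (2 * n) * pi) * \<i>"
    unfolding ee_def exp_eq_1 by (auto simp: complex_eq_iff)
  then have "x = of_int n" by (simp add: field_simps)
  then show "x \<in> \<int>" by simp
qed (rule ee_Ints)

lemma ee_eq_ee_iff: "ee x = ee y \<longleftrightarrow> x - y \<in> \<int>"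
  using ee_eq_1_iff[of "x - y"] by (simp add: ee_diff)

lemma norm_ee: "norm (ee x) = exp (- 2 * pi * Im x)"
  by (simp add: ee_def)

lemma norm_ee_real [simp]: "norm (ee (of_real x)) = 1"
  by (simp add: norm_ee)

lemma ee_power: "ee x ^ n = ee (of_nat n * x)"
  by (simp add: ee_def exp_of_nat_mult[symmetric] algebra_simps)

text \<open>
  Termwise differentiation of a sum of exponentials of linear forms. The summability hypothesis
  dominates the terms on the whole ball of radius \<open>\<delta>\<close> around
  \<open>p\<close>, since \<open>\<bar>exp (l\<^sub>i q)\<bar> \<le> exp (Re (l\<^sub>i p) +
  \<delta> B\<^sub>i)\<close> there; the surplus \<open>exp (\<delta> B\<^sub>i)\<close> also
  absorbs the factors \<open>B\<^sub>i\<close> and \<open>B\<^sub>i\<^sup>2\<close> of the first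
  derivative and of the remainder.
\<close>
lemma exp_sum_has_derivative:
  fixes c :: "'i \<Rightarrow> complex" and l :: "'i \<Rightarrow> 'e::real_normed_vector \<Rightarrow> complex" and B :: "'i \<Rightarrow> real"
  assumes lin: "\<And>i. i \<in> S \<Longrightarrow> linear (l i)"
    and bd: "\<And>i v. i \<in> S \<Longrightarrow> norm (l i v) \<le> B i * norm v"
    and B0: "\<And>i. i \<in> S \<Longrightarrow> B i \<ge> 0"
    and d: "\<delta> > 0"
    and summ: "(\<lambda>i. norm (c i) * exp (Re (l i p) + \<delta> * B i)) summable_on S"
  shows "((\<lambda>q. \<Sum>\<^sub>\<infinity>i\<in>S. c i * exp (l i q)) has_derivative
          (\<lambda>v. \<Sum>\<^sub>\<infinity>i\<in>S. c i * exp (l i p) * l i v)) (at p)"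
proof -
  define M where "M = (\<Sum>\<^sub>\<infinity>i\<in>S. norm (c i) * exp (Re (l i p) + \<delta> * B i))"
  have M: "((\<lambda>i. norm (c i) * exp (Re (l i p) + \<delta> * B i)) has_sum M) S"
    using summ by (simp add: M_def)
  have absI: "f summable_on S" if "\<And>i. i \<in> S \<Longrightarrow> norm (f i) \<le> K * (norm (c i) * exp (Re (l i p) + \<delta> * B i))" for f :: "'i \<Rightarrow> complex" and K
  proof (rule summable_on_norm_bound)
    show "(\<lambda>i. K * (norm (c i) * exp (Re (l i p) + \<delta> * B i))) summable_on S"
      by (intro summable_on_cmult_right summ)
  qed (use that in auto)
  have normI: "norm (\<Sum>\<^sub>\<infinity>i\<in>S. f i) \<le> K * M" if "\<And>i. i \<in> S \<Longrightarrow> norm (f i) \<le> K * (norm (c i) * exp (Re (l i p) + \<delta> * B i))" for f :: "'i \<Rightarrow> complex" and K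
  proof (rule norm_infsum_le)
    show "(f has_sum infsum f S) S" using absI[OF that] by simp
    show "((\<lambda>i. K * (norm (c i) * exp (Re (l i p) + \<delta> * B i))) has_sum K * M) S"
      by (rule has_sum_cmult_right[OF M])
  qed (use that in auto)
  have b0: "norm (c i * exp (l i p)) \<le> 1 * (norm (c i) * exp (Re (l i p) + \<delta> * B i))" if "i \<in> S" for i
    using B0[OF that] d by (auto simp: norm_mult intro!: mult_left_mono)
  have b1: "norm (c i * exp (l i p) * l i v) \<le> norm v / \<delta> * (norm (c i) * exp (Re (l i p) + \<delta> * B i))" if "i \<in> S" for i v
  proof -
    have "\<delta> * B i \<le> exp (\<delta> * B i)" using exp_ge_add_one_self[of "\<delta> * B i"] by linarith
    then have "(\<delta> * B i) * norm v \<le> exp (\<delta> * B i) * norm v" by (rule mult_right_mono) simp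
    then have "B i * norm v \<le> norm v / \<delta> * exp (\<delta> * B i)" using d
      by (simp add: field_simps)
    with bd[OF that, of v] have "norm (l i v) \<le> norm v / \<delta> * exp (\<delta> * B i)" by linarith
    then have "norm (c i) * exp (Re (l i p)) * norm (l i v) \<le> norm (c i) * exp (Re (l i p)) * (norm v / \<delta> * exp (\<delta> * B i))"
      by (intro mult_left_mono) auto
    then show ?thesis by (simp add: norm_mult exp_add algebra_simps)
  qed
  \<comment> \<open>Second-order remainder, with half of the surplus \<open>exp (\<delta> B\<^sub>i)\<close> spent
    on \<open>exp \<bar>w\<bar>\<close> and half on \<open>B\<^sub>i\<^sup>2\<close>.\<close>
  have b2: "norm (c i * exp (l i (p + v)) - c i * exp (l i p) - c i * exp (l i p) * l i v)
       \<le> 8 / \<delta>\<^sup>2 * (norm v)\<^sup>2 * (norm (c i) * exp (Re (l i p) + \<delta> * B i))" if "i \<in> S" "norm v \<le> \<delta> / 2" for i v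
  proof -
    define w where "w = l i v"
    have lw: "l i (p + v) = l i p + w" using lin[OF that(1)] by (simp add: linear_add w_def)
    have Bv: "B i * norm v \<le> B i * (\<delta> / 2)" using that B0 by (intro mult_left_mono) auto
    have nw: "norm w \<le> B i * norm v" using bd[OF that(1)] by (simp add: w_def)
    have "norm (exp w - 1 - w) \<le> exp \<bar>Re w\<bar> * (norm w)\<^sup>2"
      using Taylor_exp[of w 1] by (simp add: power2_eq_square algebra_simps)
    also have "\<dots> \<le> exp (B i * (\<delta> / 2)) * (B i * norm v)\<^sup>2"
      using nw Bv abs_Re_le_cmod[of w] by (intro mult_mono power_mono) auto
    also have "\<dots> = exp (B i * (\<delta> / 2)) * ((norm v)\<^sup>2 * (B i)\<^sup>2)" by (simp add: power_mult_distrib mult.commute)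
    also have "\<dots> \<le> exp (B i * (\<delta> / 2)) * ((norm v)\<^sup>2 * (8 / \<delta>\<^sup>2 * exp (B i * (\<delta> / 2))))"
    proof -
      have "1 + B i * (\<delta> / 2) + (B i * (\<delta> / 2))\<^sup>2 / 2 \<le> exp (B i * (\<delta> / 2))"
        using B0[OF that(1)] d by (intro exp_lower_Taylor_quadratic) auto
      then have "(B i * (\<delta> / 2))\<^sup>2 / 2 \<le> exp (B i * (\<delta> / 2))" using B0[OF that(1)] d
        by (smt (verit) mult_nonneg_nonneg half_gt_zero)
      then have "(B i)\<^sup>2 \<le> 8 / \<delta>\<^sup>2 * exp (B i * (\<delta> / 2))" using d by (simp add: field_simps power2_eq_square)
      then show ?thesis by (intro mult_left_mono) auto
    qed
    also have "\<dots> = 8 / \<delta>\<^sup>2 * (norm v)\<^sup>2 * exp (\<delta> * B i)"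
      by (simp add: exp_add[symmetric] algebra_simps)
    finally have *: "norm (exp w - 1 - w) \<le> 8 / \<delta>\<^sup>2 * (norm v)\<^sup>2 * exp (\<delta> * B i)" .
    have "c i * exp (l i (p + v)) - c i * exp (l i p) - c i * exp (l i p) * l i v = c i * exp (l i p) * (exp w - 1 - w)"
      by (simp add: lw exp_add algebra_simps w_def)
    then have "norm (c i * exp (l i (p + v)) - c i * exp (l i p) - c i * exp (l i p) * l i v) = norm (c i) * exp (Re (l i p)) * norm (exp w - 1 - w)"
      by (simp add: norm_mult)
    also have "\<dots> \<le> norm (c i) * exp (Re (l i p)) * (8 / \<delta>\<^sup>2 * (norm v)\<^sup>2 * exp (\<delta> * B i))"
      using * by (intro mult_left_mono) auto
    finally show ?thesis by (simp add: exp_add algebra_simps)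
  qed
  have sD: "(\<lambda>i. c i * exp (l i p) * l i v) summable_on S" for v by (rule absI[OF b1])
  have bq: "norm (c i * exp (l i (p + v))) \<le> 1 * (norm (c i) * exp (Re (l i p) + \<delta> * B i))" if "i \<in> S" "norm v \<le> \<delta> / 2" for i v
  proof -
    have "Re (l i v) \<le> \<delta> * B i"
      using bd[OF that(1), of v] complex_Re_le_cmod[of "l i v"] that B0[OF that(1)] d
        mult_left_mono[OF that(2), of "B i"] by (smt (verit, ccfv_SIG) mult.commute mult_nonneg_nonneg field_sum_of_halves distrib_right)
    then show ?thesis using lin[OF that(1)] by (auto simp: norm_mult linear_add intro!: mult_left_mono)
  qed
  define D where "D = (\<lambda>v. \<Sum>\<^sub>\<infinity>i\<in>S. c i * exp (l i p) * l i v)"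
  have "bounded_linear D"
  proof (rule bounded_linear_intro[where K="M / \<delta>"])
    show "D (x + y) = D x + D y" for x y unfolding D_def
      by (subst infsum_add[OF sD sD, symmetric]) (auto intro!: infsum_cong simp: linear_add[OF lin] algebra_simps)
    show "D (r *\<^sub>R x) = r *\<^sub>R D x" for r x unfolding D_def
      by (subst infsum_scaleR_right[symmetric]) (auto intro!: infsum_cong simp: linear_scale[OF lin] algebra_simps)
    show "norm (D x) \<le> norm x * (M / \<delta>)" for x
      unfolding D_def using normI[OF b1] by (simp add: mult.commute)
  qed
  moreover have "((\<lambda>v. norm ((\<Sum>\<^sub>\<infinity>i\<in>S. c i * exp (l i (p + v))) - (\<Sum>\<^sub>\<infinity>i\<in>S. c i * exp (l i p)) - D v) / norm v) \<longlongrightarrow> 0) (at 0)"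
  proof (rule tendsto_sandwich[where f="\<lambda>_. 0" and h="\<lambda>v. 8 / \<delta>\<^sup>2 * norm v * M"])
    show "\<forall>\<^sub>F v in at 0. norm ((\<Sum>\<^sub>\<infinity>i\<in>S. c i * exp (l i (p + v))) - (\<Sum>\<^sub>\<infinity>i\<in>S. c i * exp (l i p)) - D v) / norm v \<le> 8 / \<delta>\<^sup>2 * norm v * M"
    proof -
      have "\<forall>\<^sub>F v in at (0::'e). norm v < \<delta> / 2 \<and> v \<noteq> 0"
        using d by (auto simp: eventually_at dist_norm intro!: exI[of _ "\<delta> / 2"])
      then show ?thesis
      proof eventually_elim
        case (elim v)
        have "(\<Sum>\<^sub>\<infinity>i\<in>S. c i * exp (l i (p + v))) - (\<Sum>\<^sub>\<infinity>i\<in>S. c i * exp (l i p)) - D v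
           = (\<Sum>\<^sub>\<infinity>i\<in>S. c i * exp (l i (p + v)) - c i * exp (l i p) - c i * exp (l i p) * l i v)"
          unfolding D_def using elim
          by (intro infsumI[symmetric] has_sum_minus has_sum_infsum absI[OF bq] absI[OF b0] sD) auto
        also have "norm \<dots> \<le> 8 / \<delta>\<^sup>2 * (norm v)\<^sup>2 * M"
          using elim by (intro normI b2) auto
        finally show ?case using elim by (simp add: field_simps power2_eq_square)
      qed
    qed
    show "((\<lambda>v. 8 / \<delta>\<^sup>2 * norm v * M) \<longlongrightarrow> 0) (at 0)"
      by (rule tendsto_eq_intros refl | simp)+
  qed auto
  ultimately show ?thesis
    unfolding D_def has_derivative_at by auto
qed

lemma summable_on_exp_minus_abs: "(\<lambda>n::int. exp (- real_of_int \<bar>n\<bar>)) summable_on UNIV"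
proof -
  have *: "(\<lambda>n::nat. exp (- real n)) summable_on UNIV"
  proof (rule summable_nonneg_imp_summable_on)
    have "summable (\<lambda>n. exp (-1 :: real) ^ n)" by (rule summable_geometric) auto
    then show "summable (\<lambda>n::nat. exp (- real n))" by (simp add: exp_of_nat_mult[symmetric])
  qed auto
  have 1: "(\<lambda>n::int. exp (- real_of_int \<bar>n\<bar>)) summable_on range int"
    by (subst summable_on_reindex) (use * in \<open>auto simp: o_def\<close>)
  have 2: "(\<lambda>n::int. exp (- real_of_int \<bar>n\<bar>)) summable_on range (\<lambda>n. - int n)"
    by (subst summable_on_reindex) (use * in \<open>auto simp: o_def inj_on_def\<close>)
  have "UNIV = range int \<union> range (\<lambda>n. - int n)"
    by (auto intro: int_cases2)
  with summable_on_union[OF 1 2] show ?thesis by simp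
qed

lemma gauss_le_exp_minus_abs:
  assumes "a > 0"
  shows "exp (- a * (real_of_int n)\<^sup>2 + b * \<bar>real_of_int n\<bar>) \<le> exp ((b + 1)\<^sup>2 / (4 * a)) * exp (- real_of_int \<bar>n\<bar>)"
proof -
  have "0 \<le> a * (\<bar>real_of_int n\<bar> - (b + 1) / (2 * a))\<^sup>2" using assms by simp
  also have "\<dots> = a * (real_of_int n)\<^sup>2 - (b + 1) * \<bar>real_of_int n\<bar> + (b + 1)\<^sup>2 / (4 * a)"
    using assms by (simp add: power2_diff field_simps) (simp add: power2_eq_square algebra_simps)
  finally have "- a * (real_of_int n)\<^sup>2 + b * \<bar>real_of_int n\<bar> \<le> (b + 1)\<^sup>2 / (4 * a) - real_of_int \<bar>n\<bar>"
    by (simp add: algebra_simps)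
  then show ?thesis by (simp add: exp_add[symmetric])
qed

lemma gauss_summable_on_int:
  assumes "a > 0"
  shows "(\<lambda>n::int. exp (- a * (real_of_int n)\<^sup>2 + b * \<bar>real_of_int n\<bar>)) summable_on UNIV"
proof (rule summable_on_comparison_test)
  show "(\<lambda>n::int. exp ((b + 1)\<^sup>2 / (4 * a)) * exp (- real_of_int \<bar>n\<bar>)) summable_on UNIV"
    by (intro summable_on_cmult_right summable_on_exp_minus_abs)
  show "exp (- a * (real_of_int x)\<^sup>2 + b * \<bar>real_of_int x\<bar>) \<le> exp ((b + 1)\<^sup>2 / (4 * a)) * exp (- real_of_int \<bar>x\<bar>)" for x
    by (rule gauss_le_exp_minus_abs[OF assms])
qed auto

section \<open>Uniqueness of Fourier coefficients\<close>

lemma root_of_unity_average: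
  assumes "N > 0"
  shows "(\<Sum>j<N. ee (of_real (real j / real N) * of_int l)) = (if int N dvd l then of_nat N else 0)"
proof -
  define w where "w = ee (of_int l / of_nat N)"
  have pw: "ee (of_real (real j / real N) * of_int l) = w ^ j" for j
    by (simp add: w_def ee_power)
  have wN: "w ^ N = 1" using assms by (simp add: w_def ee_power)
  have w1: "w = 1 \<longleftrightarrow> int N dvd l"
  proof -
    have "w = 1 \<longleftrightarrow> (of_int l / of_nat N :: complex) \<in> \<int>" by (simp add: w_def ee_eq_1_iff)
    also have "\<dots> \<longleftrightarrow> int N dvd l"
    proof
      assume "(of_int l / of_nat N :: complex) \<in> \<int>"
      then obtain k where "(of_int l / of_nat N :: complex) = of_int k" by (auto elim: Ints_cases)
      then have "(of_int l :: complex) = of_int (k * int N)" using assms by (simp add: field_simps)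
      then have "l = k * int N" by (simp only: of_int_eq_iff)
      then show "int N dvd l" by simp
    next
      assume "int N dvd l"
      then obtain k where "l = int N * k" by auto
      then show "(of_int l / of_nat N :: complex) \<in> \<int>" using assms by simp
    qed
    finally show ?thesis .
  qed
  show ?thesis
  proof (cases "w = 1")
    case True then show ?thesis using w1 by (simp only: pw) simp
  next
    case False then show ?thesis using w1 wN by (simp only: pw) (simp add: geometric_sum)
  qed
qed

text \<open>
  A Fourier coefficient is extracted without integration, so that only convergent sums are
  involved: averaging over \<open>u = j/N\<close> with the weights \<open>e(-jk/N)\<close> keeps
  exactly the terms with \<open>l(s) \<equiv> k\<close> modulo \<open>N\<close>, and for large
  \<open>N\<close> those among them with \<open>l(s) \<noteq> k\<close> lie outside any given
  finite set.
\<close>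
lemma fourier_coefficient_sum_eq_0:
  fixes a :: "'i \<Rightarrow> complex" and l :: "'i \<Rightarrow> int"
  assumes summ: "a summable_on S"
    and zero: "\<And>u::real. (\<Sum>\<^sub>\<infinity>s\<in>S. a s * ee (of_real u * of_int (l s))) = 0"
  shows "(\<Sum>\<^sub>\<infinity>s\<in>{s\<in>S. l s = k}. a s) = 0"
proof -
  have abs: "(\<lambda>s. norm (a s)) summable_on S" using summ by (simp add: summable_on_iff_abs_summable_on_complex[symmetric])
  have hs: "((\<lambda>s. a s * ee (of_real u * of_int (l s))) has_sum 0) S" for u :: real
  proof -
    have "(\<lambda>s. a s * ee (of_real u * of_int (l s))) summable_on S"
    proof (rule abs_summable_summable, rule summable_on_cong[THEN iffD1, OF _ abs])
      show "norm (a s) = norm (a s * ee (of_real u * of_int (l s)))" for s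
        using norm_ee_real[of "u * of_int (l s)"] by (simp add: norm_mult)
    qed
    then show ?thesis using zero[of u] by (simp add: has_sum_iff)
  qed
  have div: "(\<Sum>\<^sub>\<infinity>s\<in>{s\<in>S. int N dvd l s - k}. a s) = 0" if N: "N > 0" for N
  proof -
    have "((\<lambda>s. \<Sum>j<N. ee (- of_real (real j / real N) * of_int k) * (a s * ee (of_real (real j / real N) * of_int (l s)))) has_sum
       (\<Sum>j<N. ee (- of_real (real j / real N) * of_int k) * 0)) S"
      by (intro has_sum_finite_sum has_sum_cmult_right hs) auto
    moreover have "(\<Sum>j<N. ee (- of_real (real j / real N) * of_int k) * (a s * ee (of_real (real j / real N) * of_int (l s))))
        = of_nat N * (if int N dvd l s - k then a s else 0)" for s
    proof -
      have "(\<Sum>j<N. ee (- of_real (real j / real N) * of_int k) * (a s * ee (of_real (real j / real N) * of_int (l s))))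
         = a s * (\<Sum>j<N. ee (of_real (real j / real N) * of_int (l s - k)))"
        by (simp add: sum_distrib_left ee_add[symmetric] algebra_simps)
      then show ?thesis using N by (simp only: root_of_unity_average[OF N]) auto
    qed
    ultimately have "((\<lambda>s. of_nat N * (if int N dvd l s - k then a s else 0)) has_sum of_nat N * 0) S" by simp
    then have "((\<lambda>s. if int N dvd l s - k then a s else 0) has_sum 0) S"
      using N by (subst (asm) has_sum_cmult_right_iff) auto
    then have "(a has_sum 0) {s\<in>S. int N dvd l s - k}"
      by (rule has_sum_cong_neutral[THEN iffD1, rotated -1]) auto
    then show ?thesis by (rule infsumI)
  qed
  have "norm (\<Sum>\<^sub>\<infinity>s\<in>{s\<in>S. l s = k}. a s) \<le> e" if e: "e > 0" for e :: real
  proof -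
    obtain F where F: "finite F" "F \<subseteq> S" "dist (\<Sum>s\<in>F. norm (a s)) (\<Sum>\<^sub>\<infinity>s\<in>S. norm (a s)) \<le> e"
      using infsum_finite_approximation[OF abs e] by auto
    define N where "N = nat (Max (insert 0 ((\<lambda>s. \<bar>l s - k\<bar>) ` F)) + 1)"
    have N: "\<bar>l s - k\<bar> < int N" if "s \<in> F" for s
    proof -
      have "\<bar>l s - k\<bar> \<le> Max (insert 0 ((\<lambda>s. \<bar>l s - k\<bar>) ` F))" using F that by (intro Max_ge) auto
      then show ?thesis by (simp add: N_def)
    qed
    have N0: "N > 0" using F by (simp add: N_def)
    define T where "T = {s\<in>S. int N dvd l s - k} - {s\<in>S. l s = k}"
    have TS: "T \<subseteq> S - F"
    proof
      fix s assume s: "s \<in> T"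
      have "s \<notin> F"
      proof
        assume "s \<in> F"
        with s N[of s] show False using zdvd_imp_le[of "int N" "\<bar>l s - k\<bar>"] by (auto simp: T_def)
      qed
      with s show "s \<in> S - F" by (auto simp: T_def)
    qed
    have sT: "a summable_on T" and sk: "a summable_on {s\<in>S. l s = k}"
      using summ by (auto intro: summable_on_subset_banach simp: T_def)
    have "{s\<in>S. int N dvd l s - k} = {s\<in>S. l s = k} \<union> T" by (auto simp: T_def)
    then have "0 = (\<Sum>\<^sub>\<infinity>s\<in>{s\<in>S. l s = k} \<union> T. a s)" using div[OF N0] by simp
    also have "\<dots> = (\<Sum>\<^sub>\<infinity>s\<in>{s\<in>S. l s = k}. a s) + (\<Sum>\<^sub>\<infinity>s\<in>T. a s)"
      by (intro infsum_Un_disjoint sT sk) (auto simp: T_def)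
    finally have "norm (\<Sum>\<^sub>\<infinity>s\<in>{s\<in>S. l s = k}. a s) = norm (\<Sum>\<^sub>\<infinity>s\<in>T. a s)"
      by (metis add_eq_0_iff norm_minus_cancel)
    also have "\<dots> \<le> (\<Sum>\<^sub>\<infinity>s\<in>T. norm (a s))"
      by (intro norm_infsum_bound summable_on_subset_banach[OF abs]) (use TS in auto)
    also have "\<dots> \<le> (\<Sum>\<^sub>\<infinity>s\<in>S - F. norm (a s))"
      using TS by (intro infsum_mono2 summable_on_subset_banach[OF abs]) auto
    also have "\<dots> = (\<Sum>\<^sub>\<infinity>s\<in>S. norm (a s)) - (\<Sum>s\<in>F. norm (a s))"
      using F abs by (subst infsum_Diff) auto
    also have "\<dots> \<le> e" using F(3) by (simp add: dist_real_def)
    finally show ?thesis .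
  qed
  then have "norm (\<Sum>\<^sub>\<infinity>s\<in>{s\<in>S. l s = k}. a s) \<le> 0" by (rule field_le_epsilon[of _ 0, simplified])
  then show ?thesis by simp
qed

text \<open>
  The frequencies are fixed one coordinate at a time: while the coordinates in \<open>K\<close>
  are already fixed, the remaining exponentials are part of the coefficients.
\<close>
lemma multiple_fourier_coefficient_eq_0:
  fixes a :: "'i \<Rightarrow> complex" and l :: "'i \<Rightarrow> 'j \<Rightarrow> int"
  assumes fin: "finite J" and summ: "a summable_on S"
    and zero: "\<And>u::'j \<Rightarrow> real. (\<Sum>\<^sub>\<infinity>s\<in>S. a s * ee (\<Sum>j\<in>J. of_real (u j) * of_int (l s j))) = 0"
    and inj: "inj_on (\<lambda>s. restrict (l s) J) S" and s: "s \<in> S"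
  shows "a s = 0"
proof -
  have "(\<Sum>\<^sub>\<infinity>t\<in>{t\<in>S. \<forall>j\<in>K. l t j = l s j}. a t * ee (\<Sum>j\<in>J-K. of_real (u j) * of_int (l t j))) = 0"
    if "K \<subseteq> J" for K and u :: "'j \<Rightarrow> real"
    using finite_subset[OF that fin] that
  proof (induction K arbitrary: u rule: finite_induct)
    case empty
    then show ?case using zero[of u] by simp
  next
    case (insert i K)
    define b where "b = (\<lambda>t. a t * ee (\<Sum>j\<in>J-insert i K. of_real (u j) * of_int (l t j)))"
    define S' where "S' = {t\<in>S. \<forall>j\<in>K. l t j = l s j}"
    have JK: "J - K = insert i (J - insert i K)" using insert by auto
    have "b summable_on S'"
    proof (rule abs_summable_summable)
      have "(\<lambda>t. norm (a t)) summable_on S'" using summ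
        by (auto simp: S'_def summable_on_iff_abs_summable_on_complex[symmetric] intro: summable_on_subset_banach)
      moreover have "norm (b t) = norm (a t)" for t
        using norm_ee_real[of "\<Sum>j\<in>J-insert i K. u j * of_int (l t j)"] by (simp add: b_def norm_mult)
      ultimately show "(\<lambda>t. norm (b t)) summable_on S'" by simp
    qed
    moreover have "(\<Sum>\<^sub>\<infinity>t\<in>S'. b t * ee (of_real v * of_int (l t i))) = 0" for v :: real
    proof -
      have "b t * ee (of_real v * of_int (l t i)) = a t * ee (\<Sum>j\<in>J-K. of_real ((u(i:=v)) j) * of_int (l t j))" for t
      proof -
        have "(\<Sum>j\<in>J-K. of_real ((u(i:=v)) j) * of_int (l t j) :: complex) =
          of_real v * of_int (l t i) + (\<Sum>j\<in>J-insert i K. of_real ((u(i:=v)) j) * of_int (l t j))"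
          unfolding JK using fin by (subst sum.insert) auto
        also have "(\<Sum>j\<in>J-insert i K. of_real ((u(i:=v)) j) * of_int (l t j) :: complex) = (\<Sum>j\<in>J-insert i K. of_real (u j) * of_int (l t j))"
          by (intro sum.cong) auto
        finally show ?thesis by (simp add: b_def ee_add)
      qed
      then show ?thesis using insert.IH[of "u(i:=v)"] insert.prems by (simp add: S'_def)
    qed
    ultimately have "(\<Sum>\<^sub>\<infinity>t\<in>{t\<in>S'. l t i = l s i}. b t) = 0" by (rule fourier_coefficient_sum_eq_0)
    moreover have "{t\<in>S'. l t i = l s i} = {t\<in>S. \<forall>j\<in>insert i K. l t j = l s j}" by (auto simp: S'_def)
    ultimately show ?case by (simp add: b_def)
  qed
  from this[of J] have "(\<Sum>\<^sub>\<infinity>t\<in>{t\<in>S. \<forall>j\<in>J. l t j = l s j}. a t) = 0" by simp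
  moreover have "{t\<in>S. \<forall>j\<in>J. l t j = l s j} = {s}"
    using s inj by (fastforce simp: inj_on_def restrict_def fun_eq_iff)
  ultimately show ?thesis by simp
qed

section \<open>Poisson summation for Gaussians\<close>

definition theta_series :: "complex \<Rightarrow> complex \<Rightarrow> complex" where
  "theta_series \<alpha> \<beta> = (\<Sum>\<^sub>\<infinity>n::int. exp (of_int n * \<beta> - (of_int n)\<^sup>2 * \<alpha>))"

lemma theta_series_summable:
  assumes "Re \<alpha> > 0"
  shows "(\<lambda>n::int. exp (of_int n * \<beta> - (of_int n)\<^sup>2 * \<alpha>)) summable_on UNIV"
proof (rule summable_on_norm_bound)
  show "(\<lambda>n::int. exp (- Re \<alpha> * (real_of_int n)\<^sup>2 + \<bar>Re \<beta>\<bar> * \<bar>real_of_int n\<bar>)) summable_on UNIV"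
    by (rule gauss_summable_on_int[OF assms])
  show "norm (exp (of_int n * \<beta> - (of_int n)\<^sup>2 * \<alpha>)) \<le> exp (- Re \<alpha> * (real_of_int n)\<^sup>2 + \<bar>Re \<beta>\<bar> * \<bar>real_of_int n\<bar>)" for n
  proof -
    have "Re ((of_int n :: complex)\<^sup>2 * \<alpha>) = Re \<alpha> * (real_of_int n)\<^sup>2"
      by (simp add: power2_eq_square)
    moreover have "real_of_int n * Re \<beta> \<le> \<bar>Re \<beta>\<bar> * \<bar>real_of_int n\<bar>"
      by (metis abs_ge_self abs_mult mult.commute)
    ultimately show ?thesis by simp
  qed
qed

text \<open>
  The second conjunct says that the derivative is complex linear. Joint differentiability in
  both arguments is what allows composition with two holomorphic functions of one parameter.
\<close>
lemma theta_series_has_derivative: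
  assumes "Re \<alpha> > 0"
  shows "\<exists>D. ((\<lambda>(a, b). theta_series a b) has_derivative D) (at (\<alpha>, \<beta>)) \<and> (\<forall>c a b. D (c * a, c * b) = c * D (a, b))"
proof -
  define l :: "int \<Rightarrow> complex \<times> complex \<Rightarrow> complex" where "l = (\<lambda>n p. of_int n * snd p - (of_int n)\<^sup>2 * fst p)"
  have "((\<lambda>q. \<Sum>\<^sub>\<infinity>n\<in>UNIV. 1 * exp (l n q)) has_derivative
          (\<lambda>v. \<Sum>\<^sub>\<infinity>n\<in>UNIV. 1 * exp (l n (\<alpha>, \<beta>)) * l n v)) (at (\<alpha>, \<beta>))"
  proof (rule exp_sum_has_derivative[where B = "\<lambda>n. (real_of_int n)\<^sup>2 + \<bar>real_of_int n\<bar>" and \<delta> = "Re \<alpha> / 2"])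
    show "linear (l n)" for n
      by (auto simp: l_def linear_iff algebra_simps scaleR_conv_of_real)
    show "norm (l n v) \<le> ((real_of_int n)\<^sup>2 + \<bar>real_of_int n\<bar>) * norm v" for n v
    proof -
      have "norm (l n v) \<le> \<bar>real_of_int n\<bar> * norm (snd v) + (real_of_int n)\<^sup>2 * norm (fst v)"
        unfolding l_def using norm_triangle_ineq4[of "of_int n * snd v" "(of_int n)\<^sup>2 * fst v"]
        by (simp add: norm_mult norm_power)
      also have "\<dots> \<le> \<bar>real_of_int n\<bar> * norm v + (real_of_int n)\<^sup>2 * norm v"
        using norm_fst_le[of "fst v" "snd v"] norm_snd_le[of "snd v" "fst v"] by (intro add_mono mult_left_mono) auto
      finally show ?thesis by (simp add: algebra_simps)
    qed
    have "(\<lambda>n::int. exp (- (Re \<alpha> / 2) * (real_of_int n)\<^sup>2 + (\<bar>Re \<beta>\<bar> + Re \<alpha> / 2) * \<bar>real_of_int n\<bar>)) summable_on UNIV"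
      using assms by (intro gauss_summable_on_int) auto
    then show "(\<lambda>n. norm (1::complex) * exp (Re (l n (\<alpha>, \<beta>)) + Re \<alpha> / 2 * ((real_of_int n)\<^sup>2 + \<bar>real_of_int n\<bar>))) summable_on UNIV"
    proof (rule summable_on_comparison_test)
      fix n :: int
      have "Re (l n (\<alpha>, \<beta>)) = real_of_int n * Re \<beta> - Re \<alpha> * (real_of_int n)\<^sup>2"
        by (simp add: l_def power2_eq_square)
      moreover have "real_of_int n * Re \<beta> \<le> \<bar>Re \<beta>\<bar> * \<bar>real_of_int n\<bar>"
        by (metis abs_ge_self abs_mult mult.commute)
      ultimately show "norm (1::complex) * exp (Re (l n (\<alpha>, \<beta>)) + Re \<alpha> / 2 * ((real_of_int n)\<^sup>2 + \<bar>real_of_int n\<bar>))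
        \<le> exp (- (Re \<alpha> / 2) * (real_of_int n)\<^sup>2 + (\<bar>Re \<beta>\<bar> + Re \<alpha> / 2) * \<bar>real_of_int n\<bar>)"
        by (simp add: algebra_simps)
    qed auto
  qed (use assms in auto)
  moreover have "(\<lambda>q. \<Sum>\<^sub>\<infinity>n\<in>UNIV. 1 * exp (l n q)) = (\<lambda>(a, b). theta_series a b)"
    by (auto simp: l_def theta_series_def fun_eq_iff)
  moreover have "(\<Sum>\<^sub>\<infinity>n\<in>UNIV. 1 * exp (l n (\<alpha>, \<beta>)) * l n (c * a, c * b)) = c * (\<Sum>\<^sub>\<infinity>n\<in>UNIV. 1 * exp (l n (\<alpha>, \<beta>)) * l n (a, b))" for c a b
    by (subst infsum_cmult_right'[symmetric]) (auto simp: l_def algebra_simps intro!: infsum_cong)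
  ultimately show ?thesis
    by (intro exI[of _ "\<lambda>v. \<Sum>\<^sub>\<infinity>n\<in>UNIV. 1 * exp (l n (\<alpha>, \<beta>)) * l n v"]) simp
qed

lemma theta_series_holomorphic:
  assumes f: "f holomorphic_on S" and g: "g holomorphic_on S" and S: "open S" and pos: "\<And>s. s \<in> S \<Longrightarrow> Re (f s) > 0"
  shows "(\<lambda>s. theta_series (f s) (g s)) holomorphic_on S"
proof (rule holomorphic_onI)
  fix s assume s: "s \<in> S"
  obtain D where D: "((\<lambda>(a, b). theta_series a b) has_derivative D) (at (f s, g s))"
    "\<And>c a b. D (c * a, c * b) = c * D (a, b)"
    using theta_series_has_derivative[OF pos[OF s]] by blast
  obtain f' g' where f': "(f has_field_derivative f') (at s within S)" and g': "(g has_field_derivative g') (at s within S)"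
    using f g s unfolding holomorphic_on_def field_differentiable_def by blast
  have "((\<lambda>s. (f s, g s)) has_derivative (\<lambda>h. (f' * h, g' * h))) (at s within S)"
    using f' g' by (intro has_derivative_Pair) (auto simp: has_field_derivative_def)
  from has_derivative_compose[OF this D(1)]
  have "((\<lambda>s. theta_series (f s) (g s)) has_derivative (\<lambda>h. D (f' * h, g' * h))) (at s within S)" by simp
  moreover have "D (f' * h, g' * h) = D (f', g') * h" for h using D(2)[of h f' g'] by (simp add: mult.commute)
  ultimately show "(\<lambda>s. theta_series (f s) (g s)) field_differentiable at s within S"
    unfolding field_differentiable_def has_field_derivative_def by auto
qed

text \<open>
  One integration by parts. The function is not assumed periodic, so the boundary terms remain,
  and they are bounded because \<open>\<bar>e(-m x)\<bar> = 1\<close>.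
\<close>
lemma integral_oscillating_bound:
  fixes G :: "complex \<Rightarrow> complex"
  assumes S: "open S" and sub: "complex_of_real ` {0..1} \<subseteq> S" and G: "G holomorphic_on S"
  obtains C where "\<And>m::int. m \<noteq> 0 \<Longrightarrow> norm (integral {0..1} (\<lambda>x. G (of_real x) * ee (- of_int m * of_real x))) \<le> C / \<bar>m\<bar>"
proof -
  have contG: "continuous_on {0..1::real} (\<lambda>x. G (of_real x))"
    by (rule continuous_on_compose2[OF holomorphic_on_imp_continuous_on[OF G]]) (use sub in \<open>auto intro!: continuous_intros\<close>)
  have contG': "continuous_on {0..1::real} (\<lambda>x. deriv G (of_real x))"
    by (rule continuous_on_compose2[OF holomorphic_on_imp_continuous_on[OF holomorphic_deriv[OF G S]]]) (use sub in \<open>auto intro!: continuous_intros\<close>)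
  have conte: "continuous_on {0..1::real} (\<lambda>x. ee (- of_int m * of_real x))" for m :: int
    unfolding ee_def by (intro continuous_intros)
  obtain K where K: "\<And>x. x \<in> {0..1::real} \<Longrightarrow> norm (deriv G (of_real x)) \<le> K"
  proof -
    have "compact ((\<lambda>x. deriv G (of_real x)) ` {0..1::real})" by (intro compact_continuous_image contG') auto
    then have "bounded ((\<lambda>x. deriv G (of_real x)) ` {0..1::real})" by (rule compact_imp_bounded)
    then obtain a where "\<forall>x\<in>{0..1::real}. norm (deriv G (of_real x)) \<le> a" unfolding bounded_iff by auto
    then show ?thesis by (intro that[of a]) auto
  qed
  have ne: "norm (ee (- of_int m * of_real x)) = 1" for m :: int and x :: real
    using norm_ee_real[of "- (of_int m * x)"] by simp
  show ?thesis
  proof (rule that[of "norm (G 0) + norm (G 1) + K"])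
    fix m :: int assume m: "m \<noteq> 0"
    define c where "c = - (2 * of_real pi * \<i> * of_int m)"
    have c0: "c \<noteq> 0" and nc: "norm c = 2 * pi * \<bar>m\<bar>" using m by (auto simp: c_def norm_mult)
    define e where "e = (\<lambda>x::real. ee (- of_int m * of_real x))"
    have e': "(e has_vector_derivative c * e x) (at x within {0..1})" for x
    proof -
      have "((\<lambda>w. ee (- of_int m * w)) has_field_derivative c * ee (- of_int m * of_real x)) (at (of_real x))"
        unfolding ee_def c_def by (rule derivative_eq_intros refl | simp)+
      then show ?thesis unfolding e_def by (rule has_vector_derivative_real_field)
    qed
    have "((\<lambda>x. G (of_real x) * (c * e x) + deriv G (of_real x) * e x) has_integral (G (of_real 1) * e 1 - G (of_real 0) * e 0)) {0..1}"
    proof (rule fundamental_theorem_of_calculus)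
      fix x :: real assume x: "x \<in> {0..1}"
      have "(G has_field_derivative deriv G (of_real x)) (at (of_real x))"
        using sub x by (intro holomorphic_derivI[OF G S]) auto
      then have "((\<lambda>x. G (of_real x)) has_vector_derivative deriv G (of_real x)) (at x within {0..1})"
        by (intro has_vector_derivative_real_field) (auto intro: has_field_derivative_at_within)
      from has_vector_derivative_mult[OF this e'[of x]]
      show "((\<lambda>x. G (of_real x) * e x) has_vector_derivative G (of_real x) * (c * e x) + deriv G (of_real x) * e x) (at x within {0..1})" .
    qed simp
    moreover have i2: "(\<lambda>x. deriv G (of_real x) * e x) integrable_on {0..1}"
      unfolding e_def by (intro integrable_continuous_real continuous_on_mult contG' conte)
    ultimately have "((\<lambda>x. G (of_real x) * (c * e x)) has_integral (G 1 * e 1 - G 0 * e 0) - integral {0..1} (\<lambda>x. deriv G (of_real x) * e x)) {0..1}"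
      using has_integral_diff[OF _ integrable_integral[OF i2]] by fastforce
    then have "integral {0..1} (\<lambda>x. c * (G (of_real x) * e x)) = (G 1 * e 1 - G 0 * e 0) - integral {0..1} (\<lambda>x. deriv G (of_real x) * e x)"
      by (simp add: mult.left_commute has_integral_iff)
    then have eq: "c * integral {0..1} (\<lambda>x. G (of_real x) * e x) = (G 1 * e 1 - G 0 * e 0) - integral {0..1} (\<lambda>x. deriv G (of_real x) * e x)"
      by simp
    have "norm (integral {0..1} (\<lambda>x. deriv G (of_real x) * e x)) \<le> K * (1 - 0)"
    proof (rule integral_bound)
      show "continuous_on {0..1} (\<lambda>x. deriv G (of_real x) * e x)" unfolding e_def by (intro continuous_on_mult contG' conte)
    qed (use K ne in \<open>auto simp: norm_mult e_def\<close>)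
    moreover have "norm (G 1 * e 1 - G 0 * e 0) \<le> norm (G 1) + norm (G 0)"
      using norm_triangle_ineq4[of "G 1 * e 1" "G 0 * e 0"] ne[of m 0] ne[of m 1] by (simp add: norm_mult e_def del: of_int_minus)
    ultimately have "norm c * norm (integral {0..1} (\<lambda>x. G (of_real x) * e x)) \<le> norm (G 0) + norm (G 1) + K"
      using norm_triangle_ineq4[of "G 1 * e 1 - G 0 * e 0" "integral {0..1} (\<lambda>x. deriv G (of_real x) * e x)"] eq
      by (simp add: norm_mult[symmetric])
    moreover have "\<bar>m\<bar> * norm (integral {0..1} (\<lambda>x. G (of_real x) * e x)) \<le> norm c * norm (integral {0..1} (\<lambda>x. G (of_real x) * e x))"
    proof (rule mult_right_mono)
      have "real_of_int \<bar>m\<bar> * 1 \<le> \<bar>m\<bar> * (2 * pi)" using pi_gt3 by (intro mult_left_mono) auto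
      then show "real_of_int \<bar>m\<bar> \<le> norm c" by (simp add: nc mult.commute)
    qed simp
    ultimately have "\<bar>m\<bar> * norm (integral {0..1} (\<lambda>x. G (of_real x) * e x)) \<le> norm (G 0) + norm (G 1) + K" by linarith
    then show "norm (integral {0..1} (\<lambda>x. G (of_real x) * ee (- of_int m * of_real x))) \<le> (norm (G 0) + norm (G 1) + K) / \<bar>m\<bar>"
      using m by (simp add: e_def field_simps)
  qed
qed

text \<open>
  Chernoff's proof of pointwise Fourier inversion: \<open>f(z) - f(0) = (e(z) - 1) g(z)\<close>
  with \<open>g\<close> holomorphic near \<open>[0, 1]\<close>, hence the \<open>m\<close>-th
  coefficients satisfy \<open>f\<^sub>m = f(0) \<delta>\<^bsub>m0\<^esub> + g\<^bsub>m-1\<^esub>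
  - g\<^sub>m\<close>, the symmetric partial sums telescope, and the two remaining coefficients
  of \<open>g\<close> tend to zero.
\<close>
lemma fourier_inversion_at_0:
  fixes f :: "complex \<Rightarrow> complex"
  assumes f: "f holomorphic_on UNIV" and f1: "f 1 = f 0"
  defines "fh \<equiv> \<lambda>m::int. integral {0..1} (\<lambda>x. f (of_real x) * ee (- of_int m * of_real x))"
  shows "(\<lambda>M::nat. \<Sum>m\<in>{- int M..int M}. fh m) \<longlonglongrightarrow> f 0"
proof -
  \<comment> \<open>In this strip \<open>e(z) = 1\<close> only at the zeros \<open>0\<close> and \<open>1\<close> of
    \<open>f - f(0)\<close>.\<close>
  define S where "S = {z. Re z > -1/2} \<inter> {z. Re z < 3/2}"
  have S: "open S" unfolding S_def by (intro open_Int open_halfspace_Re_gt open_halfspace_Re_lt)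
  define q where "q = (\<lambda>z. (f z - f 0) / (ee z - 1))"
  define g where "g = (\<lambda>z. if z \<in> {0, 1} then deriv f z / (2 * of_real pi * \<i>) else q z)"
  have ee1: "ee z = 1 \<longleftrightarrow> z \<in> {0, 1}" if "z \<in> S" for z
  proof
    assume "ee z = 1"
    then obtain n where n: "z = of_int n" by (auto simp: ee_eq_1_iff elim: Ints_cases)
    with that have "- 1 < n" "n < 2" by (auto simp: S_def)
    then have "n = 0 \<or> n = 1" by linarith
    with n show "z \<in> {0, 1}" by auto
  next
    assume "z \<in> {0, 1}"
    then show "ee z = 1" using ee_of_int[of 1] by (auto simp del: ee_of_int)
  qed
  have eder: "(ee has_field_derivative 2 * of_real pi * \<i> * ee z) (at z)" for z
    unfolding ee_def by (rule derivative_eq_intros refl | simp)+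
  have g: "g holomorphic_on S"
  proof (rule no_isolated_singularity'[where K = "{0, 1}"])
    have "q holomorphic_on S - {0, 1}"
      unfolding q_def by (intro holomorphic_intros holomorphic_on_subset[OF f]) (use ee1 in \<open>auto simp: ee_def intro!: holomorphic_intros\<close>)
    then show "g holomorphic_on S - {0, 1}"
      by (rule holomorphic_transform) (auto simp: g_def)
  next
    fix a :: complex assume a: "a \<in> {0, 1}"
    then have fa: "f a = f 0" and ea: "ee a = 1" using f1 ee_of_int[of 1] by (auto simp del: ee_of_int)
    have "(f has_field_derivative deriv f a) (at a)"
      using f by (simp add: holomorphic_derivI)
    then have l1: "((\<lambda>z. (f z - f a) / (z - a)) \<longlongrightarrow> deriv f a) (at a)" by (simp add: has_field_derivative_iff)
    have l2: "((\<lambda>z. (ee z - ee a) / (z - a)) \<longlongrightarrow> 2 * of_real pi * \<i>) (at a)"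
      using eder[of a] ea by (simp add: has_field_derivative_iff)
    have "((\<lambda>z. ((f z - f a) / (z - a)) / ((ee z - ee a) / (z - a))) \<longlongrightarrow> deriv f a / (2 * of_real pi * \<i>)) (at a)"
      by (intro tendsto_divide l1 l2) auto
    moreover have "\<forall>\<^sub>F z in at a. ((f z - f a) / (z - a)) / ((ee z - ee a) / (z - a)) = g z"
    proof -
      have "\<forall>\<^sub>F z in at a. z \<in> ball a 1 - {a}" by (intro eventually_at_in_open) auto
      then show ?thesis
      proof eventually_elim
        case (elim z)
        then have "z \<noteq> 0" "z \<noteq> 1" using a by auto
        then show ?case using elim by (simp add: g_def q_def fa ea)
      qed
    qed
    ultimately have "(g \<longlongrightarrow> deriv f a / (2 * of_real pi * \<i>)) (at a)" by (rule Lim_transform_eventually)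
    then show "(g \<longlongrightarrow> g a) (at a within S)"
      using a by (auto simp: g_def intro: tendsto_within_subset)
  qed (use S in auto)
  have fg: "f z = f 0 + (ee z - 1) * g z" if "z \<in> S" for z
    using ee1[OF that] f1 by (auto simp: g_def q_def)
  have sub: "complex_of_real ` {0..1} \<subseteq> S" by (auto simp: S_def)
  have contg: "continuous_on {0..1::real} (\<lambda>x. g (of_real x))"
    by (rule continuous_on_compose2[OF holomorphic_on_imp_continuous_on[OF g]]) (use sub in \<open>auto intro!: continuous_intros\<close>)
  have conte: "continuous_on {0..1::real} (\<lambda>x. ee (- of_int m * of_real x))" for m :: int
    unfolding ee_def by (intro continuous_intros)
  define gh where "gh = (\<lambda>m::int. integral {0..1} (\<lambda>x. g (of_real x) * ee (- of_int m * of_real x)))"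
  define \<delta> where "\<delta> = (\<lambda>m::int. integral {0..1} (\<lambda>x::real. ee (- of_int m * of_real x)))"
  have \<delta>: "\<delta> m = (if m = 0 then 1 else 0)" for m
  proof (cases "m = 0")
    case False
    define c where "c = - (2 * of_real pi * \<i> * of_int m)"
    have c0: "c \<noteq> 0" using False by (auto simp: c_def)
    have "((\<lambda>x::real. ee (- of_int m * of_real x)) has_integral (ee (- of_int m * of_real 1) / c - ee (- of_int m * of_real 0) / c)) {0..1}"
    proof (rule fundamental_theorem_of_calculus)
      fix x :: real
      show "((\<lambda>x::real. ee (- of_int m * of_real x) / c) has_vector_derivative ee (- of_int m * of_real x)) (at x within {0..1})"
      proof -
        have "((\<lambda>w. ee (- of_int m * w) / c) has_field_derivative ee (- of_int m * of_real x)) (at (of_real x))"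
          unfolding ee_def using c0 by (auto intro!: derivative_eq_intros simp: c_def field_simps)
        then show ?thesis by (rule has_vector_derivative_real_field)
      qed
    qed simp
    moreover have "ee (- of_int m) = 1" using ee_of_int[of "- m"] by simp
    ultimately show ?thesis using False by (simp add: \<delta>_def has_integral_iff)
  qed (simp add: \<delta>_def)
  have fh: "fh m = f 0 * (if m = 0 then 1 else 0) + gh (m - 1) - gh m" for m
  proof -
    have "fh m = integral {0..1} (\<lambda>x. f 0 * ee (- of_int m * of_real x) + g (of_real x) * ee (- of_int (m - 1) * of_real x) - g (of_real x) * ee (- of_int m * of_real x))"
      unfolding fh_def
    proof (rule integral_cong)
      fix x :: real assume "x \<in> {0..1}"
      then have "of_real x \<in> S" using sub by auto
      then have e1: "f (of_real x) = f 0 + (ee (of_real x) - 1) * g (of_real x)" by (rule fg)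
      have e2: "ee (- of_int (m - 1) * of_real x) = ee (of_real x) * ee (- of_int m * of_real x)"
        by (simp add: ee_add[symmetric] algebra_simps)
      show "f (of_real x) * ee (- of_int m * of_real x) = f 0 * ee (- of_int m * of_real x) + g (of_real x) * ee (- of_int (m - 1) * of_real x) - g (of_real x) * ee (- of_int m * of_real x)"
        unfolding e1 e2 by (simp add: algebra_simps)
    qed
    also have "\<dots> = f 0 * \<delta> m + gh (m - 1) - gh m"
      unfolding \<delta>_def gh_def
      by (intro integral_unique has_integral_diff has_integral_add has_integral_mult_right integrable_integral
          integrable_continuous_real continuous_on_mult contg conte)
    finally show ?thesis by (simp add: \<delta>)
  qed
  have tel: "(\<Sum>m\<in>{- int M..int M}. fh m) = f 0 + gh (- int M - 1) - gh (int M)" for M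
  proof (induction M)
    case 0 then show ?case by (simp add: fh)
  next
    case (Suc M)
    have "{- int (Suc M)..int (Suc M)} = insert (- int M - 1) (insert (int M + 1) {- int M..int M})" by auto
    then have "(\<Sum>m\<in>{- int (Suc M)..int (Suc M)}. fh m) = fh (- int M - 1) + fh (int M + 1) + (\<Sum>m\<in>{- int M..int M}. fh m)"
      by simp
    also have "\<dots> = f 0 + gh (- int (Suc M) - 1) - gh (int (Suc M))"
      unfolding Suc by (simp add: fh) (simp add: algebra_simps)
    finally show ?case .
  qed
  obtain C where C: "\<And>m::int. m \<noteq> 0 \<Longrightarrow> norm (gh m) \<le> C / \<bar>m\<bar>"
    using integral_oscillating_bound[OF S sub g] unfolding gh_def by metis
  have C0: "C \<ge> 0" using order_trans[OF norm_ge_zero C[of 1]] by simp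
  have lim0: "(\<lambda>M::nat. C / real M) \<longlonglongrightarrow> 0" by (rule lim_const_over_n)
  have "(\<lambda>M::nat. gh (int M)) \<longlonglongrightarrow> 0"
  proof (rule Lim_null_comparison[OF _ lim0])
    show "\<forall>\<^sub>F M in sequentially. norm (gh (int M)) \<le> C / real M"
      using eventually_gt_at_top[of 0]
    proof eventually_elim
      case (elim M)
      then show ?case using C[of "int M"] by simp
    qed
  qed
  moreover have "(\<lambda>M::nat. gh (- int M - 1)) \<longlonglongrightarrow> 0"
  proof (rule Lim_null_comparison[OF _ lim0])
    show "\<forall>\<^sub>F M in sequentially. norm (gh (- int M - 1)) \<le> C / real M"
      using eventually_gt_at_top[of 0]
    proof eventually_elim
      case (elim M)
      have "norm (gh (- int M - 1)) \<le> C / (real M + 1)" using C[of "- int M - 1"] by (simp add: algebra_simps abs_if split: if_splits)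
      also have "\<dots> \<le> C / real M" using C0 elim by (intro divide_left_mono) auto
      finally show ?case .
    qed
  qed
  ultimately have "(\<lambda>M::nat. f 0 + gh (- int M - 1) - gh (int M)) \<longlonglongrightarrow> f 0 + 0 - 0" by (intro tendsto_intros)
  then show ?thesis by (simp add: tel)
qed

text \<open>
  The substitution \<open>x = -x\<^sub>0 + c y\<close> reduces this to the characteristic
  function of the standard normal distribution.
\<close>
lemma gaussian_fourier_transform:
  fixes t x0 :: real and m :: int
  assumes t: "t > 0"
  defines "H \<equiv> \<lambda>x::real. exp (- (of_real (pi * t * (x + x0)\<^sup>2))) * ee (- of_int m * of_real x)"
  shows "integrable lborel H"
    and "integral\<^sup>L lborel H = of_real (1 / sqrt t) * (exp (- (of_real (pi * (of_int m)\<^sup>2 / t))) * ee (of_int m * of_real x0))"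
proof -
  define c where "c = 1 / sqrt (2 * pi * t)"
  have c: "c \<noteq> 0" "c > 0" using t by (auto simp: c_def)
  have c2: "pi * t * (c * y)\<^sup>2 = y\<^sup>2 / 2" for y
    using t by (simp add: c_def power_mult_distrib power_divide)
  define u where "u = - (2 * pi * of_int m * c)"
  have Hc: "H (- x0 + c * y) = (of_real (sqrt (2 * pi)) * ee (of_int m * of_real x0)) * (of_real (std_normal_density y) * iexp (u * y))" for y
  proof -
    have "H (- x0 + c * y) = exp (- (of_real (y\<^sup>2 / 2))) * ee (of_int m * of_real x0 + (- of_int m * of_real (c * y)))"
    proof -
      have e1: "pi * t * (- x0 + c * y + x0)\<^sup>2 = y\<^sup>2 / 2" using c2[of y] by simp
      show ?thesis unfolding H_def e1 by (simp add: algebra_simps)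
    qed
    also have "\<dots> = exp (- (of_real (y\<^sup>2 / 2))) * ee (of_int m * of_real x0) * iexp (u * y)"
      by (simp add: ee_add) (simp add: ee_def u_def exp_add[symmetric] algebra_simps)
    also have "exp (- (of_real (y\<^sup>2 / 2))) = (of_real (sqrt (2 * pi) * std_normal_density y) :: complex)"
      by (simp add: std_normal_density_def exp_of_real[symmetric])
    finally show ?thesis by (simp add: mult_ac)
  qed
  have int1: "integrable lborel (\<lambda>y. of_real (std_normal_density y) * iexp (u * y))"
  proof (rule Bochner_Integration.integrable_bound)
    show "integrable lborel std_normal_density" by (rule integrable_normal_density) simp
  qed (auto simp: norm_mult)
  have "integrable lborel (\<lambda>y. H (- x0 + c * y))"
    unfolding Hc by (intro integrable_mult_right int1)
  then show int: "integrable lborel H"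
    using lborel_integrable_real_affine_iff[OF c(1), of H "- x0"] by simp
  have "char std_normal_distribution u = (CLBINT y. std_normal_density y *\<^sub>R iexp (u * y))"
    unfolding char_def by (subst integral_density) auto
  then have ch: "(CLBINT y. of_real (std_normal_density y) * iexp (u * y)) = of_real (exp (- (u\<^sup>2) / 2))"
    by (simp add: char_std_normal_distribution scaleR_conv_of_real)
  have "integral\<^sup>L lborel H = of_real c * (CLBINT y. H (- x0 + c * y))"
    using lborel_integral_real_affine[OF c(1), of H "- x0"] c by (simp add: scaleR_conv_of_real)
  also have "\<dots> = of_real c * ((of_real (sqrt (2 * pi)) * ee (of_int m * of_real x0)) * of_real (exp (- (u\<^sup>2) / 2)))"
    unfolding Hc integral_mult_right_zero ch ..
  also have "of_real c * ((of_real (sqrt (2 * pi)) * ee (of_int m * of_real x0)) * of_real (exp (- (u\<^sup>2) / 2)))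
     = of_real (c * sqrt (2 * pi)) * (of_real (exp (- (u\<^sup>2) / 2)) * ee (of_int m * of_real x0))" by simp
  also have "c * sqrt (2 * pi) = 1 / sqrt t" using t by (simp add: c_def real_sqrt_mult)
  also have "- (u\<^sup>2) / 2 = - (pi * (of_int m)\<^sup>2 / t)"
    using t by (simp add: u_def c_def power_mult_distrib power_divide) (simp add: field_simps power2_eq_square)
  finally show "integral\<^sup>L lborel H = of_real (1 / sqrt t) * (exp (- (of_real (pi * (of_int m)\<^sup>2 / t))) * ee (of_int m * of_real x0))"
    by (simp add: exp_of_real[symmetric])
qed

lemma integral_symmetric_interval_tendsto:
  fixes H :: "real \<Rightarrow> complex"
  assumes int: "integrable lborel H"
  shows "(\<lambda>N::nat. integral {- real N..real N} H) \<longlonglongrightarrow> integral\<^sup>L lborel H"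
proof -
  have "(\<lambda>N::nat. LINT x : {- real N..real N} | lborel. H x) \<longlonglongrightarrow> integral\<^sup>L lborel H"
    unfolding set_lebesgue_integral_def
  proof (rule integral_dominated_convergence[where w="\<lambda>x. norm (H x)"])
    show "AE x in lborel. (\<lambda>N. indicator {- real N..real N} x *\<^sub>R H x) \<longlonglongrightarrow> H x"
    proof (intro always_eventually allI)
      fix x :: real
      obtain n :: nat where n: "\<bar>x\<bar> \<le> real n" using real_arch_simple by blast
      show "(\<lambda>N. indicator {- real N..real N} x *\<^sub>R H x) \<longlonglongrightarrow> H x"
      proof (rule tendsto_eventually)
        show "\<forall>\<^sub>F N in sequentially. indicator {- real N..real N} x *\<^sub>R H x = H x"
          using eventually_ge_at_top[of n] by eventually_elim (use n in \<open>auto simp: indicator_def\<close>)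
      qed
    qed
  qed (use int in \<open>auto simp: indicator_def\<close>)
  moreover have "(LINT x : {- real N..real N} | lborel. H x) = integral {- real N..real N} H" for N
  proof (rule set_borel_integral_eq_integral(2))
    show "set_integrable lborel {- real N..real N} H"
      unfolding set_integrable_def by (rule integrable_mult_indicator[OF _ int]) simp
  qed
  ultimately show ?thesis by simp
qed

lemma filterlim_symmetric_int_intervals:
  "filterlim (\<lambda>N::nat. {- int N..int N}) (finite_subsets_at_top UNIV) sequentially"
  "filterlim (\<lambda>N::nat. {- int N..<int N}) (finite_subsets_at_top UNIV) sequentially"
proof -
  have *: "\<forall>\<^sub>F N in sequentially. X \<subseteq> {- int N..<int N}" if X: "finite X" for X :: "int set"
  proof -
    define b where "b = nat (Max (insert 0 (abs ` X))) + 1"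
    have "\<bar>x\<bar> < int N" if "x \<in> X" "N \<ge> b" for x N
    proof -
      have "\<bar>x\<bar> \<le> Max (insert 0 (abs ` X))" using X that by (intro Max_ge) auto
      then show ?thesis using that by (simp add: b_def)
    qed
    then show ?thesis unfolding eventually_sequentially by (intro exI[of _ b]) fastforce
  qed
  show "filterlim (\<lambda>N::nat. {- int N..<int N}) (finite_subsets_at_top UNIV) sequentially"
    unfolding filterlim_finite_subsets_at_top using * by auto
  show "filterlim (\<lambda>N::nat. {- int N..int N}) (finite_subsets_at_top UNIV) sequentially"
    unfolding filterlim_finite_subsets_at_top
  proof safe
    fix X :: "int set" assume "finite X"
    from *[OF this] show "\<forall>\<^sub>F N in sequentially. finite {- int N..int N} \<and> X \<subseteq> {- int N..int N} \<and> {- int N..int N} \<subseteq> UNIV"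
      by eventually_elim auto
  qed
qed

text \<open>
  Unfolding: the periodised series converges uniformly, so it is integrated term by term, and
  the partial sum over \<open>-N \<le> n < N\<close> is the integral over \<open>[-N,
  N]\<close>.
\<close>
lemma integral_periodization:
  fixes H :: "real \<Rightarrow> complex"
  assumes cont: "continuous_on UNIV H" and int: "integrable lborel H"
    and bd: "\<And>n x. x \<in> {0..1} \<Longrightarrow> norm (H (real_of_int n + x)) \<le> M n" and M: "M summable_on (UNIV :: int set)"
  shows "integral {0..1} (\<lambda>x. \<Sum>\<^sub>\<infinity>n::int. H (real_of_int n + x)) = integral\<^sup>L lborel H"
proof -
  have unif: "uniform_limit {0..1::real} (\<lambda>X x. \<Sum>n\<in>X. H (real_of_int n + x)) (\<lambda>x. \<Sum>\<^sub>\<infinity>n::int. H (real_of_int n + x)) (finite_subsets_at_top UNIV)"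
    using bd M by (rule Weierstrass_m_test_general)
  have c1: "continuous_on {0..1} (\<lambda>x. H (real_of_int n + x))" for n
    by (rule continuous_on_compose2[OF cont]) (auto intro!: continuous_intros)
  obtain I J where IJ: "\<And>X. ((\<lambda>x. \<Sum>n\<in>X. H (real_of_int n + x)) has_integral I X) {0..1::real}"
    "((\<lambda>x. \<Sum>\<^sub>\<infinity>n::int. H (real_of_int n + x)) has_integral J) {0..1}" "(I \<longlongrightarrow> J) (finite_subsets_at_top UNIV)"
    by (rule uniform_limit_integral[OF unif]) (auto intro!: continuous_on_sum c1)
  from filterlim_compose[OF IJ(3) filterlim_symmetric_int_intervals(2)]
  have lim: "(\<lambda>N::nat. I {- int N..<int N}) \<longlonglongrightarrow> J" .
  have iH: "H integrable_on {a..b}" for a b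
    by (intro integrable_continuous_real continuous_on_subset[OF cont]) auto
  have "I {- int N..<int N} = integral {- real N..real N} H" for N
  proof -
    have shift: "integral {0..1} (\<lambda>x. H (real_of_int n + x)) = integral {of_int n..of_int n + 1} H" for n
      using integral_shift_Icc_real[of 0 1 H "real_of_int n"] by (simp add: o_def add.commute)
    have "I {- int N..<int N} = (\<Sum>n\<in>{- int N..<int N}. integral {0..1} (\<lambda>x. H (real_of_int n + x)))"
      using IJ(1)[of "{- int N..<int N}"] by (subst integral_sum[symmetric]) (auto simp: has_integral_iff intro!: integrable_continuous_real c1)
    also have "\<dots> = (\<Sum>n\<in>{- int N..<int N}. integral {of_int n..of_int n + 1} H)" by (simp add: shift)
    also have "\<dots> = integral {- real N..real N} H"
    proof (induction N)
      case (Suc N)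
      have "{- int (Suc N)..<int (Suc N)} = insert (- int N - 1) (insert (int N) {- int N..<int N})" by auto
      then have "(\<Sum>n\<in>{- int (Suc N)..<int (Suc N)}. integral {of_int n..of_int n + 1} H)
         = integral {- real N - 1..- real N} H + (integral {- real N..real N} H + integral {real N..real N + 1} H)"
        using Suc by simp
      also have "integral {- real N..real N} H + integral {real N..real N + 1} H = integral {- real N..real N + 1} H"
        by (rule Henstock_Kurzweil_Integration.integral_combine) (auto intro: iH)
      also have "integral {- real N - 1..- real N} H + integral {- real N..real N + 1} H = integral {- real N - 1..real N + 1} H"
        by (rule Henstock_Kurzweil_Integration.integral_combine) (auto intro: iH)
      also have "{- real N - 1..real N + 1} = {- real (Suc N)..real (Suc N)}" by (simp add: algebra_simps)
      finally show ?case .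
    qed simp
    finally show ?thesis .
  qed
  with lim have "(\<lambda>N::nat. integral {- real N..real N} H) \<longlonglongrightarrow> J" by simp
  then have "J = integral\<^sup>L lborel H"
    using integral_symmetric_interval_tendsto[OF int] LIMSEQ_unique by blast
  with IJ(2) show ?thesis by (simp add: has_integral_iff)
qed

text \<open>
  This is \<open>\<Sum>\<^sub>n exp (-\<pi> t (n + z)\<^sup>2)\<close>, written in terms of the
  theta series in order to inherit its holomorphy.
\<close>
definition gauss_sum :: "complex \<Rightarrow> complex \<Rightarrow> complex" where
  "gauss_sum t z = exp (- (of_real pi * t * z\<^sup>2)) * theta_series (of_real pi * t) (- (2 * of_real pi * t * z))"

lemma has_sum_gauss_sum:
  assumes "Re t > 0"
  shows "((\<lambda>n::int. exp (- (of_real pi * t * (of_int n + z)\<^sup>2))) has_sum gauss_sum t z) UNIV"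
proof -
  have "((\<lambda>n::int. exp (of_int n * (- (2 * of_real pi * t * z)) - (of_int n)\<^sup>2 * (of_real pi * t))) has_sum theta_series (of_real pi * t) (- (2 * of_real pi * t * z))) UNIV"
    unfolding theta_series_def using assms by (intro has_sum_infsum theta_series_summable) auto
  from has_sum_cmult_right[OF this, of "exp (- (of_real pi * t * z\<^sup>2))"]
  show ?thesis unfolding gauss_sum_def
    by (simp add: exp_add[symmetric] power2_eq_square algebra_simps)
qed

lemma gauss_sum_holomorphic:
  assumes "f holomorphic_on S" "g holomorphic_on S" "open S" "\<And>s. s \<in> S \<Longrightarrow> Re (f s) > 0"
  shows "(\<lambda>s. gauss_sum (f s) (g s)) holomorphic_on S"
  unfolding gauss_sum_def using assms
  by (intro holomorphic_intros theta_series_holomorphic) auto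

text \<open>
  Fourier inversion at \<open>0\<close> for the entire, \<open>1\<close>-periodic function
  \<open>z \<mapsto> gauss_sum t (z + x\<^sub>0)\<close>; its Fourier coefficients are Gaussian
  integrals after unfolding.
\<close>
lemma poisson_gauss_real:
  fixes t x0 :: real
  assumes t: "t > 0"
  shows "gauss_sum (of_real t) (of_real x0) = 1 / csqrt (of_real t) * theta_series (of_real (pi / t)) (2 * of_real pi * \<i> * of_real x0)"
proof -
  define f where "f = (\<lambda>z. gauss_sum (of_real t) (z + of_real x0))"
  have f: "f holomorphic_on UNIV"
    unfolding f_def using t by (intro gauss_sum_holomorphic holomorphic_intros) auto
  have hs: "((\<lambda>n::int. exp (- (of_real pi * of_real t * (of_int n + (z + of_real x0))\<^sup>2))) has_sum f z) UNIV" for z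
    unfolding f_def by (rule has_sum_gauss_sum) (use t in auto)
  have "((\<lambda>n::int. exp (- (of_real pi * of_real t * (of_int n + (0 + of_real x0))\<^sup>2))) has_sum f 1) UNIV"
  proof (subst has_sum_reindex_bij_betw[symmetric])
    show "bij_betw (\<lambda>n::int. n + 1) UNIV UNIV" by (rule bij_betwI[of _ _ _ "\<lambda>n. n - 1"]) auto
    show "((\<lambda>n::int. exp (- (of_real pi * of_real t * (of_int (n + 1) + (0 + of_real x0))\<^sup>2))) has_sum f 1) UNIV"
      using hs[of 1] by (simp add: algebra_simps)
  qed
  then have f1: "f 1 = f 0" using hs[of 0] has_sum_unique by blast
  define G where "G = (\<lambda>x. exp (- (of_real (pi * t * (x + x0)\<^sup>2))) :: complex)"
  define fh where "fh = (\<lambda>m::int. integral {0..1} (\<lambda>x. f (of_real x) * ee (- of_int m * of_real x)))"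
  have fG: "((\<lambda>n::int. G (real_of_int n + x)) has_sum f (of_real x)) UNIV" for x
    using hs[of "of_real x"] by (simp add: G_def algebra_simps)
  have fh: "fh m = of_real (1 / sqrt t) * (exp (- (of_real (pi * (of_int m)\<^sup>2 / t))) * ee (of_int m * of_real x0))" for m
  proof -
    define H where "H = (\<lambda>x::real. G x * ee (- of_int m * of_real x))"
    have "f (of_real x) * ee (- of_int m * of_real x) = (\<Sum>\<^sub>\<infinity>n::int. H (real_of_int n + x))" for x
    proof -
      have "H (real_of_int n + x) = G (real_of_int n + x) * ee (- of_int m * of_real x)" for n
      proof -
        have "ee (- of_int m * of_real (real_of_int n + x)) = ee (of_int (- m * n)) * ee (- of_int m * of_real x)"
          unfolding ee_add[symmetric] by (simp add: algebra_simps)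
        then show ?thesis by (simp only: H_def ee_of_int) simp
      qed
      then show ?thesis using has_sum_cmult_left[OF fG[of x], of "ee (- of_int m * of_real x)"]
        by (simp add: infsumI)
    qed
    then have "fh m = integral {0..1} (\<lambda>x. \<Sum>\<^sub>\<infinity>n::int. H (real_of_int n + x))" by (simp add: fh_def)
    also have "\<dots> = integral\<^sup>L lborel H"
    proof (rule integral_periodization)
      show "continuous_on UNIV H" unfolding H_def G_def ee_def by (intro continuous_intros)
      show "integrable lborel H" unfolding H_def G_def by (rule gaussian_fourier_transform(1)[OF t])
      define Y where "Y = \<bar>x0\<bar> + 1"
      show "(\<lambda>n::int. exp (- (pi * t) * (real_of_int n)\<^sup>2 + (2 * pi * t * Y) * \<bar>real_of_int n\<bar>)) summable_on UNIV"
        using t by (intro gauss_summable_on_int) auto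
      fix n :: int and x :: real assume x: "x \<in> {0..1}"
      have "norm (H (real_of_int n + x)) = exp (- (pi * t * (real_of_int n + x + x0)\<^sup>2))"
        using norm_ee_real[of "- (of_int m * (of_int n + x))"] by (simp add: H_def G_def norm_mult)
      also have "\<dots> \<le> exp (- (pi * t) * (real_of_int n)\<^sup>2 + (2 * pi * t * Y) * \<bar>real_of_int n\<bar>)"
      proof -
        have "\<bar>(x + x0) * real_of_int n\<bar> \<le> Y * \<bar>real_of_int n\<bar>"
          unfolding abs_mult using x by (intro mult_right_mono) (auto simp: Y_def)
        then have "- (Y * \<bar>real_of_int n\<bar>) \<le> (x + x0) * real_of_int n" by linarith
        then have "(real_of_int n)\<^sup>2 - 2 * (Y * \<bar>real_of_int n\<bar>) \<le> (real_of_int n)\<^sup>2 + 2 * ((x + x0) * real_of_int n) + (x + x0)\<^sup>2"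
          using zero_le_power2[of "x + x0"] by linarith
        also have "\<dots> = (real_of_int n + x + x0)\<^sup>2" by (simp add: power2_eq_square algebra_simps)
        finally have "(pi * t) * ((real_of_int n)\<^sup>2 - 2 * (Y * \<bar>real_of_int n\<bar>)) \<le> (pi * t) * (real_of_int n + x + x0)\<^sup>2"
          using t by (intro mult_left_mono) auto
        then show ?thesis by (simp add: algebra_simps)
      qed
      finally show "norm (H (real_of_int n + x)) \<le> exp (- (pi * t) * (real_of_int n)\<^sup>2 + (2 * pi * t * Y) * \<bar>real_of_int n\<bar>)" .
    qed
    also have "\<dots> = of_real (1 / sqrt t) * (exp (- (of_real (pi * (of_int m)\<^sup>2 / t))) * ee (of_int m * of_real x0))"
      unfolding H_def G_def by (rule gaussian_fourier_transform(2)[OF t])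
    finally show ?thesis .
  qed
  define \<Theta> where "\<Theta> = theta_series (of_real (pi / t)) (2 * of_real pi * \<i> * of_real x0)"
  have "((\<lambda>m::int. exp (of_int m * (2 * of_real pi * \<i> * of_real x0) - (of_int m)\<^sup>2 * of_real (pi / t))) has_sum \<Theta>) UNIV"
    unfolding \<Theta>_def theta_series_def using t by (intro has_sum_infsum theta_series_summable) auto
  then have "(fh has_sum (of_real (1 / sqrt t) * \<Theta>)) UNIV"
    unfolding fh[abs_def]
    by (intro has_sum_cmult_right) (simp add: ee_def exp_add[symmetric] algebra_simps)
  then have "(sum fh \<longlongrightarrow> of_real (1 / sqrt t) * \<Theta>) (finite_subsets_at_top UNIV)" by (simp add: has_sum_def)
  from filterlim_compose[OF this filterlim_symmetric_int_intervals(1)]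
  have "(\<lambda>M::nat. \<Sum>m\<in>{- int M..int M}. fh m) \<longlonglongrightarrow> of_real (1 / sqrt t) * \<Theta>" .
  moreover have "(\<lambda>M::nat. \<Sum>m\<in>{- int M..int M}. fh m) \<longlonglongrightarrow> f 0"
    unfolding fh_def by (rule fourier_inversion_at_0[OF f f1])
  ultimately have "f 0 = of_real (1 / sqrt t) * \<Theta>" using LIMSEQ_unique by blast
  then show ?thesis using t by (simp add: f_def \<Theta>_def)
qed

lemma islimpt_of_real: "complex_of_real x islimpt complex_of_real ` {y. y > x}"
proof -
  have "\<exists>y\<in>complex_of_real ` {y. y > x}. y \<noteq> of_real x \<and> dist y (of_real x) < e" if "e > 0" for e
    using that by (intro bexI[of _ "of_real (x + e / 2)"] imageI) (auto simp: dist_norm)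
  then show ?thesis unfolding islimpt_approachable by blast
qed

text \<open>
  Both sides are holomorphic in \<open>z\<close> and in \<open>t\<close>, so the identity
  theorem extends the formula first from real to complex \<open>z\<close> and then from real to
  complex \<open>t\<close>.
\<close>
theorem poisson_gauss:
  assumes t: "Re t > 0"
  shows "gauss_sum t z = 1 / csqrt t * theta_series (of_real pi / t) (2 * of_real pi * \<i> * z)"
proof -
  have real_t: "gauss_sum (of_real t) z = 1 / csqrt (of_real t) * theta_series (of_real (pi / t)) (2 * of_real pi * \<i> * z)"
    if t: "t > 0" for t :: real and z
  proof -
    have "gauss_sum (of_real t) z - 1 / csqrt (of_real t) * theta_series (of_real (pi / t)) (2 * of_real pi * \<i> * z) = 0"
    proof (rule analytic_continuation[where f = "\<lambda>z. gauss_sum (of_real t) z - 1 / csqrt (of_real t) * theta_series (of_real (pi / t)) (2 * of_real pi * \<i> * z)" and w = z and S = UNIV and U = "complex_of_real ` {y. y > 0}" and \<xi> = "of_real 0"])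
      show "(\<lambda>z. gauss_sum (of_real t) z - 1 / csqrt (of_real t) * theta_series (of_real (pi / t)) (2 * of_real pi * \<i> * z)) holomorphic_on UNIV"
        using t by (intro holomorphic_intros gauss_sum_holomorphic theta_series_holomorphic) auto
      show "complex_of_real 0 islimpt complex_of_real ` {y. y > 0}" by (rule islimpt_of_real)
    qed (use poisson_gauss_real[OF t] in auto)
    then show ?thesis by simp
  qed
  have "gauss_sum t z - 1 / csqrt t * theta_series (of_real pi / t) (2 * of_real pi * \<i> * z) = 0"
  proof (rule analytic_continuation[where f = "\<lambda>t. gauss_sum t z - 1 / csqrt t * theta_series (of_real pi / t) (2 * of_real pi * \<i> * z)" and w = t and S = "{t. Re t > 0}" and U = "complex_of_real ` {y. y > 1}" and \<xi> = "of_real 1"])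
    have np: "s \<notin> \<real>\<^sub>\<le>\<^sub>0" if "Re s > 0" for s using that by (auto simp: complex_nonpos_Reals_iff)
    show "(\<lambda>t. gauss_sum t z - 1 / csqrt t * theta_series (of_real pi / t) (2 * of_real pi * \<i> * z)) holomorphic_on {t. Re t > 0}"
      by (intro holomorphic_intros gauss_sum_holomorphic theta_series_holomorphic)
         (auto simp: np Re_divide open_halfspace_Re_gt divide_pos_pos intro!: divide_pos_pos mult_pos_pos add_pos_nonneg)
    show "complex_of_real 1 islimpt complex_of_real ` {y. y > 1}" by (rule islimpt_of_real)
    show "connected {t. 0 < Re t}" by (intro convex_connected convex_halfspace_Re_gt)
  qed (use real_t t in \<open>auto simp: open_halfspace_Re_gt\<close>)
  then show ?thesis by simp
qed

section \<open>The Dedekind eta function\<close>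

lemma Re_csqrt_pos:
  assumes "Re t > 0"
  shows "Re (csqrt t) > 0"
proof (rule ccontr)
  define u where "u = csqrt t"
  assume "\<not> ?thesis"
  then have "Re u = 0" using csqrt_principal[of t] unfolding u_def by linarith
  moreover have "Re (u\<^sup>2) = (Re u)\<^sup>2 - (Im u)\<^sup>2" by (simp add: power2_eq_square)
  ultimately have "Re (u\<^sup>2) \<le> 0" by simp
  with assms show False unfolding u_def power2_csqrt by simp
qed

text \<open>
  The metaplectic group uses the root of \<open>\<tau>\<close>, while Poisson summation produces
  the root of \<open>\<tau>/\<i>\<close>. All eighth roots of unity in the inversion laws come
  from this comparison.
\<close>
lemma csqrt_upper_half_plane:
  assumes "Im \<tau> > 0"
  shows "csqrt \<tau> = ee (1 / 8) * csqrt (\<tau> / \<i>)"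
proof -
  define u where "u = csqrt \<tau>"
  have "Im (u\<^sup>2) = 2 * Re u * Im u" by (simp add: power2_eq_square)
  moreover have "Im (u\<^sup>2) = Im \<tau>" unfolding u_def power2_csqrt ..
  ultimately have "Im \<tau> = 2 * (Re u * Im u)" by (simp only: mult.assoc)
  then have *: "Re u * Im u > 0" using assms by linarith
  have "Re u \<ge> 0" unfolding u_def by (rule Re_csqrt)
  with * have pos: "Re u > 0" "Im u > 0" by (auto simp: zero_less_mult_iff)
  have e8: "ee (1 / 8) = (1 + \<i>) / of_real (sqrt 2)"
  proof -
    have "ee (1 / 8) = exp (\<i> * of_real (pi / 4))" by (simp add: ee_def)
    also have "\<dots> = cis (pi / 4)" by (rule cis_conv_exp[symmetric])
    finally show ?thesis by (auto simp: complex_eq_iff cos_45 sin_45 real_div_sqrt Re_divide Im_divide field_simps power2_eq_square)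
  qed
  have n8: "ee (1 / 8) * ((1 - \<i>) / of_real (sqrt 2)) = 1"
    unfolding e8 by (simp add: field_simps of_real_mult[symmetric] del: of_real_mult)
  have "csqrt (\<tau> / \<i>) = u * ((1 - \<i>) / of_real (sqrt 2))"
  proof (rule csqrt_unique)
    have "(u * ((1 - \<i>) / of_real (sqrt 2)))\<^sup>2 = \<tau> * ((1 - \<i>)\<^sup>2 / 2)"
      by (simp add: u_def power_mult_distrib power_divide of_real_power[symmetric] del: of_real_power)
    also have "(1 - \<i>)\<^sup>2 = 2 / \<i>" by (simp add: power2_eq_square algebra_simps)
    finally show "(u * ((1 - \<i>) / of_real (sqrt 2)))\<^sup>2 = \<tau> / \<i>" by simp
    have "Re (u * ((1 - \<i>) / of_real (sqrt 2))) = (Re u + Im u) / sqrt 2"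
      by (simp add: Re_divide_of_real algebra_simps add_divide_distrib)
    then show "0 < Re (u * ((1 - \<i>) / of_real (sqrt 2))) \<or> Re (u * ((1 - \<i>) / of_real (sqrt 2))) = 0 \<and> 0 \<le> Im (u * ((1 - \<i>) / of_real (sqrt 2)))"
      using pos by auto
  qed
  then have "ee (1 / 8) * csqrt (\<tau> / \<i>) = u * (ee (1 / 8) * ((1 - \<i>) / of_real (sqrt 2)))" by simp
  also have "\<dots> = u" by (simp only: n8 mult_1_right)
  finally show ?thesis by (simp add: u_def)
qed

fun triangular :: "nat \<Rightarrow> nat" where
  "triangular 0 = 0"
| "triangular (Suc n) = triangular n + Suc n"

lemma two_triangular: "2 * triangular n = n * Suc n"
  by (induction n) auto

text \<open>
  Shanks' sum interpolates between the two sides of the pentagonal number theorem: its term with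
  \<open>s = 0\<close> is the partial product \<open>\<Prod>\<^bsub>k\<le>n\<^esub> (1 -
  x\<^sup>k)\<close>, and its increments in \<open>n\<close> are pairs of terms of the
  pentagonal series.
\<close>
definition shanks_sum :: "complex \<Rightarrow> nat \<Rightarrow> complex" where
  "shanks_sum x n = (\<Sum>s\<le>n. (-1) ^ s * (\<Prod>k\<in>{Suc s..n}. 1 - x ^ k) * x ^ (s * n + triangular s))"

text \<open>
  The termwise differences form a telescoping sum in \<open>s\<close>, because
  \<open>a\<^bsub>s+1\<^esub> (1 - x\<^bsup>s+1\<^esup>) = -a\<^sub>s\<close> for the
  coefficients \<open>a\<^sub>s = (-1)\<^sup>s \<Prod>\<^bsub>s<k\<le>n\<^esub> (1 -
  x\<^sup>k)\<close>.
\<close>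
lemma shanks_sum_Suc:
  "shanks_sum x (Suc n) = shanks_sum x n + (-1) ^ Suc n * (x ^ (Suc n * Suc n + triangular n) + x ^ (Suc n * Suc n + triangular (Suc n)))"
proof -
  define a where "a = (\<lambda>s. (-1) ^ s * (\<Prod>k\<in>{Suc s..n}. 1 - x ^ k))"
  have aS: "a (Suc s) * (1 - x ^ Suc s) = - a s" if "Suc s \<le> n" for s
  proof -
    have "{Suc s..n} = insert (Suc s) {Suc (Suc s)..n}" using that by auto
    then show ?thesis by (simp add: a_def)
  qed
  have tel: "(\<Sum>s\<le>j. a s * ((1 - x ^ Suc n) * x ^ (s * Suc n + triangular s) - x ^ (s * n + triangular s)))
     = - a j * x ^ (Suc j * Suc n + triangular j)" if "j \<le> n" for j
    using that
  proof (induction j)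
    case 0 then show ?case by (simp add: algebra_simps)
  next
    case (Suc j)
    have e: "x ^ (Suc j * Suc n + triangular (Suc j)) = x ^ (Suc j * n + triangular (Suc j)) * x ^ Suc j"
      by (simp add: power_add[symmetric] algebra_simps)
    have e2: "x ^ (Suc j * Suc n + triangular j) = x ^ (Suc j * n + triangular (Suc j))"
      by (simp add: algebra_simps)
    have e3: "x ^ Suc n * x ^ (Suc j * Suc n + triangular (Suc j)) = x ^ (Suc (Suc j) * Suc n + triangular (Suc j))"
      by (simp only: power_add[symmetric]) (simp add: algebra_simps)
    have "(\<Sum>s\<le>Suc j. a s * ((1 - x ^ Suc n) * x ^ (s * Suc n + triangular s) - x ^ (s * n + triangular s)))
      = - a j * x ^ (Suc j * Suc n + triangular j) + a (Suc j) * ((1 - x ^ Suc n) * x ^ (Suc j * Suc n + triangular (Suc j)) - x ^ (Suc j * n + triangular (Suc j)))"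
      using Suc by simp
    also have "(1 - x ^ Suc n) * x ^ (Suc j * Suc n + triangular (Suc j)) - x ^ (Suc j * n + triangular (Suc j))
      = - ((1 - x ^ Suc j) * x ^ (Suc j * n + triangular (Suc j))) - x ^ (Suc (Suc j) * Suc n + triangular (Suc j))"
      unfolding left_diff_distrib e3 unfolding e by (simp add: algebra_simps del: power_Suc triangular.simps mult_Suc mult_Suc_right)
    also have "a (Suc j) * \<dots> = - (a (Suc j) * (1 - x ^ Suc j)) * x ^ (Suc j * n + triangular (Suc j)) - a (Suc j) * x ^ (Suc (Suc j) * Suc n + triangular (Suc j))"
      by (simp add: algebra_simps del: power_Suc triangular.simps mult_Suc mult_Suc_right)
    also have "\<dots> = a j * x ^ (Suc j * Suc n + triangular j) - a (Suc j) * x ^ (Suc (Suc j) * Suc n + triangular (Suc j))"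
      by (subst aS) (use Suc.prems e2 in auto)
    finally show ?case by simp
  qed
  have "shanks_sum x (Suc n) = (\<Sum>s\<le>n. a s * ((1 - x ^ Suc n) * x ^ (s * Suc n + triangular s))) + (-1) ^ Suc n * x ^ (Suc n * Suc n + triangular (Suc n))"
  proof -
    have "(-1) ^ s * (\<Prod>k\<in>{Suc s..Suc n}. 1 - x ^ k) * x ^ (s * Suc n + triangular s) = a s * ((1 - x ^ Suc n) * x ^ (s * Suc n + triangular s))" if "s \<le> n" for s
      using that by (simp add: a_def prod.atLeast_Suc_atMost_Suc_shift atLeastAtMostSuc_conv mult_ac)
    then show ?thesis unfolding shanks_sum_def sum.atMost_Suc by (intro arg_cong2[where f="(+)"] sum.cong) auto
  qed
  moreover have "shanks_sum x n = (\<Sum>s\<le>n. a s * x ^ (s * n + triangular s))" by (simp add: shanks_sum_def a_def)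
  ultimately have "shanks_sum x (Suc n) - shanks_sum x n = (\<Sum>s\<le>n. a s * ((1 - x ^ Suc n) * x ^ (s * Suc n + triangular s) - x ^ (s * n + triangular s))) + (-1) ^ Suc n * x ^ (Suc n * Suc n + triangular (Suc n))"
    by (simp only: right_diff_distrib sum_subtractf add_diff_eq diff_add_eq)
  also have "\<dots> = - a n * x ^ (Suc n * Suc n + triangular n) + (-1) ^ Suc n * x ^ (Suc n * Suc n + triangular (Suc n))"
    by (subst tel) auto
  also have "a n = (-1) ^ n" by (simp add: a_def)
  finally show ?thesis by (simp add: algebra_simps)
qed

text \<open>
  Every term with \<open>s \<ge> 1\<close> contains \<open>x\<^sup>n\<close>, and the partial
  products are bounded.
\<close>
lemma shanks_sum_tendsto:
  assumes x: "norm x < 1"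
  shows "(\<lambda>n. shanks_sum x n - (\<Prod>k\<in>{1..n}. 1 - x ^ k)) \<longlonglongrightarrow> 0"
proof -
  define r where "r = norm x"
  have r: "0 \<le> r" "r < 1" using x by (auto simp: r_def)
  define B where "B = exp (1 / (1 - r))"
  have B: "norm (\<Prod>k\<in>{Suc s..n}. 1 - x ^ k) \<le> B" for s n
  proof -
    have "norm (\<Prod>k\<in>{Suc s..n}. 1 - x ^ k) \<le> (\<Prod>k\<in>{Suc s..n}. exp (r ^ k))"
      unfolding prod_norm[symmetric]
    proof (intro prod_mono conjI norm_ge_zero)
      fix k
      have "norm (1 - x ^ k) \<le> 1 + r ^ k" using norm_triangle_ineq4[of 1 "x ^ k"] by (simp add: r_def norm_power)
      also have "\<dots> \<le> exp (r ^ k)" by (rule exp_ge_add_one_self)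
      finally show "norm (1 - x ^ k) \<le> exp (r ^ k)" .
    qed
    also have "\<dots> = exp (\<Sum>k\<in>{Suc s..n}. r ^ k)" by (simp add: exp_sum)
    also have "(\<Sum>k\<in>{Suc s..n}. r ^ k) \<le> (\<Sum>k. r ^ k)"
      by (intro sum_le_suminf summable_geometric) (use r in auto)
    also have "(\<Sum>k. r ^ k) = 1 / (1 - r)" using r by (intro suminf_geometric) auto
    finally show ?thesis by (simp add: B_def)
  qed
  have bound: "norm (shanks_sum x n - (\<Prod>k\<in>{1..n}. 1 - x ^ k)) \<le> B * (real n * r ^ n)" for n
  proof -
    have "{..n} = insert 0 {1..n}" by auto
    then have "shanks_sum x n = (\<Prod>k\<in>{1..n}. 1 - x ^ k) + (\<Sum>s\<in>{1..n}. (-1) ^ s * (\<Prod>k\<in>{Suc s..n}. 1 - x ^ k) * x ^ (s * n + triangular s))"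
      unfolding shanks_sum_def by simp
    then have "norm (shanks_sum x n - (\<Prod>k\<in>{1..n}. 1 - x ^ k)) = norm (\<Sum>s\<in>{1..n}. (-1) ^ s * (\<Prod>k\<in>{Suc s..n}. 1 - x ^ k) * x ^ (s * n + triangular s))" by simp
    also have "\<dots> \<le> (\<Sum>s\<in>{1..n}. B * r ^ n)"
    proof (rule sum_norm_le)
      fix s assume s: "s \<in> {1..n}"
      have "n \<le> s * n + triangular s" using s by (cases s) auto
      then have "r ^ (s * n + triangular s) \<le> r ^ n" using r by (intro power_decreasing) auto
      then have "norm (\<Prod>k\<in>{Suc s..n}. 1 - x ^ k) * r ^ (s * n + triangular s) \<le> B * r ^ n"
        by (intro mult_mono B) (use r in \<open>simp_all add: B_def\<close>)
      then show "norm ((-1) ^ s * (\<Prod>k\<in>{Suc s..n}. 1 - x ^ k) * x ^ (s * n + triangular s)) \<le> B * r ^ n"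
        by (simp add: norm_mult norm_power r_def)
    qed
    also have "\<dots> = B * (real n * r ^ n)" by simp
    finally show ?thesis .
  qed
  have "(\<lambda>n. B * (real n * r ^ n)) \<longlonglongrightarrow> B * 0"
    by (intro tendsto_mult tendsto_const powser_times_n_limit_0) (use r in auto)
  then have "(\<lambda>n. B * (real n * r ^ n)) \<longlonglongrightarrow> 0" by simp
  then show ?thesis by (rule Lim_null_comparison[OF always_eventually[OF allI[OF bound]]])
qed

lemma euler_product:
  assumes "Im \<tau> > 0"
  shows "(\<lambda>n. \<Prod>k\<in>{1..n}. 1 - ee \<tau> ^ k) \<longlonglongrightarrow> (\<Prod>m. 1 - ee (of_nat (Suc m) * \<tau>))"
    and "(\<Prod>m. 1 - ee (of_nat (Suc m) * \<tau>)) \<noteq> 0"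
proof -
  define x where "x = ee \<tau>"
  have x: "norm x < 1" using assms by (simp add: x_def norm_ee)
  have t: "1 - ee (of_nat (Suc m) * \<tau>) = 1 - x ^ Suc m" for m by (simp only: x_def ee_power)
  have conv: "convergent_prod (\<lambda>m. 1 - x ^ Suc m)"
  proof (intro abs_convergent_prod_imp_convergent_prod summable_imp_abs_convergent_prod)
    have "summable (\<lambda>m. norm x * norm x ^ m)" by (intro summable_mult summable_geometric) (use x in auto)
    then show "summable (\<lambda>m. norm (1 - x ^ Suc m - 1))" by (simp add: norm_mult norm_power)
  qed
  have nz: "1 - x ^ Suc m \<noteq> 0" for m
  proof
    assume "1 - x ^ Suc m = 0"
    then have "norm (x ^ Suc m) = 1" by simp
    moreover have "norm x * norm x ^ m \<le> norm x * 1" using x by (intro mult_left_mono power_le_one) auto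
    then have "norm x ^ Suc m < 1" using x by simp
    ultimately show False by (simp add: norm_power norm_mult)
  qed
  show "(\<Prod>m. 1 - ee (of_nat (Suc m) * \<tau>)) \<noteq> 0"
    unfolding t by (rule prodinf_nonzero[OF conv nz])
  have "(\<lambda>n. \<Prod>k\<in>{1..Suc n}. 1 - x ^ k) \<longlonglongrightarrow> (\<Prod>m. 1 - x ^ Suc m)"
  proof -
    have "(\<Prod>m\<le>n. 1 - x ^ Suc m) = (\<Prod>k\<in>{1..Suc n}. 1 - x ^ k)" for n
      unfolding One_nat_def prod.shift_bounds_cl_Suc_ivl by (simp add: atMost_atLeast0)
    then show ?thesis using convergent_prod_LIMSEQ[OF conv] by simp
  qed
  then show "(\<lambda>n. \<Prod>k\<in>{1..n}. 1 - ee \<tau> ^ k) \<longlonglongrightarrow> (\<Prod>m. 1 - ee (of_nat (Suc m) * \<tau>))"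
    unfolding t x_def[symmetric] by (rule LIMSEQ_imp_Suc)
qed

lemma dedekind_eta_nonzero: "Im \<tau> > 0 \<Longrightarrow> dedekind_eta \<tau> \<noteq> 0"
  using euler_product(2) by (simp add: dedekind_eta_def)

lemma summable_gauss_character:
  fixes a b :: complex
  assumes "Im \<tau> > 0"
  shows "(\<lambda>s::int. ee (of_int s * a) * ee (\<tau> * (6 * of_int s + b)\<^sup>2 / 24)) summable_on UNIV"
proof -
  have "(\<lambda>n::int. exp (of_int n * (2 * of_real pi * \<i> * (a + \<tau> * b / 2)) - (of_int n)\<^sup>2 * (- (3 * of_real pi * \<i> * \<tau>)))) summable_on UNIV"
    by (rule theta_series_summable) (use assms in auto)
  then have "(\<lambda>n::int. ee (\<tau> * b\<^sup>2 / 24) * exp (of_int n * (2 * of_real pi * \<i> * (a + \<tau> * b / 2)) - (of_int n)\<^sup>2 * (- (3 * of_real pi * \<i> * \<tau>)))) summable_on UNIV"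
    by (rule summable_on_cmult_right)
  moreover have "ee (\<tau> * b\<^sup>2 / 24) * exp (of_int n * (2 * of_real pi * \<i> * (a + \<tau> * b / 2)) - (of_int n)\<^sup>2 * (- (3 * of_real pi * \<i> * \<tau>))) = ee (of_int n * a) * ee (\<tau> * (6 * of_int n + b)\<^sup>2 / 24)" for n
  proof -
    have "2 * of_real pi * \<i> * (\<tau> * b\<^sup>2 / 24) + (of_int n * (2 * of_real pi * \<i> * (a + \<tau> * b / 2)) - (of_int n)\<^sup>2 * (- (3 * of_real pi * \<i> * \<tau>)))
      = 2 * of_real pi * \<i> * (of_int n * a) + 2 * of_real pi * \<i> * (\<tau> * (6 * of_int n + b)\<^sup>2 / 24)"
      by (simp add: power2_eq_square field_simps)
    then show ?thesis unfolding ee_def exp_add[symmetric] by (rule arg_cong)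
  qed
  ultimately show ?thesis by simp
qed

text \<open>
  The factor \<open>q\<^bsup>1/24\<^esup>\<close> of the eta function completes the square in
  the pentagonal exponents: \<open>s (3s + 1)/2 + 1/24 = (6s + 1)\<^sup>2/24\<close>. The sign
  \<open>(-1)\<^sup>s\<close> is written \<open>e(s/2)\<close>, which makes the series a theta
  series.
\<close>
theorem pentagonal_number_theorem:
  assumes "Im \<tau> > 0"
  shows "((\<lambda>s::int. ee (of_int s * (1/2)) * ee (\<tau> * (6 * of_int s + 1)\<^sup>2 / 24)) has_sum dedekind_eta \<tau>) UNIV"
proof -
  define p where "p = (\<lambda>s::int. ee (of_int s * (1/2)) * ee (\<tau> * (6 * of_int s + 1)\<^sup>2 / 24))"
  have "norm (ee \<tau>) < 1" using assms by (simp add: norm_ee)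
  from tendsto_add[OF shanks_sum_tendsto[OF this] euler_product(1)[OF assms]]
  have lim: "(\<lambda>n. ee (\<tau> / 24) * shanks_sum (ee \<tau>) n) \<longlonglongrightarrow> dedekind_eta \<tau>"
    unfolding dedekind_eta_def by (intro tendsto_mult tendsto_const) simp
  have half: "ee (of_int s * (1/2)) = (-1) ^ nat \<bar>s\<bar>" for s
  proof -
    have "ee (1/2) = -1" by (simp add: ee_def)
    then have *: "ee (of_nat n * (1/2)) = (-1) ^ n" for n using ee_power[of "1/2" n] by simp
    show ?thesis
    proof (cases "s \<ge> 0")
      case True then show ?thesis using *[of "nat s"] by simp
    next
      case False
      then have "ee (of_int s * (1/2)) = inverse (ee (of_nat (nat (-s)) * (1/2)))" by (simp add: ee_minus[symmetric])
      also have "\<dots> = (-1) ^ nat (-s)" by (simp only: * power_inverse[symmetric]) simp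
      finally show ?thesis using False by simp
    qed
  qed
  \<comment> \<open>Shanks' identity adds the two terms \<open>s = -n - 1\<close> and \<open>s = n + 1\<close>.\<close>
  have "ee (\<tau> / 24) * shanks_sum (ee \<tau>) n = (\<Sum>s\<in>{- int n..int n}. p s)" for n
  proof (induction n)
    case 0 then show ?case by (simp add: shanks_sum_def p_def)
  next
    case (Suc n)
    have "{- int (Suc n)..int (Suc n)} = insert (- int n - 1) (insert (int n + 1) {- int n..int n})" by auto
    then have "(\<Sum>s\<in>{- int (Suc n)..int (Suc n)}. p s) = p (- int n - 1) + p (int n + 1) + (\<Sum>s\<in>{- int n..int n}. p s)"
      by simp
    also have "p (- int n - 1) = ee (\<tau> / 24) * ((-1) ^ Suc n * ee \<tau> ^ (Suc n * Suc n + triangular n))"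
    proof -
      have "of_nat (triangular n) = (of_nat n * (of_nat n + 1) / 2 :: complex)"
        using arg_cong[OF two_triangular[of n], of "of_nat :: nat \<Rightarrow> complex"] by (simp add: field_simps)
      then have "\<tau> * (6 * of_int (- int n - 1) + 1)\<^sup>2 / 24 = \<tau> / 24 + of_nat (Suc n * Suc n + triangular n) * \<tau>"
        by (simp only: of_nat_add of_nat_mult of_nat_Suc of_int_diff of_int_minus of_int_of_nat_eq of_int_1)
           (simp add: power2_eq_square field_simps)
      moreover have "nat \<bar>- int n - 1\<bar> = Suc n" by simp
      ultimately show ?thesis unfolding p_def half ee_power by (simp only: ee_add) (simp add: mult_ac)
    qed
    also have "p (int n + 1) = ee (\<tau> / 24) * ((-1) ^ Suc n * ee \<tau> ^ (Suc n * Suc n + triangular (Suc n)))"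
    proof -
      have "of_nat (triangular (Suc n)) = ((of_nat n + 1) * (of_nat n + 2) / 2 :: complex)"
        using arg_cong[OF two_triangular[of "Suc n"], of "of_nat :: nat \<Rightarrow> complex"] by (simp add: field_simps del: triangular.simps)
      then have "\<tau> * (6 * of_int (int n + 1) + 1)\<^sup>2 / 24 = \<tau> / 24 + of_nat (Suc n * Suc n + triangular (Suc n)) * \<tau>"
        by (simp only: of_nat_add of_nat_mult of_nat_Suc of_int_add of_int_of_nat_eq of_int_1)
           (simp add: power2_eq_square field_simps)
      moreover have "nat \<bar>int n + 1\<bar> = Suc n" by simp
      ultimately show ?thesis unfolding p_def half ee_power by (simp only: ee_add) (simp add: mult_ac)
    qed
    finally show ?case unfolding shanks_sum_Suc distrib_left Suc by (simp only: add_ac)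
  qed
  with lim have lim1: "(\<lambda>n. \<Sum>s\<in>{- int n..int n}. p s) \<longlonglongrightarrow> dedekind_eta \<tau>" by simp
  have "p summable_on UNIV" unfolding p_def using summable_gauss_character[OF assms, of "1/2" 1] by simp
  then have hs: "(p has_sum infsum p UNIV) UNIV" by simp
  then have "(sum p \<longlongrightarrow> infsum p UNIV) (finite_subsets_at_top UNIV)" by (simp add: has_sum_def)
  from filterlim_compose[OF this filterlim_symmetric_int_intervals(1)]
  have "(\<lambda>n. \<Sum>s\<in>{- int n..int n}. p s) \<longlonglongrightarrow> infsum p UNIV" .
  with lim1 have "infsum p UNIV = dedekind_eta \<tau>" using LIMSEQ_unique by blast
  with hs show ?thesis by (simp add: p_def)
qed

lemma dedekind_eta_shift:
  "dedekind_eta (\<tau> + of_int n) = ee (of_int n / 24) * dedekind_eta \<tau>"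
proof -
  have "ee (of_nat (Suc m) * (\<tau> + of_int n)) = ee (of_nat (Suc m) * \<tau>)" for m
  proof -
    have "of_nat (Suc m) * (\<tau> + of_int n) = of_nat (Suc m) * \<tau> + of_int (int (Suc m) * n)" by (simp add: algebra_simps)
    then show ?thesis by (simp only: ee_add ee_of_int mult_1_right)
  qed
  then show ?thesis unfolding dedekind_eta_def by (simp only: add_divide_distrib ee_add) simp
qed

lemma has_sum_int_mod_3:
  fixes f :: "int \<Rightarrow> complex"
  assumes "((\<lambda>n. f (3 * n)) has_sum a) UNIV" "((\<lambda>n. f (3 * n + 1)) has_sum b) UNIV" "((\<lambda>n. f (3 * n + 2)) has_sum c) UNIV"
  shows "(f has_sum (a + b + c)) UNIV"
proof -
  have *: "(f has_sum x) (range (\<lambda>n. 3 * n + k))" if "((\<lambda>n. f (3 * n + k)) has_sum x) UNIV" for x k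
    using that by (subst has_sum_reindex) (auto simp: inj_on_def o_def)
  have "(f has_sum (a + b + c)) (range (\<lambda>n. 3 * n + 0) \<union> range (\<lambda>n. 3 * n + 1) \<union> range (\<lambda>n. 3 * n + 2))"
  proof (intro has_sum_Un_disjoint *)
    show "range (\<lambda>n::int. 3 * n + 0) \<inter> range (\<lambda>n. 3 * n + 1) = {}" by auto presburger
    show "(range (\<lambda>n::int. 3 * n + 0) \<union> range (\<lambda>n. 3 * n + 1)) \<inter> range (\<lambda>n. 3 * n + 2) = {}" by auto presburger+
  qed (use assms in auto)
  moreover have "range (\<lambda>n::int. 3 * n + 0) \<union> range (\<lambda>n. 3 * n + 1) \<union> range (\<lambda>n. 3 * n + 2) = UNIV"
  proof -
    have "x = 3 * (x div 3) + 0 \<or> x = 3 * (x div 3) + 1 \<or> x = 3 * (x div 3) + 2" for x :: int by presburger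
    then show ?thesis by blast
  qed
  ultimately show ?thesis by simp
qed

text \<open>
  Poisson summation turns the pentagonal series at \<open>-1/\<tau>\<close> into a series over
  all odd integers \<open>j\<close>. The class \<open>j \<equiv> 1\<close> modulo
  \<open>6\<close> contributes \<open>e(1/12) \<eta>(\<tau>)\<close>, the class \<open>j
  \<equiv> -1\<close> contributes \<open>e(-1/12) \<eta>(\<tau>)\<close>, and the class \<open>j
  \<equiv> 3\<close> cancels under \<open>j \<mapsto> -j\<close>. The two roots of unity add up
  to \<open>sqrt 3\<close>, which is the constant left over from \<open>t =
  3\<i>/\<tau>\<close>.
\<close>
theorem dedekind_eta_inversion:
  assumes \<tau>: "Im \<tau> > 0"
  shows "dedekind_eta (- 1 / \<tau>) = csqrt (\<tau> / \<i>) * dedekind_eta \<tau>"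
proof -
  have \<tau>0: "\<tau> \<noteq> 0" using \<tau> by auto
  define t where "t = 3 * \<i> / \<tau>"
  have t0: "t \<noteq> 0" using \<tau>0 by (simp add: t_def)
  have t: "Re t > 0" using \<tau> \<tau>0 by (simp add: t_def Re_divide complex_eq_iff sum_power2_gt_zero_iff)
  have \<tau>': "Im (- 1 / \<tau>) > 0" using \<tau> \<tau>0 by (simp add: Im_divide complex_eq_iff sum_power2_gt_zero_iff)
  define v where "v = - \<i> * \<tau> / 6"
  have tv: "t * v = 1 / 2" and ti: "c / t = c * (2 * v)" for c using \<tau>0 by (simp_all add: t_def v_def field_simps)
  \<comment> \<open>The sign \<open>e(s/2)\<close> is absorbed by a complex shift of the Gaussian; \<open>K\<close>
    is the factor that completing the square leaves behind.\<close>
  define z where "z = 1 / 6 - \<i> * v"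
  define K where "K = exp (- (of_real pi * \<i> / 6) - of_real pi * v / 2)"
  define E where "E = (\<lambda>j::int. ee (of_int j / 12) * ee (\<tau> * (of_int j)\<^sup>2 / 24))"
  have "K * exp (- (of_real pi * t * (of_int s + z)\<^sup>2)) = ee (of_int s * (1/2)) * ee ((- 1 / \<tau>) * (6 * of_int s + 1)\<^sup>2 / 24)" for s
  proof -
    have "of_real pi * t * (of_int s + z)\<^sup>2 = of_real pi * t * (of_int s + 1/6)\<^sup>2 - 2 * \<i> * of_real pi * (t * v) * (of_int s + 1/6) - of_real pi * (t * v) * v"
      unfolding z_def by (simp add: power2_eq_square algebra_simps)
    then have "- (of_real pi * \<i> / 6) - of_real pi * v / 2 + - (of_real pi * t * (of_int s + z)\<^sup>2) = of_real pi * \<i> * of_int s - of_real pi * t * (of_int s + 1/6)\<^sup>2"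
      unfolding tv by (simp add: algebra_simps)
    also have "of_real pi * \<i> * of_int s - of_real pi * t * (of_int s + 1/6)\<^sup>2 = 2 * of_real pi * \<i> * (of_int s * (1/2)) + 2 * of_real pi * \<i> * ((- 1 / \<tau>) * (6 * of_int s + 1)\<^sup>2 / 24)"
      unfolding t_def by (simp add: power2_eq_square algebra_simps add_divide_distrib diff_divide_distrib)
    finally show ?thesis unfolding K_def ee_def exp_add[symmetric] by (rule arg_cong)
  qed
  with has_sum_cmult_right[OF has_sum_gauss_sum[OF t, of z], of K]
  have "((\<lambda>s::int. ee (of_int s * (1/2)) * ee ((- 1 / \<tau>) * (6 * of_int s + 1)\<^sup>2 / 24)) has_sum K * gauss_sum t z) UNIV" by simp
  with pentagonal_number_theorem[OF \<tau>'] have eta1: "dedekind_eta (- 1 / \<tau>) = K * gauss_sum t z"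
    using has_sum_unique by blast
  have KE: "K * exp (of_int m * (2 * of_real pi * \<i> * z) - (of_int m)\<^sup>2 * (of_real pi / t)) = E (2 * m - 1)" for m
  proof -
    have "- (of_real pi * \<i> / 6) - of_real pi * v / 2 + (of_int m * (2 * of_real pi * \<i> * z) - (of_int m)\<^sup>2 * (of_real pi / t)) = of_real pi * \<i> * (2 * of_int m - 1) / 6 - of_real pi * (2 * of_int m - 1)\<^sup>2 * v / 2"
      unfolding z_def ti by (simp add: power2_eq_square algebra_simps add_divide_distrib diff_divide_distrib)
    also have "\<dots> = 2 * of_real pi * \<i> * (of_int (2 * m - 1) / 12) + 2 * of_real pi * \<i> * (\<tau> * (of_int (2 * m - 1))\<^sup>2 / 24)"
      unfolding v_def by (simp add: power2_eq_square algebra_simps add_divide_distrib diff_divide_distrib)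
    finally show ?thesis unfolding K_def E_def ee_def exp_add[symmetric] by (rule arg_cong)
  qed
  have "((\<lambda>m::int. exp (of_int m * (2 * of_real pi * \<i> * z) - (of_int m)\<^sup>2 * (of_real pi / t))) has_sum theta_series (of_real pi / t) (2 * of_real pi * \<i> * z)) UNIV"
    unfolding theta_series_def using t by (intro has_sum_infsum theta_series_summable) (simp add: Re_divide sum_power2_gt_zero_iff complex_eq_iff)
  from has_sum_cmult_right[OF this, of K]
  have sum1: "((\<lambda>m. E (2 * m - 1)) has_sum K * theta_series (of_real pi / t) (2 * of_real pi * \<i> * z)) UNIV" by (simp only: KE)
  have pent: "((\<lambda>s::int. ee (of_int s * (1/2)) * ee (\<tau> * (6 * of_int s + 1)\<^sup>2 / 24)) has_sum dedekind_eta \<tau>) UNIV"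
    by (rule pentagonal_number_theorem[OF \<tau>])
  \<comment> \<open>The classes \<open>j = 6n + 1\<close>, \<open>j = 6n - 1\<close> and \<open>j = 6n + 3\<close>
    of \<open>j = 2m - 1\<close>.\<close>
  have A: "((\<lambda>n. E (2 * (3 * n + 1) - 1)) has_sum ee (1/12) * dedekind_eta \<tau>) UNIV"
  proof -
    have "E (2 * (3 * n + 1) - 1) = ee (1/12) * (ee (of_int n * (1/2)) * ee (\<tau> * (6 * of_int n + 1)\<^sup>2 / 24))" for n
      unfolding E_def ee_add[symmetric] by (rule arg_cong[of _ _ ee]) (simp add: field_simps)
    then show ?thesis using has_sum_cmult_right[OF pent, of "ee (1/12)"] by simp
  qed
  have B: "((\<lambda>n. E (2 * (3 * n) - 1)) has_sum ee (-1/12) * dedekind_eta \<tau>) UNIV"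
  proof (subst has_sum_reindex_bij_betw[symmetric])
    show "bij_betw (\<lambda>n::int. - n) UNIV UNIV" by (rule bij_betwI[of _ _ _ "\<lambda>n. - n"]) auto
    have "E (2 * (3 * (- n)) - 1) = ee (-1/12) * (ee (of_int n * (1/2)) * ee (\<tau> * (6 * of_int n + 1)\<^sup>2 / 24))" for n
    proof -
      have "of_int (2 * (3 * (- n)) - 1) / 12 = (-1/12 :: complex) + of_int n * (1/2) - of_int n" by (simp add: field_simps)
      moreover have "(of_int (2 * (3 * (- n)) - 1))\<^sup>2 = (6 * of_int n + 1 :: complex)\<^sup>2" by (simp add: power2_eq_square algebra_simps)
      ultimately show ?thesis unfolding E_def by (simp only: ee_add ee_diff ee_of_int) simp
    qed
    then show "((\<lambda>n. E (2 * (3 * (- n)) - 1)) has_sum ee (-1/12) * dedekind_eta \<tau>) UNIV"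
      using has_sum_cmult_right[OF pent, of "ee (-1/12)"] by simp
  qed
  have C: "((\<lambda>n. E (2 * (3 * n + 2) - 1)) has_sum 0) UNIV"
  proof -
    have Eq: "E (2 * (3 * n + 2) - 1) = ee (1/4) * (ee (of_int n * (1/2)) * ee (\<tau> * (6 * of_int n + 3)\<^sup>2 / 24))" for n
      unfolding E_def ee_add[symmetric] by (rule arg_cong[of _ _ ee]) (simp add: field_simps)
    have "(\<lambda>n. E (2 * (3 * n + 2) - 1)) summable_on UNIV"
      unfolding Eq by (intro summable_on_cmult_right summable_gauss_character[OF \<tau>])
    then obtain X where X: "((\<lambda>n. E (2 * (3 * n + 2) - 1)) has_sum X) UNIV" by (auto simp: summable_on_def)
    have "((\<lambda>n. E (2 * (3 * (- n - 1) + 2) - 1)) has_sum X) UNIV"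
    proof (subst has_sum_reindex_bij_betw[where g = "\<lambda>n::int. - n - 1" and f = "\<lambda>n. E (2 * (3 * n + 2) - 1)"])
      show "bij_betw (\<lambda>n::int. - n - 1) UNIV UNIV" by (rule bij_betwI[of _ _ _ "\<lambda>n. - n - 1"]) auto
    qed (rule X)
    moreover have "E (2 * (3 * (- n - 1) + 2) - 1) = - E (2 * (3 * n + 2) - 1)" for n
    proof -
      have "of_int (2 * (3 * (- n - 1) + 2) - 1) / 12 = of_int (2 * (3 * n + 2) - 1) / 12 - of_int n - (1/2 :: complex)" by (simp add: field_simps)
      moreover have "(of_int (2 * (3 * (- n - 1) + 2) - 1))\<^sup>2 = (of_int (2 * (3 * n + 2) - 1) :: complex)\<^sup>2" by (simp add: power2_eq_square algebra_simps)
      moreover have "ee (1/2) = -1" by (simp add: ee_def)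
      ultimately show ?thesis unfolding E_def by (simp only: ee_diff ee_of_int) simp
    qed
    ultimately have "((\<lambda>n. - E (2 * (3 * n + 2) - 1)) has_sum X) UNIV" by simp
    then have "((\<lambda>n. E (2 * (3 * n + 2) - 1)) has_sum - X) UNIV" by (simp only: has_sum_uminus)
    with X have "X = - X" using has_sum_unique by blast
    then have "X = 0" by simp
    with X show ?thesis by simp
  qed
  have cos: "ee (-1/12) + ee (1/12) = of_real (sqrt 3)"
  proof -
    have "ee (1/12) = cis (pi / 6)" "ee (-1/12) = cis (- (pi / 6))" by (simp_all add: ee_def cis_conv_exp)
    then show ?thesis by (simp add: complex_eq_iff cos_30)
  qed
  have "((\<lambda>m. E (2 * m - 1)) has_sum (ee (-1/12) * dedekind_eta \<tau> + ee (1/12) * dedekind_eta \<tau> + 0)) UNIV"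
    by (rule has_sum_int_mod_3[of "\<lambda>m. E (2 * m - 1)", OF B A C])
  with sum1 have "K * theta_series (of_real pi / t) (2 * of_real pi * \<i> * z) = of_real (sqrt 3) * dedekind_eta \<tau>"
    unfolding cos[symmetric] using has_sum_unique by (fastforce simp: distrib_right)
  then have "dedekind_eta (- 1 / \<tau>) = of_real (sqrt 3) / csqrt t * dedekind_eta \<tau>"
    using eta1 poisson_gauss[OF t, of z] by (simp add: field_simps)
  moreover have "csqrt (\<tau> / \<i>) = of_real (sqrt 3) / csqrt t"
  proof (rule csqrt_unique)
    show "(of_real (sqrt 3) / csqrt t)\<^sup>2 = \<tau> / \<i>"
      using \<tau>0 by (simp add: power_divide of_real_power[symmetric] t_def field_simps del: of_real_power)
    have "Re (csqrt t) > 0" by (rule Re_csqrt_pos[OF t])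
    moreover have "Re (of_real (sqrt 3) / u) > 0" if "Re u > 0" for u
      using that by (auto simp: Re_divide sum_power2_gt_zero_iff intro!: divide_pos_pos)
    ultimately have "Re (of_real (sqrt 3) / csqrt t) > 0" by blast
    then show "0 < Re (of_real (sqrt 3) / csqrt t) \<or> Re (of_real (sqrt 3) / csqrt t) = 0 \<and> 0 \<le> Im (of_real (sqrt 3) / csqrt t)" by simp
  qed
  ultimately show ?thesis by simp
qed

section \<open>Generation of the metaplectic group\<close>

definition S_matrix :: "int^2^2" where "S_matrix = vector [vector [0, -1], vector [1, 0]]"
definition T_matrix :: "int \<Rightarrow> int^2^2" where "T_matrix n = vector [vector [1, n], vector [0, 1]]"

lemma S_matrix_mult [simp]:
  "(S_matrix ** B) $ 1 $ j = - B $ 2 $ j" "(S_matrix ** B) $ 2 $ j = B $ 1 $ j"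
  by (simp_all add: S_matrix_def matrix_matrix_mult_def sum_2)

lemma T_matrix_mult [simp]:
  "(T_matrix n ** B) $ 1 $ j = B $ 1 $ j + n * B $ 2 $ j" "(T_matrix n ** B) $ 2 $ j = B $ 2 $ j"
  by (simp_all add: T_matrix_def matrix_matrix_mult_def sum_2)

lemma matrix_2_eqI:
  fixes A B :: "int^2^2"
  assumes "A $ 1 $ 1 = B $ 1 $ 1" "A $ 1 $ 2 = B $ 1 $ 2" "A $ 2 $ 1 = B $ 2 $ 1" "A $ 2 $ 2 = B $ 2 $ 2"
  shows "A = B"
  using assms by (simp add: vec_eq_iff forall_2)

lemma det_S_mult [simp]: "det (S_matrix ** B) = det B" and det_T_mult [simp]: "det (T_matrix n ** B) = det B"
  by (simp_all add: det_2 algebra_simps)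

lemma cocycle_nonzero:
  assumes "det A = 1" "Im \<tau> > 0"
  shows "cocycle A \<tau> \<noteq> 0"
proof
  assume 0: "cocycle A \<tau> = 0"
  then have "Im (cocycle A \<tau>) = 0" by simp
  then have c: "A $ 2 $ 1 = 0" using assms(2) by (simp add: cocycle_def)
  with 0 have "A $ 2 $ 2 = 0" by (simp add: cocycle_def)
  with c assms(1) show False by (simp add: det_2)
qed

lemma Im_moebius:
  assumes "det A = 1" "Im \<tau> > 0"
  shows "Im (moebius A \<tau>) = Im \<tau> / (norm (cocycle A \<tau>))\<^sup>2"
proof -
  have d: "real_of_int (A $ 1 $ 1) * real_of_int (A $ 2 $ 2) - real_of_int (A $ 1 $ 2) * real_of_int (A $ 2 $ 1) = 1"
    using assms(1) by (simp add: det_2 flip: of_int_mult of_int_diff)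
  have "Im (moebius A \<tau>) = (real_of_int (A $ 1 $ 1) * real_of_int (A $ 2 $ 2) - real_of_int (A $ 1 $ 2) * real_of_int (A $ 2 $ 1)) * Im \<tau> / (norm (cocycle A \<tau>))\<^sup>2"
    unfolding moebius_def Im_divide cmod_power2[symmetric] by (simp add: cocycle_def algebra_simps)
  then show ?thesis by (simp only: d mult_1_left)
qed

lemma moebius_upper:
  assumes "det A = 1" "Im \<tau> > 0"
  shows "Im (moebius A \<tau>) > 0"
  using assms cocycle_nonzero[OF assms] by (simp add: Im_moebius)

lemma cocycle_S: "det B = 1 \<Longrightarrow> Im \<tau> > 0 \<Longrightarrow> cocycle (S_matrix ** B) \<tau> = moebius B \<tau> * cocycle B \<tau>"
  using cocycle_nonzero[of B \<tau>] by (simp add: moebius_def) (simp add: cocycle_def)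

lemma moebius_S: "det B = 1 \<Longrightarrow> Im \<tau> > 0 \<Longrightarrow> moebius (S_matrix ** B) \<tau> = - 1 / moebius B \<tau>"
proof -
  assume B: "det B = 1" "Im \<tau> > 0"
  have "moebius (S_matrix ** B) \<tau> = - cocycle B \<tau> / (moebius B \<tau> * cocycle B \<tau>)"
    unfolding moebius_def[of "S_matrix ** B"] cocycle_S[OF B] by (simp add: cocycle_def)
  then show ?thesis using cocycle_nonzero[OF B] by simp
qed

lemma cocycle_T [simp]: "cocycle (T_matrix n ** B) \<tau> = cocycle B \<tau>"
  by (simp add: cocycle_def)

lemma moebius_T:
  assumes "det B = 1" "Im \<tau> > 0"
  shows "moebius (T_matrix n ** B) \<tau> = moebius B \<tau> + of_int n"
proof -
  have "of_int ((T_matrix n ** B) $ 1 $ 1) * \<tau> + of_int ((T_matrix n ** B) $ 1 $ 2)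
    = (of_int (B $ 1 $ 1) * \<tau> + of_int (B $ 1 $ 2)) + of_int n * cocycle B \<tau>"
    by (simp add: cocycle_def algebra_simps)
  note eq = this
  show ?thesis
    unfolding moebius_def cocycle_T eq using cocycle_nonzero[OF assms] by (simp add: add_divide_distrib)
qed

lemma holomorphic_on_moebius: "det A = 1 \<Longrightarrow> moebius A holomorphic_on upper_half_plane"
  unfolding moebius_def[abs_def] using cocycle_nonzero[of A]
  by (intro holomorphic_intros) (auto simp: cocycle_def[abs_def] upper_half_plane_def intro!: holomorphic_intros)

lemma Mp2Z_sqrt_nonzero: "(A, w) \<in> Mp2Z \<Longrightarrow> Im \<tau> > 0 \<Longrightarrow> w \<tau> \<noteq> 0"
  using cocycle_nonzero[of A \<tau>] by (auto simp: Mp2Z_def upper_half_plane_def)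

lemma Mp2Z_neg: "(A, w) \<in> Mp2Z \<Longrightarrow> (A, \<lambda>\<tau>. - w \<tau>) \<in> Mp2Z"
  by (auto simp: Mp2Z_def intro: holomorphic_intros)

lemma Mp2Z_S:
  assumes "(B, v) \<in> Mp2Z"
  shows "(S_matrix ** B, \<lambda>\<tau>. csqrt (moebius B \<tau>) * v \<tau>) \<in> Mp2Z"
proof -
  have B: "det B = 1" "v holomorphic_on upper_half_plane" using assms by (auto simp: Mp2Z_def)
  have np: "moebius B \<tau> \<notin> \<real>\<^sub>\<le>\<^sub>0" if "\<tau> \<in> upper_half_plane" for \<tau>
    using moebius_upper[OF B(1), of \<tau>] that by (auto simp: upper_half_plane_def complex_nonpos_Reals_iff)
  have "(\<lambda>\<tau>. csqrt (moebius B \<tau>) * v \<tau>) holomorphic_on upper_half_plane"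
    using np by (intro holomorphic_intros B holomorphic_on_moebius) auto
  then show ?thesis
    using assms by (auto simp: Mp2Z_def power_mult_distrib cocycle_S upper_half_plane_def)
qed

lemma Mp2Z_T: "(B, v) \<in> Mp2Z \<Longrightarrow> (T_matrix n ** B, v) \<in> Mp2Z"
  by (auto simp: Mp2Z_def)

lemma Mp2Z_one: "(mat 1, \<lambda>_. 1) \<in> Mp2Z" "(mat 1, \<lambda>_. - 1) \<in> Mp2Z"
  by (simp_all add: Mp2Z_def cocycle_def det_I) (simp_all add: mat_def)

lemma connected_upper_half_plane: "connected upper_half_plane"
  unfolding upper_half_plane_def by (intro convex_connected convex_halfspace_Im_gt)

lemma holomorphic_sqrt_unique:
  assumes w: "w holomorphic_on upper_half_plane" and v: "v holomorphic_on upper_half_plane"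
    and eq: "\<And>\<tau>. \<tau> \<in> upper_half_plane \<Longrightarrow> (w \<tau>)\<^sup>2 = (v \<tau>)\<^sup>2" and nz: "\<And>\<tau>. \<tau> \<in> upper_half_plane \<Longrightarrow> v \<tau> \<noteq> 0"
  shows "(\<forall>\<tau>\<in>upper_half_plane. w \<tau> = v \<tau>) \<or> (\<forall>\<tau>\<in>upper_half_plane. w \<tau> = - v \<tau>)"
proof -
  define q where "q = (\<lambda>\<tau>. w \<tau> / v \<tau>)"
  have q: "q \<tau> = 1 \<or> q \<tau> = -1" if "\<tau> \<in> upper_half_plane" for \<tau>
    using eq[OF that] nz[OF that] by (auto simp: q_def power2_eq_iff field_simps)
  have "q constant_on upper_half_plane"
  proof (rule continuous_finite_range_constant[OF connected_upper_half_plane])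
    show "continuous_on upper_half_plane q"
      unfolding q_def by (intro continuous_on_divide holomorphic_on_imp_continuous_on w v) (use nz in auto)
    show "finite (q ` upper_half_plane)"
      by (rule finite_subset[of _ "{1, -1}"]) (use q in auto)
  qed
  then obtain c where c: "\<And>\<tau>. \<tau> \<in> upper_half_plane \<Longrightarrow> q \<tau> = c" by (auto simp: constant_on_def)
  have "\<i> \<in> upper_half_plane" by (simp add: upper_half_plane_def)
  then have "c = 1 \<or> c = -1" using q c by metis
  moreover have "w \<tau> = c * v \<tau>" if "\<tau> \<in> upper_half_plane" for \<tau>
    using c[OF that] nz[OF that] by (simp add: q_def field_simps)
  ultimately show ?thesis by auto
qed

text \<open>
  The metaplectic group is generated under left multiplication by the powers of
  \<open>T\<close>, by \<open>S\<close> and by \<open>(1, -1)\<close>: the Euclidean algorithm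
  on the first column reduces the matrix to \<open>\<plusminus>T\<^sup>n\<close>. The second
  component is determined by the matrix only up to sign, so both signs are carried along. The
  rule \<open>cong\<close> is there because \<open>w\<close> is a total function of which only
  the values on the upper half plane matter.
\<close>
theorem Mp2Z_induct [consumes 1, case_names cong one minus_one T S]:
  assumes Aw: "(A, w) \<in> Mp2Z"
    and cong: "\<And>A w w'. P A w \<Longrightarrow> (\<And>\<tau>. Im \<tau> > 0 \<Longrightarrow> w \<tau> = w' \<tau>) \<Longrightarrow> P A w'"
    and one: "P (mat 1) (\<lambda>_. 1)" and minus_one: "P (mat 1) (\<lambda>_. - 1)"
    and T: "\<And>n B v. (B, v) \<in> Mp2Z \<Longrightarrow> P B v \<Longrightarrow> P (T_matrix n ** B) v"
    and S: "\<And>B v. (B, v) \<in> Mp2Z \<Longrightarrow> P B v \<Longrightarrow> P (S_matrix ** B) (\<lambda>\<tau>. csqrt (moebius B \<tau>) * v \<tau>)"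
  shows "P A w"
proof -
  define Q where "Q = (\<lambda>A. \<exists>v. (A, v) \<in> Mp2Z \<and> P A v \<and> P A (\<lambda>\<tau>. - v \<tau>))"
  have QT: "Q (T_matrix n ** B)" if "Q B" for n B
    using that unfolding Q_def by (metis T Mp2Z_T Mp2Z_neg)
  have QS: "Q (S_matrix ** B)" if QB: "Q B" for B
  proof -
    obtain v where v: "(B, v) \<in> Mp2Z" "P B v" "P B (\<lambda>\<tau>. - v \<tau>)" using QB unfolding Q_def by blast
    have "P (S_matrix ** B) (\<lambda>\<tau>. - (csqrt (moebius B \<tau>) * v \<tau>))"
      using S[OF Mp2Z_neg[OF v(1)] v(3)] by (rule cong) simp
    then show ?thesis unfolding Q_def using S[OF v(1,2)] Mp2Z_S[OF v(1)] by blast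
  qed
  have Q1: "Q (mat 1)" unfolding Q_def using Mp2Z_one one minus_one by (intro exI[of _ "\<lambda>_. 1"]) auto
  have Q: "Q A" if "det A = 1" for A
    using that
  proof (induction "nat \<bar>A $ 2 $ 1\<bar>" arbitrary: A rule: less_induct)
    case less
    show ?case
    proof (cases "A $ 2 $ 1 = 0")
      case True
      then have ad: "A $ 1 $ 1 * A $ 2 $ 2 = 1" using less.prems by (simp add: det_2)
      then consider "A $ 1 $ 1 = 1" "A $ 2 $ 2 = 1" | "A $ 1 $ 1 = -1" "A $ 2 $ 2 = -1"
        using zmult_eq_1_iff by blast
      then show ?thesis
      proof cases
        case 1
        have "A = T_matrix (A $ 1 $ 2) ** mat 1"
          by (rule matrix_2_eqI) (use 1 True in \<open>auto simp: mat_def\<close>)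
        with QT[OF Q1] show ?thesis by metis
      next
        case 2
        have "A = T_matrix (- A $ 1 $ 2) ** (S_matrix ** (S_matrix ** mat 1))"
          by (rule matrix_2_eqI) (use 2 True in \<open>auto simp: mat_def\<close>)
        with QT[OF QS[OF QS[OF Q1]]] show ?thesis by metis
      qed
    next
      case False
      define a b c d where "a = A $ 1 $ 1" "b = A $ 1 $ 2" "c = A $ 2 $ 1" "d = A $ 2 $ 2"
      note abcd = this
      define q where "q = a div c"
      \<comment> \<open>This \<open>B\<close> is \<open>S\<^sup>-\<^sup>1 T\<^bsup>-q\<^esup> A\<close>; its lower
        left entry is, up to sign, the remainder of \<open>a\<close> modulo
        \<open>c\<close>.\<close>
      define B :: "int^2^2" where "B = vector [vector [c, d], vector [q * c - a, q * d - b]]"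
      have eq: "A = T_matrix q ** (S_matrix ** B)"
        by (rule matrix_2_eqI) (auto simp: B_def abcd)
      have "det B = 1" using less.prems by (simp add: det_2 B_def abcd algebra_simps)
      moreover have "\<bar>q * c - a\<bar> < \<bar>c\<bar>"
      proof -
        have "q * c - a = - (a mod c)" unfolding q_def by (simp add: minus_mod_eq_div_mult[symmetric])
        moreover have "\<bar>a mod c\<bar> < \<bar>c\<bar>" using False by (intro abs_mod_less) (simp add: abcd)
        ultimately show ?thesis by simp
      qed
      then have "nat \<bar>B $ 2 $ 1\<bar> < nat \<bar>A $ 2 $ 1\<bar>" by (simp add: B_def abcd)
      ultimately have "Q B" using less.hyps by blast
      then show ?thesis unfolding eq by (intro QT QS)
    qed
  qed
  have A: "det A = 1" "w holomorphic_on upper_half_plane" "\<And>\<tau>. \<tau> \<in> upper_half_plane \<Longrightarrow> (w \<tau>)\<^sup>2 = cocycle A \<tau>"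
    using Aw by (auto simp: Mp2Z_def)
  from Q[OF A(1)] obtain v where v: "(A, v) \<in> Mp2Z" "P A v" "P A (\<lambda>\<tau>. - v \<tau>)" unfolding Q_def by blast
  have "(\<forall>\<tau>\<in>upper_half_plane. w \<tau> = v \<tau>) \<or> (\<forall>\<tau>\<in>upper_half_plane. w \<tau> = - v \<tau>)"
    by (rule holomorphic_sqrt_unique[OF A(2)]) (use A(3) v(1) Mp2Z_sqrt_nonzero[OF v(1)] in \<open>auto simp: Mp2Z_def upper_half_plane_def\<close>)
  then show ?thesis
  proof
    assume "\<forall>\<tau>\<in>upper_half_plane. w \<tau> = v \<tau>"
    then show ?thesis by (intro cong[OF v(2)]) (auto simp: upper_half_plane_def)
  next
    assume "\<forall>\<tau>\<in>upper_half_plane. w \<tau> = - v \<tau>"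
    then show ?thesis by (intro cong[OF v(3)]) (auto simp: upper_half_plane_def)
  qed
qed

text \<open>
  The relation that defines the character, cleared of denominators: in this form a value for
  \<open>B\<close> yields a value for \<open>T\<^sup>n B\<close> and \<open>S B\<close>, and the
  existence of a value can be proved along the generators.
\<close>
definition is_eta_multiplier :: "int^2^2 \<Rightarrow> (complex \<Rightarrow> complex) \<Rightarrow> complex \<Rightarrow> bool" where
  "is_eta_multiplier A w c \<longleftrightarrow> c \<noteq> 0 \<and> (\<forall>\<tau>. Im \<tau> > 0 \<longrightarrow> dedekind_eta (moebius A \<tau>) = c * (dedekind_eta \<tau> * w \<tau>))"

lemma eps_eqI:
  assumes "is_eta_multiplier A w c" and "(A, w) \<in> Mp2Z"
  shows "eps A w = c"
  unfolding eps_def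
proof (rule the_equality)
  have *: "dedekind_eta (moebius A \<tau>) / (dedekind_eta \<tau> * w \<tau>) = c" if "Im \<tau> > 0" for \<tau>
    using assms dedekind_eta_nonzero[OF that] Mp2Z_sqrt_nonzero[OF assms(2) that] that
    by (simp add: is_eta_multiplier_def)
  then show "\<forall>\<tau>\<in>upper_half_plane. dedekind_eta (moebius A \<tau>) / (dedekind_eta \<tau> * w \<tau>) = c"
    by (simp add: upper_half_plane_def)
  show "d = c" if "\<forall>\<tau>\<in>upper_half_plane. dedekind_eta (moebius A \<tau>) / (dedekind_eta \<tau> * w \<tau>) = d" for d
    using *[of \<i>] that by (auto simp: upper_half_plane_def)
qed

lemma dedekind_eta_S:
  assumes "Im \<tau> > 0"
  shows "dedekind_eta (- 1 / \<tau>) = ee (- 1 / 8) * (dedekind_eta \<tau> * csqrt \<tau>)"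
proof -
  have "ee (- 1 / 8) * ee (1 / 8) = 1" by (simp add: ee_add[symmetric])
  then show ?thesis
    unfolding dedekind_eta_inversion[OF assms] csqrt_upper_half_plane[OF assms] by algebra
qed

lemma is_eta_multiplier_one: "is_eta_multiplier (mat 1) (\<lambda>_. 1) 1" "is_eta_multiplier (mat 1) (\<lambda>_. - 1) (- 1)"
  by (auto simp: is_eta_multiplier_def moebius_def cocycle_def mat_def)

lemma is_eta_multiplier_T:
  assumes "(B, v) \<in> Mp2Z" "is_eta_multiplier B v c"
  shows "is_eta_multiplier (T_matrix n ** B) v (ee (of_int n / 24) * c)"
  using assms unfolding is_eta_multiplier_def
  by (auto simp: Mp2Z_def moebius_T dedekind_eta_shift)

lemma is_eta_multiplier_S:
  assumes "(B, v) \<in> Mp2Z" "is_eta_multiplier B v c"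
  shows "is_eta_multiplier (S_matrix ** B) (\<lambda>\<tau>. csqrt (moebius B \<tau>) * v \<tau>) (ee (- 1 / 8) * c)"
proof -
  have B: "det B = 1" using assms by (auto simp: Mp2Z_def)
  show ?thesis
    using assms(2) unfolding is_eta_multiplier_def
    using dedekind_eta_S[OF moebius_upper[OF B]] by (auto simp: moebius_S[OF B] simp del: minus_divide_left)
qed

section \<open>Lattices and their shadows\<close>

lemma has_sum_prod_PiE:
  fixes f :: "'i \<Rightarrow> int \<Rightarrow> complex"
  assumes A: "finite A" and f: "\<And>x. x \<in> A \<Longrightarrow> (f x has_sum s x) UNIV"
  shows "((\<lambda>g. \<Prod>x\<in>A. f x (g x)) has_sum (\<Prod>x\<in>A. s x)) (PiE A (\<lambda>_. UNIV))"
proof -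
  have abs: "(\<lambda>y. norm (f x y)) summable_on UNIV" if "x \<in> A" for x
    using f[OF that] by (subst summable_on_iff_abs_summable_on_complex[symmetric]) (auto simp: summable_on_def)
  have "(\<lambda>g. norm (\<Prod>x\<in>A. f x (g x))) summable_on (PiE A (\<lambda>_. UNIV))"
    unfolding abs_summable_equivalent
    by (rule abs_summable_on_prod_PiE) (use A abs in \<open>auto simp: abs_summable_equivalent\<close>)
  then have "(\<lambda>g. \<Prod>x\<in>A. f x (g x)) summable_on (PiE A (\<lambda>_. UNIV))" by (rule abs_summable_summable)
  moreover have "infsum (\<lambda>g. \<Prod>x\<in>A. f x (g x)) (PiE A (\<lambda>_. UNIV)) = (\<Prod>x\<in>A. infsum (f x) UNIV)"
    by (rule infsum_prod_PiE_abs[OF A abs])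
  moreover have "(\<Prod>x\<in>A. infsum (f x) UNIV) = (\<Prod>x\<in>A. s x)"
    by (intro prod.cong refl infsumI f)
  ultimately show ?thesis by (simp add: has_sum_iff)
qed

lemma common_denominator:
  fixes F :: "rat set"
  assumes "finite F"
  obtains N :: nat where "N > 0" "\<And>q. q \<in> F \<Longrightarrow> of_nat N * q \<in> \<int>"
proof -
  have "\<exists>N::nat. N > 0 \<and> (\<forall>q\<in>F. of_nat N * q \<in> \<int>)"
    using assms
  proof (induction F rule: finite_induct)
    case empty show ?case by (intro exI[of _ 1]) auto
  next
    case (insert q F)
    then obtain N :: nat where N: "N > 0" "\<forall>q\<in>F. of_nat N * q \<in> \<int>" by blast
    obtain a b where ab: "quotient_of q = (a, b)" by force
    then have b: "b > 0" and q: "q = of_int a / of_int b"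
      using quotient_of_denom_pos quotient_of_div by auto
    have "of_nat (nat b) * q = of_int a" using b q by simp
    then have "of_nat (N * nat b) * q = of_int (int N * a)" by (simp add: mult.assoc)
    then have "of_nat (N * nat b) * q \<in> \<int>" by (simp only: Ints_of_int)
    moreover have "of_nat (N * nat b) * q' \<in> \<int>" if "q' \<in> F" for q'
    proof -
      have "of_nat (N * nat b) * q' = of_int b * (of_nat N * q')" using b by (simp add: mult_ac)
      then show ?thesis using N(2) that by (simp only: Ints_mult Ints_of_int)
    qed
    ultimately show ?case using N b by (intro exI[of _ "N * nat b"]) auto
  qed
  then show ?thesis using that by blast
qed

abbreviation er :: "rat \<Rightarrow> complex" where "er q \<equiv> ee (of_rat q)"

lemma er_Ints: "q \<in> \<int> \<Longrightarrow> er q = 1"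
  by (auto elim!: Ints_cases)

lemma of_rat_in_Ints_iff: "(of_rat q :: complex) \<in> \<int> \<longleftrightarrow> q \<in> \<int>"
proof
  assume "(of_rat q :: complex) \<in> \<int>"
  then obtain n where "(of_rat q :: complex) = of_int n" by (auto elim: Ints_cases)
  then have "of_rat q = (of_rat (of_int n) :: complex)" by simp
  then have "q = of_int n" by (simp only: of_rat_eq_iff)
  then show "q \<in> \<int>" by simp
qed (auto elim!: Ints_cases)

lemma er_eq_iff: "er p = er q \<longleftrightarrow> p - q \<in> \<int>"
  unfolding ee_eq_ee_iff of_rat_diff[symmetric] of_rat_in_Ints_iff ..

lemma er_add: "er (p + q) = er p * er q"
  by (simp add: of_rat_add ee_add)

lemma er_minus: "er (- p) = inverse (er p)"
  by (simp add: of_rat_minus ee_minus)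

lemma of_real_of_rat: "complex_of_real (of_rat q) = of_rat q"
  by (cases q) (simp add: of_rat_rat)

lemma norm_er [simp]: "norm (er q) = 1"
  by (simp flip: of_real_of_rat)

lemma bil_add_left: "bil L (x + y) z = bil L x z + bil L y z"
  and bil_add_right: "bil L x (y + z) = bil L x y + bil L x z"
  by (simp_all add: bil_def algebra_simps sum.distrib)

lemma bil_scale_left: "bil L (c *s x) y = c * bil L x y"
  and bil_scale_right: "bil L x (c *s y) = c * bil L x y"
  by (simp_all add: bil_def sum_distrib_left mult_ac)

lemma bil_minus_left: "bil L (- x) y = - bil L x y" and bil_minus_right: "bil L x (- y) = - bil L x y"
  by (simp_all add: bil_def sum_negf)

lemma bil_diff_left: "bil L (x - y) z = bil L x z - bil L y z"
  and bil_diff_right: "bil L x (y - z) = bil L x y - bil L x z"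
  by (simp_all add: bil_def algebra_simps sum_subtractf)

lemma bil_0_left [simp]: "bil L 0 y = 0" and bil_0_right [simp]: "bil L x 0 = 0"
  by (simp_all add: bil_def)

lemma bil_complexify: "bil L (complexify x) (complexify y) = of_rat (bil L x y)"
  by (simp add: bil_def complexify_def of_rat_sum of_rat_mult)

lemma complexify_add: "complexify (x + y) = complexify x + complexify y"
  by (simp add: complexify_def vec_eq_iff of_rat_add)

lemma qf_complexify: "qf L (complexify x) = of_rat (qf L x)"
  by (simp add: qf_def bil_complexify of_rat_divide)

lemma qf_scale: "qf L (c *s x) = c\<^sup>2 * qf L x"
  by (simp add: qf_def bil_scale_left bil_scale_right power2_eq_square)

lemma qf_minus [simp]: "qf L (- x) = qf L x"
  by (simp add: qf_def bil_minus_left bil_minus_right)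

text \<open>
  A finite system of representatives modulo the subgroup \<open>M\<close>. The set
  \<open>A\<close> is a union of cosets and not itself a group, as is the case for a shadow.
\<close>
definition transversal :: "'a::ab_group_add set \<Rightarrow> 'a set \<Rightarrow> 'a set \<Rightarrow> bool" where
  "transversal A M T \<longleftrightarrow> finite T \<and> T \<subseteq> A \<and> (\<forall>r\<in>A. \<exists>!t\<in>T. r - t \<in> M)"

definition additive_subgroup :: "'a::ab_group_add set \<Rightarrow> bool" where
  "additive_subgroup M \<longleftrightarrow> 0 \<in> M \<and> (\<forall>x\<in>M. \<forall>y\<in>M. x - y \<in> M)"

lemma additive_subgroupD:
  assumes "additive_subgroup M"
  shows "0 \<in> M" "x \<in> M \<Longrightarrow> y \<in> M \<Longrightarrow> x - y \<in> M" "x \<in> M \<Longrightarrow> - x \<in> M" "x \<in> M \<Longrightarrow> y \<in> M \<Longrightarrow> x + y \<in> M"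
proof -
  show 0: "0 \<in> M" using assms unfolding additive_subgroup_def by auto
  show d: "x - y \<in> M" if "x \<in> M" "y \<in> M" for x y using assms that unfolding additive_subgroup_def by auto
  show m: "x \<in> M \<Longrightarrow> - x \<in> M" for x using d[OF 0, of x] by simp
  show "x \<in> M \<Longrightarrow> y \<in> M \<Longrightarrow> x + y \<in> M" using d[OF _ m[of y]] by simp
qed

lemma transversal_sum_eq:
  fixes F :: "'a::ab_group_add \<Rightarrow> complex"
  assumes M: "additive_subgroup M" and T: "transversal A M T" and T': "transversal A M T'"
    and F: "\<And>r s. r \<in> A \<Longrightarrow> s \<in> A \<Longrightarrow> r - s \<in> M \<Longrightarrow> F r = F s"
  shows "(\<Sum>t\<in>T. F t) = (\<Sum>t\<in>T'. F t)"
proof -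
  define f where "f = (\<lambda>X r. THE t. t \<in> X \<and> r - t \<in> M)"
  have f: "f X r \<in> X \<and> r - f X r \<in> M" "t \<in> X \<Longrightarrow> r - t \<in> M \<Longrightarrow> f X r = t" if "transversal A M X" "r \<in> A" for X r t
  proof -
    have ex: "\<exists>!t. t \<in> X \<and> r - t \<in> M" using that unfolding transversal_def by blast
    show "f X r \<in> X \<and> r - f X r \<in> M" unfolding f_def by (rule theI'[OF ex])
    show "t \<in> X \<Longrightarrow> r - t \<in> M \<Longrightarrow> f X r = t" unfolding f_def using ex by (intro the1_equality) auto
  qed
  have A: "T \<subseteq> A" "T' \<subseteq> A" using T T' by (auto simp: transversal_def)
  have inv: "f X (f Y t) = t" if X: "transversal A M X" and Y: "transversal A M Y" and t: "t \<in> X" for X Y t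
  proof -
    have tA: "t \<in> A" using X t by (auto simp: transversal_def)
    have "f Y t \<in> Y" "t - f Y t \<in> M" using f(1)[OF Y tA] by auto
    then have "f Y t \<in> A" "f Y t - t \<in> M" using Y additive_subgroupD(3)[OF M, of "t - f Y t"] by (auto simp: transversal_def)
    then show ?thesis using f(2)[OF X _ t] by blast
  qed
  show ?thesis
  proof (rule sum.reindex_bij_witness[of _ "f T" "f T'"])
    fix a assume a: "a \<in> T"
    show "f T (f T' a) = a" by (rule inv[OF T T' a])
    show "f T' a \<in> T'" using f(1)[OF T', of a] A a by auto
    show "F (f T' a) = F a" using f(1)[OF T', of a] A a by (intro F[symmetric]) auto
  next
    fix b assume b: "b \<in> T'"
    show "f T' (f T b) = b" by (rule inv[OF T' T b])
    show "f T b \<in> T" using f(1)[OF T, of b] A b by auto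
  qed
qed

text \<open>
  The representatives modulo a smaller group meet every class modulo the larger one equally
  often, since translation by \<open>r' - r\<close> matches the classes of \<open>r\<close> and
  \<open>r'\<close>. The closure condition on \<open>A\<close> is the one of a torsor.
\<close>
lemma transversal_coarsen:
  fixes A M M' T :: "'a::ab_group_add set"
  assumes M: "additive_subgroup M" and M': "additive_subgroup M'" and sub: "M \<subseteq> M'"
    and T: "transversal A M T" and A: "\<And>a b c. a \<in> A \<Longrightarrow> b \<in> A \<Longrightarrow> c \<in> A \<Longrightarrow> a + (b - c) \<in> A"
  obtains R and N :: nat where "transversal A M' R" "N > 0"
    "\<And>F :: 'a \<Rightarrow> complex. (\<And>r s. r \<in> A \<Longrightarrow> s \<in> A \<Longrightarrow> r - s \<in> M' \<Longrightarrow> F r = F s) \<Longrightarrow> (\<Sum>t\<in>T. F t) = of_nat N * (\<Sum>t\<in>R. F t)"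
proof -
  have Tfin: "finite T" and TA: "T \<subseteq> A" and Tex: "\<And>r. r \<in> A \<Longrightarrow> \<exists>!t. t \<in> T \<and> r - t \<in> M"
    using T by (auto simp: transversal_def)
  define f where "f = (\<lambda>r. SOME t. t \<in> T \<and> r - t \<in> M')"
  have f: "f r \<in> T" "r - f r \<in> M'" if "r \<in> A" for r
  proof -
    have "\<exists>t. t \<in> T \<and> r - t \<in> M'" using Tex[OF that] sub by blast
    then have "f r \<in> T \<and> r - f r \<in> M'" unfolding f_def by (rule someI_ex)
    then show "f r \<in> T" "r - f r \<in> M'" by auto
  qed
  have feq: "f r = f s" if "r - s \<in> M'" for r s
  proof -
    have "r - t \<in> M' \<longleftrightarrow> s - t \<in> M'" for t
      using additive_subgroupD(2)[OF M', of "r - t" "r - s"] additive_subgroupD(4)[OF M', of "s - t" "r - s"] that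
      by auto
    then show ?thesis by (simp add: f_def)
  qed
  define R where "R = f ` A"
  have R: "transversal A M' R"
    unfolding transversal_def
  proof (intro conjI ballI)
    show "finite R" by (rule finite_subset[OF _ Tfin]) (use f in \<open>auto simp: R_def\<close>)
    show "R \<subseteq> A" using f TA by (auto simp: R_def)
    fix r assume r: "r \<in> A"
    show "\<exists>!t. t \<in> R \<and> r - t \<in> M'"
    proof (rule ex1I[of _ "f r"])
      show "f r \<in> R \<and> r - f r \<in> M'" using r f by (auto simp: R_def)
      fix t assume t: "t \<in> R \<and> r - t \<in> M'"
      then obtain s where s: "s \<in> A" "t = f s" by (auto simp: R_def)
      have "r - s \<in> M'"
        using additive_subgroupD(2)[OF M', of "r - t" "s - t"] t f(2)[OF s(1)] s by simp
      then show "t = f r" using feq s by metis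
    qed
  qed
  define C where "C = (\<lambda>r. {t\<in>T. t - r \<in> M'})"
  have Cle: "card (C r) \<le> card (C r')" if r: "r \<in> A" "r' \<in> A" for r r'
  proof (rule card_inj_on_le)
    define g where "g = (\<lambda>t. THE u. u \<in> T \<and> (t + (r' - r)) - u \<in> M)"
    have g: "g t \<in> T" "(t + (r' - r)) - g t \<in> M" if "t \<in> T" for t
      using theI'[OF Tex[of "t + (r' - r)"]] A[of t r' r] TA that r by (auto simp: g_def)
    show "inj_on g (C r)"
    proof (rule inj_onI)
      fix s t assume st: "s \<in> C r" "t \<in> C r" "g s = g t"
      then have T: "s \<in> T" "t \<in> T" by (auto simp: C_def)
      have "s - t \<in> M" using additive_subgroupD(2)[OF M g(2)[OF T(1)] g(2)[OF T(2)]] st by (simp add: algebra_simps)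
      moreover have "s - s \<in> M" using additive_subgroupD(1)[OF M] by simp
      ultimately show "s = t" using Tex[of s] TA T by blast
    qed
    show "g ` C r \<subseteq> C r'"
    proof safe
      fix t assume t: "t \<in> C r"
      then have "t \<in> T" "t - r \<in> M'" by (auto simp: C_def)
      moreover have "g t - r' = (t - r) - ((t + (r' - r)) - g t)" by simp
      ultimately show "g t \<in> C r'" using g[of t] sub additive_subgroupD(2)[OF M', of "t - r" "(t + (r' - r)) - g t"]
        by (auto simp: C_def)
    qed
    show "finite (C r')" using Tfin by (auto simp: C_def)
  qed
  have RA: "R \<subseteq> A" using R by (simp add: transversal_def)
  define N where "N = (if A = {} then 1 else card (C (SOME r. r \<in> A)))"
  have N: "card (C r) = N" if "r \<in> A" for r
  proof -
    have "(SOME r. r \<in> A) \<in> A" using that by (rule someI)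
    then show ?thesis using Cle[OF that] Cle[OF _ that] that by (auto simp: N_def intro: le_antisym)
  qed
  have "N > 0"
  proof (cases "A = {}")
    case False
    then obtain r where r: "r \<in> A" by blast
    then have "f r \<in> C r" using f[OF r] additive_subgroupD(3)[OF M', of "r - f r"] by (auto simp: C_def)
    then have "card (C r) > 0" using Tfin by (auto simp: card_gt_0_iff C_def)
    then show ?thesis using N[OF r] by simp
  qed (simp add: N_def)
  moreover have "(\<Sum>t\<in>T. F t) = of_nat N * (\<Sum>t\<in>R. F t)"
    if F: "\<And>r s. r \<in> A \<Longrightarrow> s \<in> A \<Longrightarrow> r - s \<in> M' \<Longrightarrow> F r = F s" for F :: "'a \<Rightarrow> complex"
  proof -
    have fR: "f t = r \<longleftrightarrow> t \<in> C r" if "t \<in> T" "r \<in> R" for t r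
    proof -
      have tA: "t \<in> A" using that TA by auto
      have ex: "\<exists>!u. u \<in> R \<and> t - u \<in> M'" using R tA by (auto simp: transversal_def)
      have "f t \<in> R" "t - f t \<in> M'" using f[OF tA] tA by (auto simp: R_def)
      then show ?thesis using ex that by (auto simp: C_def)
    qed
    have "(\<Sum>t\<in>T. F t) = (\<Sum>r\<in>R. \<Sum>t\<in>{t\<in>T. f t = r}. F t)"
      using Tfin R TA by (intro sum.group[symmetric]) (auto simp: transversal_def R_def)
    also have "\<dots> = (\<Sum>r\<in>R. of_nat N * F r)"
    proof (rule sum.cong[OF refl])
      fix r assume r: "r \<in> R"
      then have rA: "r \<in> A" using RA by auto
      have "{t\<in>T. f t = r} = C r" using fR r by (auto simp: C_def)
      moreover have "F t = F r" if "t \<in> C r" for t using that TA rA by (intro F) (auto simp: C_def)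
      ultimately show "(\<Sum>t\<in>{t\<in>T. f t = r}. F t) = of_nat N * F r" using N[OF rA] by simp
    qed
    finally show ?thesis by (simp add: sum_distrib_left)
  qed
  ultimately show ?thesis using that R by blast
qed

lemma additive_subgroup_points: "additive_subgroup (points L)"
  by (auto simp: additive_subgroup_def points_def scalars_def)

definition basis_vector :: "'n::finite \<Rightarrow> 'r::{zero,one} ^ 'n" where
  "basis_vector i = (\<chi> j. if j = i then 1 else 0)"

lemma basis_vector_nth [simp]: "basis_vector i $ j = (if j = i then 1 else 0)"
  by (simp add: basis_vector_def)

lemma bil_basis_right:
  "i \<in> idx L \<Longrightarrow> bil L x (basis_vector i) = (\<Sum>j\<in>idx L. of_int (gram L j i) * x $ j)"
  by (simp add: bil_def if_distrib cong: if_cong)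

text \<open>
  Completing squares one variable at a time. Over the rationals this gives \<open>g = P\<^sup>T
  diag(a) P\<close> with \<open>Q = P\<^sup>-\<^sup>1\<close>. The change of coordinates is
  rational, so it turns lattice vectors into integral vectors up to bounded denominators, and
  likewise back.
\<close>
lemma lagrange_diagonalization:
  fixes g :: "'n \<Rightarrow> 'n \<Rightarrow> rat"
  assumes "finite I" and "\<And>i j. i \<in> I \<Longrightarrow> j \<in> I \<Longrightarrow> g i j = g j i"
    and "\<And>x. \<exists>i\<in>I. x i \<noteq> 0 \<Longrightarrow> (\<Sum>i\<in>I. \<Sum>j\<in>I. g i j * x i * x j) > 0"
  shows "\<exists>a P Q. (\<forall>k\<in>I. a k > 0) \<and> (\<forall>i\<in>I. \<forall>j\<in>I. g i j = (\<Sum>k\<in>I. a k * P k i * P k j))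
    \<and> (\<forall>i\<in>I. \<forall>j\<in>I. (\<Sum>k\<in>I. P i k * Q k j) = (if i = j then 1 else 0))
    \<and> (\<forall>i\<in>I. \<forall>j\<in>I. (\<Sum>k\<in>I. Q i k * P k j) = (if i = j then 1 else (0::rat)))"
  using assms
proof (induction I arbitrary: g rule: finite_induct)
  case empty then show ?case by simp
next
  case (insert e I)
  note fin = insert.hyps(1) and eI = insert.hyps(2)
  have sym: "g i j = g j i" if "i \<in> insert e I" "j \<in> insert e I" for i j using insert.prems(1) that by blast
  have pos: "(\<Sum>i\<in>insert e I. \<Sum>j\<in>insert e I. g i j * x i * x j) > 0" if "\<exists>i\<in>insert e I. x i \<noteq> 0" for x
    using insert.prems(2) that by blast
  have split: "(\<Sum>i\<in>insert e I. \<Sum>j\<in>insert e I. g i j * x i * x j)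
     = g e e * x e * x e + 2 * x e * (\<Sum>j\<in>I. g e j * x j) + (\<Sum>i\<in>I. \<Sum>j\<in>I. g i j * x i * x j)" for x
  proof -
    have "(\<Sum>i\<in>I. g i e * x i * x e) = (\<Sum>i\<in>I. g e i * x e * x i)" by (intro sum.cong) (auto simp: sym)
    then show ?thesis using fin eI by (simp add: sum.distrib sum_distrib_left mult_ac)
  qed
  have ge: "g e e > 0"
  proof -
    define x where "x = (\<lambda>i. if i = e then 1 else (0::rat))"
    have "(\<Sum>j\<in>I. g e j * x j) = 0" "(\<Sum>i\<in>I. \<Sum>j\<in>I. g i j * x i * x j) = 0"
      using eI by (auto intro!: sum.neutral simp: x_def)
    then show ?thesis using pos[of x] unfolding split by (simp add: x_def)
  qed
  define g' where "g' = (\<lambda>i j. g i j - g e i * g e j / g e e)"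
  have pos': "(\<Sum>i\<in>I. \<Sum>j\<in>I. g' i j * x i * x j) > 0" if x: "\<exists>i\<in>I. x i \<noteq> 0" for x
  proof -
    define u where "u = (\<Sum>j\<in>I. g e j * x j)"
    \<comment> \<open>This extension of \<open>x\<close> minimises the form in the variable \<open>e\<close>; the
      minimum is the form \<open>g'\<close> at \<open>x\<close>.\<close>
    define x' where "x' = x(e := - u / g e e)"
    have [simp]: "x' i = x i" if "i \<in> I" for i using that eI by (auto simp: x'_def)
    have "(\<Sum>i\<in>insert e I. \<Sum>j\<in>insert e I. g i j * x' i * x' j) = g e e * x' e * x' e + 2 * x' e * u + (\<Sum>i\<in>I. \<Sum>j\<in>I. g i j * x i * x j)"
      unfolding split u_def by simp
    also have "g e e * x' e * x' e + 2 * x' e * u = - (u * u / g e e)" using ge by (simp add: x'_def field_simps)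
    also have "u * u / g e e = (\<Sum>i\<in>I. \<Sum>j\<in>I. g e i * g e j / g e e * x i * x j)"
      unfolding u_def by (simp add: sum_product sum_divide_distrib mult_ac)
    finally have "(\<Sum>i\<in>insert e I. \<Sum>j\<in>insert e I. g i j * x' i * x' j) = (\<Sum>i\<in>I. \<Sum>j\<in>I. g' i j * x i * x j)"
      by (simp add: g'_def left_diff_distrib sum_subtractf)
    moreover have "(\<Sum>i\<in>insert e I. \<Sum>j\<in>insert e I. g i j * x' i * x' j) > 0"
      using x by (intro pos) auto
    ultimately show ?thesis by simp
  qed
  have sym': "g' i j = g' j i" if "i \<in> I" "j \<in> I" for i j using sym[of i j] that by (simp add: g'_def)
  obtain a P Q where IH0: "(\<forall>k\<in>I. a k > 0) \<and> (\<forall>i\<in>I. \<forall>j\<in>I. g' i j = (\<Sum>k\<in>I. a k * P k i * P k j))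
    \<and> (\<forall>i\<in>I. \<forall>j\<in>I. (\<Sum>k\<in>I. P i k * Q k j) = (if i = j then 1 else 0))
    \<and> (\<forall>i\<in>I. \<forall>j\<in>I. (\<Sum>k\<in>I. Q i k * P k j) = (if i = j then 1 else (0::rat)))"
  proof -
    have "\<exists>a P Q. (\<forall>k\<in>I. a k > 0) \<and> (\<forall>i\<in>I. \<forall>j\<in>I. g' i j = (\<Sum>k\<in>I. a k * P k i * P k j))
      \<and> (\<forall>i\<in>I. \<forall>j\<in>I. (\<Sum>k\<in>I. P i k * Q k j) = (if i = j then 1 else 0))
      \<and> (\<forall>i\<in>I. \<forall>j\<in>I. (\<Sum>k\<in>I. Q i k * P k j) = (if i = j then 1 else (0::rat)))"
      by (rule insert.IH) (use sym' pos' in blast)+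
    then show ?thesis using that by (elim exE)
  qed
  have IH: "\<And>k. k \<in> I \<Longrightarrow> a k > 0"
    "\<And>i j. i \<in> I \<Longrightarrow> j \<in> I \<Longrightarrow> g' i j = (\<Sum>k\<in>I. a k * P k i * P k j)"
    "\<And>i j. i \<in> I \<Longrightarrow> j \<in> I \<Longrightarrow> (\<Sum>k\<in>I. P i k * Q k j) = (if i = j then 1 else (0::rat))"
    "\<And>i j. i \<in> I \<Longrightarrow> j \<in> I \<Longrightarrow> (\<Sum>k\<in>I. Q i k * P k j) = (if i = j then 1 else (0::rat))"
    using IH0 by blast+
  define p where "p = (\<lambda>i. g e i / g e e)"
  define a' where "a' = a(e := g e e)"
  define P' where "P' = (\<lambda>k i. if k = e then (if i = e then 1 else p i) else if i = e then 0 else P k i)"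
  define Q' where "Q' = (\<lambda>k i. if k = e then (if i = e then 1 else - (\<Sum>l\<in>I. p l * Q l i)) else if i = e then 0 else Q k i)"
  have ne: "i \<noteq> e" if "i \<in> I" for i using that eI by auto
  have s [simp]: "a' k = a k" "P' k i = P k i" "P' e i = p i" "P' k e = 0" "P' e e = 1"
    "Q' k i = Q k i" "Q' k e = 0" "Q' e e = 1" "a' e = g e e" if "k \<in> I" "i \<in> I" for k i
    using ne[OF that(1)] ne[OF that(2)] by (auto simp: a'_def P'_def Q'_def)
  have s' [simp]: "P' e e = 1" "Q' e e = 1" "a' e = g e e" by (auto simp: a'_def P'_def Q'_def)
  have pe: "g e e * p i * p j = g e i * g e j / g e e" "g e e * p i = g e i" for i j using ge by (simp_all add: p_def)
  show ?case
  proof (rule exI[of _ a'], rule exI[of _ P'], rule exI[of _ Q'], intro conjI ballI)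
    show "a' k > 0" if "k \<in> insert e I" for k using that IH(1) ge by (auto simp: a'_def)
    fix i j assume i: "i \<in> insert e I" and j: "j \<in> insert e I"
    have iI: "i \<in> I" if "i \<noteq> e" using i that by auto
    have jI: "j \<in> I" if "j \<noteq> e" using j that by auto
    show "g i j = (\<Sum>k\<in>insert e I. a' k * P' k i * P' k j)"
    proof -
      have "(\<Sum>k\<in>insert e I. a' k * P' k i * P' k j) = g e e * P' e i * P' e j + (\<Sum>k\<in>I. a' k * P' k i * P' k j)"
        using fin eI by simp
      also have "\<dots> = g i j"
      proof (cases "i = e \<or> j = e")
        case True
        have "(\<Sum>k\<in>I. a' k * P' k i * P' k j) = 0" using True by (intro sum.neutral) (auto simp: P'_def ne)
        moreover have "g e e * P' e i * P' e j = g i j"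
          using True sym[OF i j] ge by (auto simp: P'_def p_def)
        ultimately show ?thesis by simp
      next
        case False
        then have ij: "i \<in> I" "j \<in> I" using iI jI by auto
        have "(\<Sum>k\<in>I. a' k * P' k i * P' k j) = (\<Sum>k\<in>I. a k * P k i * P k j)" using ij by (intro sum.cong) auto
        also have "\<dots> = g' i j" using IH(2)[OF ij] by simp
        finally show ?thesis using ij False pe(1)[of i j] by (simp add: g'_def P'_def)
      qed
      finally show ?thesis by simp
    qed
    show "(\<Sum>k\<in>insert e I. P' i k * Q' k j) = (if i = j then 1 else 0)"
    proof -
      have "(\<Sum>k\<in>insert e I. P' i k * Q' k j) = P' i e * Q' e j + (\<Sum>k\<in>I. P' i k * Q' k j)" using fin eI by simp
      also have "\<dots> = (if i = j then 1 else 0)"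
      proof (cases "i = e")
        case True
        show ?thesis
        proof (cases "j = e")
          case True
          with \<open>i = e\<close> show ?thesis by (simp add: sum.neutral)
        next
          case False
          then have "j \<in> I" using jI by auto
          then have "(\<Sum>k\<in>I. P' e k * Q' k j) = (\<Sum>l\<in>I. p l * Q l j)" by (intro sum.cong) auto
          with True False show ?thesis by (simp add: Q'_def)
        qed
      next
        case False
        then have i: "i \<in> I" using iI by auto
        show ?thesis
        proof (cases "j = e")
          case True
          with i False show ?thesis by (simp add: sum.neutral)
        next
          case False
          then have j: "j \<in> I" using jI by auto
          have "(\<Sum>k\<in>I. P' i k * Q' k j) = (\<Sum>k\<in>I. P i k * Q k j)" using i j by (intro sum.cong) auto
          then show ?thesis using IH(3)[OF i j] i j by simp
        qed
      qed
      finally show ?thesis .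
    qed
    show "(\<Sum>k\<in>insert e I. Q' i k * P' k j) = (if i = j then 1 else 0)"
    proof -
      have "(\<Sum>k\<in>insert e I. Q' i k * P' k j) = Q' i e * P' e j + (\<Sum>k\<in>I. Q' i k * P' k j)" using fin eI by simp
      also have "\<dots> = (if i = j then 1 else 0)"
      proof (cases "i = e")
        case True
        show ?thesis
        proof (cases "j = e")
          case True
          with \<open>i = e\<close> show ?thesis by (simp add: sum.neutral)
        next
          case False
          then have j: "j \<in> I" using jI by auto
          have "(\<Sum>k\<in>I. Q' e k * P' k j) = (\<Sum>k\<in>I. - (\<Sum>l\<in>I. p l * (Q l k * P k j)))"
            using j ne by (intro sum.cong) (auto simp: Q'_def sum_distrib_right mult.assoc)
          also have "\<dots> = - (\<Sum>l\<in>I. p l * (\<Sum>k\<in>I. Q l k * P k j))"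
            unfolding sum_negf by (subst sum.swap) (simp add: sum_distrib_left)
          also have "\<dots> = - (\<Sum>l\<in>I. p l * (if l = j then 1 else 0))" using IH(4) j by (simp cong: sum.cong)
          also have "\<dots> = - p j" using fin j by (simp add: if_distrib cong: if_cong)
          finally show ?thesis using True False j by simp
        qed
      next
        case False
        then have i: "i \<in> I" using iI by auto
        show ?thesis
        proof (cases "j = e")
          case True
          with i False show ?thesis by (simp add: sum.neutral)
        next
          case False
          then have j: "j \<in> I" using jI by auto
          have "(\<Sum>k\<in>I. Q' i k * P' k j) = (\<Sum>k\<in>I. Q i k * P k j)" using i j by (intro sum.cong) auto
          then show ?thesis using IH(4)[OF i j] i j by simp
        qed
      qed
      finally show ?thesis .
    qed
  qed
qed

locale definite_lattice =
  fixes L :: "'n::finite int_lattice"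
  assumes sym: "symmetric_form L" and pos: "positive_definite L"
begin

abbreviation I where "I \<equiv> idx L"

lemma bil_sym: "bil L x y = bil L y x"
proof -
  have "bil L x y = (\<Sum>j\<in>I. \<Sum>i\<in>I. of_int (gram L i j) * x $ i * y $ j)"
    unfolding bil_def by (rule sum.swap)
  also have "\<dots> = bil L y x"
    unfolding bil_def using sym by (intro sum.cong) (auto simp: symmetric_form_def mult_ac)
  finally show ?thesis .
qed

lemma qf_add: "qf L (x + y) = qf L x + qf L y + bil L x (y :: 'r::field_char_0 ^ 'n)"
  unfolding qf_def bil_add_left bil_add_right bil_sym[of y x] by (simp add: field_simps)

lemma qf_diff: "qf L (x - y) = qf L x + qf L y - bil L x (y :: 'r::field_char_0 ^ 'n)"
  using qf_add[of x "- y"] by (simp add: bil_minus_right)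

lemma bil_points: "x \<in> points L \<Longrightarrow> y \<in> points L \<Longrightarrow> bil L x y \<in> \<int>"
  by (auto simp: bil_def points_def intro!: Ints_sum)

lemma points_scalars: "x \<in> points L \<Longrightarrow> x \<in> scalars L"
  by (simp add: points_def)

lemma two_qf: "2 * qf L x = bil L x x"
  for x :: "'r::field_char_0 ^ 'n"
  by (simp add: qf_def)

lemma shadow_scalars: "r \<in> shadow L \<Longrightarrow> r \<in> scalars L"
  by (simp add: shadow_def)

lemma shadowD: "r \<in> shadow L \<Longrightarrow> x \<in> points L \<Longrightarrow> bil L r x - qf L x \<in> \<int>"
  by (simp add: shadow_def)

lemma scalars_add: "x \<in> scalars L \<Longrightarrow> y \<in> scalars L \<Longrightarrow> x + y \<in> scalars L"
  and scalars_diff: "x \<in> scalars L \<Longrightarrow> y \<in> scalars L \<Longrightarrow> x - y \<in> scalars L"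
  and scalars_minus: "x \<in> scalars L \<Longrightarrow> - x \<in> scalars L"
  for x y :: "'r::ring ^ 'n"
  by (simp_all add: scalars_def)

lemma shadow_add_points: "r \<in> shadow L \<Longrightarrow> x \<in> points L \<Longrightarrow> r + x \<in> shadow L"
  unfolding shadow_def using bil_points[of x]
  by (auto simp: bil_add_left scalars_add points_scalars add_diff_eq[symmetric] intro: Ints_add)
     (metis Ints_add add_diff_eq add.commute)

lemma shadow_diff_points: "r \<in> shadow L \<Longrightarrow> x \<in> points L \<Longrightarrow> r - x \<in> shadow L"
  using shadow_add_points[of r "- x"] additive_subgroupD(3)[OF additive_subgroup_points, of x] by simp

lemma shadow_translate:
  assumes "a \<in> shadow L" "b \<in> shadow L" "c \<in> shadow L"
  shows "a + (b - c) \<in> shadow L"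
proof -
  have "bil L (a + (b - c)) x - qf L x \<in> \<int>" if "x \<in> points L" for x
  proof -
    have "bil L (a + (b - c)) x - qf L x = (bil L a x - qf L x) + ((bil L b x - qf L x) - (bil L c x - qf L x))"
      by (simp add: bil_add_left bil_diff_left)
    also have "\<dots> \<in> \<int>" using assms that by (intro Ints_add[OF shadowD Ints_diff[OF shadowD shadowD]])
    finally show ?thesis .
  qed
  then show ?thesis using assms by (auto simp: shadow_def scalars_add scalars_diff)
qed

lemma qf_shift_Ints: "r \<in> shadow L \<Longrightarrow> x \<in> points L \<Longrightarrow> qf L (r + x) - qf L r \<in> \<int>"
proof -
  assume r: "r \<in> shadow L" and x: "x \<in> points L"
  have "qf L (r + x) - qf L r = (bil L r x - qf L x) + 2 * qf L x" by (simp add: qf_add)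
  also have "\<dots> \<in> \<int>" unfolding two_qf by (intro Ints_add[OF shadowD bil_points] r x)
  finally show ?thesis .
qed

lemma shadow_minus: "r \<in> shadow L \<Longrightarrow> - r \<in> shadow L"
proof -
  assume r: "r \<in> shadow L"
  have "bil L (- r) x - qf L x \<in> \<int>" if x: "x \<in> points L" for x
  proof -
    have "bil L (- r) x - qf L x = - (bil L r x - qf L x) - 2 * qf L x" by (simp add: bil_minus_left)
    also have "\<dots> \<in> \<int>" unfolding two_qf using shadowD[OF r x] bil_points[OF x x] by (intro Ints_diff) (auto simp: minus_in_Ints_iff simp del: minus_diff_eq)
    finally show ?thesis .
  qed
  with r show ?thesis by (auto simp: shadow_def scalars_minus)
qed

text \<open>
  Positivity is assumed for lattice vectors only; it extends to rational vectors by clearing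
  denominators.
\<close>
lemma rational_form_positive:
  fixes x :: "'n \<Rightarrow> rat"
  assumes "\<exists>i\<in>I. x i \<noteq> 0"
  shows "(\<Sum>i\<in>I. \<Sum>j\<in>I. of_int (gram L i j) * x i * x j) > 0"
proof -
  obtain N :: nat where N: "N > 0" "\<And>q. q \<in> x ` I \<Longrightarrow> of_nat N * q \<in> \<int>"
    using common_denominator[of "x ` I"] by auto
  define v :: "rat ^ 'n" where "v = (\<chi> i. if i \<in> I then of_nat N * x i else 0)"
  have "v \<in> points L" using N by (auto simp: points_def scalars_def v_def)
  moreover have "v \<noteq> 0" using assms N by (auto simp: v_def vec_eq_iff)
  ultimately have "bil L v v > 0" using pos by (auto simp: positive_definite_def)
  also have "bil L v v = (of_nat N)\<^sup>2 * (\<Sum>i\<in>I. \<Sum>j\<in>I. of_int (gram L i j) * x i * x j)"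
    by (simp add: bil_def v_def sum_distrib_left power2_eq_square mult_ac)
  finally show ?thesis using N(1) by (simp add: zero_less_mult_iff)
qed

definition diagonalizes :: "('n \<Rightarrow> rat) \<times> ('n \<Rightarrow> 'n \<Rightarrow> rat) \<times> ('n \<Rightarrow> 'n \<Rightarrow> rat) \<Rightarrow> bool" where
  "diagonalizes = (\<lambda>(a, P, Q). (\<forall>k\<in>I. a k > 0) \<and> (\<forall>i\<in>I. \<forall>j\<in>I. of_int (gram L i j) = (\<Sum>k\<in>I. a k * P k i * P k j))
    \<and> (\<forall>i\<in>I. \<forall>j\<in>I. (\<Sum>k\<in>I. P i k * Q k j) = (if i = j then 1 else 0))
    \<and> (\<forall>i\<in>I. \<forall>j\<in>I. (\<Sum>k\<in>I. Q i k * P k j) = (if i = j then 1 else 0)))"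

definition "diag = (SOME apq. diagonalizes apq)"
definition dA :: "'n \<Rightarrow> rat" where "dA = fst diag"
definition dP :: "'n \<Rightarrow> 'n \<Rightarrow> rat" where "dP = fst (snd diag)"
definition dQ :: "'n \<Rightarrow> 'n \<Rightarrow> rat" where "dQ = snd (snd diag)"

lemma diagonalizes: "diagonalizes (dA, dP, dQ)"
proof -
  have "\<exists>a P Q. diagonalizes (a, P, Q)"
    unfolding diagonalizes_def prod.case
    by (rule lagrange_diagonalization) (use sym rational_form_positive in \<open>auto simp: symmetric_form_def\<close>)
  then have "diagonalizes diag" unfolding diag_def by (metis someI_ex)
  then show ?thesis by (simp add: dA_def dP_def dQ_def)
qed

lemma dA_pos: "k \<in> I \<Longrightarrow> dA k > 0"
  and gram_diag: "i \<in> I \<Longrightarrow> j \<in> I \<Longrightarrow> of_int (gram L i j) = (\<Sum>k\<in>I. dA k * dP k i * dP k j)"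
  and dP_dQ: "i \<in> I \<Longrightarrow> j \<in> I \<Longrightarrow> (\<Sum>k\<in>I. dP i k * dQ k j) = (if i = j then 1 else 0)"
  and dQ_dP: "i \<in> I \<Longrightarrow> j \<in> I \<Longrightarrow> (\<Sum>k\<in>I. dQ i k * dP k j) = (if i = j then 1 else 0)"
  using diagonalizes unfolding diagonalizes_def by auto

text \<open>
  Coordinates in which the form is diagonal. They are defined over any extension of the
  rationals, and \<open>dvec\<close> is the inverse change of coordinates over the rationals.
\<close>
definition dcoord :: "'n \<Rightarrow> 'r::field_char_0 ^ 'n \<Rightarrow> 'r" where
  "dcoord k x = (\<Sum>i\<in>I. of_rat (dP k i) * x $ i)"

definition dvec :: "('n \<Rightarrow> rat) \<Rightarrow> rat ^ 'n" where
  "dvec x = (\<chi> i. if i \<in> I then \<Sum>k\<in>I. dQ i k * x k else 0)"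

lemma dcoord_add: "dcoord k (x + y) = dcoord k x + dcoord k y"
  and dcoord_diff: "dcoord k (x - y) = dcoord k x - dcoord k y"
  and dcoord_0 [simp]: "dcoord k 0 = 0"
  by (simp_all add: dcoord_def algebra_simps sum.distrib sum_subtractf)

lemma dcoord_complexify: "dcoord k (complexify x) = of_rat (dcoord k x)"
  by (simp add: dcoord_def complexify_def of_rat_sum of_rat_mult)

lemma bil_diag: "bil L x y = (\<Sum>k\<in>I. of_rat (dA k) * dcoord k x * dcoord k y)"
  for x y :: "'r::field_char_0 ^ 'n"
proof -
  have g: "of_int (gram L i j) = (\<Sum>k\<in>I. of_rat (dA k) * of_rat (dP k i) * of_rat (dP k j) :: 'r)" if "i \<in> I" "j \<in> I" for i j
    using arg_cong[OF gram_diag[OF that], of "of_rat :: rat \<Rightarrow> 'r"] by (simp add: of_rat_sum of_rat_mult)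
  have "bil L x y = (\<Sum>i\<in>I. \<Sum>j\<in>I. \<Sum>k\<in>I. of_rat (dA k) * (of_rat (dP k i) * x $ i) * (of_rat (dP k j) * y $ j))"
    unfolding bil_def by (intro sum.cong refl) (simp add: g sum_distrib_left sum_distrib_right mult_ac)
  also have "\<dots> = (\<Sum>k\<in>I. \<Sum>i\<in>I. \<Sum>j\<in>I. of_rat (dA k) * (of_rat (dP k i) * x $ i) * (of_rat (dP k j) * y $ j))"
    by (subst sum.swap, subst (2) sum.swap, subst sum.swap) (intro sum.cong refl sum.swap)
  also have "\<dots> = (\<Sum>k\<in>I. of_rat (dA k) * dcoord k x * dcoord k y)"
    by (intro sum.cong refl) (simp add: dcoord_def sum_product sum_distrib_left mult_ac)
  finally show ?thesis .
qed

lemma qf_diag: "qf L x = (\<Sum>k\<in>I. of_rat (dA k) / 2 * (dcoord k x)\<^sup>2)"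
  for x :: "'r::field_char_0 ^ 'n"
  by (simp add: qf_def bil_diag sum_divide_distrib power2_eq_square mult_ac)

lemma dvec_scalars [simp]: "dvec x \<in> scalars L"
  by (simp add: dvec_def scalars_def)

lemma dcoord_dvec:
  assumes "k \<in> I"
  shows "dcoord k (dvec x) = x k"
proof -
  have "dcoord k (dvec x) = (\<Sum>i\<in>I. \<Sum>l\<in>I. dP k i * dQ i l * x l)"
    by (simp add: dcoord_def dvec_def sum_distrib_left mult_ac cong: if_cong)
  also have "\<dots> = (\<Sum>l\<in>I. (\<Sum>i\<in>I. dP k i * dQ i l) * x l)"
    by (subst sum.swap) (simp add: sum_distrib_right)
  also have "\<dots> = (\<Sum>l\<in>I. if l = k then x l else 0)"
    using assms by (intro sum.cong) (auto simp: dP_dQ)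
  also have "\<dots> = x k" using assms by simp
  finally show ?thesis .
qed

lemma dvec_dcoord:
  assumes "r \<in> scalars L"
  shows "dvec (\<lambda>k. dcoord k r) = r"
proof -
  have "(\<Sum>k\<in>I. dQ i k * dcoord k r) = r $ i" if "i \<in> I" for i
  proof -
    have "(\<Sum>k\<in>I. dQ i k * dcoord k r) = (\<Sum>k\<in>I. \<Sum>j\<in>I. dQ i k * dP k j * r $ j)"
      by (simp add: dcoord_def sum_distrib_left mult_ac)
    also have "\<dots> = (\<Sum>j\<in>I. (\<Sum>k\<in>I. dQ i k * dP k j) * r $ j)"
      by (subst sum.swap) (simp add: sum_distrib_right)
    also have "\<dots> = (\<Sum>j\<in>I. if j = i then r $ j else 0)"
      using that by (intro sum.cong) (auto simp: dQ_dP)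
    finally show ?thesis using that by simp
  qed
  then show ?thesis using assms by (auto simp: dvec_def vec_eq_iff scalars_def)
qed

lemma dvec_cong: "(\<And>k. k \<in> I \<Longrightarrow> x k = y k) \<Longrightarrow> dvec x = dvec y"
  unfolding dvec_def by (auto simp: vec_eq_iff intro!: sum.cong)

lemma dcoord_eqI:
  fixes r s :: "rat ^ 'n"
  assumes "r \<in> scalars L" "s \<in> scalars L" "\<And>k::'n. k \<in> I \<Longrightarrow> dcoord k r = dcoord k s"
  shows "r = s"
  using dvec_cong[of "\<lambda>k. dcoord k r" "\<lambda>k. dcoord k s"] assms by (simp add: dvec_dcoord)

lemma basis_vector_points: "i \<in> I \<Longrightarrow> basis_vector i \<in> points L"
  by (auto simp: points_def scalars_def)

lemma shadow_basis: "r \<in> shadow L \<Longrightarrow> i \<in> I \<Longrightarrow> 2 * bil L r (basis_vector i) \<in> \<int>"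
proof -
  assume r: "r \<in> shadow L" and i: "i \<in> I"
  note p = basis_vector_points[OF i]
  have "2 * bil L r (basis_vector i) = 2 * (bil L r (basis_vector i) - qf L (basis_vector i)) + 2 * qf L (basis_vector i)" by simp
  also have "\<dots> \<in> \<int>" unfolding two_qf by (intro Ints_add[OF Ints_mult[OF Ints_numeral shadowD] bil_points] r p)
  finally show ?thesis .
qed

lemma bil_basis_sum: "bil L x v = (\<Sum>i\<in>I. v $ i * bil L x (basis_vector i))"
  unfolding bil_def[of L x v] by (subst sum.swap) (auto intro!: sum.cong simp: bil_basis_right sum_distrib_left mult_ac)

lemma dcoord_via_basis:
  assumes k: "k \<in> I"
  shows "dA k * dcoord k r = (\<Sum>i\<in>I. dQ i k * bil L r (basis_vector i))"
proof -
  define v where "v = dvec (\<lambda>l. if l = k then 1 else 0)"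
  have vi: "v $ i = dQ i k" if "i \<in> I" for i
    using that k by (simp add: v_def dvec_def if_distrib cong: if_cong)
  have "dA k * dcoord k r = (\<Sum>l\<in>I. if l = k then dA l * dcoord l r else 0)" using k by simp
  also have "\<dots> = bil L r v"
    unfolding bil_diag v_def by (intro sum.cong) (auto simp: dcoord_dvec)
  also have "\<dots> = (\<Sum>i\<in>I. v $ i * bil L r (basis_vector i))"
    unfolding bil_def[of L r v] by (subst sum.swap) (auto intro!: sum.cong simp: bil_basis_right sum_distrib_left mult_ac)
  also have "\<dots> = (\<Sum>i\<in>I. dQ i k * bil L r (basis_vector i))" by (simp add: vi)
  finally show ?thesis .
qed

text \<open>
  In diagonal coordinates the shadow lies in \<open>K\<^sup>-\<^sup>1 \<int>\<^sup>n\<close>,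
  which reduces sums over the shadow to sums over \<open>\<int>\<^sup>n\<close>.
\<close>
lemma shadow_denominator:
  obtains K :: nat where "K > 0" "\<And>r k. r \<in> shadow L \<Longrightarrow> k \<in> I \<Longrightarrow> of_nat K * dcoord k r \<in> \<int>"
proof -
  obtain N :: nat where N: "N > 0" "\<And>q. q \<in> (\<lambda>(i, k). dQ i k / dA k) ` (I \<times> I) \<Longrightarrow> of_nat N * q \<in> \<int>"
    using common_denominator[of "(\<lambda>(i, k). dQ i k / dA k) ` (I \<times> I)"] by auto
  show ?thesis
  proof (rule that[of "N * 2"])
    fix r k assume r: "r \<in> shadow L" and k: "k \<in> I"
    have "dcoord k r = (\<Sum>i\<in>I. dQ i k * bil L r (basis_vector i)) / dA k"
      using dA_pos[OF k] dcoord_via_basis[OF k, of r] by (simp add: field_simps)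
    then have "of_nat (N * 2) * dcoord k r = (\<Sum>i\<in>I. (of_nat N * (dQ i k / dA k)) * (2 * bil L r (basis_vector i)))"
      by (simp add: sum_distrib_left sum_divide_distrib mult_ac)
    also have "\<dots> \<in> \<int>"
    proof (rule Ints_sum)
      fix i assume i: "i \<in> I"
      have "of_nat N * (dQ i k / dA k) \<in> \<int>" using i k by (intro N(2)) auto
      then show "(of_nat N * (dQ i k / dA k)) * (2 * bil L r (basis_vector i)) \<in> \<int>"
        by (rule Ints_mult[OF _ shadow_basis[OF r i]])
    qed
    finally show "of_nat (N * 2) * dcoord k r \<in> \<int>" .
  qed (use N in auto)
qed

definition csize :: "rat ^ 'n \<Rightarrow> real" where
  "csize r = (\<Sum>k\<in>I. \<bar>of_rat (dcoord k r)\<bar>)"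

text \<open>
  The linear term in the exponent leaves room for \<open>e(\<beta>(z, r))\<close> with complex
  \<open>z\<close>.
\<close>
lemma gauss_summable_on_shadow:
  fixes t b :: real
  assumes t: "t > 0"
  shows "(\<lambda>r. exp (- t * of_rat (qf L r) + b * csize r)) summable_on shadow L"
proof -
  obtain K where K: "K > 0" "\<And>r k. r \<in> shadow L \<Longrightarrow> k \<in> I \<Longrightarrow> of_nat K * dcoord k r \<in> \<int>"
    using shadow_denominator by blast
  define X where "X = (\<lambda>r :: rat ^ 'n. restrict (\<lambda>k. \<lfloor>of_nat K * dcoord k r\<rfloor>) I)"
  have X: "of_int (X r k) = of_nat K * dcoord k r" if "r \<in> shadow L" "k \<in> I" for r :: "rat ^ 'n" and k
    using K(2)[OF that] that by (auto simp: X_def elim!: Ints_cases)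
  have dX: "of_rat (dcoord k r) = real_of_int (X r k) / real K" if "r \<in> shadow L" "k \<in> I" for r k
    using arg_cong[OF X[OF that], of "of_rat :: rat \<Rightarrow> real"] K(1) by (simp add: of_rat_mult field_simps)
  have inj: "inj_on X (shadow L)"
  proof (rule inj_onI)
    fix r s assume rs: "r \<in> shadow L" "s \<in> shadow L" "X r = X s"
    have "dcoord k r = dcoord k s" if "k \<in> I" for k
      using X[OF rs(1) that] X[OF rs(2) that] rs(3) K(1) by simp
    then show "r = s" using rs by (intro dcoord_eqI) (auto simp: shadow_scalars)
  qed
  define \<alpha> where "\<alpha> = (\<lambda>k. t * of_rat (dA k) / (2 * (real K)\<^sup>2))"
  define f where "f = (\<lambda>k n. exp (- \<alpha> k * (real_of_int n)\<^sup>2 + b / real K * \<bar>real_of_int n\<bar>))"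
  have "\<alpha> k > 0" if "k \<in> I" for k using dA_pos[OF that] t K by (simp add: \<alpha>_def)
  then have "(f k) summable_on UNIV" if "k \<in> I" for k
    unfolding f_def using that by (intro gauss_summable_on_int) auto
  then have "((\<lambda>n. complex_of_real (f k n)) has_sum of_real (infsum (f k) UNIV)) UNIV" if "k \<in> I" for k
    using that by (intro has_sum_of_real has_sum_infsum) auto
  then have "((\<lambda>g. \<Prod>k\<in>I. complex_of_real (f k (g k))) has_sum (\<Prod>k\<in>I. of_real (infsum (f k) UNIV))) (PiE I (\<lambda>_. UNIV))"
    by (intro has_sum_prod_PiE[where f = "\<lambda>k n. complex_of_real (f k n)"]) auto
  then have "(\<lambda>g. \<Prod>k\<in>I. complex_of_real (f k (g k))) summable_on (PiE I (\<lambda>_. UNIV))"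
    unfolding summable_on_def by blast
  then have "(\<lambda>g. norm (\<Prod>k\<in>I. complex_of_real (f k (g k)))) summable_on (PiE I (\<lambda>_. UNIV))"
    by (simp only: summable_on_iff_abs_summable_on_complex)
  then have "(\<lambda>g. \<Prod>k\<in>I. f k (g k)) summable_on (PiE I (\<lambda>_. UNIV))"
    by (simp add: prod_norm[symmetric] f_def del: of_real_prod)
  then have "(\<lambda>g. \<Prod>k\<in>I. f k (g k)) summable_on X ` shadow L"
    by (rule summable_on_subset_banach) (auto simp: X_def)
  then have "(\<lambda>r. \<Prod>k\<in>I. f k (X r k)) summable_on shadow L"
    by (subst (asm) summable_on_reindex[OF inj]) (simp add: o_def)
  moreover have "(\<Prod>k\<in>I. f k (X r k)) = exp (- t * of_rat (qf L r) + b * csize r)" if r: "r \<in> shadow L" for r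
  proof -
    have "of_rat (qf L r) = (\<Sum>k\<in>I. of_rat (dA k) / 2 * (real_of_int (X r k) / real K)\<^sup>2)"
      using dX[OF r] by (simp add: qf_diag of_rat_sum of_rat_mult of_rat_divide of_rat_power)
    moreover have "csize r = (\<Sum>k\<in>I. \<bar>real_of_int (X r k) / real K\<bar>)"
      using dX[OF r] by (simp add: csize_def)
    ultimately have "- t * of_rat (qf L r) + b * csize r = (\<Sum>k\<in>I. - t * (of_rat (dA k) / 2 * (real_of_int (X r k) / real K)\<^sup>2) + b * \<bar>real_of_int (X r k) / real K\<bar>)"
      by (simp only: sum_distrib_left sum.distrib)
    also have "\<dots> = (\<Sum>k\<in>I. - \<alpha> k * (real_of_int (X r k))\<^sup>2 + b / real K * \<bar>real_of_int (X r k)\<bar>)"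
      by (simp add: \<alpha>_def power_divide mult.assoc)
    finally show ?thesis by (simp add: f_def exp_sum)
  qed
  ultimately show ?thesis by (subst summable_on_cong[symmetric]) auto
qed

lemma norm_bil_le: "norm (bil L z (complexify r)) \<le> (\<Sum>k\<in>I. of_rat (dA k) * norm (dcoord k z)) * csize r"
proof -
  have "norm (bil L z (complexify r)) \<le> (\<Sum>k\<in>I. (of_rat (dA k) * norm (dcoord k z)) * \<bar>of_rat (dcoord k r)\<bar>)"
    unfolding bil_diag
  proof (rule sum_norm_le)
    fix k assume k: "k \<in> I"
    have "norm (of_rat (dA k) * dcoord k z * dcoord k (complexify r)) = norm (complex_of_real (of_rat (dA k))) * norm (dcoord k z) * norm (complex_of_real (of_rat (dcoord k r)))"
      by (simp add: norm_mult dcoord_complexify of_real_of_rat)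
    then show "norm (of_rat (dA k) * dcoord k z * dcoord k (complexify r)) \<le> of_rat (dA k) * norm (dcoord k z) * \<bar>of_rat (dcoord k r)\<bar>"
      using dA_pos[OF k] by simp
  qed
  also have "\<dots> \<le> (\<Sum>k\<in>I. (of_rat (dA k) * norm (dcoord k z)) * csize r)"
  proof (intro sum_mono mult_left_mono)
    fix k assume k: "k \<in> I"
    show "\<bar>of_rat (dcoord k r)\<bar> \<le> csize r" unfolding csize_def using k by (intro member_le_sum) auto
    show "0 \<le> real_of_rat (dA k) * norm (dcoord k z)" using dA_pos[OF k] by simp
  qed
  finally show ?thesis by (simp add: sum_distrib_right)
qed

definition theta_term :: "complex \<Rightarrow> complex ^ 'n \<Rightarrow> rat ^ 'n \<Rightarrow> complex" where
  "theta_term \<tau> z s = ee (\<tau> * of_rat (qf L s)) * ee (bil L z (complexify s))"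

lemma norm_theta_term_le:
  "norm (theta_term \<tau> z s) \<le> exp (- (2 * pi * Im \<tau>) * of_rat (qf L s) + 2 * pi * (\<Sum>k\<in>I. of_rat (dA k) * norm (dcoord k z)) * csize s)"
proof -
  have "Im (\<tau> * of_rat (qf L s)) = Im \<tau> * of_rat (qf L s)" by (simp flip: of_real_of_rat)
  then have "norm (theta_term \<tau> z s) = exp (- (2 * pi * Im \<tau>) * of_rat (qf L s) - 2 * pi * Im (bil L z (complexify s)))"
    by (simp add: theta_term_def norm_mult norm_ee exp_add[symmetric])
  also have "\<dots> \<le> exp (- (2 * pi * Im \<tau>) * of_rat (qf L s) + 2 * pi * (\<Sum>k\<in>I. of_rat (dA k) * norm (dcoord k z)) * csize s)"
  proof -
    have "- Im (bil L z (complexify s)) \<le> (\<Sum>k\<in>I. of_rat (dA k) * norm (dcoord k z)) * csize s"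
      using norm_bil_le[of z s] abs_Im_le_cmod[of "bil L z (complexify s)"] by linarith
    then have "2 * pi * (- Im (bil L z (complexify s))) \<le> 2 * pi * ((\<Sum>k\<in>I. of_rat (dA k) * norm (dcoord k z)) * csize s)"
      by (rule mult_left_mono) simp
    then show ?thesis unfolding exp_le_cancel_iff by (simp only: mult.assoc)
  qed
  finally show ?thesis .
qed

lemma theta_term_summable:
  assumes "Im \<tau> > 0" and B: "\<And>s. s \<in> shadow L \<Longrightarrow> norm (a s) \<le> B"
  shows "(\<lambda>s. a s * theta_term \<tau> z s) summable_on shadow L"
proof (rule summable_on_norm_bound)
  show "(\<lambda>s. B * exp (- (2 * pi * Im \<tau>) * of_rat (qf L s) + 2 * pi * (\<Sum>k\<in>I. of_rat (dA k) * norm (dcoord k z)) * csize s)) summable_on shadow L"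
    using assms by (intro summable_on_cmult_right gauss_summable_on_shadow) auto
  fix s assume s: "s \<in> shadow L"
  show "norm (a s * theta_term \<tau> z s) \<le> B * exp (- (2 * pi * Im \<tau>) * of_rat (qf L s) + 2 * pi * (\<Sum>k\<in>I. of_rat (dA k) * norm (dcoord k z)) * csize s)"
    unfolding norm_mult by (rule mult_mono[OF B[OF s] norm_theta_term_le order_trans[OF norm_ge_zero B[OF s]] norm_ge_zero])
qed

end

section \<open>Poisson summation over the shadow\<close>

lemma csqrt_scaled_inverse:
  assumes u: "Re u > 0" and b: "b > 0"
  shows "1 / csqrt (of_real b / u) = csqrt u / of_real (sqrt b)"
proof -
  have p: "Re (csqrt u) > 0" by (rule Re_csqrt_pos[OF u])
  then have nz: "csqrt u \<noteq> 0" by (metis less_irrefl zero_complex.sel(1))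
  have "csqrt (of_real b / u) = of_real (sqrt b) / csqrt u"
  proof (rule csqrt_unique)
    show "(of_real (sqrt b) / csqrt u)\<^sup>2 = of_real b / u"
      using b by (simp add: power_divide flip: of_real_power)
    have "Re (of_real (sqrt b) / v) > 0" if "Re v > 0" for v
      using that b by (auto simp: Re_divide sum_power2_gt_zero_iff intro!: divide_pos_pos)
    with p show "0 < Re (of_real (sqrt b) / csqrt u) \<or> Re (of_real (sqrt b) / csqrt u) = 0 \<and> 0 \<le> Im (of_real (sqrt b) / csqrt u)"
      by blast
  qed
  then show ?thesis using b nz by (simp del: csqrt.sel)
qed

context definite_lattice
begin

text \<open>
  The behaviour of theta coefficients under translation by the lattice. The factor is
  \<open>1\<close> or \<open>-1\<close>, and it cancels against \<open>e(-\<beta>(r, s))\<close>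
  for \<open>s\<close> in the shadow, so that the finite Fourier transform is well defined on
  classes (\<open>pairing_periodic\<close>).
\<close>
definition shadow_periodic :: "(rat ^ 'n \<Rightarrow> complex) \<Rightarrow> bool" where
  "shadow_periodic h \<longleftrightarrow> (\<forall>r\<in>shadow L. \<forall>x\<in>points L. h (r + x) = er (qf L x) * h r)"

lemma pairing_periodic:
  assumes h: "shadow_periodic h" and s: "s \<in> shadow L" and rr: "r \<in> shadow L" "r' \<in> shadow L" "r - r' \<in> points L"
  shows "h r * er (- bil L r s) = h r' * er (- bil L r' s)"
proof -
  define x where "x = r - r'"
  have x: "x \<in> points L" and r: "r = r' + x" using rr by (auto simp: x_def)
  have "er (qf L x) * er (- bil L x s) = er (- (bil L s x - qf L x))"
    by (simp add: er_add[symmetric] bil_sym[of x s])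
  also have "\<dots> = 1" using shadowD[OF s x] by (intro er_Ints) (simp only: minus_in_Ints_iff)
  finally have "er (qf L x) * er (- bil L x s) = 1" .
  then have "er (qf L x) * h r' * (er (- bil L x s) * er (- bil L r' s)) = h r' * er (- bil L r' s)"
    by (simp add: mult_ac)
  moreover have "h r = er (qf L x) * h r'" using h rr(2) x unfolding shadow_periodic_def r by blast
  moreover have "er (- bil L r s) = er (- bil L x s) * er (- bil L r' s)"
    by (simp only: r bil_add_left minus_add_distrib er_add mult.commute)
  ultimately show ?thesis by simp
qed

text \<open>
  The lattice \<open>\<Lambda>\<close> of vectors with diagonal coordinates in
  \<open>\<kappa>\<int>\<close> is so small that shadow-periodic functions are constant on its
  cosets. On each coset the sum is a product of one-dimensional sums, to which
  \<open>poisson_gauss\<close> applies. The dual side then runs over the dual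
  \<open>\<Lambda>\<^sup>#\<close>, but the finite sums \<open>H\<close> over the
  representatives modulo \<open>\<Lambda>\<close> vanish off the shadow, and on the shadow they
  reduce to \<open>N\<close> times the sum over representatives modulo the lattice. The constant
  \<open>c\<close> and the representatives do not depend on \<open>h\<close>,
  \<open>\<tau>\<close> and \<open>z\<close>, and this with the positivity of \<open>c\<close>
  is what later arguments rely on.
\<close>
theorem poisson_shadow:
  "\<exists>R c. transversal (shadow L) (points L) R \<and> c > 0 \<and>
    (\<forall>h \<tau> z. shadow_periodic h \<longrightarrow> Im \<tau> > 0 \<longrightarrow>
      ((\<lambda>r. h r * ee (- qf L (complexify r - z) / \<tau>)) has_sum
        of_real c * csqrt (\<tau> / \<i>) ^ card I *
        (\<Sum>\<^sub>\<infinity>s\<in>shadow L. (\<Sum>r\<in>R. h r * er (- bil L r s)) * theta_term \<tau> z s)) (shadow L))"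
proof -
  obtain K1 :: nat where K1: "K1 > 0" "\<And>r k. r \<in> shadow L \<Longrightarrow> k \<in> I \<Longrightarrow> of_nat K1 * dcoord k r \<in> \<int>"
    using shadow_denominator by blast
  obtain D :: nat where D: "D > 0" "\<And>q. q \<in> (\<lambda>(i, k). dQ i k) ` (I \<times> I) \<union> dA ` I \<Longrightarrow> of_nat D * q \<in> \<int>"
    using common_denominator[of "(\<lambda>(i, k). dQ i k) ` (I \<times> I) \<union> dA ` I"] by auto
  have DQ: "of_nat D * dQ i k \<in> \<int>" if "i \<in> I" "k \<in> I" for i k using that by (intro D(2)) auto
  have DA: "of_nat D * dA k \<in> \<int>" if "k \<in> I" for k using that by (intro D(2)) auto
  \<comment> \<open>Divisibility of \<open>\<kappa>\<close> by \<open>2D\<close> puts \<open>\<Lambda>\<close>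
    inside twice the lattice, divisibility by \<open>K1 D\<close> puts the shadow inside the
    dual of \<open>\<Lambda>\<close>.\<close>
  define \<kappa> :: rat where "\<kappa> = of_nat (2 * K1 * D)"
  have \<kappa>: "\<kappa> > 0" using K1 D by (simp add: \<kappa>_def)
  define \<Lambda> where "\<Lambda> = {v \<in> scalars L. \<forall>k\<in>I. dcoord k v / \<kappa> \<in> \<int>}"
  have \<Lambda>: "additive_subgroup \<Lambda>"
    by (auto simp: additive_subgroup_def \<Lambda>_def scalars_diff dcoord_diff diff_divide_distrib) (simp add: scalars_def)
  have half: "\<exists>l\<in>points L. v = 2 *s l" if v: "v \<in> \<Lambda>" for v
  proof -
    define l :: "rat ^ 'n" where "l = (1/2) *s v"
    have "l $ i \<in> \<int>" if i: "i \<in> I" for i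
    proof -
      have "v $ i = (\<Sum>k\<in>I. dQ i k * dcoord k v)"
      proof -
        have "v $ i = dvec (\<lambda>k. dcoord k v) $ i" using v by (simp add: dvec_dcoord \<Lambda>_def)
        then show ?thesis using i by (simp add: dvec_def)
      qed
      then have "l $ i = (\<Sum>k\<in>I. of_nat K1 * ((of_nat D * dQ i k) * (dcoord k v / \<kappa>)))"
        using K1(1) D(1) by (simp add: l_def sum_divide_distrib \<kappa>_def)
      also have "\<dots> \<in> \<int>"
      proof (rule Ints_sum)
        fix k assume k: "k \<in> I"
        have "dcoord k v / \<kappa> \<in> \<int>" using v k by (auto simp: \<Lambda>_def)
        then show "of_nat K1 * ((of_nat D * dQ i k) * (dcoord k v / \<kappa>)) \<in> \<int>"
          by (intro Ints_mult[OF Ints_of_nat] Ints_mult[OF DQ[OF i k]])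
      qed
      finally show ?thesis .
    qed
    moreover have "l $ i = 0" if "i \<notin> I" for i using v that by (simp add: l_def \<Lambda>_def scalars_def)
    ultimately have "l \<in> points L" unfolding points_def scalars_def by (auto intro: Ints_0) (metis Ints_0)
    moreover have "v = 2 *s l" by (simp add: l_def vec_eq_iff)
    ultimately show ?thesis by blast
  qed
  have \<Lambda>L: "\<Lambda> \<subseteq> points L"
  proof
    fix v assume "v \<in> \<Lambda>"
    then obtain l where l: "l \<in> points L" "v = 2 *s l" using half by blast
    then have "v = l + l" by (simp add: vec_eq_iff)
    then show "v \<in> points L" using additive_subgroupD(4)[OF additive_subgroup_points l(1) l(1)] by simp
  qed
  have \<Lambda>q: "er (qf L v) = 1" if v: "v \<in> \<Lambda>" for v
  proof -
    obtain l where l: "l \<in> points L" "v = 2 *s l" using half[OF v] by blast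
    have "qf L v = 2 * bil L l l" by (simp add: l(2) qf_scale two_qf[symmetric])
    then show ?thesis using bil_points[OF l(1) l(1)] by (intro er_Ints) auto
  qed
  define T where "T = {r \<in> shadow L. \<forall>k\<in>I. 0 \<le> dcoord k r \<and> dcoord k r < \<kappa>}"
  have TS: "T \<subseteq> shadow L" by (auto simp: T_def)
  have dcoord_scale: "dcoord k (c *s v) = c * dcoord k v" for k c and v :: "rat ^ 'n"
    by (simp add: dcoord_def sum_distrib_left mult_ac)
  have T: "transversal (shadow L) \<Lambda> T"
    unfolding transversal_def
  proof (intro conjI ballI)
    show "finite T"
    proof (rule inj_on_finite)
      show "finite (PiE I (\<lambda>_. {0..<int (K1 * (2 * K1 * D))}))" by (intro finite_PiE) auto
      define X where "X = (\<lambda>r :: rat ^ 'n. restrict (\<lambda>k. \<lfloor>of_nat K1 * dcoord k r\<rfloor>) I)"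
      have X: "of_int (X r k) = of_nat K1 * dcoord k r" if "r \<in> shadow L" "k \<in> I" for r k
        using K1(2)[OF that] that by (auto simp: X_def elim!: Ints_cases)
      show "inj_on X T"
      proof (rule inj_onI)
        fix r s assume rs: "r \<in> T" "s \<in> T" "X r = X s"
        then have rs': "r \<in> shadow L" "s \<in> shadow L" using TS by auto
        have "dcoord k r = dcoord k s" if "k \<in> I" for k
          using X[OF rs'(1) that] X[OF rs'(2) that] rs(3) K1(1) by simp
        then show "r = s" using rs' by (intro dcoord_eqI) (auto simp: shadow_scalars)
      qed
      show "X ` T \<subseteq> PiE I (\<lambda>_. {0..<int (K1 * (2 * K1 * D))})"
      proof (intro subsetI, elim imageE, rule PiE_I)
        fix g r k assume g: "g = X r" and r: "r \<in> T" and k: "k \<in> I"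
        have c: "0 \<le> dcoord k r" "dcoord k r < \<kappa>" using r k by (auto simp: T_def)
        have "rat_of_int (g k) = of_nat K1 * dcoord k r" using X[of r k] r k TS g by auto
        moreover have "of_nat K1 * dcoord k r < of_nat K1 * \<kappa>" using c K1(1) by simp
        ultimately have "0 \<le> rat_of_int (g k)" "rat_of_int (g k) < rat_of_int (int (K1 * (2 * K1 * D)))"
          using c by (auto simp: \<kappa>_def)
        then show "g k \<in> {0..<int (K1 * (2 * K1 * D))}" by (simp only: of_int_less_iff of_int_0_le_iff atLeastLessThan_iff)
      qed (auto simp: X_def)
    qed
    show "T \<subseteq> shadow L" by (rule TS)
    fix r assume r: "r \<in> shadow L"
    define v where "v = dvec (\<lambda>k. \<kappa> * of_int \<lfloor>dcoord k r / \<kappa>\<rfloor>)"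
    have dv: "dcoord k v = \<kappa> * of_int \<lfloor>dcoord k r / \<kappa>\<rfloor>" if "k \<in> I" for k
      unfolding v_def by (rule dcoord_dvec[OF that])
    have v\<Lambda>: "v \<in> \<Lambda>" unfolding \<Lambda>_def using dv \<kappa> by (auto simp: v_def)
    show "\<exists>!t. t \<in> T \<and> r - t \<in> \<Lambda>"
    proof (rule ex1I[of _ "r - v"])
      have "r - v \<in> shadow L" using shadow_diff_points[OF r] \<Lambda>L v\<Lambda> by auto
      moreover have "0 \<le> dcoord k (r - v) \<and> dcoord k (r - v) < \<kappa>" if k: "k \<in> I" for k
      proof -
        define n where "n = \<lfloor>dcoord k r / \<kappa>\<rfloor>"
        have "of_int n \<le> dcoord k r / \<kappa>" "dcoord k r / \<kappa> < of_int n + 1"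
          using floor_correct[of "dcoord k r / \<kappa>"] unfolding n_def by auto
        then have "\<kappa> * of_int n \<le> dcoord k r" "dcoord k r < \<kappa> * of_int n + \<kappa>"
          using \<kappa> by (auto simp: field_simps)
        moreover have "dcoord k (r - v) = dcoord k r - \<kappa> * of_int n" by (simp add: dcoord_diff dv[OF k] n_def)
        ultimately show ?thesis by simp
      qed
      ultimately show "r - v \<in> T \<and> r - (r - v) \<in> \<Lambda>" using v\<Lambda> by (simp add: T_def)
      fix t assume t: "t \<in> T \<and> r - t \<in> \<Lambda>"
      show "t = r - v"
      proof (rule dcoord_eqI)
        show "t \<in> scalars L" "r - v \<in> scalars L" using t TS \<open>r - v \<in> shadow L\<close> by (auto simp: shadow_scalars)
        fix k assume k: "k \<in> I"
        obtain m where m: "dcoord k (r - t) / \<kappa> = of_int m" using t k by (auto simp: \<Lambda>_def elim: Ints_cases)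
        have tk: "0 \<le> dcoord k t" "dcoord k t < \<kappa>" using t k by (auto simp: T_def)
        have "dcoord k r / \<kappa> = of_int m + dcoord k t / \<kappa>" using m \<kappa> by (simp add: dcoord_diff field_simps)
        moreover have "0 \<le> dcoord k t / \<kappa>" "dcoord k t / \<kappa> < 1" using tk \<kappa> by auto
        ultimately have "\<lfloor>dcoord k r / \<kappa>\<rfloor> = m" by (intro floor_unique) auto
        then show "dcoord k t = dcoord k (r - v)" using m \<kappa> by (simp add: dcoord_diff dv[OF k] field_simps)
      qed
    qed
  qed
  then have finT: "finite T" by (simp add: transversal_def)
  obtain R N where R: "transversal (shadow L) (points L) R" and N: "N > 0"
    and TR: "\<And>F. (\<And>r s. r \<in> shadow L \<Longrightarrow> s \<in> shadow L \<Longrightarrow> r - s \<in> points L \<Longrightarrow> F r = F s) \<Longrightarrow> (\<Sum>t\<in>T. F t) = of_nat N * (\<Sum>t\<in>R. F t :: complex)"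
  proof (rule transversal_coarsen[OF \<Lambda> additive_subgroup_points \<Lambda>L T shadow_translate])
    fix R and N :: nat
    assume "transversal (shadow L) (points L) R" "N > 0"
      "\<And>F :: rat ^ 'n \<Rightarrow> complex. (\<And>r s. r \<in> shadow L \<Longrightarrow> s \<in> shadow L \<Longrightarrow> r - s \<in> points L \<Longrightarrow> F r = F s) \<Longrightarrow> (\<Sum>t\<in>T. F t) = of_nat N * (\<Sum>t\<in>R. F t)"
    then show thesis by (rule that)
  qed
  define \<kappa>r where "\<kappa>r = (of_rat \<kappa> :: real)"
  have \<kappa>r: "\<kappa>r > 0" using \<kappa> by (simp add: \<kappa>r_def)
  have \<kappa>rc: "of_rat \<kappa> = complex_of_real \<kappa>r" by (simp add: \<kappa>r_def of_real_of_rat)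
  define a where "a = (\<lambda>k. of_rat (dA k) :: real)"
  have a: "a k > 0" if "k \<in> I" for k using dA_pos[OF that] by (simp add: a_def)
  have ac: "of_rat (dA k) = complex_of_real (a k)" for k by (simp add: a_def of_real_of_rat)
  define c where "c = real N * (\<Prod>k\<in>I. 1 / sqrt (a k * \<kappa>r\<^sup>2))"
  have c: "c > 0" unfolding c_def using N a \<kappa>r by (intro mult_pos_pos prod_pos) auto
  \<comment> \<open>The vectors \<open>s \<xi>\<close> are those of the dual lattice of \<open>\<Lambda>\<close>.\<close>
  define s where "s = (\<lambda>\<xi> :: 'n \<Rightarrow> int. dvec (\<lambda>k. of_int (\<xi> k) / (\<kappa> * dA k)))"
  have ds: "dcoord k (s \<xi>) = of_int (\<xi> k) / (\<kappa> * dA k)" if "k \<in> I" for k \<xi>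
    unfolding s_def by (rule dcoord_dvec[OF that])
  have bij_s: "bij_betw s {\<xi> \<in> PiE I (\<lambda>_. UNIV). s \<xi> \<in> shadow L} (shadow L)"
  proof (rule bij_betw_imageI)
    show "inj_on s {\<xi> \<in> PiE I (\<lambda>_. UNIV). s \<xi> \<in> shadow L}"
    proof (rule inj_onI)
      fix \<xi> \<xi>' assume x: "\<xi> \<in> {\<xi> \<in> PiE I (\<lambda>_. UNIV). s \<xi> \<in> shadow L}" "\<xi>' \<in> {\<xi> \<in> PiE I (\<lambda>_. UNIV). s \<xi> \<in> shadow L}" and eq: "s \<xi> = s \<xi>'"
      have "\<xi> k = \<xi>' k" if k: "k \<in> I" for k
        using ds[OF k, of \<xi>] ds[OF k, of \<xi>'] eq dA_pos[OF k] \<kappa> by auto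
      then show "\<xi> = \<xi>'" using x by (intro PiE_ext[of \<xi> I "\<lambda>_. UNIV" \<xi>']) auto
    qed
    show "s ` {\<xi> \<in> PiE I (\<lambda>_. UNIV). s \<xi> \<in> shadow L} = shadow L"
    proof safe
      fix r assume r: "r \<in> shadow L"
      define \<xi> where "\<xi> = restrict (\<lambda>k. \<lfloor>dcoord k r * (\<kappa> * dA k)\<rfloor>) I"
      have "s \<xi> = r"
      proof (rule dcoord_eqI)
        fix k assume k: "k \<in> I"
        have "dcoord k r * (\<kappa> * dA k) = 2 * ((of_nat K1 * dcoord k r) * (of_nat D * dA k))" by (simp add: \<kappa>_def)
        also have "\<dots> \<in> \<int>" by (intro Ints_mult[OF Ints_numeral] Ints_mult[OF K1(2)[OF r k] DA[OF k]])
        finally have "of_int (\<xi> k) = dcoord k r * (\<kappa> * dA k)" using k by (auto simp: \<xi>_def elim: Ints_cases)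
        then show "dcoord k (s \<xi>) = dcoord k r" using ds[OF k] dA_pos[OF k] \<kappa> by simp
      qed (use r in \<open>auto simp: s_def shadow_scalars\<close>)
      moreover have "\<xi> \<in> PiE I (\<lambda>_. UNIV)" by (auto simp: \<xi>_def)
      ultimately show "r \<in> s ` {\<xi> \<in> PiE I (\<lambda>_. UNIV). s \<xi> \<in> shadow L}" using r by (intro image_eqI[of _ _ \<xi>]) auto
    qed
  qed
  have main: "((\<lambda>r. h r * ee (- qf L (complexify r - z) / \<tau>)) has_sum
        of_real c * csqrt (\<tau> / \<i>) ^ card I *
        (\<Sum>\<^sub>\<infinity>s\<in>shadow L. (\<Sum>r\<in>R. h r * er (- bil L r s)) * theta_term \<tau> z s)) (shadow L)"
    if h: "shadow_periodic h" and \<tau>: "Im \<tau> > 0" for h \<tau> z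
  proof -
    have \<tau>0: "\<tau> \<noteq> 0" using \<tau> by auto
    have u: "Re (\<tau> / \<i>) > 0" using \<tau> by (simp add: Re_divide)
    define t where "t = (\<lambda>k. of_real (a k * \<kappa>r\<^sup>2) / (\<tau> / \<i>))"
    have t_eq: "t k = of_real (a k) * (of_real \<kappa>r)\<^sup>2 * (\<i> / \<tau>)" for k
      unfolding t_def using \<tau>0 by (simp add: field_simps)
    have t: "Re (t k) > 0" if "k \<in> I" for k
    proof -
      have "t k = of_real (a k * \<kappa>r\<^sup>2) * (\<i> / \<tau>)" unfolding t_def using \<tau>0 by (simp add: field_simps)
      moreover have "Re (\<i> / \<tau>) > 0" using \<tau> \<tau>0 by (simp add: Re_divide sum_power2_gt_zero_iff complex_eq_iff)
      ultimately show ?thesis using a[OF that] \<kappa>r by (simp only: Re_complex_of_real times_complex.sel Im_complex_of_real) (auto intro!: mult_pos_pos)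
    qed
    have tnz: "t k \<noteq> 0" if "k \<in> I" for k using t[OF that] by auto
    define w where "w = (\<lambda>r k. (of_rat (dcoord k r) - dcoord k z) / of_real \<kappa>r)"
    define \<mu> where "\<mu> = (\<lambda>m :: 'n \<Rightarrow> int. dvec (\<lambda>k. \<kappa> * of_int (m k)))"
    have d\<mu>: "dcoord k (\<mu> m) = \<kappa> * of_int (m k)" if "k \<in> I" for k m
      unfolding \<mu>_def by (rule dcoord_dvec[OF that])
    have \<mu>\<Lambda>: "\<mu> m \<in> \<Lambda>" for m unfolding \<Lambda>_def using d\<mu> \<kappa> by (auto simp: \<mu>_def)
    define G where "G = (\<lambda>r. \<Prod>k\<in>I. gauss_sum (t k) (w r k))"
    define H where "H = (\<lambda>v. \<Sum>r\<in>T. h r * er (- bil L r v))"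
    have coset: "((\<lambda>r. h r * ee (- qf L (complexify r - z) / \<tau>)) has_sum h r0 * G r0) ((\<lambda>m. r0 + \<mu> m) ` PiE I (\<lambda>_. UNIV))"
      if r0: "r0 \<in> shadow L" for r0
    proof -
      have inj: "inj_on (\<lambda>m. r0 + \<mu> m) (PiE I (\<lambda>_. UNIV))"
      proof (rule inj_onI)
        fix m m' assume m: "m \<in> PiE I (\<lambda>_. UNIV)" "m' \<in> PiE I (\<lambda>_. UNIV)" and eq: "r0 + \<mu> m = r0 + \<mu> m'"
        then have "m k = m' k" if k: "k \<in> I" for k using d\<mu>[OF k, of m] d\<mu>[OF k, of m'] \<kappa> by auto
        then show "m = m'" using m by (intro PiE_ext[of m I "\<lambda>_. UNIV" m']) auto
      qed
      have "((\<lambda>m. \<Prod>k\<in>I. exp (- (of_real pi * t k * (of_int (m k) + w r0 k)\<^sup>2))) has_sum G r0) (PiE I (\<lambda>_. UNIV))"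
        unfolding G_def by (intro has_sum_prod_PiE has_sum_gauss_sum t) auto
      moreover have "(\<Prod>k\<in>I. exp (- (of_real pi * t k * (of_int (m k) + w r0 k)\<^sup>2))) = ee (- qf L (complexify (r0 + \<mu> m) - z) / \<tau>)" for m
      proof -
        have "2 * of_real pi * \<i> * (- qf L (complexify (r0 + \<mu> m) - z) / \<tau>) = (\<Sum>k\<in>I. - (of_real pi * t k * (of_int (m k) + w r0 k)\<^sup>2))"
          unfolding qf_diag sum_negf[symmetric] sum_divide_distrib sum_distrib_left
        proof (rule sum.cong[OF refl])
          fix k assume k: "k \<in> I"
          have "dcoord k (complexify (r0 + \<mu> m) - z) = of_real \<kappa>r * (of_int (m k) + w r0 k)"
            using \<kappa>r by (simp add: dcoord_diff dcoord_complexify dcoord_add d\<mu>[OF k] of_rat_add of_rat_mult \<kappa>rc w_def field_simps)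
          then show "2 * of_real pi * \<i> * (- (of_rat (dA k) / 2 * (dcoord k (complexify (r0 + \<mu> m) - z))\<^sup>2) / \<tau>) = - (of_real pi * t k * (of_int (m k) + w r0 k)\<^sup>2)"
            by (simp add: ac t_eq power_mult_distrib)
        qed
        then show ?thesis unfolding ee_def by (simp only: exp_sum[OF finite])
      qed
      ultimately have "((\<lambda>m. h r0 * ee (- qf L (complexify (r0 + \<mu> m) - z) / \<tau>)) has_sum h r0 * G r0) (PiE I (\<lambda>_. UNIV))"
        by (intro has_sum_cmult_right) simp
      moreover have "h (r0 + \<mu> m) = h r0" for m
        using h r0 \<mu>\<Lambda>[of m] \<Lambda>L \<Lambda>q[OF \<mu>\<Lambda>[of m]] by (auto simp: shadow_periodic_def)
      ultimately show ?thesis by (subst has_sum_reindex[OF inj]) (simp add: o_def)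
    qed
    have lhs: "((\<lambda>r. h r * ee (- qf L (complexify r - z) / \<tau>)) has_sum (\<Sum>r\<in>T. h r * G r)) (shadow L)"
    proof -
      have in\<Lambda>: "(r - r0 \<in> \<Lambda>) = (r \<in> (\<lambda>m. r0 + \<mu> m) ` PiE I (\<lambda>_. UNIV))" for r r0
      proof
        assume "r - r0 \<in> \<Lambda>"
        define m where "m = restrict (\<lambda>k. \<lfloor>dcoord k (r - r0) / \<kappa>\<rfloor>) I"
        have "\<mu> m = r - r0"
        proof (rule dcoord_eqI)
          fix k assume k: "k \<in> I"
          have "dcoord k (r - r0) / \<kappa> \<in> \<int>" using \<open>r - r0 \<in> \<Lambda>\<close> k by (auto simp: \<Lambda>_def)
          then have "of_int (m k) = dcoord k (r - r0) / \<kappa>" using k by (auto simp: m_def elim: Ints_cases)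
          then show "dcoord k (\<mu> m) = dcoord k (r - r0)" using d\<mu>[OF k] \<kappa> by simp
        qed (use \<open>r - r0 \<in> \<Lambda>\<close> in \<open>auto simp: \<Lambda>_def \<mu>_def\<close>)
        then show "r \<in> (\<lambda>m. r0 + \<mu> m) ` PiE I (\<lambda>_. UNIV)" by (intro image_eqI[of _ _ m]) (auto simp: m_def)
      qed (use \<mu>\<Lambda> in auto)
      have "((\<lambda>r. h r * ee (- qf L (complexify r - z) / \<tau>)) has_sum (\<Sum>r\<in>T. h r * G r)) (\<Union>r\<in>T. (\<lambda>m. r + \<mu> m) ` PiE I (\<lambda>_. UNIV))"
      proof (rule sum_has_sum[OF finT])
        fix r r' assume rr: "r \<in> T" "r' \<in> T" "r \<noteq> r'"
        show "(\<lambda>m. r + \<mu> m) ` PiE I (\<lambda>_. UNIV) \<inter> (\<lambda>m. r' + \<mu> m) ` PiE I (\<lambda>_. UNIV) = {}"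
        proof (rule ccontr)
          assume "\<not> ?thesis"
          then obtain q where "q - r \<in> \<Lambda>" "q - r' \<in> \<Lambda>" using in\<Lambda> by blast
          then have "r - r' \<in> \<Lambda>" using additive_subgroupD(2)[OF \<Lambda>, of "q - r'" "q - r"] by simp
          moreover have "r - r \<in> \<Lambda>" using additive_subgroupD(1)[OF \<Lambda>] by simp
          moreover have "r \<in> shadow L" using rr TS by auto
          ultimately show False using T rr unfolding transversal_def by blast
        qed
      qed (use coset TS in auto)
      moreover have "(\<Union>r\<in>T. (\<lambda>m. r + \<mu> m) ` PiE I (\<lambda>_. UNIV)) = shadow L"
      proof
        show "(\<Union>r\<in>T. (\<lambda>m. r + \<mu> m) ` PiE I (\<lambda>_. UNIV)) \<subseteq> shadow L"
          using TS \<Lambda>L \<mu>\<Lambda> by (auto intro!: shadow_add_points)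
        show "shadow L \<subseteq> (\<Union>r\<in>T. (\<lambda>m. r + \<mu> m) ` PiE I (\<lambda>_. UNIV))"
        proof
          fix q assume "q \<in> shadow L"
          then obtain r where "r \<in> T" "q - r \<in> \<Lambda>" using T unfolding transversal_def by blast
          then show "q \<in> (\<Union>r\<in>T. (\<lambda>m. r + \<mu> m) ` PiE I (\<lambda>_. UNIV))" using in\<Lambda>[of q r] by blast
        qed
      qed
      ultimately show ?thesis by simp
    qed
    define C where "C = (\<Prod>k\<in>I. 1 / csqrt (t k))"
    have C: "C = csqrt (\<tau> / \<i>) ^ card I * of_real (\<Prod>k\<in>I. 1 / sqrt (a k * \<kappa>r\<^sup>2))"
    proof -
      have "C = (\<Prod>k\<in>I. csqrt (\<tau> / \<i>) * of_real (1 / sqrt (a k * \<kappa>r\<^sup>2)))"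
        unfolding C_def t_def
      proof (rule prod.cong[OF refl])
        fix k assume "k \<in> I"
        then have "a k * \<kappa>r\<^sup>2 > 0" using a \<kappa>r by simp
        from csqrt_scaled_inverse[OF u this]
        show "1 / csqrt (of_real (a k * \<kappa>r\<^sup>2) / (\<tau> / \<i>)) = csqrt (\<tau> / \<i>) * of_real (1 / sqrt (a k * \<kappa>r\<^sup>2))"
          by simp
      qed
      then show ?thesis by (simp only: prod.distrib of_real_prod prod_constant)
    qed
    have dual: "((\<lambda>\<xi>. er (- bil L r (s \<xi>)) * theta_term \<tau> z (s \<xi>)) has_sum G r / C) (PiE I (\<lambda>_. UNIV))" for r
    proof -
      have "((\<lambda>\<xi>::int. exp (- (of_int \<xi> * (2 * of_real pi * \<i> * w r k)) - (of_int \<xi>)\<^sup>2 * (of_real pi / t k))) has_sum theta_series (of_real pi / t k) (2 * of_real pi * \<i> * w r k)) UNIV" if "k \<in> I" for k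
      proof (subst has_sum_reindex_bij_betw[symmetric])
        show "bij_betw (\<lambda>n::int. - n) UNIV UNIV" by (rule bij_betwI[of _ _ _ "\<lambda>n. - n"]) auto
        have "Re (of_real pi / t k) > 0"
          using t[OF that] by (auto simp: Re_divide sum_power2_gt_zero_iff)
        from has_sum_infsum[OF theta_series_summable[OF this]]
        show "((\<lambda>x::int. exp (- (of_int (- x) * (2 * of_real pi * \<i> * w r k)) - (of_int (- x))\<^sup>2 * (of_real pi / t k))) has_sum theta_series (of_real pi / t k) (2 * of_real pi * \<i> * w r k)) UNIV"
          unfolding theta_series_def of_int_minus mult_minus_left minus_minus power2_minus .
      qed
      then have "((\<lambda>\<xi>. \<Prod>k\<in>I. exp (- (of_int (\<xi> k) * (2 * of_real pi * \<i> * w r k)) - (of_int (\<xi> k))\<^sup>2 * (of_real pi / t k))) has_sum (\<Prod>k\<in>I. theta_series (of_real pi / t k) (2 * of_real pi * \<i> * w r k))) (PiE I (\<lambda>_. UNIV))"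
        by (intro has_sum_prod_PiE[where f = "\<lambda>k \<xi>. exp (- (of_int \<xi> * (2 * of_real pi * \<i> * w r k)) - (of_int \<xi>)\<^sup>2 * (of_real pi / t k))"]) auto
      moreover have "(\<Prod>k\<in>I. exp (- (of_int (\<xi> k) * (2 * of_real pi * \<i> * w r k)) - (of_int (\<xi> k))\<^sup>2 * (of_real pi / t k))) = er (- bil L r (s \<xi>)) * theta_term \<tau> z (s \<xi>)" for \<xi>
      proof -
        have "2 * of_real pi * \<i> * (of_rat (- bil L r (s \<xi>)) + (\<tau> * of_rat (qf L (s \<xi>)) + bil L z (complexify (s \<xi>)))) =
          (\<Sum>k\<in>I. 2 * of_real pi * \<i> * (- (of_rat (dA k) * of_rat (dcoord k r) * of_rat (dcoord k (s \<xi>))) + (\<tau> * (of_rat (dA k) / 2 * (of_rat (dcoord k (s \<xi>)))\<^sup>2) + of_rat (dA k) * dcoord k z * of_rat (dcoord k (s \<xi>)))))"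
          unfolding bil_diag qf_diag
          by (simp add: of_rat_minus of_rat_sum of_rat_mult of_rat_divide of_rat_power dcoord_complexify sum_distrib_left sum.distrib sum_subtractf sum_negf algebra_simps)
        also have "\<dots> = (\<Sum>k\<in>I. - (of_int (\<xi> k) * (2 * of_real pi * \<i> * w r k)) - (of_int (\<xi> k))\<^sup>2 * (of_real pi / t k))"
        proof (rule sum.cong[OF refl])
          fix k assume k: "k \<in> I"
          define x :: complex where "x = of_int (\<xi> k)"
          define y :: complex where "y = of_rat (dcoord k (s \<xi>))"
          have xy: "x = of_real \<kappa>r * of_real (a k) * y"
            using \<kappa>r a[OF k] by (simp add: x_def y_def ds[OF k] of_rat_divide of_rat_mult \<kappa>rc ac)
          have w: "of_real \<kappa>r * w r k = of_rat (dcoord k r) - dcoord k z" using \<kappa>r by (simp add: w_def)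
          have "of_real pi / t k = - (of_real pi * \<i> * \<tau>) / (of_real (a k) * (of_real \<kappa>r)\<^sup>2)" by (simp add: t_def)
          then have "x\<^sup>2 * (of_real pi / t k) = - (of_real pi * \<i> * \<tau>) * (of_real (a k) * y\<^sup>2)"
            unfolding xy using \<kappa>r a[OF k] by (simp add: power2_eq_square)
          moreover have "x * (2 * of_real pi * \<i> * w r k) = 2 * of_real pi * \<i> * of_real (a k) * y * (of_real \<kappa>r * w r k)"
            unfolding xy by simp
          ultimately show "2 * of_real pi * \<i> * (- (of_rat (dA k) * of_rat (dcoord k r) * of_rat (dcoord k (s \<xi>))) + (\<tau> * (of_rat (dA k) / 2 * (of_rat (dcoord k (s \<xi>)))\<^sup>2) + of_rat (dA k) * dcoord k z * of_rat (dcoord k (s \<xi>)))) =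
            - (of_int (\<xi> k) * (2 * of_real pi * \<i> * w r k)) - (of_int (\<xi> k))\<^sup>2 * (of_real pi / t k)"
            unfolding x_def[symmetric] y_def[symmetric] w ac by (simp add: algebra_simps)
        qed
        finally show ?thesis
          unfolding theta_term_def ee_def exp_add[symmetric] distrib_left[symmetric] by (simp only: exp_sum[OF finite])
      qed
      moreover have "(\<Prod>k\<in>I. theta_series (of_real pi / t k) (2 * of_real pi * \<i> * w r k)) = G r / C"
      proof -
        have "G r = C * (\<Prod>k\<in>I. theta_series (of_real pi / t k) (2 * of_real pi * \<i> * w r k))"
          unfolding G_def C_def prod.distrib[symmetric] by (intro prod.cong refl poisson_gauss t)
        moreover have "C \<noteq> 0" unfolding C_def using tnz by (auto simp: prod_zero_iff)
        ultimately show ?thesis by simp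
      qed
      ultimately show ?thesis by simp
    qed
    have C0: "C \<noteq> 0" unfolding C_def using tnz by (auto simp: prod_zero_iff)
    have "((\<lambda>\<xi>. \<Sum>r\<in>T. h r * (er (- bil L r (s \<xi>)) * theta_term \<tau> z (s \<xi>))) has_sum (\<Sum>r\<in>T. h r * (G r / C))) (PiE I (\<lambda>_. UNIV))"
      by (intro has_sum_finite_sum finT has_sum_cmult_right dual)
    then have sum1: "((\<lambda>\<xi>. H (s \<xi>) * theta_term \<tau> z (s \<xi>)) has_sum (\<Sum>r\<in>T. h r * G r) / C) (PiE I (\<lambda>_. UNIV))"
      by (simp add: H_def sum_distrib_right sum_distrib_left sum_divide_distrib mult_ac)
    \<comment> \<open>Moving the representatives by a lattice vector \<open>l\<close> multiplies \<open>H (s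
      \<xi>)\<close> by \<open>e(\<beta>(l) - \<beta>(s \<xi>, l))\<close>; if \<open>H (s
      \<xi>)\<close> is not zero, this factor is \<open>1\<close> for all \<open>l\<close>,
      and \<open>s \<xi>\<close> lies in the shadow.\<close>
    have H0: "H (s \<xi>) = 0" if "s \<xi> \<notin> shadow L" for \<xi>
    proof (rule ccontr)
      assume nz: "H (s \<xi>) \<noteq> 0"
      define F where "F = (\<lambda>r. h r * er (- bil L r (s \<xi>)))"
      have F\<Lambda>: "F r = F r'" if rr: "r \<in> shadow L" "r' \<in> shadow L" "r - r' \<in> \<Lambda>" for r r'
      proof -
        define v where "v = r - r'"
        have v: "v \<in> \<Lambda>" and r: "r = r' + v" using rr by (auto simp: v_def)
        have "bil L v (s \<xi>) = (\<Sum>k\<in>I. (dcoord k v / \<kappa>) * of_int (\<xi> k))"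
          unfolding bil_diag
        proof (rule sum.cong[OF refl])
          fix k assume k: "k \<in> I"
          show "of_rat (dA k) * dcoord k v * dcoord k (s \<xi>) = (dcoord k v / \<kappa>) * of_int (\<xi> k)"
            using dA_pos[OF k] \<kappa> by (simp add: ds[OF k])
        qed
        also have "\<dots> \<in> \<int>" using v by (intro Ints_sum Ints_mult[OF _ Ints_of_int]) (auto simp: \<Lambda>_def)
        finally have "er (- bil L v (s \<xi>)) = 1" by (intro er_Ints) (simp only: minus_in_Ints_iff)
        moreover have "er (- bil L r (s \<xi>)) = er (- bil L v (s \<xi>)) * er (- bil L r' (s \<xi>))"
          by (simp only: r bil_add_left minus_add_distrib er_add mult.commute)
        moreover have "h r = h r'" using h rr(2) v \<Lambda>L \<Lambda>q[OF v] unfolding r by (auto simp: shadow_periodic_def)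
        ultimately show ?thesis by (simp add: F_def)
      qed
      have "s \<xi> \<in> shadow L"
        unfolding shadow_def
      proof (intro CollectI conjI ballI)
        show "s \<xi> \<in> scalars L" by (simp add: s_def)
        fix l assume l: "l \<in> points L"
        have "transversal (shadow L) \<Lambda> ((+) l ` T)"
          unfolding transversal_def
        proof (intro conjI ballI)
          show "finite ((+) l ` T)" using finT by simp
          show "(+) l ` T \<subseteq> shadow L" using TS l shadow_add_points by (auto simp: add.commute)
          fix r assume "r \<in> shadow L"
          then have "r - l \<in> shadow L" using l by (rule shadow_diff_points)
          then have "\<exists>!t. t \<in> T \<and> (r - l) - t \<in> \<Lambda>" using T unfolding transversal_def by blast
          then obtain t where t: "t \<in> T \<and> (r - l) - t \<in> \<Lambda>" "\<forall>t'. t' \<in> T \<and> (r - l) - t' \<in> \<Lambda> \<longrightarrow> t' = t" by (elim ex1E)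
          show "\<exists>!t. t \<in> (+) l ` T \<and> r - t \<in> \<Lambda>"
          proof (rule ex1I[of _ "l + t"])
            show "l + t \<in> (+) l ` T \<and> r - (l + t) \<in> \<Lambda>" using t(1) unfolding diff_diff_eq by blast
            fix u assume "u \<in> (+) l ` T \<and> r - u \<in> \<Lambda>"
            then obtain t' where "t' \<in> T" "u = l + t'" "(r - l) - t' \<in> \<Lambda>" unfolding diff_diff_eq by blast
            then show "u = l + t" using t(2) by blast
          qed
        qed
        then have "(\<Sum>r\<in>T. F r) = (\<Sum>r\<in>(+) l ` T. F r)"
          using F\<Lambda> by (rule transversal_sum_eq[OF \<Lambda> T])
        also have "\<dots> = (\<Sum>r\<in>T. F (l + r))" by (subst sum.reindex) (auto simp: inj_on_def)
        also have "\<dots> = (\<Sum>r\<in>T. er (qf L l - bil L (s \<xi>) l) * F r)"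
        proof (rule sum.cong[OF refl])
          fix r assume "r \<in> T"
          then have "h (l + r) = er (qf L l) * h r" using h l TS unfolding shadow_periodic_def add.commute[of l r] by blast
          moreover have "er (- bil L (l + r) (s \<xi>)) = er (- bil L (s \<xi>) l) * er (- bil L r (s \<xi>))"
            by (simp only: bil_add_left minus_add_distrib er_add bil_sym[of l])
          moreover have "er (qf L l - bil L (s \<xi>) l) = er (qf L l) * er (- bil L (s \<xi>) l)"
            by (simp only: diff_conv_add_uminus er_add)
          ultimately show "F (l + r) = er (qf L l - bil L (s \<xi>) l) * F r" by (simp add: F_def)
        qed
        finally have "H (s \<xi>) = er (qf L l - bil L (s \<xi>) l) * H (s \<xi>)"
          unfolding H_def F_def sum_distrib_left[symmetric] .
        then have "er (qf L l - bil L (s \<xi>) l) = er 0" using nz by simp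
        then show "bil L (s \<xi>) l - qf L l \<in> \<int>" unfolding er_eq_iff using minus_in_Ints_iff[of "qf L l - bil L (s \<xi>) l"] by simp
      qed
      with that show False by simp
    qed
    have "((\<lambda>\<xi>. H (s \<xi>) * theta_term \<tau> z (s \<xi>)) has_sum (\<Sum>r\<in>T. h r * G r) / C) {\<xi> \<in> PiE I (\<lambda>_. UNIV). s \<xi> \<in> shadow L}"
      by (rule has_sum_cong_neutral[THEN iffD1, OF _ _ _ sum1]) (auto simp: H0)
    then have sum2: "((\<lambda>v. H v * theta_term \<tau> z v) has_sum (\<Sum>r\<in>T. h r * G r) / C) (shadow L)"
      by (subst (asm) has_sum_reindex_bij_betw[OF bij_s])
    have HN: "H v = of_nat N * (\<Sum>r\<in>R. h r * er (- bil L r v))" if v: "v \<in> shadow L" for v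
      unfolding H_def by (rule TR) (rule pairing_periodic[OF h v])
    have "(\<Sum>r\<in>T. h r * G r) / C = (\<Sum>\<^sub>\<infinity>v\<in>shadow L. H v * theta_term \<tau> z v)"
      using sum2 by (simp add: infsumI)
    also have "\<dots> = (\<Sum>\<^sub>\<infinity>v\<in>shadow L. of_nat N * ((\<Sum>r\<in>R. h r * er (- bil L r v)) * theta_term \<tau> z v))"
      by (intro infsum_cong) (simp add: HN)
    also have "\<dots> = of_nat N * (\<Sum>\<^sub>\<infinity>v\<in>shadow L. (\<Sum>r\<in>R. h r * er (- bil L r v)) * theta_term \<tau> z v)"
      by (rule infsum_cmult_right')
    finally have "(\<Sum>r\<in>T. h r * G r) = C * (of_nat N * (\<Sum>\<^sub>\<infinity>v\<in>shadow L. (\<Sum>r\<in>R. h r * er (- bil L r v)) * theta_term \<tau> z v))"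
      using C0 by (simp add: field_simps)
    also have "\<dots> = of_real c * csqrt (\<tau> / \<i>) ^ card I * (\<Sum>\<^sub>\<infinity>v\<in>shadow L. (\<Sum>r\<in>R. h r * er (- bil L r v)) * theta_term \<tau> z v)"
      unfolding C c_def by simp
    finally show ?thesis using lhs by simp
  qed
  show ?thesis using R c main by blast
qed

end

section \<open>Theta series and the Gauss sum of the shadow\<close>

lemma ee_minus_eighth: "ee (- 1 / 8) = (1 - \<i>) / of_real (sqrt 2)"
proof -
  have "ee (- 1 / 8) = exp (\<i> * of_real (- (pi / 4)))" by (simp add: ee_def)
  also have "\<dots> = cis (- (pi / 4))" by (rule cis_conv_exp[symmetric])
  finally show ?thesis by (auto simp: complex_eq_iff cos_45 sin_45 real_div_sqrt Re_divide Im_divide field_simps power2_eq_square)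
qed

context definite_lattice
begin

text \<open>
  Take \<open>r\<close> with \<open>\<beta>(r, e\<^sub>j) = \<beta>(e\<^sub>j)\<close> on a
  basis. The defect \<open>d(x) = \<beta>(r, x) - \<beta>(x)\<close> satisfies \<open>d(x + y) =
  d(x) + d(y) - \<beta>(x, y)\<close>, so its integrality spreads from multiples of basis
  vectors to the lattice.
\<close>
lemma shadow_nonempty: "\<exists>r. r \<in> shadow L"
proof -
  define r where "r = dvec (\<lambda>k. (\<Sum>i\<in>I. dQ i k * qf L (basis_vector i)) / dA k)"
  define d where "d = (\<lambda>x. bil L r x - qf L x)"
  have rb: "bil L r (basis_vector j) = qf L (basis_vector j)" if j: "j \<in> I" for j
  proof -
    have "bil L r (basis_vector j) = (\<Sum>k\<in>I. dA k * dcoord k r * dP k j)"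
      unfolding bil_diag using j by (intro sum.cong refl) (simp add: dcoord_def if_distrib cong: if_cong)
    also have "\<dots> = (\<Sum>k\<in>I. \<Sum>i\<in>I. dQ i k * dP k j * qf L (basis_vector i))"
    proof (rule sum.cong[OF refl])
      fix k assume k: "k \<in> I"
      have "dA k * dcoord k r = (\<Sum>i\<in>I. dQ i k * qf L (basis_vector i))"
        using dA_pos[OF k] unfolding r_def by (subst dcoord_dvec[OF k]) simp
      then show "dA k * dcoord k r * dP k j = (\<Sum>i\<in>I. dQ i k * dP k j * qf L (basis_vector i))"
        by (simp add: sum_distrib_left sum_distrib_right mult_ac)
    qed
    also have "\<dots> = (\<Sum>i\<in>I. (\<Sum>k\<in>I. dQ i k * dP k j) * qf L (basis_vector i))"
      by (subst sum.swap) (simp add: sum_distrib_right)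
    also have "\<dots> = (\<Sum>i\<in>I. if i = j then qf L (basis_vector i) else 0)"
      using j by (intro sum.cong) (auto simp: dQ_dP)
    finally show ?thesis using j by simp
  qed
  have dadd: "d (x + y) = d x + d y - bil L x y" for x y
    by (simp add: d_def bil_add_right qf_add)
  have de: "d (of_int m *s basis_vector j) \<in> \<int>" if j: "j \<in> I" for j and m :: int
  proof -
    have q: "qf L (basis_vector j) = of_int (gram L j j) / 2"
      using j by (simp add: qf_def bil_basis_right[OF j] if_distrib cong: if_cong)
    have "even (m * (m - 1))" by simp
    then obtain n where n: "m * (m - 1) = 2 * n" by (rule evenE)
    have "d (of_int m *s basis_vector j) = - (of_int (m * (m - 1)) * qf L (basis_vector j))"
      by (simp add: d_def bil_scale_right rb[OF j] qf_scale power2_eq_square algebra_simps)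
    also have "\<dots> = of_int (- (n * gram L j j))" unfolding n q by simp
    finally show ?thesis by simp
  qed
  have "d x \<in> \<int>" if x: "x \<in> points L" for x
  proof -
    obtain m where m: "\<And>i. x $ i = of_int (m i)"
    proof -
      have "\<forall>i. \<exists>n::int. x $ i = of_int n" using x unfolding points_def by (blast elim: Ints_cases)
      then show ?thesis using that by metis
    qed
    define y where "y = (\<lambda>J. \<Sum>j\<in>J. of_int (m j) *s basis_vector j :: rat ^ 'n)"
    have y: "y J \<in> points L \<and> d (y J) \<in> \<int>" if "J \<subseteq> I" for J
      using finite_subset[OF that finite] that
    proof (induction J rule: finite_induct)
      case empty
      show ?case by (simp add: y_def d_def additive_subgroupD(1)[OF additive_subgroup_points] qf_def)
    next
      case (insert j J)
      have p: "of_int (m j) *s basis_vector j \<in> points L" using insert.prems by (auto simp: points_def scalars_def)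
      have eq: "y (insert j J) = of_int (m j) *s basis_vector j + y J" using insert.hyps by (simp add: y_def)
      show ?case
        unfolding eq dadd using insert p de[of j "m j"]
        by (intro conjI additive_subgroupD(4)[OF additive_subgroup_points] Ints_add Ints_diff bil_points) auto
    qed
    have "x = y I"
    proof -
      have "x $ i = y I $ i" for i
      proof (cases "i \<in> I")
        case True
        have "y I $ i = (\<Sum>j\<in>I. (of_int (m j) *s basis_vector j :: rat ^ 'n) $ i)"
          unfolding y_def by (rule sum_component)
        also have "\<dots> = (\<Sum>j\<in>I. if i = j then of_int (m j) else 0)"
          by (intro sum.cong) auto
        finally have "y I $ i = (\<Sum>j\<in>I. if i = j then of_int (m j) else 0)" .
        then show ?thesis using True m by simp
      next
        case False
        then have "x $ i = 0" using x by (simp add: points_def scalars_def)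
        moreover have "y I \<in> points L" using y by auto
        then have "y I $ i = 0" using False by (simp add: points_def scalars_def)
        ultimately show ?thesis by simp
      qed
      then show ?thesis by (simp add: vec_eq_iff)
    qed
    then show ?thesis using y[of I] by simp
  qed
  then have "r \<in> shadow L" by (simp add: shadow_def d_def r_def)
  then show ?thesis ..
qed

text \<open>
  An element \<open>r\<close> of the shadow is determined by the numbers \<open>2 \<beta>(r,
  e\<^sub>j)\<close>, and these are integers, so the series becomes a multiple Fourier series in
  \<open>u\<close> at the points \<open>z = 2u\<close> with real coordinates.
\<close>
lemma shadow_series_unique:
  assumes summ: "a summable_on shadow L"
    and zero: "\<And>z. z \<in> scalars L \<Longrightarrow> (\<Sum>\<^sub>\<infinity>r\<in>shadow L. a r * ee (bil L z (complexify r))) = 0"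
    and r: "r \<in> shadow L"
  shows "a r = 0"
proof -
  define l where "l = (\<lambda>(r :: rat ^ 'n) j. \<lfloor>2 * bil L r (basis_vector j)\<rfloor>)"
  have l: "of_int (l r j) = 2 * bil L r (basis_vector j)" if "r \<in> shadow L" "j \<in> I" for r j
    using shadow_basis[OF that] by (auto simp: l_def elim: Ints_cases)
  show ?thesis
  proof (rule multiple_fourier_coefficient_eq_0[where J = I and l = l and S = "shadow L"])
    show "inj_on (\<lambda>s. restrict (l s) I) (shadow L)"
    proof (rule inj_onI)
      fix s t assume st: "s \<in> shadow L" "t \<in> shadow L" "restrict (l s) I = restrict (l t) I"
      have b: "bil L s (basis_vector i) = bil L t (basis_vector i)" if "i \<in> I" for i
        using l[OF st(1) that] l[OF st(2) that] fun_cong[OF st(3), of i] that by simp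
      have "dcoord k s = dcoord k t" if k: "k \<in> I" for k
      proof -
        have "dA k * dcoord k s = dA k * dcoord k t" unfolding dcoord_via_basis[OF k] by (simp add: b)
        then show ?thesis using dA_pos[OF k] by simp
      qed
      then show "s = t" using st by (intro dcoord_eqI) (auto simp: shadow_scalars)
    qed
    fix u :: "'n \<Rightarrow> real"
    define z :: "complex ^ 'n" where "z = (\<chi> j. if j \<in> I then 2 * of_real (u j) else 0)"
    have z: "z \<in> scalars L" by (simp add: z_def scalars_def)
    have "bil L z (complexify s) = (\<Sum>j\<in>I. of_real (u j) * of_int (l s j))" if s: "s \<in> shadow L" for s
    proof -
      have "bil L z (complexify s) = (\<Sum>j\<in>I. z $ j * bil L (complexify s) (basis_vector j))"
        unfolding bil_sym[of z] by (rule bil_basis_sum)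
      also have "\<dots> = (\<Sum>j\<in>I. of_real (u j) * of_int (l s j))"
      proof (rule sum.cong[OF refl])
        fix j assume j: "j \<in> I"
        have "basis_vector j = complexify (basis_vector j)" by (simp add: complexify_def vec_eq_iff)
        then have "2 * bil L (complexify s) (basis_vector j) = of_rat (2 * bil L s (basis_vector j))"
          by (simp add: bil_complexify of_rat_mult)
        also have "\<dots> = of_int (l s j)" unfolding l[OF s j, symmetric] by simp
        finally show "z $ j * bil L (complexify s) (basis_vector j) = of_real (u j) * of_int (l s j)"
          using j by (simp add: z_def)
      qed
      finally show ?thesis .
    qed
    then show "(\<Sum>\<^sub>\<infinity>s\<in>shadow L. a s * ee (\<Sum>j\<in>I. of_real (u j) * of_int (l s j))) = 0"
      using zero[OF z] by (simp cong: infsum_cong)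
  qed (use summ r in auto)
qed

definition poisson_data :: "(rat ^ 'n) set \<times> real \<Rightarrow> bool" where
  "poisson_data = (\<lambda>(R, c). transversal (shadow L) (points L) R \<and> c > 0 \<and>
    (\<forall>h \<tau> z. shadow_periodic h \<longrightarrow> Im \<tau> > 0 \<longrightarrow>
      ((\<lambda>r. h r * ee (- qf L (complexify r - z) / \<tau>)) has_sum
        of_real c * csqrt (\<tau> / \<i>) ^ card I *
        (\<Sum>\<^sub>\<infinity>s\<in>shadow L. (\<Sum>r\<in>R. h r * er (- bil L r s)) * theta_term \<tau> z s)) (shadow L)))"

text \<open>
  The representatives and the constant in the Poisson formula belong together and are chosen
  simultaneously.
\<close>
definition reps :: "(rat ^ 'n) set" where "reps = fst (SOME Rc. poisson_data Rc)"
definition theta_const :: real where "theta_const = snd (SOME Rc. poisson_data Rc)"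

lemma poisson_data: "poisson_data (reps, theta_const)"
proof -
  have "\<exists>Rc. poisson_data Rc" using poisson_shadow unfolding poisson_data_def by auto
  then have "poisson_data (SOME Rc. poisson_data Rc)" by (rule someI_ex)
  then show ?thesis by (simp add: reps_def theta_const_def)
qed

lemma reps: "transversal (shadow L) (points L) reps" and theta_const_pos: "theta_const > 0"
  using poisson_data by (auto simp: poisson_data_def)

lemma finite_reps [simp]: "finite reps" and reps_shadow: "r \<in> reps \<Longrightarrow> r \<in> shadow L"
  using reps by (auto simp: transversal_def)

lemma reps_ex1: "r \<in> shadow L \<Longrightarrow> \<exists>!t. t \<in> reps \<and> r - t \<in> points L"
  using reps unfolding transversal_def by blast

text \<open>
  The finite Fourier transform on the shadow modulo the lattice.
\<close>
definition hat :: "(rat ^ 'n \<Rightarrow> complex) \<Rightarrow> rat ^ 'n \<Rightarrow> complex" where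
  "hat h s = (\<Sum>r\<in>reps. h r * er (- bil L r s))"

definition Theta :: "(rat ^ 'n \<Rightarrow> complex) \<Rightarrow> complex \<Rightarrow> complex ^ 'n \<Rightarrow> complex" where
  "Theta h \<tau> z = (\<Sum>\<^sub>\<infinity>r\<in>shadow L. h r * theta_term \<tau> z r)"

lemma shadow_periodicD: "shadow_periodic h \<Longrightarrow> r \<in> shadow L \<Longrightarrow> x \<in> points L \<Longrightarrow> h (r + x) = er (qf L x) * h r"
  by (simp add: shadow_periodic_def)

lemma shadow_periodic_bounded:
  assumes h: "shadow_periodic h"
  obtains B where "\<And>r. r \<in> shadow L \<Longrightarrow> norm (h r) \<le> B"
proof (rule that[of "\<Sum>t\<in>reps. norm (h t)"])
  fix r assume r: "r \<in> shadow L"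
  then obtain t where t: "t \<in> reps" "r - t \<in> points L" using reps_ex1 by blast
  have "norm (h r) = norm (h t)"
    using shadow_periodicD[OF h reps_shadow[OF t(1)] t(2)] by (simp add: norm_mult)
  also have "\<dots> \<le> (\<Sum>t\<in>reps. norm (h t))" using t by (intro member_le_sum) auto
  finally show "norm (h r) \<le> (\<Sum>t\<in>reps. norm (h t))" .
qed

lemma Theta_has_sum:
  assumes "shadow_periodic h" "Im \<tau> > 0"
  shows "((\<lambda>r. h r * theta_term \<tau> z r) has_sum Theta h \<tau> z) (shadow L)"
proof -
  obtain B where "\<And>r. r \<in> shadow L \<Longrightarrow> norm (h r) \<le> B" using shadow_periodic_bounded[OF assms(1)] by blast
  then show ?thesis unfolding Theta_def by (intro has_sum_infsum theta_term_summable assms)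
qed

lemma Theta_unique:
  assumes a: "shadow_periodic a" and b: "shadow_periodic b" and \<tau>: "Im \<tau> > 0"
    and eq: "\<And>z. z \<in> scalars L \<Longrightarrow> Theta a \<tau> z = Theta b \<tau> z" and r: "r \<in> shadow L"
  shows "a r = b r"
proof -
  have "(a r - b r) * ee (\<tau> * of_rat (qf L r)) = 0"
  proof (rule shadow_series_unique[OF _ _ r, of "\<lambda>r. (a r - b r) * ee (\<tau> * of_rat (qf L r))"])
    have hs: "((\<lambda>r. (a r - b r) * ee (\<tau> * of_rat (qf L r)) * ee (bil L z (complexify r))) has_sum (Theta a \<tau> z - Theta b \<tau> z)) (shadow L)" for z
      using has_sum_minus[OF Theta_has_sum[OF a \<tau>, of z] Theta_has_sum[OF b \<tau>, of z]]
      by (simp add: theta_term_def algebra_simps)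
    show "(\<lambda>r. (a r - b r) * ee (\<tau> * of_rat (qf L r))) summable_on shadow L"
      using hs[of 0] by (auto simp: summable_on_def)
    show "(\<Sum>\<^sub>\<infinity>r\<in>shadow L. (a r - b r) * ee (\<tau> * of_rat (qf L r)) * ee (bil L z (complexify r))) = 0" if "z \<in> scalars L" for z
      using infsumI[OF hs[of z]] eq[OF that] by simp
  qed
  then show ?thesis by simp
qed

lemma er_neg_points: "x \<in> points L \<Longrightarrow> er (- qf L x) = er (qf L x)"
proof -
  assume x: "x \<in> points L"
  have "- qf L x - qf L x = - (2 * qf L x)" by simp
  also have "\<dots> \<in> \<int>" unfolding two_qf minus_in_Ints_iff by (rule bil_points[OF x x])
  finally show ?thesis unfolding er_eq_iff .
qed

lemma er_shadow_points: "r \<in> shadow L \<Longrightarrow> x \<in> points L \<Longrightarrow> er (bil L r x) = er (qf L x)"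
  unfolding er_eq_iff by (rule shadowD)

lemma hat_periodic: "shadow_periodic (hat h)"
  unfolding shadow_periodic_def
proof (intro ballI)
  fix s x assume s: "s \<in> shadow L" and x: "x \<in> points L"
  have "er (- bil L r (s + x)) = er (qf L x) * er (- bil L r s)" if "r \<in> reps" for r
  proof -
    have "er (- bil L r (s + x)) = er (- bil L r x) * er (- bil L r s)"
      by (simp only: bil_add_right minus_add_distrib er_add mult.commute)
    also have "er (- bil L r x) = er (- qf L x)"
      using er_shadow_points[OF reps_shadow[OF that] x] by (simp add: er_minus)
    finally show ?thesis using er_neg_points[OF x] by simp
  qed
  then show "hat h (s + x) = er (qf L x) * hat h s"
    by (simp add: hat_def sum_distrib_left mult_ac)
qed

lemma shadow_periodic_mult_er_qf:
  assumes "shadow_periodic h"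
  shows "shadow_periodic (\<lambda>r. er (qf L r) * h r)" "shadow_periodic (\<lambda>r. er (- qf L r) * h r)"
proof -
  have *: "er (qf L (r + x)) = er (qf L r)" if "r \<in> shadow L" "x \<in> points L" for r x
    unfolding er_eq_iff by (rule qf_shift_Ints[OF that])
  have **: "er (- qf L (r + x)) = er (- qf L r)" if "r \<in> shadow L" "x \<in> points L" for r x
    using *[OF that] by (simp add: er_minus)
  show "shadow_periodic (\<lambda>r. er (qf L r) * h r)" "shadow_periodic (\<lambda>r. er (- qf L r) * h r)"
    using assms by (auto simp: shadow_periodic_def * **)
qed

lemma Theta_plus_1: "Theta h (\<tau> + 1) z = Theta (\<lambda>r. er (qf L r) * h r) \<tau> z"
  and Theta_minus_1: "Theta h (\<tau> - 1) z = Theta (\<lambda>r. er (- qf L r) * h r) \<tau> z"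
  by (simp_all add: Theta_def theta_term_def distrib_right left_diff_distrib ee_add ee_diff er_minus field_simps)

lemma Theta_inversion:
  assumes h: "shadow_periodic h" and \<tau>: "Im \<tau> > 0"
  shows "Theta h (- 1 / \<tau>) ((1 / \<tau>) *s z) = ee (qf L z / \<tau>) * (of_real theta_const * csqrt (\<tau> / \<i>) ^ card I * Theta (hat h) \<tau> z)"
proof -
  have \<tau>0: "\<tau> \<noteq> 0" using \<tau> by auto
  have "((\<lambda>r. h r * ee (- qf L (complexify r - z) / \<tau>)) has_sum
        of_real theta_const * csqrt (\<tau> / \<i>) ^ card I * Theta (hat h) \<tau> z) (shadow L)"
    using poisson_data h \<tau> unfolding poisson_data_def Theta_def hat_def by blast
  from has_sum_cmult_right[OF this, of "ee (qf L z / \<tau>)"]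
  have "((\<lambda>r. ee (qf L z / \<tau>) * (h r * ee (- qf L (complexify r - z) / \<tau>))) has_sum
    ee (qf L z / \<tau>) * (of_real theta_const * csqrt (\<tau> / \<i>) ^ card I * Theta (hat h) \<tau> z)) (shadow L)" .
  moreover have "ee (qf L z / \<tau>) * (h r * ee (- qf L (complexify r - z) / \<tau>)) = h r * theta_term (- 1 / \<tau>) ((1 / \<tau>) *s z) r" for r
  proof -
    have "qf L z / \<tau> + - qf L (complexify r - z) / \<tau> = - 1 / \<tau> * of_rat (qf L r) + bil L ((1 / \<tau>) *s z) (complexify r)"
      using \<tau>0 by (simp add: qf_diff qf_complexify bil_scale_left bil_sym[of "complexify r"] field_simps)
    then have "ee (qf L z / \<tau>) * ee (- qf L (complexify r - z) / \<tau>) = theta_term (- 1 / \<tau>) ((1 / \<tau>) *s z) r"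
      unfolding theta_term_def ee_add[symmetric] by simp
    then show ?thesis by (simp add: mult_ac)
  qed
  ultimately show ?thesis unfolding Theta_def[of h] by (simp only: infsumI)
qed

text \<open>
  The shadow-periodic function that is supported on \<open>r\<^sub>0 + L\<close> and is
  \<open>1\<close> at \<open>r\<^sub>0\<close>.
\<close>
definition delta :: "rat ^ 'n \<Rightarrow> rat ^ 'n \<Rightarrow> complex" where
  "delta r0 r = (if r - r0 \<in> points L then er (qf L (r - r0)) else 0)"

lemma delta_periodic: "shadow_periodic (delta r0)"
  unfolding shadow_periodic_def
proof (intro ballI)
  fix r x assume x: "x \<in> points L"
  have iff: "r + x - r0 \<in> points L \<longleftrightarrow> r - r0 \<in> points L"
    using additive_subgroupD(2)[OF additive_subgroup_points _ x, of "r + x - r0"]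
      additive_subgroupD(4)[OF additive_subgroup_points _ x, of "r - r0"] by (auto simp: algebra_simps)
  have "er (qf L (r + x - r0)) = er (qf L x) * er (qf L (r - r0))" if "r - r0 \<in> points L"
  proof -
    have "r + x - r0 = x + (r - r0)" by simp
    then have "er (qf L (r + x - r0)) = er (qf L x) * er (qf L (r - r0)) * er (bil L x (r - r0))"
      by (simp only: qf_add er_add)
    then show ?thesis using bil_points[OF x that] by (simp add: er_Ints)
  qed
  then show "delta r0 (r + x) = er (qf L x) * delta r0 r" unfolding delta_def iff by simp
qed

lemma hat_delta:
  assumes r0: "r0 \<in> shadow L" and s: "s \<in> shadow L"
  shows "hat (delta r0) s = er (- bil L r0 s)"
proof -
  obtain t where t: "t \<in> reps" "r0 - t \<in> points L" "\<And>t'. t' \<in> reps \<Longrightarrow> r0 - t' \<in> points L \<Longrightarrow> t' = t"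
    using reps_ex1[OF r0] by auto
  have t0: "t - r0 \<in> points L" using additive_subgroupD(3)[OF additive_subgroup_points t(2)] by simp
  have "delta r0 t' = 0" if "t' \<in> reps" "t' \<noteq> t" for t'
    using t(3)[OF that(1)] that additive_subgroupD(3)[OF additive_subgroup_points, of "t' - r0"] by (auto simp: delta_def)
  then have "hat (delta r0) s = (\<Sum>t'\<in>{t}. delta r0 t' * er (- bil L t' s))"
    unfolding hat_def using t(1) by (intro sum.mono_neutral_right) auto
  also have "\<dots> = delta r0 r0 * er (- bil L r0 s)"
    using pairing_periodic[OF delta_periodic s reps_shadow[OF t(1)] r0 t0] by simp
  also have "delta r0 r0 = 1"
    by (simp add: delta_def additive_subgroupD(1)[OF additive_subgroup_points] qf_def)
  finally show ?thesis by simp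
qed

text \<open>
  The theta series with coefficients \<open>delta r0\<close> is evaluated at
  \<open>-1/\<sigma>\<close> in two ways, according to \<open>S T S = T\<^sup>-\<^sup>1 S
  T\<^sup>-\<^sup>1\<close>: two inversions with one translation in between, or one inversion
  between two translations. Comparing the coefficients at \<open>-r\<^sub>0\<close>, the first
  way gives the Gauss sum, since the two Fourier kernels cancel, and the second gives
  \<open>1\<close>. A single \<open>\<tau>\<close> suffices for the comparison because theta
  coefficients are unique at each \<open>\<tau>\<close>.
\<close>
theorem milgram: "of_real theta_const * (\<Sum>r\<in>reps. er (qf L r)) = ee (of_nat (card I) / 8)"
proof -
  obtain r0 where r0: "r0 \<in> shadow L" using shadow_nonempty by blast
  note mr0 = shadow_minus[OF r0]
  define n where "n = card I"
  define h where "h = delta r0"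
  have h: "shadow_periodic h" unfolding h_def by (rule delta_periodic)
  define g where "g = (\<lambda>r. er (qf L r) * hat h r)"
  have g: "shadow_periodic g" unfolding g_def by (rule shadow_periodic_mult_er_qf(1)[OF hat_periodic])
  define f where "f = (\<lambda>r. er (- qf L r) * h r)"
  have f: "shadow_periodic f" unfolding f_def by (rule shadow_periodic_mult_er_qf(2)[OF h])
  define e where "e = (\<lambda>r. er (- qf L r) * hat f r)"
  have e: "shadow_periodic e" unfolding e_def by (rule shadow_periodic_mult_er_qf(2)[OF hat_periodic])
  define C where "C = complex_of_real theta_const"
  have C0: "C \<noteq> 0" using theta_const_pos by (simp add: C_def)
  \<comment> \<open>At \<open>\<tau> = 1 + \<i>\<close> the second way inverts at the fixed point
    \<open>\<i>\<close>, where the root is \<open>1\<close>, and the roots of the first way have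
    the product \<open>e(-1/8)\<close>.\<close>
  define \<tau> where "\<tau> = 1 + \<i>"
  define \<sigma> where "\<sigma> = (1 + \<i>) / 2"
  have ne: "\<tau> \<noteq> 0" "1 + \<i> \<noteq> 0" by (auto simp: \<tau>_def complex_eq_iff)
  have \<sigma>: "- 1 / \<tau> + 1 = \<sigma>" and \<sigma>2: "- 1 / \<sigma> = - 1 / \<i> - 1"
    unfolding \<tau>_def \<sigma>_def using ne by (auto simp: field_simps)
  have "csqrt (\<tau> / \<i>) * csqrt (\<sigma> / \<i>) = ee (- 1 / 8)"
  proof -
    define v where "v = csqrt (1 - \<i>)"
    have v2: "v\<^sup>2 = 1 - \<i>" unfolding v_def by (rule power2_csqrt)
    have "\<tau> / \<i> = 1 - \<i>" by (simp add: \<tau>_def complex_eq_iff)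
    then have "csqrt (\<tau> / \<i>) = v" by (simp only: v_def)
    moreover have "csqrt (\<sigma> / \<i>) = v / of_real (sqrt 2)"
    proof (rule csqrt_unique)
      show "(v / of_real (sqrt 2))\<^sup>2 = \<sigma> / \<i>"
        by (simp add: power_divide v2 \<sigma>_def field_simps flip: of_real_power)
      have "Re v > 0" unfolding v_def by (rule Re_csqrt_pos) simp
      then show "0 < Re (v / of_real (sqrt 2)) \<or> Re (v / of_real (sqrt 2)) = 0 \<and> 0 \<le> Im (v / of_real (sqrt 2))"
        by (simp add: Re_divide_of_real)
    qed
    ultimately have "csqrt (\<tau> / \<i>) * csqrt (\<sigma> / \<i>) = v\<^sup>2 / of_real (sqrt 2)" by (simp add: power2_eq_square)
    then show ?thesis unfolding v2 ee_minus_eighth .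
  qed
  then have roots: "csqrt (\<tau> / \<i>) ^ n * csqrt (\<sigma> / \<i>) ^ n = ee (- of_nat n / 8)"
    by (simp add: power_mult_distrib[symmetric] ee_power del: csqrt.sel)
  have key: "Theta (\<lambda>r. C * ee (- of_nat n / 8) * hat g r) \<tau> u = Theta e \<tau> u" for u
  proof -
    have scale: "(1 / \<sigma>) *s ((1 / \<tau>) *s u) = (1 / \<i>) *s u"
    proof -
      have "1 / \<sigma> * (1 / \<tau>) = 1 / \<i>" unfolding \<sigma>_def \<tau>_def using ne by (simp add: field_simps)
      then show ?thesis by (simp only: vector_smult_assoc)
    qed
    have "Theta h (- 1 / \<sigma>) ((1 / \<sigma>) *s ((1 / \<tau>) *s u)) = ee (qf L ((1 / \<tau>) *s u) / \<sigma>) * (C * csqrt (\<sigma> / \<i>) ^ n * Theta (hat h) \<sigma> ((1 / \<tau>) *s u))"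
      unfolding C_def n_def by (rule Theta_inversion[OF h]) (simp add: \<sigma>_def)
    also have "Theta (hat h) \<sigma> ((1 / \<tau>) *s u) = Theta g (- 1 / \<tau>) ((1 / \<tau>) *s u)"
      unfolding \<sigma>[symmetric] Theta_plus_1 g_def ..
    also have "\<dots> = ee (qf L u / \<tau>) * (C * csqrt (\<tau> / \<i>) ^ n * Theta (hat g) \<tau> u)"
      unfolding C_def n_def by (rule Theta_inversion[OF g]) (simp add: \<tau>_def)
    finally have way1: "Theta h (- 1 / \<sigma>) ((1 / \<i>) *s u) = (ee (qf L ((1 / \<tau>) *s u) / \<sigma>) * ee (qf L u / \<tau>)) * (C * (C * ee (- of_nat n / 8) * Theta (hat g) \<tau> u))"
      unfolding scale roots[symmetric] by (simp only: mult_ac)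
    have "qf L ((1 / \<tau>) *s u) / \<sigma> + qf L u / \<tau> = qf L u / \<i>"
    proof -
      have "(1 / \<tau>)\<^sup>2 / \<sigma> + 1 / \<tau> = 1 / \<i>"
        unfolding \<sigma>_def \<tau>_def using ne by (simp add: field_simps power2_eq_square)
      then have "((1 / \<tau>)\<^sup>2 / \<sigma> + 1 / \<tau>) * qf L u = 1 / \<i> * qf L u" by simp
      then show ?thesis by (simp add: qf_scale distrib_right)
    qed
    then have way1: "Theta h (- 1 / \<sigma>) ((1 / \<i>) *s u) = ee (qf L u / \<i>) * (C * (C * ee (- of_nat n / 8) * Theta (hat g) \<tau> u))"
      using way1 by (simp only: ee_add[symmetric])
    have "Theta h (- 1 / \<sigma>) ((1 / \<i>) *s u) = Theta f (- 1 / \<i>) ((1 / \<i>) *s u)"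
      unfolding \<sigma>2 Theta_minus_1 f_def ..
    also have "\<dots> = ee (qf L u / \<i>) * (C * csqrt (\<i> / \<i>) ^ n * Theta (hat f) \<i> u)"
      unfolding C_def n_def by (rule Theta_inversion[OF f]) simp
    also have "Theta (hat f) \<i> u = Theta e \<tau> u"
      using Theta_minus_1[of "hat f" \<tau> u] by (simp add: \<tau>_def e_def)
    finally have "ee (qf L u / \<i>) * (C * (C * ee (- of_nat n / 8) * Theta (hat g) \<tau> u)) = ee (qf L u / \<i>) * (C * Theta e \<tau> u)"
      unfolding way1 by simp
    then have "C * ee (- of_nat n / 8) * Theta (hat g) \<tau> u = Theta e \<tau> u" using C0 by simp
    moreover have "Theta (\<lambda>r. C * ee (- of_nat n / 8) * hat g r) \<tau> u = C * ee (- of_nat n / 8) * Theta (hat g) \<tau> u"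
      unfolding Theta_def by (subst infsum_cmult_right'[symmetric]) (simp add: mult.assoc)
    ultimately show ?thesis by simp
  qed
  have per: "shadow_periodic (\<lambda>r. C * ee (- of_nat n / 8) * hat g r)"
    using hat_periodic[of g] by (auto simp: shadow_periodic_def)
  have "C * ee (- of_nat n / 8) * hat g (- r0) = e (- r0)"
    by (rule Theta_unique[OF per e, of \<tau>]) (use key mr0 in \<open>auto simp: \<tau>_def\<close>)
  moreover have "hat g (- r0) = (\<Sum>r\<in>reps. er (qf L r))"
    unfolding hat_def[of g]
  proof (rule sum.cong[OF refl])
    fix r assume "r \<in> reps"
    then have "g r = er (qf L r) * er (- bil L r0 r)"
      unfolding g_def h_def by (simp add: hat_delta[OF r0 reps_shadow])
    moreover have "er (- bil L r0 r) * er (- bil L r (- r0)) = 1"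
      unfolding er_add[symmetric] by (simp add: bil_minus_right bil_sym[of r0])
    ultimately show "g r * er (- bil L r (- r0)) = er (qf L r)" by simp
  qed
  moreover have "e (- r0) = 1"
  proof -
    have "f r * er (- bil L r (- r0)) = er (- qf L r0) * (delta r0 r * er (- bil L r (- r0)))" if "r \<in> reps" for r
    proof (cases "r - r0 \<in> points L")
      case True
      have "er (qf L r) = er (qf L r0)" using qf_shift_Ints[OF r0 True] unfolding er_eq_iff by simp
      then have "er (- qf L r) = er (- qf L r0)" by (simp add: er_minus)
      then show ?thesis by (simp add: f_def h_def)
    qed (simp add: f_def h_def delta_def)
    then have "hat f (- r0) = er (- qf L r0) * hat (delta r0) (- r0)"
      unfolding hat_def sum_distrib_left by (intro sum.cong refl) simp
    also have "\<dots> = er (- qf L r0) * er (2 * qf L r0)"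
      by (simp add: hat_delta[OF r0 mr0] bil_minus_right two_qf)
    finally have "e (- r0) = er (- qf L r0) * (er (- qf L r0) * er (2 * qf L r0))" by (simp add: e_def)
    then show ?thesis unfolding er_add[symmetric] by simp
  qed
  ultimately have "C * ee (- of_nat n / 8) * (\<Sum>r\<in>reps. er (qf L r)) = 1" by simp
  then have "ee (of_nat n / 8) * ee (- of_nat n / 8) * (C * (\<Sum>r\<in>reps. er (qf L r))) = ee (of_nat n / 8)"
    by (simp add: mult_ac)
  then show ?thesis unfolding ee_add[symmetric] C_def n_def by simp
qed

end

section \<open>Gluing two lattices along a unimodular lattice\<close>

context definite_lattice
begin

lemma additive_subgroup_dual: "additive_subgroup (dual L)"
  by (auto simp: additive_subgroup_def dual_def scalars_diff bil_diff_left) (simp add: scalars_def)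

lemma points_dual: "x \<in> points L \<Longrightarrow> x \<in> dual L"
  using bil_points by (auto simp: dual_def points_scalars)

lemma dual_scalars: "x \<in> dual L \<Longrightarrow> x \<in> scalars L"
  by (simp add: dual_def)

lemma dualD: "x \<in> dual L \<Longrightarrow> y \<in> points L \<Longrightarrow> bil L x y \<in> \<int>"
  by (simp add: dual_def)

lemma shadow_diff_dual: "r \<in> shadow L \<Longrightarrow> s \<in> shadow L \<Longrightarrow> r - s \<in> dual L"
proof -
  assume rs: "r \<in> shadow L" "s \<in> shadow L"
  have "bil L (r - s) x \<in> \<int>" if "x \<in> points L" for x
  proof -
    have "bil L (r - s) x = (bil L r x - qf L x) - (bil L s x - qf L x)" by (simp add: bil_diff_left)
    also have "\<dots> \<in> \<int>" by (intro Ints_diff[OF shadowD shadowD] rs that)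
    finally show ?thesis .
  qed
  then show ?thesis using rs by (simp add: dual_def scalars_diff shadow_scalars)
qed

lemma shadow_add_dual: "r \<in> shadow L \<Longrightarrow> x \<in> dual L \<Longrightarrow> r + x \<in> shadow L"
proof -
  assume r: "r \<in> shadow L" and x: "x \<in> dual L"
  have "bil L (r + x) y - qf L y \<in> \<int>" if "y \<in> points L" for y
  proof -
    have "bil L (r + x) y - qf L y = (bil L r y - qf L y) + bil L x y" by (simp add: bil_add_left)
    also have "\<dots> \<in> \<int>" by (rule Ints_add[OF shadowD[OF r that] dualD[OF x that]])
    finally show ?thesis .
  qed
  then show ?thesis using r x by (simp add: shadow_def dual_def scalars_add)
qed

definition dual_basis :: "'n \<Rightarrow> rat ^ 'n" where
  "dual_basis i = dvec (\<lambda>k. dQ i k / dA k)"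

lemma bil_dual_basis:
  assumes i: "i \<in> I" and j: "j \<in> I"
  shows "bil L (dual_basis i) (basis_vector j) = (if i = j then 1 else 0)"
proof -
  have "bil L (dual_basis i) (basis_vector j) = (\<Sum>k\<in>I. dQ i k * dP k j)"
    unfolding bil_diag
  proof (rule sum.cong[OF refl])
    fix k assume k: "k \<in> I"
    have "dcoord k (basis_vector j :: rat ^ 'n) = dP k j"
      using j by (simp add: dcoord_def if_distrib cong: if_cong)
    then show "of_rat (dA k) * dcoord k (dual_basis i) * dcoord k (basis_vector j) = dQ i k * dP k j"
      using dA_pos[OF k] by (simp add: dual_basis_def dcoord_dvec[OF k])
  qed
  then show ?thesis using dQ_dP[OF i j] by simp
qed

lemma bil_dual_basis_left: "i \<in> I \<Longrightarrow> bil L (dual_basis i) x = x $ i"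
  by (subst bil_basis_sum) (simp add: bil_dual_basis if_distrib cong: if_cong)

lemma dual_basis_dual: "i \<in> I \<Longrightarrow> dual_basis i \<in> dual L"
  by (auto simp: dual_def bil_dual_basis_left points_def) (simp add: dual_basis_def)

lemma nondegenerate:
  fixes x y :: "rat ^ 'n"
  assumes "x \<in> scalars L" "y \<in> scalars L" "\<And>i. i \<in> I \<Longrightarrow> bil L x (basis_vector i) = bil L y (basis_vector i)"
  shows "x = y"
proof (rule dcoord_eqI)
  fix k assume k: "k \<in> I"
  have "dA k * dcoord k x = dA k * dcoord k y" unfolding dcoord_via_basis[OF k] by (simp add: assms(3))
  then show "dcoord k x = dcoord k y" using dA_pos[OF k] by simp
qed (use assms in auto)

lemma dual_basis_expansion:
  assumes "x \<in> scalars L"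
  shows "x = (\<Sum>i\<in>I. bil L x (basis_vector i) *s dual_basis i)"
proof (rule nondegenerate[OF assms])
  have "(\<Sum>i\<in>A. c i *s dual_basis i) \<in> scalars L" for A :: "'n set" and c
    by (induction A rule: infinite_finite_induct) (auto simp: scalars_def dual_basis_def dvec_def)
  then show "(\<Sum>i\<in>I. bil L x (basis_vector i) *s dual_basis i) \<in> scalars L" .
  fix j assume j: "j \<in> I"
  have lin: "bil L (\<Sum>i\<in>A. c i *s dual_basis i) y = (\<Sum>i\<in>A. c i * bil L (dual_basis i) y)" for A :: "'n set" and c y
    by (induction A rule: infinite_finite_induct) (auto simp: bil_add_left bil_scale_left)
  show "bil L x (basis_vector j) = bil L (\<Sum>i\<in>I. bil L x (basis_vector i) *s dual_basis i) (basis_vector j)"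
    unfolding lin using j by (simp add: bil_dual_basis_left if_distrib cong: if_cong)
qed

lemma shadow_if: "r \<in> scalars L \<Longrightarrow> (\<And>x. x \<in> points L \<Longrightarrow> bil L r x - qf L x \<in> \<int>) \<Longrightarrow> r \<in> shadow L"
  by (simp add: shadow_def)

end

lemma additive_subgroup_int_multiple:
  fixes x :: "rat ^ 'm" and y :: "rat ^ 'n"
  assumes D: "additive_subgroup D" and xy: "(x, y) \<in> D"
  shows "(of_int m *s x, of_int m *s y) \<in> D"
proof (induction m rule: int_induct[where k = 0])
  case base
  then show ?case using additive_subgroupD(1)[OF D] by (simp add: zero_prod_def)
next
  case (step1 i)
  then show ?case using additive_subgroupD(4)[OF D _ xy] by (fastforce simp: vector_sadd_rdistrib)
next
  case (step2 i)
  then show ?case using additive_subgroupD(2)[OF D _ xy] by (fastforce simp: vector_ssub_ldistrib vec_eq_iff left_diff_distrib vector_sub_rdistrib)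
qed

lemma additive_subgroup_sum:
  assumes "additive_subgroup D" "\<And>i. i \<in> A \<Longrightarrow> f i \<in> D"
  shows "sum f A \<in> D"
  using assms(2) by (induction A rule: infinite_finite_induct) (auto intro: additive_subgroupD[OF assms(1)])

text \<open>
  Modulo \<open>L \<oplus> M\<close>, the group \<open>U\<close> is the graph of an isomorphism
  of the discriminant groups; \<open>isotropic\<close> says that this isomorphism respects the
  bilinear forms. The axioms are symmetric in the two lattices, so every result can be used in
  the opposite direction through \<open>swap\<close>.
\<close>
locale glued_lattices = L: definite_lattice L + M: definite_lattice M
  for L :: "'m::finite int_lattice" and M :: "'n::finite int_lattice" +
  fixes U :: "((rat ^ 'm) \<times> (rat ^ 'n)) set"
  assumes subgroup: "additive_subgroup U"
    and sub_dual: "(x, y) \<in> U \<Longrightarrow> x \<in> dual L" "(x, y) \<in> U \<Longrightarrow> y \<in> dual M"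
    and isotropic: "(x, y) \<in> U \<Longrightarrow> (x', y') \<in> U \<Longrightarrow> bil L x x' - bil M y y' \<in> \<int>"
    and surj: "x \<in> dual L \<Longrightarrow> \<exists>y. (x, y) \<in> U" "y \<in> dual M \<Longrightarrow> \<exists>x. (x, y) \<in> U"
    and points_iff: "(x, y) \<in> U \<Longrightarrow> x \<in> points L \<longleftrightarrow> y \<in> points M"
    and points_sub: "x \<in> points L \<Longrightarrow> y \<in> points M \<Longrightarrow> (x, y) \<in> U"
begin

lemma swap: "glued_lattices M L (U\<inverse>)"
proof unfold_locales
  show "additive_subgroup (U\<inverse>)"
    using additive_subgroupD(1,2)[OF subgroup] by (auto simp: additive_subgroup_def zero_prod_def)
  show "(x, y) \<in> U\<inverse> \<Longrightarrow> x \<in> dual M" "(x, y) \<in> U\<inverse> \<Longrightarrow> y \<in> dual L" for x y using sub_dual by auto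
  show "bil M x x' - bil L y y' \<in> \<int>" if "(x, y) \<in> U\<inverse>" "(x', y') \<in> U\<inverse>" for x y x' y'
    using isotropic[of y x y' x'] that minus_in_Ints_iff[of "bil M x x' - bil L y y'"] by simp
  show "x \<in> dual M \<Longrightarrow> \<exists>y. (x, y) \<in> U\<inverse>" "y \<in> dual L \<Longrightarrow> \<exists>x. (x, y) \<in> U\<inverse>" for x y using surj by auto
  show "(x, y) \<in> U\<inverse> \<Longrightarrow> x \<in> points M \<longleftrightarrow> y \<in> points L" for x y using points_iff by auto
  show "x \<in> points M \<Longrightarrow> y \<in> points L \<Longrightarrow> (x, y) \<in> U\<inverse>" for x y using points_sub by auto
qed

lemma U_add: "(x, y) \<in> U \<Longrightarrow> (x', y') \<in> U \<Longrightarrow> (x + x', y + y') \<in> U"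
  and U_diff: "(x, y) \<in> U \<Longrightarrow> (x', y') \<in> U \<Longrightarrow> (x - x', y - y') \<in> U"
  using additive_subgroupD(2,4)[OF subgroup, of "(x, y)" "(x', y')"] by auto

lemma two_qf_U: "(x, y) \<in> U \<Longrightarrow> 2 * (qf L x - qf M y) \<in> \<int>"
  using isotropic[of x y x y] by (simp add: right_diff_distrib L.two_qf M.two_qf)

text \<open>
  With \<open>s\<close> in the shadow of \<open>M\<close>, the component \<open>r\<close> can be
  chosen to satisfy the condition on one lift \<open>(e\<^sub>i\<^sup>*, y\<^sub>i)\<close> of
  each element of the dual basis of \<open>L\<close>. The condition holds on a subgroup of
  \<open>U\<close>, because the defect is additive modulo integers, and \<open>U\<close> is
  generated by these lifts and \<open>0 \<oplus> M\<close>.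
\<close>
theorem unimodular_shadow_exists:
  "\<exists>r s. r \<in> scalars L \<and> s \<in> scalars M \<and> (\<forall>(x, y)\<in>U. (bil L r x - bil M s y) - (qf L x - qf M y) \<in> \<int>)"
proof -
  obtain s where s: "s \<in> shadow M" using M.shadow_nonempty by blast
  have "\<forall>i\<in>L.I. \<exists>y. (L.dual_basis i, y) \<in> U" using surj(1) L.dual_basis_dual by blast
  then obtain y where y: "\<And>i. i \<in> L.I \<Longrightarrow> (L.dual_basis i, y i) \<in> U" by metis
  define r :: "rat ^ 'm" where "r = (\<chi> i. if i \<in> L.I then qf L (L.dual_basis i) - qf M (y i) + bil M s (y i) else 0)"
  have r: "r \<in> scalars L" by (simp add: r_def scalars_def)
  define d where "d = (\<lambda>(x, y). (bil L r x - bil M s y) - (qf L x - qf M y))"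
  define D where "D = {u \<in> U. d u \<in> \<int>}"
  have dd: "d (x - x', y - y') = d (x, y) - d (x', y') + (bil L x x' - bil M y y') - 2 * (qf L x' - qf M y')" for x x' y y'
    by (simp add: d_def bil_diff_right L.qf_diff M.qf_diff)
  have D: "additive_subgroup D"
    unfolding additive_subgroup_def
  proof (intro conjI ballI)
    show "0 \<in> D" using additive_subgroupD(1)[OF subgroup] by (auto simp: D_def d_def zero_prod_def qf_def)
    fix u v assume uv: "u \<in> D" "v \<in> D"
    obtain x y x' y' where [simp]: "u = (x, y)" "v = (x', y')" by (cases u, cases v) auto
    have "(x, y) \<in> U" "(x', y') \<in> U" "d (x, y) \<in> \<int>" "d (x', y') \<in> \<int>" using uv by (auto simp: D_def)
    then show "u - v \<in> D" unfolding D_def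
      using U_diff dd[of x x' y y'] isotropic[of x y x' y'] two_qf_U[of x' y'] by auto
  qed
  have basis: "(L.dual_basis i, y i) \<in> D" if i: "i \<in> L.I" for i
  proof -
    have "bil L r (L.dual_basis i) = r $ i" unfolding L.bil_sym[of r] by (rule L.bil_dual_basis_left[OF i])
    then show ?thesis using y[OF i] i by (simp add: D_def d_def r_def)
  qed
  have "d (x, z) \<in> \<int>" if xz: "(x, z) \<in> U" for x z
  proof -
    have x: "x \<in> dual L" using sub_dual xz by auto
    have "\<forall>i\<in>L.I. \<exists>m::int. bil L x (basis_vector i) = of_int m"
      using L.dualD[OF x L.basis_vector_points] by (blast elim: Ints_cases)
    then obtain m where m: "\<And>i. i \<in> L.I \<Longrightarrow> bil L x (basis_vector i) = of_int (m i)" by metis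
    define w where "w = (\<Sum>i\<in>L.I. of_int (m i) *s y i)"
    have "(\<Sum>i\<in>L.I. (of_int (m i) *s L.dual_basis i, of_int (m i) *s y i)) \<in> D"
      by (intro additive_subgroup_sum[OF D] additive_subgroup_int_multiple[OF D] basis)
    also have "(\<Sum>i\<in>L.I. (of_int (m i) *s L.dual_basis i, of_int (m i) *s y i)) = (x, w)"
      using L.dual_basis_expansion[OF L.dual_scalars[OF x]] m by (simp add: sum_prod w_def)
    finally have xw: "(x, w) \<in> D" .
    then have U0: "(0, z - w) \<in> U" using U_diff[OF xz, of x w] by (auto simp: D_def)
    then have l: "z - w \<in> points M" using points_iff additive_subgroupD(1)[OF additive_subgroup_points, of L] by blast
    have "d (0, z - w) = - (bil M s (z - w) - qf M (z - w))" by (simp add: d_def qf_def)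
    also have "\<dots> \<in> \<int>" using M.shadowD[OF s l] by (simp only: minus_in_Ints_iff)
    finally have "(0, z - w) \<in> D" using U0 by (simp add: D_def)
    from additive_subgroupD(4)[OF D xw this] show ?thesis by (simp add: D_def)
  qed
  then show ?thesis using r M.shadow_scalars[OF s] by (intro exI[of _ r] exI[of _ s]) (auto simp: d_def)
qed

end

text \<open>
  The pair \<open>(r0, s0)\<close> is a base point of the shadow of \<open>U\<close> with
  respect to \<open>\<beta>\<^sub>L - \<beta>\<^sub>M\<close>.
\<close>
locale glued_shadow = glued_lattices +
  fixes r0 :: "rat ^ 'a" and s0 :: "rat ^ 'b"
  assumes r0_scalars: "r0 \<in> scalars L" and s0_scalars: "s0 \<in> scalars M"
    and characteristic: "(x, y) \<in> U \<Longrightarrow> (bil L r0 x - bil M s0 y) - (qf L x - qf M y) \<in> \<int>"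
begin

lemma swap_shadow: "glued_shadow M L (U\<inverse>) s0 r0"
proof -
  interpret S: glued_lattices M L "U\<inverse>" by (rule swap)
  show ?thesis
  proof unfold_locales
    show "s0 \<in> scalars M" "r0 \<in> scalars L" by (rule s0_scalars r0_scalars)+
    show "(bil M s0 x - bil L r0 y) - (qf M x - qf L y) \<in> \<int>" if "(x, y) \<in> U\<inverse>" for x y
    proof -
      have "(bil M s0 x - bil L r0 y) - (qf M x - qf L y) = - ((bil L r0 y - bil M s0 x) - (qf L y - qf M x))" by simp
      then show ?thesis using characteristic[of y x] that by (simp only: minus_in_Ints_iff converse_iff)
    qed
  qed
qed

lemma r0_shadow: "r0 \<in> shadow L"
proof (rule L.shadow_if[OF r0_scalars])
  fix x assume "x \<in> points L"
  then have "(x, 0) \<in> U" using points_sub additive_subgroupD(1)[OF additive_subgroup_points] by blast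
  from characteristic[OF this] show "bil L r0 x - qf L x \<in> \<int>" by (simp add: qf_def)
qed

lemma s0_shadow: "s0 \<in> shadow M"
  by (rule glued_shadow.r0_shadow[OF swap_shadow])

text \<open>
  The pairs in the shadow of \<open>U\<close>, which is the coset of \<open>U\<close> through
  \<open>(r0, s0)\<close>.
\<close>
definition partners :: "rat ^ 'a \<Rightarrow> rat ^ 'b \<Rightarrow> bool" where
  "partners r s \<longleftrightarrow> (r - r0, s - s0) \<in> U"

text \<open>
  For partners this is a sign, because \<open>\<beta>\<^sub>L - \<beta>\<^sub>M\<close> takes
  values in \<open>\<int>/2\<close> on \<open>U\<close>.
\<close>
definition twist :: "rat ^ 'a \<Rightarrow> rat ^ 'b \<Rightarrow> complex" where
  "twist r s = er (qf L (r - r0) - qf M (s - s0))"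

lemma twist_nonzero [simp]: "twist r s \<noteq> 0"
  by (simp add: twist_def)

lemma twist_square: "partners r s \<Longrightarrow> twist r s * twist r s = 1"
  using two_qf_U[of "r - r0" "s - s0"] unfolding twist_def er_add[symmetric] partners_def
  by (intro er_Ints) simp

lemma partners_shadow: "partners r s \<Longrightarrow> r \<in> shadow L \<and> s \<in> shadow M"
  using L.shadow_add_dual[OF r0_shadow, of "r - r0"] M.shadow_add_dual[OF s0_shadow, of "s - s0"] sub_dual
  unfolding partners_def by fastforce

lemma partner_exists: "r \<in> shadow L \<Longrightarrow> \<exists>s. partners r s"
proof -
  assume "r \<in> shadow L"
  then obtain y where "(r - r0, y) \<in> U" using surj(1) L.shadow_diff_dual[OF _ r0_shadow] by blast
  then show ?thesis by (intro exI[of _ "s0 + y"]) (simp add: partners_def)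
qed

lemma partner_exists': "s \<in> shadow M \<Longrightarrow> \<exists>r. partners r s"
proof -
  assume "s \<in> shadow M"
  then obtain x where "(x, s - s0) \<in> U" using surj(2) M.shadow_diff_dual[OF _ s0_shadow] by blast
  then show ?thesis by (intro exI[of _ "r0 + x"]) (simp add: partners_def)
qed

lemma partners_diff: "partners r s \<Longrightarrow> partners r' s' \<Longrightarrow> (r - r', s - s') \<in> U"
  using U_diff[of "r - r0" "s - s0" "r' - r0" "s' - s0"] by (simp add: partners_def)

lemma partners_points_iff: "partners r s \<Longrightarrow> partners r' s' \<Longrightarrow> r - r' \<in> points L \<longleftrightarrow> s - s' \<in> points M"
  by (rule points_iff[OF partners_diff])

lemma partners_qf:
  assumes p: "partners r s"
  shows "er (qf L r) = er (qf L r0 - qf M s0) * er (qf M s)"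
proof -
  define x y where "x = r - r0" "y = s - s0"
  have xy: "(x, y) \<in> U" "r = r0 + x" "s = s0 + y" using p by (auto simp: x_y_def partners_def)
  have "qf L r - (qf L r0 - qf M s0 + qf M s) = ((bil L r0 x - bil M s0 y) - (qf L x - qf M y)) + 2 * (qf L x - qf M y)"
    unfolding xy(2,3) L.qf_add M.qf_add by simp
  also have "\<dots> \<in> \<int>" by (intro Ints_add characteristic two_qf_U xy)
  finally show ?thesis unfolding er_add[symmetric] er_eq_iff .
qed

text \<open>
  The kernels of the two finite Fourier transforms agree on partners up to the signs of the two
  pairs and one constant that depends on the base point.
\<close>
lemma twist_mult:
  assumes p: "partners r s" and p': "partners r' s'"
  shows "er (- bil L r r') = er (- 2 * (qf L r0 - qf M s0)) * (er (- bil M s s') * (twist r s * twist r' s'))"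
proof -
  define x y where "x = r - r0" "y = s - s0"
  define x' y' where "x' = r' - r0" "y' = s' - s0"
  note d = x_y_def x'_y'_def
  have xy: "(x, y) \<in> U" "r = r0 + x" "s = s0 + y" "(x', y') \<in> U" "r' = r0 + x'" "s' = s0 + y'"
    using p p' by (auto simp: d partners_def)
  define c where "c = (\<lambda>x y. (bil L r0 x - bil M s0 y) - (qf L x - qf M y))"
  have "- bil L r r' - (- 2 * (qf L r0 - qf M s0) + (- bil M s s' + (qf L x - qf M y + (qf L x' - qf M y')))) =
     - (c x y + c x' y' + (bil L x x' - bil M y y') + 2 * (qf L x - qf M y) + 2 * (qf L x' - qf M y'))"
    unfolding c_def xy(2,3,5,6) bil_add_left bil_add_right L.bil_sym[of x r0] M.bil_sym[of y s0]
    by (simp add: right_diff_distrib L.two_qf M.two_qf)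
  also have "\<dots> \<in> \<int>" unfolding minus_in_Ints_iff c_def by (intro Ints_add characteristic two_qf_U isotropic xy)
  finally show ?thesis unfolding twist_def er_add[symmetric] er_eq_iff d .
qed

text \<open>
  The partners define a bijection between the classes of the two shadows.
\<close>
lemma reps_sum_eq:
  assumes F: "\<And>r s. partners r s \<Longrightarrow> F r = F' s"
    and inv: "\<And>s s'. s \<in> shadow M \<Longrightarrow> s' \<in> shadow M \<Longrightarrow> s - s' \<in> points M \<Longrightarrow> F' s = (F' s' :: complex)"
  shows "(\<Sum>r\<in>L.reps. F r) = (\<Sum>s\<in>M.reps. F' s)"
proof -
  define f where "f = (\<lambda>r. SOME s. partners r s)"
  have f: "partners r (f r)" if "r \<in> shadow L" for r
    unfolding f_def using partner_exists[OF that] by (rule someI_ex)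
  have inj: "r = r'" if "r \<in> L.reps" "r' \<in> L.reps" "f r - f r' \<in> points M" for r r'
  proof -
    have r: "r \<in> shadow L" "r' \<in> shadow L" using that L.reps_shadow by auto
    have "r - r' \<in> points L" using partners_points_iff[OF f[OF r(1)] f[OF r(2)]] that by simp
    moreover have "r - r \<in> points L" using additive_subgroupD(1)[OF additive_subgroup_points] by simp
    ultimately show ?thesis using L.reps_ex1[OF r(1)] that by blast
  qed
  have "transversal (shadow M) (points M) (f ` L.reps)"
    unfolding transversal_def
  proof (intro conjI ballI)
    show "finite (f ` L.reps)" by simp
    show "f ` L.reps \<subseteq> shadow M" using partners_shadow[OF f] L.reps_shadow by auto
    fix s assume "s \<in> shadow M"
    then obtain r where r: "partners r s" using partner_exists' by blast
    then obtain t where t: "t \<in> L.reps" "r - t \<in> points L" using L.reps_ex1 partners_shadow by blast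
    have tS: "t \<in> shadow L" using t L.reps_shadow by auto
    show "\<exists>!u. u \<in> f ` L.reps \<and> s - u \<in> points M"
    proof (rule ex1I[of _ "f t"])
      show ft: "f t \<in> f ` L.reps \<and> s - f t \<in> points M" using t partners_points_iff[OF r f[OF tS]] by simp
      fix u assume u: "u \<in> f ` L.reps \<and> s - u \<in> points M"
      then obtain t' where t': "t' \<in> L.reps" "u = f t'" by auto
      have "f t' - f t \<in> points M" using additive_subgroupD(2)[OF additive_subgroup_points, of "s - f t" M "s - f t'"] ft u t' by simp
      then show "u = f t" using inj[OF t'(1) t(1)] t' by simp
    qed
  qed
  then have "(\<Sum>s\<in>M.reps. F' s) = (\<Sum>s\<in>f ` L.reps. F' s)"
    using inv by (rule transversal_sum_eq[OF additive_subgroup_points M.reps])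
  also have "\<dots> = (\<Sum>r\<in>L.reps. F' (f r))"
    using inj additive_subgroupD(1)[OF additive_subgroup_points, of M]
    by (subst sum.reindex) (auto simp: inj_on_def)
  also have "\<dots> = (\<Sum>r\<in>L.reps. F r)"
    using F[OF f[OF L.reps_shadow]] by (intro sum.cong) auto
  finally show ?thesis by simp
qed

text \<open>
  By \<open>partners_qf\<close> the Gauss sums of the two shadows differ by the factor
  \<open>e(\<beta>(r\<^sub>0) - \<beta>(s\<^sub>0))\<close>. In the quotient of Milgram's
  formulas the absolute values show that the positive constants agree, and then the phases give
  the factor. For \<open>M = 0\<close> this is van der Blij's congruence for the norm of a
  characteristic vector of a unimodular lattice.
\<close>
theorem van_der_blij:
  shows "L.theta_const = M.theta_const" and "er (qf L r0 - qf M s0) = ee ((of_nat (card L.I) - of_nat (card M.I)) / 8)"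
proof -
  define e where "e = er (qf L r0 - qf M s0)"
  define G where "G = (\<Sum>s\<in>M.reps. er (qf M s))"
  have "(\<Sum>r\<in>L.reps. er (qf L r)) = (\<Sum>s\<in>M.reps. e * er (qf M s))"
  proof (rule reps_sum_eq)
    show "partners r s \<Longrightarrow> er (qf L r) = e * er (qf M s)" for r s unfolding e_def by (rule partners_qf)
    show "e * er (qf M s) = e * er (qf M s')" if "s \<in> shadow M" "s' \<in> shadow M" "s - s' \<in> points M" for s s'
      using M.qf_shift_Ints[OF that(2,3)] er_eq_iff[of "qf M s" "qf M s'"] by simp
  qed
  then have 1: "of_real L.theta_const * (e * G) = ee (of_nat (card L.I) / 8)"
    using L.milgram by (simp add: G_def sum_distrib_left)
  have 2: "of_real M.theta_const * G = ee (of_nat (card M.I) / 8)"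
    unfolding G_def by (rule M.milgram)
  have n8: "norm (ee (of_nat k / 8)) = 1" for k
    using norm_ee_real[of "real k / 8"] by simp
  have nG: "L.theta_const * norm G = 1" "M.theta_const * norm G = 1"
    using arg_cong[OF 1, of norm] arg_cong[OF 2, of norm] L.theta_const_pos M.theta_const_pos
    unfolding norm_mult n8 by (simp_all add: e_def)
  have "norm G \<noteq> 0" using nG(1) by (intro notI) simp
  with nG show eq: "L.theta_const = M.theta_const" by (metis mult_right_cancel)
  have "e * ee (of_nat (card M.I) / 8) = of_real M.theta_const * (e * G)" unfolding 2[symmetric] by (rule mult.left_commute)
  also have "\<dots> = ee (of_nat (card L.I) / 8)" using 1 unfolding eq .
  finally have "e = ee (of_nat (card L.I) / 8) / ee (of_nat (card M.I) / 8)" by (simp only: nonzero_eq_divide_eq ee_nonzero not_False_eq_True)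
  then show "e = ee ((of_nat (card L.I) - of_nat (card M.I)) / 8)" unfolding diff_divide_distrib ee_diff .
qed

lemma qf_shadow_difference:
  assumes p: "partners r s"
  shows "qf L r - qf M s - (of_nat (card L.I) - of_nat (card M.I)) / 8 \<in> \<int>"
proof -
  have "ee ((of_nat (card L.I) - of_nat (card M.I)) / 8) = er ((of_nat (card L.I) - of_nat (card M.I)) / 8)"
    by (simp add: of_rat_divide of_rat_diff)
  then have "er (qf L r) = er ((of_nat (card L.I) - of_nat (card M.I)) / 8 + qf M s)"
    using partners_qf[OF p] van_der_blij(2) by (simp add: er_add)
  then have "qf L r - ((of_nat (card L.I) - of_nat (card M.I)) / 8 + qf M s) \<in> \<int>" by (simp only: er_eq_iff)
  then show ?thesis by (simp add: algebra_simps)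
qed

end

lemma (in definite_lattice) coset_eq: "points L #>\<^bsub>dual_group L\<^esub> x = {l + x | l. l \<in> points L}"
  by (auto simp: r_coset_def dual_group_def)

lemma (in definite_lattice) coset_eq_iff:
  "points L #>\<^bsub>dual_group L\<^esub> x = points L #>\<^bsub>dual_group L\<^esub> y \<longleftrightarrow> x - y \<in> points L"
proof
  assume "points L #>\<^bsub>dual_group L\<^esub> x = points L #>\<^bsub>dual_group L\<^esub> y"
  moreover have "x \<in> points L #>\<^bsub>dual_group L\<^esub> x"
    unfolding coset_eq using additive_subgroupD(1)[OF additive_subgroup_points, of L] by force
  ultimately obtain l where "l \<in> points L" "x = l + y" unfolding coset_eq by blast
  then show "x - y \<in> points L" by simp
next
  assume xy: "x - y \<in> points L"
  have "l + x \<in> points L #>\<^bsub>dual_group L\<^esub> y" if "l \<in> points L" for l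
    unfolding coset_eq using additive_subgroupD(4)[OF additive_subgroup_points that xy]
    by (intro CollectI exI[of _ "l + (x - y)"]) auto
  moreover have "l + y \<in> points L #>\<^bsub>dual_group L\<^esub> x" if "l \<in> points L" for l
    unfolding coset_eq using additive_subgroupD(2)[OF additive_subgroup_points that xy]
    by (intro CollectI exI[of _ "l - (x - y)"]) auto
  ultimately show "points L #>\<^bsub>dual_group L\<^esub> x = points L #>\<^bsub>dual_group L\<^esub> y"
    unfolding coset_eq by blast
qed

lemma (in definite_lattice) carrier_disc_group:
  "carrier (disc_group L) = (\<lambda>x. points L #>\<^bsub>dual_group L\<^esub> x) ` dual L"
  by (auto simp: disc_group_def FactGroup_def RCOSETS_def) (auto simp: dual_group_def)

lemma (in definite_lattice) mult_disc_group:
  "(points L #>\<^bsub>dual_group L\<^esub> x) \<otimes>\<^bsub>disc_group L\<^esub> (points L #>\<^bsub>dual_group L\<^esub> y) = points L #>\<^bsub>dual_group L\<^esub> (x + y)"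
proof -
  have "(points L #>\<^bsub>dual_group L\<^esub> x) \<otimes>\<^bsub>disc_group L\<^esub> (points L #>\<^bsub>dual_group L\<^esub> y) =
    {a + b | a b. a \<in> points L #>\<^bsub>dual_group L\<^esub> x \<and> b \<in> points L #>\<^bsub>dual_group L\<^esub> y}"
    by (auto simp: disc_group_def FactGroup_def set_mult_def) (auto simp: dual_group_def)
  also have "\<dots> = points L #>\<^bsub>dual_group L\<^esub> (x + y)"
  proof (intro equalityI subsetI)
    fix q assume "q \<in> {a + b | a b. a \<in> points L #>\<^bsub>dual_group L\<^esub> x \<and> b \<in> points L #>\<^bsub>dual_group L\<^esub> y}"
    then obtain l l' where "l \<in> points L" "l' \<in> points L" "q = (l + x) + (l' + y)" unfolding coset_eq by blast
    then show "q \<in> points L #>\<^bsub>dual_group L\<^esub> (x + y)" unfolding coset_eq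
      using additive_subgroupD(4)[OF additive_subgroup_points, of l L l'] by (intro CollectI exI[of _ "l + l'"]) (auto simp: algebra_simps)
  next
    fix q assume "q \<in> points L #>\<^bsub>dual_group L\<^esub> (x + y)"
    then obtain l where l: "l \<in> points L" "q = l + (x + y)" unfolding coset_eq by blast
    then show "q \<in> {a + b | a b. a \<in> points L #>\<^bsub>dual_group L\<^esub> x \<and> b \<in> points L #>\<^bsub>dual_group L\<^esub> y}"
    proof -
      have "l + x \<in> points L #>\<^bsub>dual_group L\<^esub> x" unfolding coset_eq using l(1) by blast
      moreover have "0 + y \<in> points L #>\<^bsub>dual_group L\<^esub> y"
        unfolding coset_eq using additive_subgroupD(1)[OF additive_subgroup_points, of L] by blast
      moreover have "q = (l + x) + (0 + y)" by (simp add: l(2))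
      ultimately show ?thesis by blast
    qed
  qed
  finally show ?thesis .
qed

text \<open>
  That \<open>\<gamma>\<close> is a homomorphism makes the glue a subgroup, injectivity gives
  \<open>points_iff\<close>, surjectivity gives \<open>surj\<close>, and compatibility with the
  forms gives \<open>isotropic\<close>.
\<close>
theorem glued_lattices_glue:
  assumes L: "definite_lattice L" and M: "definite_lattice M" and iso: "bilinear_module_iso L M \<gamma>"
  shows "glued_lattices L M (glue L M \<gamma>)"
proof -
  interpret L: definite_lattice L by (rule L)
  interpret M: definite_lattice M by (rule M)
  define cL where "cL = (\<lambda>x. points L #>\<^bsub>dual_group L\<^esub> x)"
  define cM where "cM = (\<lambda>x. points M #>\<^bsub>dual_group M\<^esub> x)"
  note defs = cL_def[symmetric] cM_def[symmetric]
  have cLi: "cL x = cL y \<longleftrightarrow> x - y \<in> points L" for x y unfolding cL_def by (rule L.coset_eq_iff)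
  have cMi: "cM x = cM y \<longleftrightarrow> x - y \<in> points M" for x y unfolding cM_def by (rule M.coset_eq_iff)
  have carL: "carrier (disc_group L) = cL ` dual L" unfolding cL_def by (rule L.carrier_disc_group)
  have carM: "carrier (disc_group M) = cM ` dual M" unfolding cM_def by (rule M.carrier_disc_group)
  have mL: "cL x \<otimes>\<^bsub>disc_group L\<^esub> cL y = cL (x + y)" for x y unfolding cL_def by (rule L.mult_disc_group)
  have mM: "cM x \<otimes>\<^bsub>disc_group M\<^esub> cM y = cM (x + y)" for x y unfolding cM_def by (rule M.mult_disc_group)
  have hom: "\<gamma> (cL x \<otimes>\<^bsub>disc_group L\<^esub> cL y) = \<gamma> (cL x) \<otimes>\<^bsub>disc_group M\<^esub> \<gamma> (cL y)" if "x \<in> dual L" "y \<in> dual L" for x y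
    using iso that unfolding bilinear_module_iso_def iso_def hom_def carL by auto
  have bij: "bij_betw \<gamma> (cL ` dual L) (cM ` dual M)"
    using iso unfolding bilinear_module_iso_def iso_def carL carM by auto
  have form: "disc_form M (\<gamma> (cL x)) (\<gamma> (cL y)) = disc_form L (cL x) (cL y)" if "x \<in> dual L" "y \<in> dual L" for x y
    using iso that unfolding bilinear_module_iso_def carL by auto
  define U where "U = glue L M \<gamma>"
  have U: "(x, y) \<in> U \<longleftrightarrow> x \<in> dual L \<and> y \<in> dual M \<and> \<gamma> (cL x) = cM y" for x y
    by (simp add: U_def glue_def cL_def cM_def)
  note dL = L.additive_subgroup_dual and dM = M.additive_subgroup_dual
  note pL = additive_subgroup_points[of L] and pM = additive_subgroup_points[of M]
  have add: "(x + x', y + y') \<in> U" if "(x, y) \<in> U" "(x', y') \<in> U" for x y x' y'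
    using that hom[of x x'] additive_subgroupD(4)[OF dL] additive_subgroupD(4)[OF dM] by (auto simp: U mL mM)
  have s1: "\<exists>y. (x, y) \<in> U" if "x \<in> dual L" for x
  proof -
    have "\<gamma> (cL x) \<in> cM ` dual M" using bij that by (auto simp: bij_betw_def)
    then show ?thesis using that by (auto simp: U)
  qed
  have s2: "\<exists>x. (x, y) \<in> U" if "y \<in> dual M" for y
  proof -
    have "cM y \<in> \<gamma> ` cL ` dual L" using bij that by (auto simp: bij_betw_def)
    then show ?thesis using that by (force simp: U)
  qed
  have z: "(0, 0) \<in> U"
  proof -
    obtain y where y: "(0, y) \<in> U" using s1[OF additive_subgroupD(1)[OF dL]] by blast
    from add[OF y y] have "cM (y + y) = cM y" using y by (auto simp: U)
    then have "y \<in> points M" unfolding cMi by simp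
    then have "cM y = cM 0" unfolding cMi by simp
    then show ?thesis using y additive_subgroupD(1)[OF dM] by (simp add: U)
  qed
  have piff: "x \<in> points L \<longleftrightarrow> y \<in> points M" if xy: "(x, y) \<in> U" for x y
  proof -
    have "x \<in> points L \<longleftrightarrow> cL x = cL 0" unfolding cLi by simp
    also have "\<dots> \<longleftrightarrow> \<gamma> (cL x) = \<gamma> (cL 0)"
      using bij xy additive_subgroupD(1)[OF dL] inj_on_eq_iff[of \<gamma> "cL ` dual L" "cL x" "cL 0"] by (simp add: bij_betw_def U)
    also have "\<dots> \<longleftrightarrow> cM y = cM 0" using xy z by (simp add: U)
    also have "\<dots> \<longleftrightarrow> y \<in> points M" unfolding cMi by simp
    finally show ?thesis .
  qed
  have psub: "(x, y) \<in> U" if "x \<in> points L" "y \<in> points M" for x y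
  proof -
    have "cL x = cL 0" "cM y = cM 0" unfolding cLi cMi using that by simp_all
    then show ?thesis using z that L.points_dual M.points_dual by (simp add: U)
  qed
  have neg: "(- x, - y) \<in> U" if xy: "(x, y) \<in> U" for x y
  proof -
    have "- x \<in> dual L" using xy additive_subgroupD(3)[OF dL] by (simp add: U)
    then obtain y' where y': "(- x, y') \<in> U" using s1 by blast
    from piff[OF add[OF xy y']] have "y + y' \<in> points M" using additive_subgroupD(1)[OF pL] by simp
    then have "- (y + y') \<in> points M" by (rule additive_subgroupD(3)[OF pM])
    then have "cM (- y) = cM y'" unfolding cMi by simp
    then show ?thesis using y' xy additive_subgroupD(3)[OF dM] by (simp add: U)
  qed
  have "glued_lattices L M U"
  proof unfold_locales
    show "additive_subgroup U"
      unfolding additive_subgroup_def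
    proof (intro conjI ballI)
      show "0 \<in> U" using z by (simp add: zero_prod_def)
      fix u v assume "u \<in> U" "v \<in> U"
      then show "u - v \<in> U" using add[of "fst u" "snd u" "- fst v" "- snd v"] neg[of "fst v" "snd v"]
        by (simp add: minus_prod_def)
    qed
    show "(x, y) \<in> U \<Longrightarrow> x \<in> dual L" "(x, y) \<in> U \<Longrightarrow> y \<in> dual M" for x y by (auto simp: U)
    show "bil L x x' - bil M y y' \<in> \<int>" if xy: "(x, y) \<in> U" "(x', y') \<in> U" for x y x' y'
    proof -
      have x: "x \<in> dual L" "x' \<in> dual L" and y: "y \<in> dual M" "y' \<in> dual M" using xy by (auto simp: U)
      have "0 + x \<in> cL x" "0 + x' \<in> cL x'"
        unfolding cL_def L.coset_eq using additive_subgroupD(1)[OF pL] by blast+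
      then have "bil L x x' \<in> disc_form L (cL x) (cL x')" unfolding disc_form_def
        by (intro CollectI bexI[of _ x] bexI[of _ x' "cL x'"]) auto
      then have "bil L x x' \<in> disc_form M (cM y) (cM y')" using form[OF x] xy by (simp add: U)
      then obtain l l' where l: "l \<in> points M" "l' \<in> points M" "bil L x x' - bil M (l + y) (l' + y') \<in> \<int>"
        unfolding disc_form_def cM_def M.coset_eq by auto
      have "bil L x x' - bil M y y' = (bil L x x' - bil M (l + y) (l' + y')) + (bil M l l' + bil M y' l + bil M y l')"
        by (simp add: bil_add_left bil_add_right M.bil_sym[of y' l])
      also have "\<dots> \<in> \<int>"
        by (intro Ints_add l(3) M.bil_points[OF l(1,2)] M.dualD[OF y(2) l(1)] M.dualD[OF y(1) l(2)])
      finally show ?thesis .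
    qed
  qed (use s1 s2 piff psub in auto)
  then show ?thesis by (simp add: U_def)
qed

section \<open>The theta decomposition of a Jacobi form\<close>

text \<open>
  With \<open>\<tau> = \<i> + u\<close> for real \<open>u\<close> the series becomes a Fourier
  series with the integral frequencies \<open>D - \<alpha>\<close>.
\<close>
lemma rat_exponents_unique:
  fixes a :: "rat \<Rightarrow> complex"
  assumes supp: "\<And>D. a D \<noteq> 0 \<Longrightarrow> D - \<alpha> \<in> \<int>"
    and summ: "(\<lambda>D. norm (a D) * exp (- 2 * pi * of_rat D)) summable_on UNIV"
    and zero: "\<And>\<tau>. Im \<tau> > 0 \<Longrightarrow> (\<Sum>\<^sub>\<infinity>D. a D * ee (of_rat D * \<tau>)) = 0"
  shows "a D = 0"
proof (rule ccontr)
  assume nz: "a D \<noteq> 0"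
  define S where "S = {D. a D \<noteq> 0}"
  define l where "l = (\<lambda>D. \<lfloor>D - \<alpha>\<rfloor>)"
  have l: "of_rat D = (of_int (l D) + of_rat \<alpha> :: complex)" if "D \<in> S" for D
  proof -
    have "of_int (l D) = D - \<alpha>" using supp[of D] that by (auto simp: l_def S_def elim: Ints_cases)
    then have "of_rat (of_int (l D)) = (of_rat (D - \<alpha>) :: complex)" by simp
    then show ?thesis by (simp add: of_rat_diff)
  qed
  have nee: "norm (ee (of_rat D * \<i>)) = exp (- 2 * pi * of_rat D)" for D
    by (simp add: norm_ee flip: of_real_of_rat)
  have "(\<lambda>D. a D * ee (of_rat D * \<i>)) summable_on UNIV"
    by (rule summable_on_norm_bound[OF summ]) (simp add: norm_mult nee)
  then have s: "(\<lambda>D. a D * ee (of_rat D * \<i>)) summable_on S"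
    by (rule summable_on_subset_banach) simp
  have z: "(\<Sum>\<^sub>\<infinity>D\<in>S. a D * ee (of_rat D * \<i>) * ee (of_real u * of_int (l D))) = 0" for u :: real
  proof -
    have "0 = (\<Sum>\<^sub>\<infinity>D. a D * ee (of_rat D * (\<i> + of_real u)))" by (rule zero[symmetric]) simp
    also have "\<dots> = (\<Sum>\<^sub>\<infinity>D\<in>S. a D * ee (of_rat D * (\<i> + of_real u)))"
      by (rule infsum_cong_neutral) (auto simp: S_def)
    also have "\<dots> = (\<Sum>\<^sub>\<infinity>D\<in>S. ee (of_real u * of_rat \<alpha>) * (a D * ee (of_rat D * \<i>) * ee (of_real u * of_int (l D))))"
    proof (rule infsum_cong)
      fix D assume D: "D \<in> S"
      have "of_rat D * (\<i> + of_real u) = of_real u * of_rat \<alpha> + (of_rat D * \<i> + of_real u * of_int (l D))"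
        using l[OF D] by (simp add: algebra_simps)
      then show "a D * ee (of_rat D * (\<i> + of_real u)) = ee (of_real u * of_rat \<alpha>) * (a D * ee (of_rat D * \<i>) * ee (of_real u * of_int (l D)))"
        by (simp only: ee_add) (simp add: mult_ac)
    qed
    also have "\<dots> = ee (of_real u * of_rat \<alpha>) * (\<Sum>\<^sub>\<infinity>D\<in>S. a D * ee (of_rat D * \<i>) * ee (of_real u * of_int (l D)))"
      by (rule infsum_cmult_right')
    finally show ?thesis by simp
  qed
  have "(\<Sum>\<^sub>\<infinity>D'\<in>{D'\<in>S. l D' = l D}. a D' * ee (of_rat D' * \<i>)) = 0"
    by (rule fourier_coefficient_sum_eq_0[OF s z])
  moreover have "{D'\<in>S. l D' = l D} = {D}"
    using l nz by (auto simp: S_def) (metis of_rat_eq_iff)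
  ultimately show False using nz by simp
qed

context definite_lattice
begin

lemma qf_nonneg: "qf L r \<ge> (0 :: rat)"
  unfolding qf_diag using dA_pos by (intro sum_nonneg mult_nonneg_nonneg) (auto simp: less_imp_le)

text \<open>
  The component \<open>h\<^sub>r(\<tau>)\<close> of the theta decomposition.
\<close>
definition h_fun :: "(rat \<Rightarrow> rat ^ 'n \<Rightarrow> complex) \<Rightarrow> rat ^ 'n \<Rightarrow> complex \<Rightarrow> complex" where
  "h_fun C r \<tau> = (\<Sum>\<^sub>\<infinity>D. C D r * ee (of_rat D * \<tau>))"

text \<open>
  The number \<open>C D r\<close> stands for the Fourier coefficient \<open>c(D + \<beta>(r),
  r)\<close>. Unlike the exponent \<open>m = D + \<beta>(r)\<close> of \<open>q\<close>, the
  difference \<open>D = m - \<beta>(r)\<close> is not affected by translations, so that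
  periodicity in \<open>r\<close> can be stated for fixed \<open>D\<close>. The coefficients
  vanish off the support allowed by the Fourier expansion; this normalisation makes them unique.
\<close>
definition theta_coeffs :: "int \<Rightarrow> (rat \<Rightarrow> rat ^ 'n \<Rightarrow> complex) \<Rightarrow> bool" where
  "theta_coeffs h C \<longleftrightarrow>
     (\<forall>D r. C D r \<noteq> 0 \<longrightarrow> r \<in> shadow L \<and> D \<ge> 0 \<and> D + qf L r - of_int h / 24 \<in> \<int>) \<and>
     (\<forall>r\<in>shadow L. \<forall>y>0. (\<lambda>D. norm (C D r) * exp (- 2 * pi * y * of_rat D)) summable_on UNIV) \<and>
     (\<forall>D. shadow_periodic (C D))"

lemma theta_coeffsD:
  assumes "theta_coeffs h C"
  shows "C D r \<noteq> 0 \<Longrightarrow> r \<in> shadow L" "C D r \<noteq> 0 \<Longrightarrow> D \<ge> 0" "C D r \<noteq> 0 \<Longrightarrow> D + qf L r - of_int h / 24 \<in> \<int>"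
    "r \<in> shadow L \<Longrightarrow> y > 0 \<Longrightarrow> (\<lambda>D. norm (C D r) * exp (- 2 * pi * y * of_rat D)) summable_on UNIV"
    "shadow_periodic (C D)"
  using assms unfolding theta_coeffs_def by blast+

lemma norm_q_power: "norm (ee (of_rat D * \<tau>)) = exp (- 2 * pi * Im \<tau> * of_rat D)"
  by (simp add: norm_ee flip: of_real_of_rat)

lemma h_fun_has_sum:
  assumes C: "theta_coeffs h C" and r: "r \<in> shadow L" and \<tau>: "Im \<tau> > 0"
  shows "((\<lambda>D. C D r * ee (of_rat D * \<tau>)) has_sum h_fun C r \<tau>) UNIV"
  unfolding h_fun_def
  by (intro has_sum_infsum summable_on_norm_bound[OF theta_coeffsD(4)[OF C r \<tau>]]) (simp add: norm_mult norm_q_power)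

lemma h_fun_periodic:
  assumes C: "theta_coeffs h C"
  shows "shadow_periodic (\<lambda>r. h_fun C r \<tau>)"
  unfolding shadow_periodic_def h_fun_def
proof (intro ballI)
  fix r x assume "r \<in> shadow L" "x \<in> points L"
  then have "C D (r + x) = er (qf L x) * C D r" for D using shadow_periodicD[OF theta_coeffsD(5)[OF C]] by blast
  then show "(\<Sum>\<^sub>\<infinity>D. C D (r + x) * ee (of_rat D * \<tau>)) = er (qf L x) * (\<Sum>\<^sub>\<infinity>D. C D r * ee (of_rat D * \<tau>))"
    by (subst infsum_cmult_right'[symmetric]) (simp add: mult.assoc)
qed

definition jacobi_series :: "(rat \<Rightarrow> rat ^ 'n \<Rightarrow> complex) \<Rightarrow> complex \<times> (complex ^ 'n) \<Rightarrow> complex" where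
  "jacobi_series C p = (if p \<in> jacobi_domain L then Theta (\<lambda>r. h_fun C r (fst p)) (fst p) (snd p) else 0)"

lemma jacobi_series_eq: "Im \<tau> > 0 \<Longrightarrow> z \<in> scalars L \<Longrightarrow> jacobi_series C (\<tau>, z) = Theta (\<lambda>r. h_fun C r \<tau>) \<tau> z"
  by (simp add: jacobi_series_def jacobi_domain_def upper_half_plane_def)

lemma jacobi_domain_iff: "(\<tau>, z) \<in> jacobi_domain L \<longleftrightarrow> Im \<tau> > 0 \<and> z \<in> scalars L"
  by (simp add: jacobi_domain_def upper_half_plane_def)

text \<open>
  By periodicity the inner sums over \<open>D\<close> take finitely many absolute values, which
  leaves a Gaussian sum over the shadow.
\<close>
lemma double_series_summable:
  assumes C: "theta_coeffs h C" and y: "y > 0" and t: "t > 0"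
  shows "(\<lambda>(r, D). norm (C D r) * exp (- 2 * pi * y * of_rat D) * exp (- t * of_rat (qf L r) + b * csize r)) summable_on (shadow L \<times> UNIV)"
proof -
  define A where "A = (\<lambda>r. \<Sum>\<^sub>\<infinity>D. norm (C D r) * exp (- 2 * pi * y * of_rat D))"
  define B where "B = (\<Sum>r\<in>reps. A r)"
  have A: "((\<lambda>D. norm (C D r) * exp (- 2 * pi * y * of_rat D)) has_sum A r) UNIV" if "r \<in> shadow L" for r
    unfolding A_def by (intro has_sum_infsum theta_coeffsD(4)[OF C that y])
  have A0: "A r \<ge> 0" for r unfolding A_def by (intro infsum_nonneg) auto
  have AB: "A r \<le> B" if r: "r \<in> shadow L" for r
  proof -
    obtain t where t: "t \<in> reps" "r - t \<in> points L" using reps_ex1[OF r] by blast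
    have "norm (C D r) = norm (C D t)" for D
      using shadow_periodicD[OF theta_coeffsD(5)[OF C] reps_shadow[OF t(1)] t(2), of D] by (simp add: norm_mult)
    then have "A r = A t" by (simp add: A_def)
    also have "\<dots> \<le> B" unfolding B_def using t A0 by (intro member_le_sum) auto
    finally show ?thesis .
  qed
  have "(\<lambda>(r, D). norm (C D r) * exp (- 2 * pi * y * of_rat D) * exp (- t * of_rat (qf L r) + b * csize r)) summable_on Sigma (shadow L) (\<lambda>_. UNIV)"
  proof (rule summable_on_SigmaI)
    show "((\<lambda>D. case (r, D) of (r, D) \<Rightarrow> norm (C D r) * exp (- 2 * pi * y * of_rat D) * exp (- t * of_rat (qf L r) + b * csize r)) has_sum (A r * exp (- t * of_rat (qf L r) + b * csize r))) UNIV"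
      if "r \<in> shadow L" for r
      unfolding prod.case by (intro has_sum_cmult_left A that)
    show "(\<lambda>r. A r * exp (- t * of_rat (qf L r) + b * csize r)) summable_on shadow L"
    proof (rule summable_on_comparison_test)
      show "(\<lambda>r. B * exp (- t * of_rat (qf L r) + b * csize r)) summable_on shadow L"
        by (intro summable_on_cmult_right gauss_summable_on_shadow t)
    qed (use AB A0 in \<open>auto intro!: mult_right_mono\<close>)
  qed auto
  then show ?thesis .
qed

lemma jacobi_series_has_sum:
  assumes C: "theta_coeffs h C" and \<tau>: "Im \<tau> > 0" and z: "z \<in> scalars L"
  shows "((\<lambda>(r, D). C D r * ee (of_rat D * \<tau>) * theta_term \<tau> z r) has_sum jacobi_series C (\<tau>, z)) (shadow L \<times> UNIV)"
proof (rule has_sum_SigmaI)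
  show "((\<lambda>D. case (r, D) of (r, D) \<Rightarrow> C D r * ee (of_rat D * \<tau>) * theta_term \<tau> z r) has_sum (h_fun C r \<tau> * theta_term \<tau> z r)) UNIV"
    if "r \<in> shadow L" for r
    unfolding prod.case by (intro has_sum_cmult_left h_fun_has_sum[OF C that \<tau>])
  show "((\<lambda>r. h_fun C r \<tau> * theta_term \<tau> z r) has_sum jacobi_series C (\<tau>, z)) (shadow L)"
    unfolding jacobi_series_eq[OF \<tau> z] by (rule Theta_has_sum[OF h_fun_periodic[OF C] \<tau>])
  show "(\<lambda>(r, D). C D r * ee (of_rat D * \<tau>) * theta_term \<tau> z r) summable_on (shadow L \<times> UNIV)"
  proof (rule summable_on_norm_bound)
    show "(\<lambda>(r, D). norm (C D r) * exp (- 2 * pi * Im \<tau> * of_rat D) * exp (- (2 * pi * Im \<tau>) * of_rat (qf L r) + 2 * pi * (\<Sum>k\<in>I. of_rat (dA k) * norm (dcoord k z)) * csize r)) summable_on (shadow L \<times> UNIV)"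
      using \<tau> by (intro double_series_summable[OF C]) auto
    fix i :: "(rat ^ 'n) \<times> rat" assume "i \<in> shadow L \<times> UNIV"
    obtain r D where i: "i = (r, D)" by force
    show "norm (case i of (r, D) \<Rightarrow> C D r * ee (of_rat D * \<tau>) * theta_term \<tau> z r) \<le>
      (case i of (r, D) \<Rightarrow> norm (C D r) * exp (- 2 * pi * Im \<tau> * of_rat D) * exp (- (2 * pi * Im \<tau>) * of_rat (qf L r) + 2 * pi * (\<Sum>k\<in>I. of_rat (dA k) * norm (dcoord k z)) * csize r))"
      unfolding i prod.case norm_mult norm_q_power by (rule mult_left_mono[OF norm_theta_term_le]) simp
  qed
qed

lemma bij_fourier_index:
  "bij_betw (\<lambda>(r, D). (D + qf L r, r)) {(r, D). (D + qf L r, r) \<in> fourier_index L h} (fourier_index L h)"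
  by (rule bij_betwI[of _ _ _ "\<lambda>(m, r). (r, m - qf L r)"]) auto

lemma fourier_term: "ee (of_rat (D + qf L r) * \<tau>) * ee (bil L z (complexify r)) = ee (of_rat D * \<tau>) * theta_term \<tau> z r"
  unfolding theta_term_def of_rat_add distrib_right ee_add by (simp add: mult_ac)

lemma fourier_index_iff: "(D + qf L r, r) \<in> fourier_index L h \<longleftrightarrow> r \<in> shadow L \<and> D \<ge> 0 \<and> D + qf L r - of_int h / 24 \<in> \<int>"
  by (auto simp: fourier_index_def)

lemma fourier_expansion_jacobi_series:
  assumes C: "theta_coeffs h C"
  shows "fourier_expansion L h (jacobi_series C) (\<lambda>m r. C (m - qf L r) r)"
  unfolding fourier_expansion_def
proof (clarify)
  fix \<tau> z assume "(\<tau>, z) \<in> jacobi_domain L"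
  then have \<tau>: "Im \<tau> > 0" and z: "z \<in> scalars L" by (auto simp: jacobi_domain_iff)
  have "((\<lambda>(r, D). C D r * ee (of_rat D * \<tau>) * theta_term \<tau> z r) has_sum jacobi_series C (\<tau>, z)) {(r, D). (D + qf L r, r) \<in> fourier_index L h}"
    by (rule has_sum_cong_neutral[THEN iffD1, OF _ _ _ jacobi_series_has_sum[OF C \<tau> z]])
       (use theta_coeffsD(1,2,3)[OF C] in \<open>auto simp: fourier_index_iff\<close>)
  then have "((\<lambda>x. (\<lambda>(m, r). C (m - qf L r) r * ee (of_rat m * \<tau>) * ee (bil L z (complexify r))) ((\<lambda>(r, D). (D + qf L r, r)) x)) has_sum jacobi_series C (\<tau>, z)) {(r, D). (D + qf L r, r) \<in> fourier_index L h}"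
    by (rule has_sum_cong[THEN iffD1, rotated]) (auto simp: mult.assoc fourier_term)
  then show "((\<lambda>(m, r). C (m - qf L r) r * ee (of_rat m * \<tau>) * ee (bil L z (complexify r))) has_sum jacobi_series C (\<tau>, z)) (fourier_index L h)"
    by (subst (asm) has_sum_reindex_bij_betw[OF bij_fourier_index])
qed

text \<open>
  An expansion leaves its coefficients undetermined outside the index set; here they are
  replaced by zero and indexed by \<open>D\<close>.
\<close>
definition coeffs_of :: "int \<Rightarrow> (rat \<Rightarrow> rat ^ 'n \<Rightarrow> complex) \<Rightarrow> rat \<Rightarrow> rat ^ 'n \<Rightarrow> complex" where
  "coeffs_of h c D r = (if (D + qf L r, r) \<in> fourier_index L h then c (D + qf L r) r else 0)"

lemma coeffs_of_has_sum:
  assumes c: "fourier_expansion L h \<phi> c" and \<tau>: "Im \<tau> > 0" and z: "z \<in> scalars L"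
  shows "((\<lambda>(r, D). coeffs_of h c D r * ee (of_rat D * \<tau>) * theta_term \<tau> z r) has_sum \<phi> (\<tau>, z)) (shadow L \<times> UNIV)"
proof -
  have "((\<lambda>(m, r). c m r * ee (of_rat m * \<tau>) * ee (bil L z (complexify r))) has_sum \<phi> (\<tau>, z)) (fourier_index L h)"
    using c \<tau> z unfolding fourier_expansion_def jacobi_domain_iff by (auto simp: jacobi_domain_iff)
  then have "((\<lambda>x. (\<lambda>(m, r). c m r * ee (of_rat m * \<tau>) * ee (bil L z (complexify r))) ((\<lambda>(r, D). (D + qf L r, r)) x)) has_sum \<phi> (\<tau>, z)) {(r, D). (D + qf L r, r) \<in> fourier_index L h}"
    by (subst has_sum_reindex_bij_betw[OF bij_fourier_index])
  then have "((\<lambda>(r, D). coeffs_of h c D r * ee (of_rat D * \<tau>) * theta_term \<tau> z r) has_sum \<phi> (\<tau>, z)) {(r, D). (D + qf L r, r) \<in> fourier_index L h}"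
    by (rule has_sum_cong[THEN iffD1, rotated]) (auto simp: mult.assoc fourier_term coeffs_of_def)
  then show ?thesis
    by (rule has_sum_cong_neutral[THEN iffD1, rotated -1]) (auto simp: fourier_index_iff coeffs_of_def split: if_splits)
qed

lemma coeffs_of_summable:
  assumes c: "fourier_expansion L h \<phi> c" and r: "r \<in> shadow L" and y: "y > 0"
  shows "(\<lambda>D. norm (coeffs_of h c D r) * exp (- 2 * pi * y * of_rat D)) summable_on UNIV"
proof -
  define \<tau> where "\<tau> = \<i> * of_real y"
  have \<tau>: "Im \<tau> > 0" using y by (simp add: \<tau>_def)
  have z: "0 \<in> scalars L" by (simp add: scalars_def)
  have "(\<lambda>(r, D). coeffs_of h c D r * ee (of_rat D * \<tau>) * theta_term \<tau> 0 r) summable_on (shadow L \<times> UNIV)"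
    using coeffs_of_has_sum[OF c \<tau> z] by (auto simp: summable_on_def)
  from summable_on_SigmaD1[OF this r]
  have "(\<lambda>D. coeffs_of h c D r * ee (of_rat D * \<tau>) * theta_term \<tau> 0 r) summable_on UNIV" .
  then have "(\<lambda>D. coeffs_of h c D r * ee (of_rat D * \<tau>)) summable_on UNIV"
    by (subst (asm) summable_on_cmult_left') (auto simp: theta_term_def)
  then have "(\<lambda>D. norm (coeffs_of h c D r * ee (of_rat D * \<tau>))) summable_on UNIV"
    by (simp only: summable_on_iff_abs_summable_on_complex)
  then show ?thesis by (simp add: norm_mult norm_q_power \<tau>_def)
qed

lemma coeffs_of_theta_decomposition:
  assumes c: "fourier_expansion L h \<phi> c" and \<tau>: "Im \<tau> > 0" and z: "z \<in> scalars L"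
  shows "((\<lambda>r. h_fun (coeffs_of h c) r \<tau> * theta_term \<tau> z r) has_sum \<phi> (\<tau>, z)) (shadow L)"
proof (rule has_sum_SigmaD[OF coeffs_of_has_sum[OF c \<tau> z]])
  fix r assume r: "r \<in> shadow L"
  have "((\<lambda>D. coeffs_of h c D r * ee (of_rat D * \<tau>)) has_sum h_fun (coeffs_of h c) r \<tau>) UNIV"
    unfolding h_fun_def
    by (intro has_sum_infsum summable_on_norm_bound[OF coeffs_of_summable[OF c r \<tau>]]) (simp add: norm_mult norm_q_power)
  from has_sum_cmult_left[OF this]
  show "((\<lambda>D. case (r, D) of (r, D) \<Rightarrow> coeffs_of h c D r * ee (of_rat D * \<tau>) * theta_term \<tau> z r) has_sum h_fun (coeffs_of h c) r \<tau> * theta_term \<tau> z r) UNIV"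
    by simp
qed

lemma theta_decomposition_unique:
  assumes f: "\<And>z. z \<in> scalars L \<Longrightarrow> ((\<lambda>r. f r * theta_term \<tau> z r) has_sum F z) (shadow L)"
    and g: "\<And>z. z \<in> scalars L \<Longrightarrow> ((\<lambda>r. g r * theta_term \<tau> z r) has_sum F z) (shadow L)"
    and r: "r \<in> shadow L"
  shows "f r = g r"
proof -
  have "(f r - g r) * ee (\<tau> * of_rat (qf L r)) = 0"
  proof (rule shadow_series_unique[OF _ _ r, of "\<lambda>r. (f r - g r) * ee (\<tau> * of_rat (qf L r))"])
    have hs: "((\<lambda>r. (f r - g r) * ee (\<tau> * of_rat (qf L r)) * ee (bil L z (complexify r))) has_sum 0) (shadow L)" if "z \<in> scalars L" for z
      using has_sum_minus[OF f[OF that] g[OF that]] by (simp add: theta_term_def algebra_simps)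
    have "0 \<in> scalars L" by (simp add: scalars_def)
    from hs[OF this] show "(\<lambda>r. (f r - g r) * ee (\<tau> * of_rat (qf L r))) summable_on shadow L"
      by (auto simp: summable_on_def)
    show "(\<Sum>\<^sub>\<infinity>r\<in>shadow L. (f r - g r) * ee (\<tau> * of_rat (qf L r)) * ee (bil L z (complexify r))) = 0" if "z \<in> scalars L" for z
      using infsumI[OF hs[OF that]] .
  qed
  then show ?thesis by simp
qed

lemma h_fun_eq_imp_coeff_eq:
  assumes eq: "\<And>\<tau>. Im \<tau> > 0 \<Longrightarrow> (\<Sum>\<^sub>\<infinity>D. a D * ee (of_rat D * \<tau>)) = (\<Sum>\<^sub>\<infinity>D. b D * ee (of_rat D * \<tau>))"
    and a: "\<And>y. y > 0 \<Longrightarrow> (\<lambda>D. norm (a D) * exp (- 2 * pi * y * of_rat D)) summable_on UNIV" "\<And>D. a D \<noteq> 0 \<Longrightarrow> D - \<alpha> \<in> \<int>"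
    and b: "\<And>y. y > 0 \<Longrightarrow> (\<lambda>D. norm (b D) * exp (- 2 * pi * y * of_rat D)) summable_on UNIV" "\<And>D. b D \<noteq> 0 \<Longrightarrow> D - \<alpha> \<in> \<int>"
  shows "a D = b D"
proof -
  have "a D - b D = 0"
  proof (rule rat_exponents_unique[where a = "\<lambda>D. a D - b D" and \<alpha> = \<alpha>])
    show "a D - b D \<noteq> 0 \<Longrightarrow> D - \<alpha> \<in> \<int>" for D using a(2)[of D] b(2)[of D] by (cases "a D = 0") auto
    have "(\<lambda>D. norm (a D) * exp (- 2 * pi * 1 * of_rat D) + norm (b D) * exp (- 2 * pi * 1 * of_rat D)) summable_on UNIV"
      by (intro summable_on_add a b) auto
    then show "(\<lambda>D. norm (a D - b D) * exp (- 2 * pi * of_rat D)) summable_on UNIV"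
    proof (rule summable_on_comparison_test)
      show "norm (a D - b D) * exp (- 2 * pi * of_rat D) \<le> norm (a D) * exp (- 2 * pi * 1 * of_rat D) + norm (b D) * exp (- 2 * pi * 1 * of_rat D)" for D
        using mult_right_mono[OF norm_triangle_ineq4[of "a D" "b D"], of "exp (- 2 * pi * of_rat D)"] by (simp add: distrib_right)
    qed auto
    fix \<tau> assume \<tau>: "Im \<tau> > 0"
    have hs: "((\<lambda>D. f D * ee (of_rat D * \<tau>)) has_sum (\<Sum>\<^sub>\<infinity>D. f D * ee (of_rat D * \<tau>))) UNIV"
      if "(\<lambda>D. norm (f D) * exp (- 2 * pi * Im \<tau> * of_rat D)) summable_on UNIV" for f
      by (intro has_sum_infsum summable_on_norm_bound[OF that]) (simp add: norm_mult norm_q_power)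
    have "((\<lambda>D. a D * ee (of_rat D * \<tau>) - b D * ee (of_rat D * \<tau>)) has_sum 0) UNIV"
      using has_sum_minus[OF hs[OF a(1)[OF \<tau>]] hs[OF b(1)[OF \<tau>]]] eq[OF \<tau>] by simp
    then show "(\<Sum>\<^sub>\<infinity>D. (a D - b D) * ee (of_rat D * \<tau>)) = 0" by (simp add: left_diff_distrib infsumI)
  qed
  then show ?thesis by simp
qed

lemma coeffs_of_support: "coeffs_of h c D r \<noteq> 0 \<Longrightarrow> r \<in> shadow L \<and> D \<ge> 0 \<and> D + qf L r - of_int h / 24 \<in> \<int>"
  by (simp add: coeffs_of_def fourier_index_iff split: if_splits)

lemma coeffs_unique:
  assumes c: "fourier_expansion L h \<phi> c" and C: "theta_coeffs h C" and eq: "\<And>p. p \<in> jacobi_domain L \<Longrightarrow> \<phi> p = jacobi_series C p"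
  shows "coeffs_of h c = C"
proof (intro ext)
  fix D r
  show "coeffs_of h c D r = C D r"
  proof (cases "r \<in> shadow L")
    case False
    then show ?thesis using theta_coeffsD(1)[OF C, of D r] by (auto simp: coeffs_of_def fourier_index_iff)
  next
    case r: True
    show ?thesis
    proof (rule h_fun_eq_imp_coeff_eq[where \<alpha> = "of_int h / 24 - qf L r"])
      show "(\<Sum>\<^sub>\<infinity>D. coeffs_of h c D r * ee (of_rat D * \<tau>)) = (\<Sum>\<^sub>\<infinity>D. C D r * ee (of_rat D * \<tau>))" if \<tau>: "Im \<tau> > 0" for \<tau>
        unfolding h_fun_def[symmetric]
      proof (rule theta_decomposition_unique[OF _ _ r])
        show "((\<lambda>r. h_fun (coeffs_of h c) r \<tau> * theta_term \<tau> z r) has_sum \<phi> (\<tau>, z)) (shadow L)" if "z \<in> scalars L" for z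
          by (rule coeffs_of_theta_decomposition[OF c \<tau> that])
        show "((\<lambda>r. h_fun C r \<tau> * theta_term \<tau> z r) has_sum \<phi> (\<tau>, z)) (shadow L)" if z: "z \<in> scalars L" for z
          using Theta_has_sum[OF h_fun_periodic[OF C] \<tau>, of \<tau> z] eq[of "(\<tau>, z)"] \<tau> z
          by (simp add: jacobi_series_eq jacobi_domain_iff)
      qed
      show "D - (of_int h / 24 - qf L r) \<in> \<int>" if "coeffs_of h c D r \<noteq> 0" for D
        using coeffs_of_support[OF that] by (simp add: algebra_simps)
      show "D - (of_int h / 24 - qf L r) \<in> \<int>" if "C D r \<noteq> 0" for D
        using theta_coeffsD(3)[OF C that] by (simp add: algebra_simps)
    qed (use coeffs_of_summable[OF c r] theta_coeffsD(4)[OF C r] in auto)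
  qed
qed

definition translation_law :: "(complex \<times> (complex ^ 'n) \<Rightarrow> complex) \<Rightarrow> bool" where
  "translation_law \<phi> \<longleftrightarrow> (\<forall>x\<in>points L. \<forall>y\<in>points L. \<forall>(\<tau>, z)\<in>jacobi_domain L.
        \<phi> (\<tau>, z + \<tau> *s complexify x + complexify y) * ee (\<tau> * of_rat (qf L x) + bil L (complexify x) z)
        = ee (of_rat (qf L (x + y))) * \<phi> (\<tau>, z))"

lemma translation_lawD:
  assumes "translation_law \<phi>" "x \<in> points L" "y \<in> points L" "Im \<tau> > 0" "z \<in> scalars L"
  shows "\<phi> (\<tau>, z + \<tau> *s complexify x + complexify y) * ee (\<tau> * of_rat (qf L x) + bil L (complexify x) z) = er (qf L (x + y)) * \<phi> (\<tau>, z)"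
proof -
  have "(\<tau>, z) \<in> jacobi_domain L" using assms by (simp add: jacobi_domain_iff)
  then show ?thesis using assms(1-3) unfolding translation_law_def by blast
qed

lemma theta_term_translate:
  "theta_term \<tau> (z + \<tau> *s complexify x + complexify y) r * ee (\<tau> * of_rat (qf L x) + bil L (complexify x) z)
    = er (bil L r y) * theta_term \<tau> z (r + x)"
  unfolding theta_term_def ee_add[symmetric]
  by (rule arg_cong[of _ _ ee])
     (simp add: bil_add_left bil_add_right bil_scale_left bil_complexify complexify_add qf_add of_rat_add
        bil_sym[of "complexify x" z] bil_sym[of y r] bil_sym[of x r] algebra_simps)

lemma bij_shadow_translate: "x \<in> points L \<Longrightarrow> bij_betw (\<lambda>r. r + x) (shadow L) (shadow L)"
  by (rule bij_betwI[of _ _ _ "\<lambda>r. r - x"]) (auto intro: shadow_add_points shadow_diff_points)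

lemma scalars_translate: "z \<in> scalars L \<Longrightarrow> x \<in> points L \<Longrightarrow> y \<in> points L \<Longrightarrow> z + \<tau> *s complexify x + complexify y \<in> scalars L"
  by (auto simp: scalars_def points_def complexify_def)

lemma translation_law_jacobi_series:
  assumes C: "theta_coeffs h C"
  shows "translation_law (jacobi_series C)"
  unfolding translation_law_def
proof (clarify)
  fix x y \<tau> z assume x: "x \<in> points L" and y: "y \<in> points L" and "(\<tau>, z) \<in> jacobi_domain L"
  then have \<tau>: "Im \<tau> > 0" and z: "z \<in> scalars L" by (auto simp: jacobi_domain_iff)
  define f where "f = (\<lambda>r. h_fun C r \<tau>)"
  have f: "shadow_periodic f" unfolding f_def by (rule h_fun_periodic[OF C])
  have "Theta f \<tau> (z + \<tau> *s complexify x + complexify y) * ee (\<tau> * of_rat (qf L x) + bil L (complexify x) z) =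
    (\<Sum>\<^sub>\<infinity>r\<in>shadow L. f r * theta_term \<tau> (z + \<tau> *s complexify x + complexify y) r * ee (\<tau> * of_rat (qf L x) + bil L (complexify x) z))"
    unfolding Theta_def by (rule infsum_cmult_left'[symmetric])
  also have "\<dots> = (\<Sum>\<^sub>\<infinity>r\<in>shadow L. er (qf L (x + y)) * (f (r + x) * theta_term \<tau> z (r + x)))"
  proof (rule infsum_cong)
    fix r assume r: "r \<in> shadow L"
    have "f (r + x) = er (qf L x) * f r" by (rule shadow_periodicD[OF f r x])
    moreover have "er (qf L x) * er (qf L x) = 1" using er_neg_points[OF x] by (metis er_minus left_inverse ee_nonzero)
    ultimately have fr: "f r = er (qf L x) * f (r + x)" by (simp add: mult.assoc[symmetric])
    have "er (qf L (x + y)) = er (qf L x) * er (qf L y)"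
      unfolding qf_add er_add using bil_points[OF x y] by (simp add: er_Ints)
    moreover have "f r * theta_term \<tau> (z + \<tau> *s complexify x + complexify y) r * ee (\<tau> * of_rat (qf L x) + bil L (complexify x) z)
      = f r * (er (qf L y) * theta_term \<tau> z (r + x))"
      unfolding mult.assoc theta_term_translate er_shadow_points[OF r y] ..
    ultimately show "f r * theta_term \<tau> (z + \<tau> *s complexify x + complexify y) r * ee (\<tau> * of_rat (qf L x) + bil L (complexify x) z)
      = er (qf L (x + y)) * (f (r + x) * theta_term \<tau> z (r + x))"
      using fr by (simp add: mult_ac)
  qed
  also have "\<dots> = er (qf L (x + y)) * (\<Sum>\<^sub>\<infinity>r\<in>shadow L. f (r + x) * theta_term \<tau> z (r + x))"
    by (rule infsum_cmult_right')
  also have "(\<Sum>\<^sub>\<infinity>r\<in>shadow L. f (r + x) * theta_term \<tau> z (r + x)) = Theta f \<tau> z"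
    unfolding Theta_def by (rule infsum_reindex_bij_betw[OF bij_shadow_translate[OF x]])
  finally show "jacobi_series C (\<tau>, z + \<tau> *s complexify x + complexify y) * ee (\<tau> * of_rat (qf L x) + bil L (complexify x) z)
        = ee (of_rat (qf L (x + y))) * jacobi_series C (\<tau>, z)"
    using \<tau> z x y by (simp add: jacobi_series_eq scalars_translate f_def)
qed

text \<open>
  Translation of \<open>z\<close> by \<open>x \<tau>\<close> permutes the theta terms by
  \<open>r \<mapsto> r + x\<close>, so uniqueness of the theta decomposition turns the
  translation law into periodicity.
\<close>
lemma theta_coeffs_coeffs_of:
  assumes c: "fourier_expansion L h \<phi> c" and tr: "translation_law \<phi>"
  shows "theta_coeffs h (coeffs_of h c)"
proof -
  have z0: "0 \<in> points L" by (rule additive_subgroupD(1)[OF additive_subgroup_points])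
  have per: "coeffs_of h c D (r + x) = er (qf L x) * coeffs_of h c D r" if r: "r \<in> shadow L" and x: "x \<in> points L" for D r x
  proof (rule h_fun_eq_imp_coeff_eq[where \<alpha> = "of_int h / 24 - qf L r" and b = "\<lambda>D. er (qf L x) * coeffs_of h c D r"])
    note rx = shadow_add_points[OF r x]
    fix \<tau> assume \<tau>: "Im \<tau> > 0"
    define f where "f = (\<lambda>r. h_fun (coeffs_of h c) r \<tau>)"
    have "f (r + x - x) = er (qf L x) * f (r + x)"
    proof (rule theta_decomposition_unique[OF _ _ rx, of "\<lambda>s. f (s - x)" \<tau> _ "\<lambda>s. er (qf L x) * f s"])
      fix z :: "complex ^ 'n" assume z: "z \<in> scalars L"
      show "((\<lambda>r. er (qf L x) * f r * theta_term \<tau> z r) has_sum er (qf L x) * \<phi> (\<tau>, z)) (shadow L)"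
        unfolding mult.assoc f_def by (intro has_sum_cmult_right coeffs_of_theta_decomposition[OF c \<tau> z])
      have "((\<lambda>r. f r * theta_term \<tau> (z + \<tau> *s complexify x + complexify 0) r) has_sum \<phi> (\<tau>, z + \<tau> *s complexify x + complexify 0)) (shadow L)"
        unfolding f_def by (rule coeffs_of_theta_decomposition[OF c \<tau> scalars_translate[OF z x z0]])
      from has_sum_cmult_left[OF this, of "ee (\<tau> * of_rat (qf L x) + bil L (complexify x) z)"]
      have "((\<lambda>r. f r * theta_term \<tau> z (r + x)) has_sum er (qf L x) * \<phi> (\<tau>, z)) (shadow L)"
        unfolding translation_lawD[OF tr x z0 \<tau> z] mult.assoc theta_term_translate by simp
      then have "((\<lambda>r. (\<lambda>s. f (s - x) * theta_term \<tau> z s) (r + x)) has_sum er (qf L x) * \<phi> (\<tau>, z)) (shadow L)" by simp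
      then show "((\<lambda>s. f (s - x) * theta_term \<tau> z s) has_sum er (qf L x) * \<phi> (\<tau>, z)) (shadow L)"
        by (subst (asm) has_sum_reindex_bij_betw[OF bij_shadow_translate[OF x]])
    qed
    then have "f r = er (qf L x) * f (r + x)" by simp
    moreover have "er (qf L x) * er (qf L x) = 1" using er_neg_points[OF x] by (metis er_minus left_inverse ee_nonzero)
    ultimately have "f (r + x) = er (qf L x) * f r" by (simp add: mult.assoc[symmetric])
    then show "(\<Sum>\<^sub>\<infinity>D. coeffs_of h c D (r + x) * ee (of_rat D * \<tau>)) = (\<Sum>\<^sub>\<infinity>D. er (qf L x) * coeffs_of h c D r * ee (of_rat D * \<tau>))"
      unfolding mult.assoc infsum_cmult_right' by (simp add: f_def h_fun_def)
  next
    fix D assume "coeffs_of h c D (r + x) \<noteq> 0"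
    then have "(D + qf L (r + x) - of_int h / 24) - (qf L (r + x) - qf L r) \<in> \<int>"
      by (intro Ints_diff[OF _ qf_shift_Ints[OF r x]] coeffs_of_support[THEN conjunct2, THEN conjunct2])
    then show "D - (of_int h / 24 - qf L r) \<in> \<int>" by (simp add: algebra_simps)
  next
    fix D assume "er (qf L x) * coeffs_of h c D r \<noteq> 0"
    then show "D - (of_int h / 24 - qf L r) \<in> \<int>" using coeffs_of_support[of h c D r] by (simp add: algebra_simps)
  qed (use coeffs_of_summable[OF c shadow_add_points[OF r x]] coeffs_of_summable[OF c r] in \<open>auto simp: norm_mult\<close>)
  show ?thesis
    unfolding theta_coeffs_def shadow_periodic_def
    by (intro conjI allI impI ballI per coeffs_of_summable[OF c]) (auto dest: coeffs_of_support)
qed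

end

section \<open>Jacobi forms in terms of their theta coefficients\<close>

context definite_lattice
begin

lemma csize_nonneg: "csize r \<ge> 0"
  unfolding csize_def by (intro sum_nonneg) auto

text \<open>
  The Fourier series is a sum of exponentials of forms that are linear in \<open>(\<tau>,
  z)\<close> jointly. With \<open>\<delta> = Im \<tau>\<^sub>0 / 2\<close> half of the decay of
  the powers of \<open>q\<close> remains available for convergence.
\<close>
lemma holomorphic_jacobi_series:
  assumes C: "theta_coeffs h C"
  shows "holomorphic_in (jacobi_series C) (jacobi_domain L)"
  unfolding holomorphic_in_def
proof (clarify)
  fix \<tau>0 z0 assume "(\<tau>0, z0) \<in> jacobi_domain L"
  then have \<tau>0: "Im \<tau>0 > 0" and z0: "z0 \<in> scalars L" by (auto simp: jacobi_domain_iff)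
  define c where "c = (\<lambda>(r, D). C D r)"
  define l :: "(rat ^ 'n) \<times> rat \<Rightarrow> complex \<times> (complex ^ 'n) \<Rightarrow> complex" where
    "l = (\<lambda>(r, D) (\<tau>, z). 2 * of_real pi * \<i> * (of_rat (D + qf L r) * \<tau> + bil L z (complexify r)))"
  define S where "S = shadow L \<times> {D::rat. D \<ge> 0}"
  define N where "N = (\<Sum>k\<in>I. \<Sum>i\<in>I. of_rat (dA k) * \<bar>of_rat (dP k i)\<bar> :: real)"
  have N0: "N \<ge> 0" unfolding N_def using dA_pos by (intro sum_nonneg mult_nonneg_nonneg) (auto simp: less_imp_le)
  have bilN: "norm (bil L z (complexify r)) \<le> N * csize r * norm z" for z :: "complex ^ 'n" and r
  proof -
    have "(\<Sum>k\<in>I. of_rat (dA k) * norm (dcoord k z)) \<le> (\<Sum>k\<in>I. of_rat (dA k) * (\<Sum>i\<in>I. \<bar>of_rat (dP k i)\<bar> * norm z))"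
    proof (intro sum_mono mult_left_mono)
      fix k assume k: "k \<in> I"
      show "norm (dcoord k z) \<le> (\<Sum>i\<in>I. \<bar>of_rat (dP k i)\<bar> * norm z)"
        unfolding dcoord_def
      proof (rule sum_norm_le)
        fix i
        have "norm (complex_of_rat (dP k i)) = \<bar>of_rat (dP k i)\<bar>" by (simp flip: of_real_of_rat)
        then show "norm (of_rat (dP k i) * z $ i) \<le> \<bar>of_rat (dP k i)\<bar> * norm z"
          by (simp only: norm_mult) (intro mult_left_mono Finite_Cartesian_Product.norm_nth_le, simp)
      qed
      show "0 \<le> real_of_rat (dA k)" using dA_pos[OF k] by simp
    qed
    also have "\<dots> = N * norm z" by (simp add: N_def sum_distrib_left sum_distrib_right mult_ac)
    finally have "(\<Sum>k\<in>I. of_rat (dA k) * norm (dcoord k z)) * csize r \<le> N * norm z * csize r"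
      by (rule mult_right_mono[OF _ csize_nonneg])
    then show ?thesis using norm_bil_le[of z r] by (simp add: mult_ac)
  qed
  define B where "B = (\<lambda>(r, D). 2 * pi * (of_rat (D + qf L r) + N * csize r))"
  define \<delta> where "\<delta> = Im \<tau>0 / 2"
  have \<delta>: "\<delta> > 0" using \<tau>0 by (simp add: \<delta>_def)
  have ser: "(\<Sum>\<^sub>\<infinity>i\<in>S. c i * exp (l i p)) = jacobi_series C p" if "p \<in> jacobi_domain L" for p
  proof -
    obtain \<tau> z where p: "p = (\<tau>, z)" by force
    have \<tau>: "Im \<tau> > 0" and z: "z \<in> scalars L" using that by (auto simp: p jacobi_domain_iff)
    have "((\<lambda>(r, D). C D r * ee (of_rat D * \<tau>) * theta_term \<tau> z r) has_sum jacobi_series C (\<tau>, z)) S"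
      by (rule has_sum_cong_neutral[THEN iffD1, OF _ _ _ jacobi_series_has_sum[OF C \<tau> z]])
         (use theta_coeffsD(2)[OF C] in \<open>auto simp: S_def\<close>)
    moreover have "(\<lambda>(r, D). C D r * ee (of_rat D * \<tau>) * theta_term \<tau> z r) = (\<lambda>i. c i * exp (l i p))"
      unfolding mult.assoc fourier_term[symmetric] ee_add[symmetric]
      by (auto simp: c_def l_def p ee_def fun_eq_iff)
    ultimately show ?thesis by (simp add: p infsumI)
  qed
  define D where "D = (\<lambda>v. \<Sum>\<^sub>\<infinity>i\<in>S. c i * exp (l i (\<tau>0, z0)) * l i v)"
  have "((\<lambda>q. \<Sum>\<^sub>\<infinity>i\<in>S. c i * exp (l i q)) has_derivative D) (at (\<tau>0, z0))"
    unfolding D_def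
  proof (rule exp_sum_has_derivative[where B = B and \<delta> = \<delta>])
    fix i assume i: "i \<in> S"
    obtain r D where rD: "i = (r, D)" by force
    show "linear (l i)"
    proof -
      have sc: "a *\<^sub>R z = of_real a *s z" for a and z :: "complex ^ 'n"
        by (simp add: vec_eq_iff scaleR_conv_of_real[where 'a = complex])
      show ?thesis
        unfolding rD l_def
        by (auto simp: linear_iff bil_add_left sc bil_scale_left algebra_simps scaleR_conv_of_real[where 'a = complex])
    qed
    show "B i \<ge> 0" using i N0 csize_nonneg[of r] qf_nonneg[of r] by (auto simp: B_def rD S_def)
    show "norm (l i v) \<le> B i * norm v" for v
    proof -
      obtain \<tau> z where v: "v = (\<tau>, z)" by force
      have q: "norm (of_rat (D + qf L r) :: complex) = of_rat (D + qf L r)"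
        using i qf_nonneg[of r] by (simp add: rD S_def flip: of_real_of_rat)
      have "norm (of_rat (D + qf L r) * \<tau> + bil L z (complexify r)) \<le> of_rat (D + qf L r) * norm \<tau> + N * csize r * norm z"
        using norm_triangle_ineq[of "of_rat (D + qf L r) * \<tau>" "bil L z (complexify r)"] bilN[of z r] q by (simp add: norm_mult)
      also have "\<dots> \<le> of_rat (D + qf L r) * norm v + N * csize r * norm v"
        unfolding v using norm_fst_le[of \<tau> z] norm_snd_le[of z \<tau>] i qf_nonneg[of r] N0 csize_nonneg[of r]
        by (intro add_mono mult_left_mono) (auto simp: rD S_def)
      finally have "norm (of_rat (D + qf L r) * \<tau> + bil L z (complexify r)) \<le> (of_rat (D + qf L r) + N * csize r) * norm v"
        by (simp add: distrib_right)
      then have "2 * pi * norm (of_rat (D + qf L r) * \<tau> + bil L z (complexify r)) \<le> 2 * pi * ((of_rat (D + qf L r) + N * csize r) * norm v)"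
        by (intro mult_left_mono) auto
      then show ?thesis by (simp add: l_def B_def rD v norm_mult mult.assoc)
    qed
  next
    define Z where "Z = (\<Sum>k\<in>I. of_rat (dA k) * norm (dcoord k z0))"
    define b where "b = 2 * pi * Z + 2 * pi * \<delta> * N"
    have "(\<lambda>(r, D). norm (C D r) * exp (- 2 * pi * \<delta> * of_rat D) * exp (- (2 * pi * \<delta>) * of_rat (qf L r) + b * csize r)) summable_on (shadow L \<times> UNIV)"
      using \<delta> by (intro double_series_summable[OF C]) auto
    then have "(\<lambda>(r, D). norm (C D r) * exp (- 2 * pi * \<delta> * of_rat D) * exp (- (2 * pi * \<delta>) * of_rat (qf L r) + b * csize r)) summable_on S"
      by (rule summable_on_subset_banach) (auto simp: S_def)
    then show "(\<lambda>i. norm (c i) * exp (Re (l i (\<tau>0, z0)) + \<delta> * B i)) summable_on S"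
    proof (rule summable_on_comparison_test)
      fix i assume i: "i \<in> S"
      obtain r D where rD: "i = (r, D)" by force
      have "Re (l i (\<tau>0, z0)) = - 2 * pi * (Im \<tau>0 * of_rat (D + qf L r)) - 2 * pi * Im (bil L z0 (complexify r))"
        by (simp add: l_def rD algebra_simps flip: of_real_of_rat)
      moreover have "- (2 * pi * Im (bil L z0 (complexify r))) \<le> 2 * pi * (Z * csize r)"
      proof -
        have "- Im (bil L z0 (complexify r)) \<le> Z * csize r"
          unfolding Z_def using norm_bil_le[of z0 r] abs_Im_le_cmod[of "bil L z0 (complexify r)"] by linarith
        then have "2 * pi * (- Im (bil L z0 (complexify r))) \<le> 2 * pi * (Z * csize r)"
          by (rule mult_left_mono) simp
        then show ?thesis by (simp only: mult_minus_right)
      qed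
      moreover have "\<delta> * B i = 2 * pi * \<delta> * of_rat (D + qf L r) + 2 * pi * \<delta> * N * csize r"
        by (simp add: B_def rD algebra_simps)
      moreover have "Im \<tau>0 * of_rat (D + qf L r) = 2 * (\<delta> * of_rat (D + qf L r))" unfolding \<delta>_def by simp
      ultimately have "Re (l i (\<tau>0, z0)) + \<delta> * B i \<le> - (2 * pi * (\<delta> * of_rat (D + qf L r))) + 2 * pi * (Z * csize r) + 2 * pi * \<delta> * N * csize r"
        by (simp only: mult.assoc)
      also have "\<dots> = - 2 * pi * \<delta> * of_rat D + (- (2 * pi * \<delta>) * of_rat (qf L r) + b * csize r)"
        unfolding b_def of_rat_add by (simp only: algebra_simps) simp
      finally have "Re (l i (\<tau>0, z0)) + \<delta> * B i \<le> - 2 * pi * \<delta> * of_rat D + (- (2 * pi * \<delta>) * of_rat (qf L r) + b * csize r)" .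
      then have "norm (C D r) * exp (Re (l i (\<tau>0, z0)) + \<delta> * B i) \<le> norm (C D r) * exp (- 2 * pi * \<delta> * of_rat D + (- (2 * pi * \<delta>) * of_rat (qf L r) + b * csize r))"
        by (intro mult_left_mono) auto
      then show "norm (c i) * exp (Re (l i (\<tau>0, z0)) + \<delta> * B i) \<le>
         (case i of (r, D) \<Rightarrow> norm (C D r) * exp (- 2 * pi * \<delta> * of_rat D) * exp (- (2 * pi * \<delta>) * of_rat (qf L r) + b * csize r))"
        by (simp only: c_def rD prod.case mult.assoc exp_add[symmetric])
    qed auto
  qed (rule \<delta>)
  then have "((\<lambda>q. \<Sum>\<^sub>\<infinity>i\<in>S. c i * exp (l i q)) has_derivative D) (at (\<tau>0, z0) within jacobi_domain L)"
    by (rule has_derivative_at_withinI)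
  then have "(jacobi_series C has_derivative D) (at (\<tau>0, z0) within jacobi_domain L)"
    by (rule has_derivative_transform[rotated 2]) (use ser \<tau>0 z0 in \<open>auto simp: jacobi_domain_iff\<close>)
  moreover have "D (a * \<tau>, a *s z) = a * D (\<tau>, z)" for a \<tau> z
  proof -
    have "l i (a * \<tau>, a *s z) = a * l i (\<tau>, z)" for i
      by (auto simp: l_def bil_scale_left algebra_simps split: prod.split)
    then show ?thesis unfolding D_def by (subst infsum_cmult_right'[symmetric]) (simp add: mult_ac)
  qed
  ultimately show "\<exists>D. (jacobi_series C has_derivative D) (at (\<tau>0, z0) within jacobi_domain L) \<and>
      (\<forall>c \<tau> z. D (c * \<tau>, c *s z) = c * D (\<tau>, z))" by blast
qed

text \<open>
  The modular law of weight \<open>K/2\<close> at a single element, with a number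
  \<open>e\<close> in place of the value of the character, so that it can be proved along the
  generators together with \<open>is_eta_multiplier\<close>.
\<close>
definition modular_law :: "int \<Rightarrow> int \<Rightarrow> int^2^2 \<Rightarrow> (complex \<Rightarrow> complex) \<Rightarrow> complex \<Rightarrow> (complex \<times> (complex ^ 'n) \<Rightarrow> complex) \<Rightarrow> bool" where
  "modular_law K h A w e \<phi> \<longleftrightarrow> (\<forall>\<tau> z. Im \<tau> > 0 \<longrightarrow> z \<in> scalars L \<longrightarrow>
     \<phi> (moebius A \<tau>, (1 / cocycle A \<tau>) *s z) * ee (- of_int (A $ 2 $ 1) * qf L z / cocycle A \<tau>) * w \<tau> powi (- K)
        = e powi h * \<phi> (\<tau>, z))"

text \<open>
  The modular law at \<open>S\<close>, read off on the coefficients of the theta terms: the left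
  side is the coefficient that Poisson summation produces.
\<close>
definition inversion_law :: "int \<Rightarrow> int \<Rightarrow> (rat \<Rightarrow> rat ^ 'n \<Rightarrow> complex) \<Rightarrow> bool" where
  "inversion_law K h C \<longleftrightarrow> (\<forall>\<tau>. Im \<tau> > 0 \<longrightarrow> (\<forall>s\<in>shadow L.
     of_real theta_const * csqrt (\<tau> / \<i>) ^ card I * hat (\<lambda>r. h_fun C r (- 1 / \<tau>)) s
       = ee (- of_int h / 8) * csqrt \<tau> powi K * h_fun C s \<tau>))"

text \<open>
  The last condition is the modular law at \<open>(1, -1)\<close>, which reads
  \<open>(-1)\<^sup>K \<phi> = (-1)\<^sup>h \<phi>\<close>. The law at \<open>T\<close> is
  contained in the support condition of \<open>theta_coeffs\<close>.
\<close>
definition jacobi_coeffs :: "int \<Rightarrow> int \<Rightarrow> (rat \<Rightarrow> rat ^ 'n \<Rightarrow> complex) \<Rightarrow> bool" where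
  "jacobi_coeffs K h C \<longleftrightarrow> theta_coeffs h C \<and> inversion_law K h C \<and> ((\<exists>D r. C D r \<noteq> 0) \<longrightarrow> even (K - h))"

lemma scalars_scale: "z \<in> scalars L \<Longrightarrow> a *s z \<in> scalars L" for z :: "complex ^ 'n"
  by (simp add: scalars_def)

lemma Im_inversion: "Im \<tau> > 0 \<Longrightarrow> Im (- 1 / \<tau>) > 0"
  by (auto simp: Im_divide sum_power2_gt_zero_iff)

lemma csqrt_upper_nonzero: "Im \<tau> > 0 \<Longrightarrow> csqrt \<tau> \<noteq> 0"
  by auto

lemma ee_powi: "ee x powi h = ee (of_int h * x)"
proof (cases "h \<ge> 0")
  case True
  then show ?thesis using ee_power[of x "nat h"] by (simp add: power_int_def)
next
  case False
  then show ?thesis using ee_power[of "- x" "nat (- h)"] by (simp add: power_int_def ee_minus[symmetric])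
qed

lemma jacobi_series_inversion:
  assumes C: "theta_coeffs h C" and \<tau>: "Im \<tau> > 0" and z: "z \<in> scalars L"
  shows "jacobi_series C (- 1 / \<tau>, (1 / \<tau>) *s z) * ee (- qf L z / \<tau>)
    = Theta (\<lambda>s. of_real theta_const * csqrt (\<tau> / \<i>) ^ card I * hat (\<lambda>r. h_fun C r (- 1 / \<tau>)) s) \<tau> z"
proof -
  define a where "a = of_real theta_const * csqrt (\<tau> / \<i>) ^ card I"
  define f where "f = (\<lambda>r. h_fun C r (- 1 / \<tau>))"
  have f: "shadow_periodic f" unfolding f_def by (rule h_fun_periodic[OF C])
  have "jacobi_series C (- 1 / \<tau>, (1 / \<tau>) *s z) = Theta f (- 1 / \<tau>) ((1 / \<tau>) *s z)"
    unfolding f_def by (rule jacobi_series_eq[OF Im_inversion[OF \<tau>] scalars_scale[OF z]])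
  also have "\<dots> = ee (qf L z / \<tau>) * (a * Theta (hat f) \<tau> z)"
    unfolding a_def by (rule Theta_inversion[OF f \<tau>])
  finally have "jacobi_series C (- 1 / \<tau>, (1 / \<tau>) *s z) * ee (- qf L z / \<tau>) = (ee (qf L z / \<tau>) * ee (- qf L z / \<tau>)) * (a * Theta (hat f) \<tau> z)"
    by simp
  also have "ee (qf L z / \<tau>) * ee (- qf L z / \<tau>) = 1" unfolding ee_add[symmetric] by simp
  also have "a * Theta (hat f) \<tau> z = Theta (\<lambda>s. a * hat f s) \<tau> z"
    unfolding Theta_def by (subst infsum_cmult_right'[symmetric]) (simp add: mult.assoc)
  finally show ?thesis by (simp add: a_def f_def)
qed

lemma inversion_law_iff:
  assumes C: "theta_coeffs h C"
  shows "inversion_law K h C \<longleftrightarrow> (\<forall>\<tau> z. Im \<tau> > 0 \<longrightarrow> z \<in> scalars L \<longrightarrow>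
    jacobi_series C (- 1 / \<tau>, (1 / \<tau>) *s z) * ee (- qf L z / \<tau>) * csqrt \<tau> powi (- K) = ee (- 1 / 8) powi h * jacobi_series C (\<tau>, z))"
    (is "_ = ?R")
proof -
  define lhs where "lhs = (\<lambda>\<tau> s. of_real theta_const * csqrt (\<tau> / \<i>) ^ card I * hat (\<lambda>r. h_fun C r (- 1 / \<tau>)) s)"
  define rhs where "rhs = (\<lambda>\<tau> s. ee (- of_int h / 8) * csqrt \<tau> powi K * h_fun C s \<tau>)"
  have pl: "shadow_periodic (lhs \<tau>)" for \<tau>
    using hat_periodic[of "\<lambda>r. h_fun C r (- 1 / \<tau>)"] by (auto simp: lhs_def shadow_periodic_def)
  have pr: "shadow_periodic (rhs \<tau>)" for \<tau>
    using h_fun_periodic[OF C, of \<tau>] by (auto simp: rhs_def shadow_periodic_def)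
  have e8: "ee (- 1 / 8) powi h = ee (- of_int h / 8)" by (simp add: ee_powi)
  have R: "(jacobi_series C (- 1 / \<tau>, (1 / \<tau>) *s z) * ee (- qf L z / \<tau>) * csqrt \<tau> powi (- K) = ee (- 1 / 8) powi h * jacobi_series C (\<tau>, z))
    \<longleftrightarrow> Theta (lhs \<tau>) \<tau> z = Theta (rhs \<tau>) \<tau> z" if \<tau>: "Im \<tau> > 0" and z: "z \<in> scalars L" for \<tau> z
  proof -
    have nz: "csqrt \<tau> powi K \<noteq> 0" using csqrt_upper_nonzero[OF \<tau>] by simp
    have r: "Theta (rhs \<tau>) \<tau> z = (ee (- of_int h / 8) * csqrt \<tau> powi K) * jacobi_series C (\<tau>, z)"
      unfolding jacobi_series_eq[OF \<tau> z] Theta_def rhs_def by (subst infsum_cmult_right'[symmetric]) (simp add: mult.assoc)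
    have l: "jacobi_series C (- 1 / \<tau>, (1 / \<tau>) *s z) * ee (- qf L z / \<tau>) = Theta (lhs \<tau>) \<tau> z"
      unfolding lhs_def by (rule jacobi_series_inversion[OF C \<tau> z])
    have cancel: "(a * inverse p = b) = (a = p * b)" if "p \<noteq> 0" for a b p :: complex
      using that by (auto simp: field_simps)
    show ?thesis
      unfolding e8 power_int_minus l r cancel[OF nz] by (simp only: mult_ac)
  qed
  have "inversion_law K h C \<longleftrightarrow> (\<forall>\<tau>. Im \<tau> > 0 \<longrightarrow> (\<forall>s\<in>shadow L. lhs \<tau> s = rhs \<tau> s))"
    by (simp add: inversion_law_def lhs_def rhs_def)
  also have "\<dots> \<longleftrightarrow> (\<forall>\<tau> z. Im \<tau> > 0 \<longrightarrow> z \<in> scalars L \<longrightarrow> Theta (lhs \<tau>) \<tau> z = Theta (rhs \<tau>) \<tau> z)"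
  proof (intro iffI allI impI ballI)
    fix \<tau> z assume "\<forall>\<tau>. Im \<tau> > 0 \<longrightarrow> (\<forall>s\<in>shadow L. lhs \<tau> s = rhs \<tau> s)" "Im \<tau> > 0"
    then show "Theta (lhs \<tau>) \<tau> z = Theta (rhs \<tau>) \<tau> z" unfolding Theta_def by (intro infsum_cong) auto
  next
    fix \<tau> s assume a: "\<forall>\<tau> z. Im \<tau> > 0 \<longrightarrow> z \<in> scalars L \<longrightarrow> Theta (lhs \<tau>) \<tau> z = Theta (rhs \<tau>) \<tau> z" "Im \<tau> > 0" "s \<in> shadow L"
    show "lhs \<tau> s = rhs \<tau> s" by (rule Theta_unique[OF pl pr a(2) _ a(3)]) (use a in auto)
  qed
  also have "\<dots> \<longleftrightarrow> ?R" using R by simp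
  finally show ?thesis .
qed

lemma jacobi_series_shift:
  assumes C: "theta_coeffs h C" and \<tau>: "Im \<tau> > 0" and z: "z \<in> scalars L"
  shows "jacobi_series C (\<tau> + of_int n, z) = ee (of_int n / 24) powi h * jacobi_series C (\<tau>, z)"
proof -
  have \<tau>n: "Im (\<tau> + of_int n) > 0" using \<tau> by simp
  have "((\<lambda>(r, D). C D r * ee (of_rat D * (\<tau> + of_int n)) * theta_term (\<tau> + of_int n) z r) has_sum jacobi_series C (\<tau> + of_int n, z)) (shadow L \<times> UNIV)"
    by (rule jacobi_series_has_sum[OF C \<tau>n z])
  moreover have "((\<lambda>x. ee (of_int n / 24) powi h * (case x of (r, D) \<Rightarrow> C D r * ee (of_rat D * \<tau>) * theta_term \<tau> z r)) has_sum ee (of_int n / 24) powi h * jacobi_series C (\<tau>, z)) (shadow L \<times> UNIV)"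
    by (intro has_sum_cmult_right jacobi_series_has_sum[OF C \<tau> z])
  moreover have "C D r * ee (of_rat D * (\<tau> + of_int n)) * theta_term (\<tau> + of_int n) z r = ee (of_int n / 24) powi h * (C D r * ee (of_rat D * \<tau>) * theta_term \<tau> z r)" for D r
  proof (cases "C D r = 0")
    case False
    have "er ((D + qf L r) * of_int n) = er (of_int h / 24 * of_int n)"
    proof -
      have "(D + qf L r) * of_int n - of_int h / 24 * of_int n = (D + qf L r - of_int h / 24) * of_int n" by (simp add: left_diff_distrib)
      then show ?thesis unfolding er_eq_iff using Ints_mult[OF theta_coeffsD(3)[OF C False] Ints_of_int[of n]] by simp
    qed
    also have "of_rat (of_int h / 24 * of_int n) = (of_int h * (of_int n / 24) :: complex)"
      by (simp add: of_rat_mult of_rat_divide)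
    finally have e: "ee (of_rat (D + qf L r) * of_int n) = ee (of_int n / 24) powi h"
      unfolding ee_powi by (simp add: of_rat_mult)
    have "ee (of_rat D * (\<tau> + of_int n)) * theta_term (\<tau> + of_int n) z r = ee (of_rat (D + qf L r) * of_int n) * (ee (of_rat D * \<tau>) * theta_term \<tau> z r)"
      unfolding fourier_term[symmetric] unfolding distrib_left ee_add by (simp only: mult_ac)
    then show ?thesis unfolding e by simp
  qed simp
  ultimately show ?thesis using has_sum_unique by (simp add: case_prod_unfold) blast
qed

lemma parity_sign:
  assumes "even (K - h)"
  shows "(-1) powi (- K) = ((-1) powi h :: complex)"
proof -
  have "(-1) powi h * (-1) powi K = (((-1) powi (h + K)) :: complex)" by (simp add: power_int_add)
  also have "\<dots> = 1" using assms by (simp add: even_add even_diff)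
  finally show ?thesis by (simp add: power_int_minus field_simps)
qed

lemma sign_parity:
  assumes "(-1) powi (- K) = ((-1) powi h :: complex)"
  shows "even (K - h)"
proof (rule ccontr)
  assume "odd (K - h)"
  then have "odd K \<and> even h \<or> even K \<and> odd h" by (auto simp: even_diff)
  with assms show False by (auto simp: power_int_minus)
qed

text \<open>
  The automorphy factors satisfy the cocycle relation. For the exponential factor it rests on
  the determinant: \<open>a (c \<tau> + d) = 1 + c (a \<tau> + b)\<close>.
\<close>
lemma modular_law_S:
  assumes B: "(B, v) \<in> Mp2Z" and law: "modular_law K h B v e \<phi>"
    and S: "\<And>\<tau> z. Im \<tau> > 0 \<Longrightarrow> z \<in> scalars L \<Longrightarrow> \<phi> (- 1 / \<tau>, (1 / \<tau>) *s z) * ee (- qf L z / \<tau>) * csqrt \<tau> powi (- K) = ee (- 1 / 8) powi h * \<phi> (\<tau>, z)"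
  shows "modular_law K h (S_matrix ** B) (\<lambda>\<tau>. csqrt (moebius B \<tau>) * v \<tau>) (ee (- 1 / 8) * e) \<phi>"
  unfolding modular_law_def
proof (intro allI impI)
  fix \<tau> and z :: "complex ^ 'n" assume \<tau>: "Im \<tau> > 0" and z: "z \<in> scalars L"
  have det: "det B = 1" using B by (simp add: Mp2Z_def)
  define \<sigma> where "\<sigma> = moebius B \<tau>"
  define k where "k = cocycle B \<tau>"
  define u where "u = (1 / k) *s z"
  have \<sigma>: "Im \<sigma> > 0" unfolding \<sigma>_def by (rule moebius_upper[OF det \<tau>])
  have nz: "\<sigma> \<noteq> 0" "k \<noteq> 0" using \<sigma> cocycle_nonzero[OF det \<tau>] by (auto simp: k_def)
  have u: "u \<in> scalars L" unfolding u_def by (rule scalars_scale[OF z])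
  have ad: "of_int (B $ 1 $ 1) * k = 1 + of_int (B $ 2 $ 1) * (\<sigma> * k)"
  proof -
    have "of_int (B $ 1 $ 1 * B $ 2 $ 2 - B $ 1 $ 2 * B $ 2 $ 1) = (1 :: complex)" using det by (simp add: det_2)
    then have d: "of_int (B $ 1 $ 1) * of_int (B $ 2 $ 2) = (1 + of_int (B $ 1 $ 2) * of_int (B $ 2 $ 1) :: complex)" by (simp add: algebra_simps)
    have "\<sigma> * k = of_int (B $ 1 $ 1) * \<tau> + of_int (B $ 1 $ 2)"
      using nz by (simp add: \<sigma>_def moebius_def k_def[symmetric])
    then show ?thesis using d by (simp add: k_def cocycle_def algebra_simps)
  qed
  have scale: "(1 / (\<sigma> * k)) *s z = (1 / \<sigma>) *s u" by (simp add: u_def vector_smult_assoc)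
  have expo: "- of_int (B $ 1 $ 1) * qf L z / (\<sigma> * k) = - qf L u / \<sigma> + - of_int (B $ 2 $ 1) * qf L z / k"
  proof -
    have "of_int (B $ 1 $ 1) / (\<sigma> * k) = (1 / k)\<^sup>2 / \<sigma> + of_int (B $ 2 $ 1) / k"
      using ad nz by (simp add: field_simps power2_eq_square)
    then have "(of_int (B $ 1 $ 1) / (\<sigma> * k)) * qf L z = ((1 / k)\<^sup>2 / \<sigma> + of_int (B $ 2 $ 1) / k) * qf L z" by simp
    then show ?thesis by (simp add: u_def qf_scale distrib_right)
  qed
  have "\<phi> (- 1 / \<sigma>, (1 / (\<sigma> * k)) *s z) * ee (- of_int (B $ 1 $ 1) * qf L z / (\<sigma> * k)) * (csqrt \<sigma> * v \<tau>) powi (- K)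
    = (\<phi> (- 1 / \<sigma>, (1 / \<sigma>) *s u) * ee (- qf L u / \<sigma>) * csqrt \<sigma> powi (- K)) * (ee (- of_int (B $ 2 $ 1) * qf L z / k) * v \<tau> powi (- K))"
    unfolding scale expo ee_add power_int_mult_distrib by (simp only: mult_ac)
  also have "\<dots> = ee (- 1 / 8) powi h * (\<phi> (\<sigma>, u) * ee (- of_int (B $ 2 $ 1) * qf L z / k) * v \<tau> powi (- K))"
    unfolding S[OF \<sigma> u] by (simp only: mult_ac)
  also have "\<phi> (\<sigma>, u) * ee (- of_int (B $ 2 $ 1) * qf L z / k) * v \<tau> powi (- K) = e powi h * \<phi> (\<tau>, z)"
    using law \<tau> z unfolding modular_law_def \<sigma>_def u_def k_def by blast
  finally show "\<phi> (moebius (S_matrix ** B) \<tau>, (1 / cocycle (S_matrix ** B) \<tau>) *s z)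
      * ee (- of_int ((S_matrix ** B) $ 2 $ 1) * qf L z / cocycle (S_matrix ** B) \<tau>) * (csqrt (moebius B \<tau>) * v \<tau>) powi (- K)
      = (ee (- 1 / 8) * e) powi h * \<phi> (\<tau>, z)"
    unfolding moebius_S[OF det \<tau>] cocycle_S[OF det \<tau>] \<sigma>_def[symmetric] k_def[symmetric] S_matrix_mult power_int_mult_distrib mult.assoc .
qed

text \<open>
  Induction along the generators of the metaplectic group: \<open>T\<close> is the congruence
  for the exponents, \<open>S\<close> the inversion law, and \<open>(1, -1)\<close> the parity
  condition.
\<close>
theorem jacobi_series_in_jacobi_forms:
  assumes C: "jacobi_coeffs \<lfloor>2 * k\<rfloor> h C"
  shows "jacobi_series C \<in> jacobi_forms L k h"
proof -
  define K where "K = \<lfloor>2 * k\<rfloor>"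
  define \<phi> where "\<phi> = jacobi_series C"
  have tc: "theta_coeffs h C" and inv: "inversion_law K h C" and par: "(\<exists>D r. C D r \<noteq> 0) \<Longrightarrow> even (K - h)"
    using C by (auto simp: jacobi_coeffs_def K_def)
  have sgn: "\<phi> p * (-1) powi (- K) = (-1) powi h * \<phi> p" for p
  proof (cases "\<exists>D r. C D r \<noteq> 0")
    case True
    then show ?thesis using parity_sign[OF par] by simp
  next
    case False
    then have "\<phi> p = 0" by (auto simp: \<phi>_def jacobi_series_def Theta_def h_fun_def)
    then show ?thesis by simp
  qed
  have law: "\<exists>e. is_eta_multiplier A w e \<and> modular_law K h A w e \<phi>" if "(A, w) \<in> Mp2Z" for A w
    using that
  proof (induction rule: Mp2Z_induct)
    case (cong A w w')
    then show ?case by (simp add: is_eta_multiplier_def modular_law_def)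
  next
    case one
    show ?case
      by (intro exI[of _ 1] conjI is_eta_multiplier_one) (simp add: modular_law_def moebius_def cocycle_def, simp add: mat_def)
  next
    case minus_one
    show ?case
      by (intro exI[of _ "-1"] conjI is_eta_multiplier_one) (simp add: modular_law_def moebius_def cocycle_def, simp add: mat_def sgn)
  next
    case (T n B v)
    then obtain e where e: "is_eta_multiplier B v e" "modular_law K h B v e \<phi>" by blast
    have det: "det B = 1" using T by (simp add: Mp2Z_def)
    have "modular_law K h (T_matrix n ** B) v (ee (of_int n / 24) * e) \<phi>"
      unfolding modular_law_def
    proof (intro allI impI)
      fix \<tau> and z :: "complex ^ 'n" assume \<tau>: "Im \<tau> > 0" and z: "z \<in> scalars L"
      have "\<phi> (moebius B \<tau> + of_int n, (1 / cocycle B \<tau>) *s z) = ee (of_int n / 24) powi h * \<phi> (moebius B \<tau>, (1 / cocycle B \<tau>) *s z)"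
        unfolding \<phi>_def by (rule jacobi_series_shift[OF tc moebius_upper[OF det \<tau>] scalars_scale[OF z]])
      then show "\<phi> (moebius (T_matrix n ** B) \<tau>, (1 / cocycle (T_matrix n ** B) \<tau>) *s z)
        * ee (- of_int ((T_matrix n ** B) $ 2 $ 1) * qf L z / cocycle (T_matrix n ** B) \<tau>) * v \<tau> powi (- K)
        = (ee (of_int n / 24) * e) powi h * \<phi> (\<tau>, z)"
        using e(2) \<tau> z unfolding modular_law_def moebius_T[OF det \<tau>] cocycle_T T_matrix_mult power_int_mult_distrib
        by (simp add: mult.assoc)
    qed
    then show ?case using is_eta_multiplier_T[OF T(1) e(1), of n] by blast
  next
    case (S B v)
    then obtain e where e: "is_eta_multiplier B v e" "modular_law K h B v e \<phi>" by blast
    have "modular_law K h (S_matrix ** B) (\<lambda>\<tau>. csqrt (moebius B \<tau>) * v \<tau>) (ee (- 1 / 8) * e) \<phi>"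
      by (rule modular_law_S[OF S(1) e(2)]) (use inv[unfolded inversion_law_iff[OF tc]] in \<open>simp add: \<phi>_def\<close>)
    then show ?case using is_eta_multiplier_S[OF S(1) e(1)] by blast
  qed
  have "\<forall>(A, w)\<in>Mp2Z. \<forall>(\<tau>, z)\<in>jacobi_domain L.
        \<phi> (moebius A \<tau>, (1 / cocycle A \<tau>) *s z)
          * ee (- of_int (A $ 2 $ 1) * qf L z / cocycle A \<tau>) * w \<tau> powi (- K)
        = eps A w powi h * \<phi> (\<tau>, z)"
  proof (clarify)
    fix A w \<tau> z assume Aw: "(A, w) \<in> Mp2Z" and "(\<tau>, z) \<in> jacobi_domain L"
    then have "Im \<tau> > 0" "z \<in> scalars L" by (auto simp: jacobi_domain_iff)
    moreover obtain e where "is_eta_multiplier A w e" "modular_law K h A w e \<phi>" using law[OF Aw] by blast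
    ultimately show "\<phi> (moebius A \<tau>, (1 / cocycle A \<tau>) *s z)
          * ee (- of_int (A $ 2 $ 1) * qf L z / cocycle A \<tau>) * w \<tau> powi (- K)
        = eps A w powi h * \<phi> (\<tau>, z)"
      unfolding modular_law_def using eps_eqI[OF _ Aw] by blast
  qed
  moreover have "\<forall>p. p \<notin> jacobi_domain L \<longrightarrow> \<phi> p = 0" by (simp add: \<phi>_def jacobi_series_def)
  moreover have "holomorphic_in \<phi> (jacobi_domain L)" unfolding \<phi>_def by (rule holomorphic_jacobi_series[OF tc])
  moreover have "\<exists>c. fourier_expansion L h \<phi> c" unfolding \<phi>_def using fourier_expansion_jacobi_series[OF tc] by blast
  moreover have "translation_law \<phi>" unfolding \<phi>_def by (rule translation_law_jacobi_series[OF tc])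
  ultimately have "\<phi> \<in> jacobi_forms L k h"
    unfolding jacobi_forms_def translation_law_def K_def by blast
  then show ?thesis by (simp add: \<phi>_def)
qed

text \<open>
  Conversely, the laws at \<open>S\<close> and \<open>(1, -1)\<close> are special cases of the
  modular law, and the translation law makes the coefficients periodic.
\<close>
theorem jacobi_form_coeffs:
  assumes \<phi>: "\<phi> \<in> jacobi_forms L k h" and c: "fourier_expansion L h \<phi> c"
  shows "jacobi_coeffs \<lfloor>2 * k\<rfloor> h (coeffs_of h c)" and "\<phi> = jacobi_series (coeffs_of h c)"
proof -
  define K where "K = \<lfloor>2 * k\<rfloor>"
  define C where "C = coeffs_of h c"
  have off: "\<And>p. p \<notin> jacobi_domain L \<Longrightarrow> \<phi> p = 0"
    and mod: "\<And>A w \<tau> z. (A, w) \<in> Mp2Z \<Longrightarrow> Im \<tau> > 0 \<Longrightarrow> z \<in> scalars L \<Longrightarrow> \<phi> (moebius A \<tau>, (1 / cocycle A \<tau>) *s z)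
          * ee (- of_int (A $ 2 $ 1) * qf L z / cocycle A \<tau>) * w \<tau> powi (- K) = eps A w powi h * \<phi> (\<tau>, z)"
    and tr: "translation_law \<phi>"
  proof -
    have all: "\<forall>p. p \<notin> jacobi_domain L \<longrightarrow> \<phi> p = 0" "\<forall>(A, w)\<in>Mp2Z. \<forall>(\<tau>, z)\<in>jacobi_domain L.
        \<phi> (moebius A \<tau>, (1 / cocycle A \<tau>) *s z)
          * ee (- of_int (A $ 2 $ 1) * qf L z / cocycle A \<tau>) * w \<tau> powi (- K)
        = eps A w powi h * \<phi> (\<tau>, z)" "translation_law \<phi>"
      using \<phi> unfolding jacobi_forms_def translation_law_def K_def by blast+
    show "\<And>p. p \<notin> jacobi_domain L \<Longrightarrow> \<phi> p = 0" "translation_law \<phi>" using all by blast+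
    show "\<phi> (moebius A \<tau>, (1 / cocycle A \<tau>) *s z)
          * ee (- of_int (A $ 2 $ 1) * qf L z / cocycle A \<tau>) * w \<tau> powi (- K) = eps A w powi h * \<phi> (\<tau>, z)"
      if "(A, w) \<in> Mp2Z" "Im \<tau> > 0" "z \<in> scalars L" for A w \<tau> z
      using bspec[OF bspec[OF all(2) that(1), unfolded prod.case], of "(\<tau>, z)"] that by (simp only: prod.case jacobi_domain_iff)
  qed
  have tc: "theta_coeffs h C" unfolding C_def by (rule theta_coeffs_coeffs_of[OF c tr])
  have eq: "\<phi> = jacobi_series C"
  proof
    fix p
    show "\<phi> p = jacobi_series C p"
    proof (cases "p \<in> jacobi_domain L")
      case False
      then show ?thesis by (simp add: off jacobi_series_def)
    next
      case True
      obtain \<tau> z where p: "p = (\<tau>, z)" by force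
      have \<tau>: "Im \<tau> > 0" and z: "z \<in> scalars L" using True by (auto simp: p jacobi_domain_iff)
      show ?thesis
        unfolding p jacobi_series_eq[OF \<tau> z] Theta_def C_def
        using infsumI[OF coeffs_of_theta_decomposition[OF c \<tau> z]] by simp
    qed
  qed
  then show "\<phi> = jacobi_series (coeffs_of h c)" by (simp add: C_def)
  have "inversion_law K h C"
    unfolding inversion_law_iff[OF tc] eq[symmetric]
  proof (intro allI impI)
    fix \<tau> and z :: "complex ^ 'n" assume \<tau>: "Im \<tau> > 0" and z: "z \<in> scalars L"
    have id: "moebius (mat 1) \<sigma> = \<sigma>" "cocycle (mat 1) \<sigma> = 1" for \<sigma>
      by (simp_all add: moebius_def cocycle_def) (simp_all add: mat_def)
    note m = Mp2Z_one(1)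
    have "eps (S_matrix ** mat 1) (\<lambda>\<tau>. csqrt (moebius (mat 1) \<tau>) * 1) = ee (- 1 / 8) * 1"
      by (rule eps_eqI[OF is_eta_multiplier_S[OF m is_eta_multiplier_one(1)] Mp2Z_S[OF m]])
    moreover have "(S_matrix ** mat 1) $ 2 $ 1 = 1" by (simp add: S_matrix_def)
    ultimately show "\<phi> (- 1 / \<tau>, (1 / \<tau>) *s z) * ee (- qf L z / \<tau>) * csqrt \<tau> powi (- K) = ee (- 1 / 8) powi h * \<phi> (\<tau>, z)"
      using mod[OF Mp2Z_S[OF m] \<tau> z] moebius_S[OF det_I \<tau>] cocycle_S[OF det_I \<tau>] by (simp add: id)
  qed
  moreover have "even (K - h)" if ne: "\<exists>D r. C D r \<noteq> 0"
  proof -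
    have "\<exists>p. \<phi> p \<noteq> 0"
    proof (rule ccontr)
      assume "\<not> ?thesis"
      then have z: "\<phi> p = 0" for p by blast
      have "theta_coeffs h (\<lambda>D r. 0)" by (simp add: theta_coeffs_def shadow_periodic_def)
      then have "coeffs_of h c = (\<lambda>D r. 0)"
        by (rule coeffs_unique[OF c]) (simp add: z jacobi_series_def Theta_def h_fun_def)
      with ne show False by (simp add: C_def)
    qed
    then obtain \<tau> z where p: "\<phi> (\<tau>, z) \<noteq> 0" by auto
    then have "(\<tau>, z) \<in> jacobi_domain L" using off by blast
    then have \<tau>: "Im \<tau> > 0" and z: "z \<in> scalars L" by (auto simp: jacobi_domain_iff)
    have "eps (mat 1) (\<lambda>_. - 1) = - 1" by (rule eps_eqI[OF is_eta_multiplier_one(2) Mp2Z_one(2)])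
    then have "\<phi> (\<tau>, z) * (-1) powi (- K) = (-1) powi h * \<phi> (\<tau>, z)"
      using mod[OF Mp2Z_one(2) \<tau> z] by (simp add: moebius_def cocycle_def) (simp add: mat_def)
    then have "(-1) powi (- K) = ((-1) powi h :: complex)" using p by simp
    then show ?thesis by (rule sign_parity)
  qed
  ultimately show "jacobi_coeffs \<lfloor>2 * k\<rfloor> h (coeffs_of h c)"
    using tc by (simp add: jacobi_coeffs_def C_def K_def)
qed

end

context definite_lattice
begin

lemma theta_coeffs_linear:
  assumes C: "theta_coeffs h C" and C': "theta_coeffs h C'"
  shows "theta_coeffs h (\<lambda>D r. a * C D r + C' D r)"
proof -
  have supp: "C D r \<noteq> 0 \<or> C' D r \<noteq> 0" if "a * C D r + C' D r \<noteq> 0" for D r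
    using that by auto
  have "(\<lambda>D. norm (a * C D r + C' D r) * exp (- 2 * pi * y * of_rat D)) summable_on UNIV"
    if r: "r \<in> shadow L" and y: "y > 0" for r y
  proof (rule summable_on_comparison_test)
    show "(\<lambda>D. norm a * (norm (C D r) * exp (- 2 * pi * y * of_rat D)) + norm (C' D r) * exp (- 2 * pi * y * of_rat D)) summable_on UNIV"
      by (intro summable_on_add summable_on_cmult_right theta_coeffsD(4)[OF C r y] theta_coeffsD(4)[OF C' r y])
    show "norm (a * C D r + C' D r) * exp (- 2 * pi * y * of_rat D)
      \<le> norm a * (norm (C D r) * exp (- 2 * pi * y * of_rat D)) + norm (C' D r) * exp (- 2 * pi * y * of_rat D)" for D
      using mult_right_mono[OF norm_triangle_ineq[of "a * C D r" "C' D r"], of "exp (- 2 * pi * y * of_rat D)"]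
      by (simp add: distrib_right norm_mult mult.assoc)
  qed auto
  moreover have "shadow_periodic (\<lambda>r. a * C D r + C' D r)" for D
    using theta_coeffsD(5)[OF C, of D] theta_coeffsD(5)[OF C', of D]
    by (simp add: shadow_periodic_def distrib_left mult.left_commute)
  moreover have "r \<in> shadow L \<and> D \<ge> 0 \<and> D + qf L r - of_int h / 24 \<in> \<int>" if "a * C D r + C' D r \<noteq> 0" for D r
    using supp[OF that] theta_coeffsD(1-3)[OF C, of D r] theta_coeffsD(1-3)[OF C', of D r] by blast
  ultimately show ?thesis unfolding theta_coeffs_def by blast
qed

lemma theta_coeffs_zero: "theta_coeffs h (\<lambda>D r. 0)"
  by (simp add: theta_coeffs_def shadow_periodic_def)

lemma jacobi_series_zero: "jacobi_series (\<lambda>D r. 0) = (\<lambda>p. 0)"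
  by (simp add: fun_eq_iff jacobi_series_def Theta_def h_fun_def)

lemma jacobi_series_linear:
  assumes C: "theta_coeffs h C" and C': "theta_coeffs h C'"
  shows "jacobi_series (\<lambda>D r. a * C D r + C' D r) = (\<lambda>p. a * jacobi_series C p + jacobi_series C' p)"
proof
  fix p
  show "jacobi_series (\<lambda>D r. a * C D r + C' D r) p = a * jacobi_series C p + jacobi_series C' p"
  proof (cases "p \<in> jacobi_domain L")
    case True
    obtain \<tau> z where p: "p = (\<tau>, z)" by force
    have \<tau>: "Im \<tau> > 0" and z: "z \<in> scalars L" using True by (auto simp: p jacobi_domain_iff)
    have "((\<lambda>i. a * (case i of (r, D) \<Rightarrow> C D r * ee (of_rat D * \<tau>) * theta_term \<tau> z r)
        + (case i of (r, D) \<Rightarrow> C' D r * ee (of_rat D * \<tau>) * theta_term \<tau> z r))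
        has_sum (a * jacobi_series C (\<tau>, z) + jacobi_series C' (\<tau>, z))) (shadow L \<times> UNIV)"
      by (intro has_sum_add has_sum_cmult_right jacobi_series_has_sum[OF C \<tau> z] jacobi_series_has_sum[OF C' \<tau> z])
    also have "(\<lambda>i. a * (case i of (r, D) \<Rightarrow> C D r * ee (of_rat D * \<tau>) * theta_term \<tau> z r)
        + (case i of (r, D) \<Rightarrow> C' D r * ee (of_rat D * \<tau>) * theta_term \<tau> z r))
      = (\<lambda>(r, D). (a * C D r + C' D r) * ee (of_rat D * \<tau>) * theta_term \<tau> z r)"
      by (simp add: fun_eq_iff distrib_right mult.assoc)
    finally show ?thesis
      unfolding p by (rule has_sum_unique[OF jacobi_series_has_sum[OF theta_coeffs_linear[OF C C'] \<tau> z]])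
  qed (simp add: jacobi_series_def)
qed

text \<open>
  All Fourier expansions of a form lead to the same normalised coefficients, by
  \<open>coeffs_unique\<close>.
\<close>
definition coefficients :: "int \<Rightarrow> (complex \<times> (complex ^ 'n) \<Rightarrow> complex) \<Rightarrow> rat \<Rightarrow> rat ^ 'n \<Rightarrow> complex" where
  "coefficients h \<phi> = coeffs_of h (SOME c. fourier_expansion L h \<phi> c)"

lemma coefficients_jacobi_series:
  assumes C: "theta_coeffs h C"
  shows "coefficients h (jacobi_series C) = C"
  unfolding coefficients_def
  using coeffs_unique[OF someI[of "fourier_expansion L h (jacobi_series C)", OF fourier_expansion_jacobi_series[OF C]] C] by simp

lemma jacobi_coeffs_theta: "jacobi_coeffs K h C \<Longrightarrow> theta_coeffs h C"
  by (simp add: jacobi_coeffs_def)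

lemma jacobi_formE:
  assumes "\<phi> \<in> jacobi_forms L k h"
  obtains C where "jacobi_coeffs \<lfloor>2 * k\<rfloor> h C" "\<phi> = jacobi_series C"
proof -
  obtain c where "fourier_expansion L h \<phi> c" using assms by (auto simp: jacobi_forms_def)
  then show ?thesis using jacobi_form_coeffs[OF assms] that by blast
qed

lemma bij_betw_coefficients:
  "bij_betw (coefficients h) (jacobi_forms L k h) {C. jacobi_coeffs \<lfloor>2 * k\<rfloor> h C}"
  by (rule bij_betwI[of _ _ _ jacobi_series])
     (auto simp: coefficients_jacobi_series jacobi_coeffs_theta jacobi_series_in_jacobi_forms elim!: jacobi_formE)

lemma bij_betw_jacobi_series:
  "bij_betw jacobi_series {C. jacobi_coeffs \<lfloor>2 * k\<rfloor> h C} (jacobi_forms L k h)"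
  by (rule bij_betwI[of _ _ _ "coefficients h"])
     (auto simp: coefficients_jacobi_series jacobi_coeffs_theta jacobi_series_in_jacobi_forms elim!: jacobi_formE)

text \<open>
  The shifts of weight and character by the rank \<open>n\<close> are exactly those that remove
  \<open>csqrt(\<tau>/\<i>)\<^sup>n\<close>: the weight contributes \<open>csqrt(\<tau>)\<^sup>n
  = e(n/8) csqrt(\<tau>/\<i>)\<^sup>n\<close>, the character \<open>e(-3n/8)\<close>, and
  \<open>e(-n/4)\<close> is what remains.
\<close>
lemma inversion_law_reduced:
  "inversion_law (K + int (card I)) (h + 3 * int (card I)) C \<longleftrightarrow>
    (\<forall>\<tau>. Im \<tau> > 0 \<longrightarrow> (\<forall>s\<in>shadow L. of_real theta_const * hat (\<lambda>r. h_fun C r (- 1 / \<tau>)) s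
       = ee (- of_nat (card I) / 4) * (ee (- of_int h / 8) * csqrt \<tau> powi K * h_fun C s \<tau>)))"
proof -
  have "of_real theta_const * csqrt (\<tau> / \<i>) ^ card I * H
       = ee (- of_int (h + 3 * int (card I)) / 8) * csqrt \<tau> powi (K + int (card I)) * G
    \<longleftrightarrow> of_real theta_const * H = ee (- of_nat (card I) / 4) * (ee (- of_int h / 8) * csqrt \<tau> powi K * G)"
    if \<tau>: "Im \<tau> > 0" for \<tau> H G
  proof -
    define u where "u = csqrt (\<tau> / \<i>) ^ card I"
    define e where "e = ee (- of_nat (card I) / 4)"
    have nz: "csqrt \<tau> \<noteq> 0" "u \<noteq> 0" using \<tau> by (auto simp: u_def)
    have "csqrt \<tau> powi (K + int (card I)) = csqrt \<tau> powi K * csqrt \<tau> ^ card I"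
      using nz by (simp add: power_int_add)
    also have "csqrt \<tau> ^ card I = ee (of_nat (card I) / 8) * u"
      by (simp add: csqrt_upper_half_plane[OF \<tau>] power_mult_distrib u_def ee_power)
    finally have p: "csqrt \<tau> powi (K + int (card I)) = csqrt \<tau> powi K * (ee (of_nat (card I) / 8) * u)" .
    have "ee (- of_int (h + 3 * int (card I)) / 8) * ee (of_nat (card I) / 8) = ee (- of_int h / 8) * e"
      unfolding e_def ee_add[symmetric] by (rule arg_cong[of _ _ ee]) (simp add: field_simps)
    then have "ee (- of_int (h + 3 * int (card I)) / 8) * csqrt \<tau> powi (K + int (card I)) * G = u * (e * (ee (- of_int h / 8) * csqrt \<tau> powi K * G))"
      unfolding p by algebra
    moreover have "of_real theta_const * u * H = u * (of_real theta_const * H)" by simp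
    ultimately show ?thesis unfolding u_def[symmetric] e_def[symmetric] using nz(2) by (simp only: mult_cancel_left) simp
  qed
  then show ?thesis unfolding inversion_law_def by blast
qed

end

section \<open>Transfer of coefficients along the glue\<close>

context glued_shadow
begin

lemma norm_twist: "norm (twist r s) = 1"
  by (simp add: twist_def norm_ee flip: of_real_of_rat)

lemma partners_shift:
  assumes p: "partners r s"
  shows "x \<in> points L \<Longrightarrow> partners (r + x) s" and "y \<in> points M \<Longrightarrow> partners r (s + y)"
proof -
  have z: "0 \<in> points L" "0 \<in> points M" by (auto simp: points_def scalars_def)
  show "partners (r + x) s" if "x \<in> points L"
    using U_add[OF p[unfolded partners_def] points_sub[OF that z(2)]] by (simp add: partners_def algebra_simps)
  show "partners r (s + y)" if "y \<in> points M"
    using U_add[OF p[unfolded partners_def] points_sub[OF z(1) that]] by (simp add: partners_def algebra_simps)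
qed

text \<open>
  The sign changes in the same way as theta coefficients do, in either component.
\<close>
lemma twist_shift:
  assumes p: "partners r s"
  shows "x \<in> points L \<Longrightarrow> twist (r + x) s = er (qf L x) * twist r s"
    and "y \<in> points M \<Longrightarrow> twist r (s + y) = er (qf M y) * twist r s"
proof -
  have dual: "r - r0 \<in> dual L" "s - s0 \<in> dual M" using p sub_dual unfolding partners_def by blast+
  show "twist (r + x) s = er (qf L x) * twist r s" if x: "x \<in> points L"
  proof -
    have "qf L (r + x - r0) = qf L x + bil L (r - r0) x + qf L (r - r0)"
      using L.qf_add[of "r - r0" x] by (simp add: algebra_simps)
    then show ?thesis
      unfolding twist_def er_add[symmetric] er_eq_iff using L.dualD[OF dual(1) x] by simp
  qed
  show "twist r (s + y) = er (qf M y) * twist r s" if y: "y \<in> points M"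
  proof -
    have "qf M (s + y - s0) = qf M y + bil M (s - s0) y + qf M (s - s0)"
      using M.qf_add[of "s - s0" y] by (simp add: algebra_simps)
    then have "twist r (s + y) = er (- qf M y) * twist r s"
      unfolding twist_def er_add[symmetric] er_eq_iff using M.dualD[OF dual(2) y] by (simp add: minus_in_Ints_iff)
    then show ?thesis by (simp only: M.er_neg_points[OF y])
  qed
qed

text \<open>
  Any partner of \<open>s\<close> may be chosen: two of them differ by a lattice vector, and the
  signs of \<open>twist\<close> and of the periodic coefficients cancel
  (\<open>transfer_eq\<close>).
\<close>
definition transfer :: "(rat \<Rightarrow> rat ^ 'a \<Rightarrow> complex) \<Rightarrow> rat \<Rightarrow> rat ^ 'b \<Rightarrow> complex" where
  "transfer C D s = (if s \<in> shadow M then let r = SOME r. partners r s in twist r s * C D r else 0)"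

lemma transfer_eq:
  assumes C: "L.theta_coeffs h C" and p: "partners r s"
  shows "transfer C D s = twist r s * C D r"
proof -
  define r' where "r' = (SOME r. partners r s)"
  define x where "x = r' - r"
  have p': "partners r' s" unfolding r'_def using p by (rule someI)
  have x: "x \<in> points L"
    unfolding x_def partners_points_iff[OF p' p] by (simp add: points_def scalars_def)
  have r': "r' = r + x" by (simp add: x_def)
  have sh: "r \<in> shadow L" "s \<in> shadow M" using partners_shadow[OF p] by auto
  have e: "er (qf L x) * er (qf L x) = 1" using L.er_neg_points[OF x] by (metis er_minus left_inverse ee_nonzero)
  have "transfer C D s = twist r' s * C D r'" using sh by (simp add: transfer_def r'_def Let_def)
  also have "\<dots> = (er (qf L x) * er (qf L x)) * (twist r s * C D r)"
    unfolding r' twist_shift(1)[OF p x] L.shadow_periodicD[OF L.theta_coeffsD(5)[OF C] sh(1) x] by (simp only: mult_ac)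
  finally show ?thesis by (simp add: e)
qed

lemma transfer_linear: "transfer (\<lambda>D r. a * C D r + C' D r) = (\<lambda>D s. a * transfer C D s + transfer C' D s)"
  by (simp add: fun_eq_iff transfer_def Let_def algebra_simps)

lemma transfer_zero: "transfer (\<lambda>D r. 0) = (\<lambda>D s. 0)"
  by (simp add: fun_eq_iff transfer_def Let_def)

text \<open>
  The difference \<open>3(n\<^sub>1 - n\<^sub>2)/24\<close> of the shifts of the characters is
  \<open>\<beta>(r) - \<beta>(s)\<close> modulo integers.
\<close>
lemma fourier_index_partners:
  assumes p: "partners r s"
  shows "D + qf M s - of_int (h + 3 * int (card M.I)) / 24 \<in> \<int> \<longleftrightarrow> D + qf L r - of_int (h + 3 * int (card L.I)) / 24 \<in> \<int>"
proof -
  define d where "d = qf L r - qf M s - (of_nat (card L.I) - of_nat (card M.I)) / 8"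
  define A where "A = D + qf M s - of_int (h + 3 * int (card M.I)) / 24"
  have d: "d \<in> \<int>" unfolding d_def by (rule qf_shadow_difference[OF p])
  have "D + qf L r - of_int (h + 3 * int (card L.I)) / 24 = A + d" by (simp add: A_def d_def field_simps)
  moreover have "A + d \<in> \<int> \<longleftrightarrow> A \<in> \<int>"
  proof
    assume "A + d \<in> \<int>"
    from Ints_diff[OF this d] show "A \<in> \<int>" by simp
  qed (use d in auto)
  ultimately show ?thesis by (simp only: A_def)
qed

lemma theta_coeffs_transfer:
  assumes C: "L.theta_coeffs (h + 3 * int (card L.I)) C"
  shows "M.theta_coeffs (h + 3 * int (card M.I)) (transfer C)"
  unfolding M.theta_coeffs_def
proof (intro conjI allI impI ballI)
  fix D s assume nz: "transfer C D s \<noteq> 0"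
  then show s: "s \<in> shadow M" by (auto simp: transfer_def split: if_splits)
  obtain r where p: "partners r s" using partner_exists'[OF s] by blast
  have c: "C D r \<noteq> 0" using nz unfolding transfer_eq[OF C p] by simp
  show "D \<ge> 0" by (rule L.theta_coeffsD(2)[OF C c])
  show "D + qf M s - of_int (h + 3 * int (card M.I)) / 24 \<in> \<int>"
    unfolding fourier_index_partners[OF p] by (rule L.theta_coeffsD(3)[OF C c])
next
  fix s :: "rat ^ 'b" and y :: real assume s: "s \<in> shadow M" and y: "y > 0"
  obtain r where p: "partners r s" using partner_exists'[OF s] by blast
  show "(\<lambda>D. norm (transfer C D s) * exp (- 2 * pi * y * of_rat D)) summable_on UNIV"
    using L.theta_coeffsD(4)[OF C _ y, of r] partners_shadow[OF p]
    by (simp add: transfer_eq[OF C p] norm_mult norm_twist)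
next
  fix D
  show "M.shadow_periodic (transfer C D)"
    unfolding M.shadow_periodic_def
  proof (intro ballI)
    fix s y assume s: "s \<in> shadow M" and y: "y \<in> points M"
    obtain r where p: "partners r s" using partner_exists'[OF s] by blast
    show "transfer C D (s + y) = er (qf M y) * transfer C D s"
      unfolding transfer_eq[OF C p] transfer_eq[OF C partners_shift(2)[OF p y]] twist_shift(2)[OF p y] by (rule mult.assoc)
  qed
qed

lemma h_fun_transfer:
  assumes C: "L.theta_coeffs h C" and p: "partners r s"
  shows "M.h_fun (transfer C) s \<tau> = twist r s * L.h_fun C r \<tau>"
  unfolding M.h_fun_def L.h_fun_def transfer_eq[OF C p] mult.assoc by (rule infsum_cmult_right')

text \<open>
  The base point constant of \<open>twist_mult\<close> is evaluated by
  \<open>van_der_blij\<close>.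
\<close>
lemma hat_transfer:
  assumes C: "L.theta_coeffs (h + 3 * int (card L.I)) C" and p: "partners r s"
  shows "L.hat (\<lambda>r. L.h_fun C r \<tau>) r
    = ee (- (of_nat (card L.I) - of_nat (card M.I)) / 4) * (twist r s * M.hat (\<lambda>s. M.h_fun (transfer C) s \<tau>) s)"
proof -
  define e where "e = er (- 2 * (qf L r0 - qf M s0))"
  define F' where "F' = (\<lambda>s'. M.h_fun (transfer C) s' \<tau> * er (- bil M s' s))"
  note per = M.h_fun_periodic[OF theta_coeffs_transfer[OF C], of \<tau>]
  note sh = partners_shadow[OF p]
  have "(\<Sum>r'\<in>L.reps. L.h_fun C r' \<tau> * er (- bil L r' r)) = (\<Sum>s'\<in>M.reps. e * twist r s * F' s')"
  proof (rule reps_sum_eq)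
    fix r' s' assume p': "partners r' s'"
    show "L.h_fun C r' \<tau> * er (- bil L r' r) = e * twist r s * F' s'"
      unfolding twist_mult[OF p' p] F'_def h_fun_transfer[OF C p'] e_def by (simp only: mult_ac)
  next
    fix s1 s2 assume "s1 \<in> shadow M" "s2 \<in> shadow M" "s1 - s2 \<in> points M"
    then have "F' s1 = F' s2" unfolding F'_def using M.pairing_periodic[OF per] sh by blast
    then show "e * twist r s * F' s1 = e * twist r s * F' s2" by simp
  qed
  also have "\<dots> = e * (twist r s * (\<Sum>s'\<in>M.reps. F' s'))" by (simp add: sum_distrib_left mult.assoc)
  also have "e = ee (- (of_nat (card L.I) - of_nat (card M.I)) / 4)"
  proof -
    define d where "d = er (qf L r0 - qf M s0)"
    have "e = inverse (d * d)"
      unfolding e_def d_def er_add[symmetric] er_minus[symmetric] by (rule arg_cong[of _ _ er]) simp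
    also have "\<dots> = ee (- (of_nat (card L.I) - of_nat (card M.I)) / 4)"
      unfolding d_def van_der_blij(2) ee_add[symmetric] ee_minus[symmetric] by (rule arg_cong[of _ _ ee]) (simp add: field_simps)
    finally show ?thesis .
  qed
  finally show ?thesis by (simp only: L.hat_def M.hat_def F'_def)
qed

text \<open>
  In the reduced inversion law the two lattices differ by \<open>e(-n\<^sub>1/4)\<close> against
  \<open>e(-n\<^sub>2/4)\<close>, and this is the constant by which the finite Fourier
  transforms differ. The parity condition is insensitive to the rank, as weight and character
  change by \<open>n\<close> and \<open>3n\<close>.
\<close>
theorem jacobi_coeffs_transfer:
  assumes C: "L.jacobi_coeffs (K + int (card L.I)) (h + 3 * int (card L.I)) C"
  shows "M.jacobi_coeffs (K + int (card M.I)) (h + 3 * int (card M.I)) (transfer C)"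
proof -
  have tc: "L.theta_coeffs (h + 3 * int (card L.I)) C" by (rule L.jacobi_coeffs_theta[OF C])
  have inv: "L.inversion_law (K + int (card L.I)) (h + 3 * int (card L.I)) C" using C by (simp add: L.jacobi_coeffs_def)
  have "M.inversion_law (K + int (card M.I)) (h + 3 * int (card M.I)) (transfer C)"
    unfolding M.inversion_law_reduced
  proof (intro allI impI ballI)
    fix \<tau> s assume \<tau>: "Im \<tau> > 0" and s: "s \<in> shadow M"
    obtain r where p: "partners r s" using partner_exists'[OF s] by blast
    define eL where "eL = ee (- of_nat (card L.I) / 4)"
    define eM where "eM = ee (- of_nat (card M.I) / 4)"
    define t where "t = twist r s"
    define H where "H = M.hat (\<lambda>s. M.h_fun (transfer C) s (- 1 / \<tau>)) s"
    define a where "a = ee (- of_int h / 8) * csqrt \<tau> powi K"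
    define G where "G = M.h_fun (transfer C) s \<tau>"
    have tt: "t * t = 1" unfolding t_def by (rule twist_square[OF p])
    have "L.h_fun C r \<tau> = t * G"
      unfolding G_def h_fun_transfer[OF tc p] t_def[symmetric] mult.assoc[symmetric] tt by simp
    moreover have "ee (- (of_nat (card L.I) - of_nat (card M.I)) / 4) = eL / eM"
      unfolding eL_def eM_def ee_diff[symmetric] by (rule arg_cong[of _ _ ee]) (simp add: field_simps)
    moreover have "of_real L.theta_const * L.hat (\<lambda>r. L.h_fun C r (- 1 / \<tau>)) r = eL * (a * L.h_fun C r \<tau>)"
      using inv partners_shadow[OF p] \<tau> unfolding L.inversion_law_reduced eL_def a_def by blast
    ultimately have "of_real L.theta_const * (eL / eM * (t * H)) = eL * (a * (t * G))"
      unfolding hat_transfer[OF tc p] H_def t_def by simp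
    then have "(eL * t) * (of_real L.theta_const * H) = (eL * t) * (eM * (a * G))"
      by (simp add: eM_def field_simps)
    moreover have "eL * t \<noteq> 0" by (simp add: eL_def t_def)
    ultimately have "of_real L.theta_const * H = eM * (a * G)" by simp
    then show "of_real M.theta_const * M.hat (\<lambda>s. M.h_fun (transfer C) s (- 1 / \<tau>)) s
       = ee (- of_nat (card M.I) / 4) * (ee (- of_int h / 8) * csqrt \<tau> powi K * M.h_fun (transfer C) s \<tau>)"
      by (simp only: van_der_blij(1) H_def eM_def a_def G_def)
  qed
  moreover have "even (K + int (card M.I) - (h + 3 * int (card M.I)))" if "\<exists>D s. transfer C D s \<noteq> 0"
  proof -
    have "\<exists>D r. C D r \<noteq> 0"
      using that by (auto simp: transfer_def Let_def split: if_splits)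
    then have "even (K + int (card L.I) - (h + 3 * int (card L.I)))" using C by (simp add: L.jacobi_coeffs_def)
    then show ?thesis by presburger
  qed
  ultimately show ?thesis using theta_coeffs_transfer[OF tc] unfolding M.jacobi_coeffs_def by blast
qed

text \<open>
  The sign of the swapped pair is inverse to that of the pair, so the transfer in the opposite
  direction inverts the transfer.
\<close>
lemma transfer_swap:
  assumes C: "L.theta_coeffs (h + 3 * int (card L.I)) C"
  shows "glued_shadow.transfer M L (U\<inverse>) s0 r0 (transfer C) = C"
proof -
  interpret S: glued_shadow M L "U\<inverse>" s0 r0 by (rule swap_shadow)
  have "S.transfer (transfer C) D r = C D r" for D r
  proof (cases "r \<in> shadow L")
    case True
    then obtain s where p: "partners r s" using partner_exists by blast
    then have p': "S.partners s r" by (simp add: S.partners_def partners_def)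
    have "S.twist s r = inverse (twist r s)"
      unfolding S.twist_def twist_def er_minus[symmetric] by (rule arg_cong[of _ _ er]) simp
    then show ?thesis
      unfolding S.transfer_eq[OF theta_coeffs_transfer[OF C] p'] transfer_eq[OF C p] by simp
  next
    case False
    then show ?thesis using L.theta_coeffsD(1)[OF C, of D r] by (auto simp: S.transfer_def)
  qed
  then show ?thesis by blast
qed

lemma bij_betw_transfer:
  "bij_betw transfer {C. L.jacobi_coeffs (K + int (card L.I)) (h + 3 * int (card L.I)) C}
     {C. M.jacobi_coeffs (K + int (card M.I)) (h + 3 * int (card M.I)) C}"
proof -
  interpret S: glued_shadow M L "U\<inverse>" s0 r0 by (rule swap_shadow)
  show ?thesis
  proof (rule bij_betwI[of _ _ _ S.transfer])
    show "S.transfer (transfer C) = C" if "C \<in> {C. L.jacobi_coeffs (K + int (card L.I)) (h + 3 * int (card L.I)) C}" for C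
      using transfer_swap[OF L.jacobi_coeffs_theta] that by blast
    show "transfer (S.transfer C) = C" if "C \<in> {C. M.jacobi_coeffs (K + int (card M.I)) (h + 3 * int (card M.I)) C}" for C
      using S.transfer_swap[OF M.jacobi_coeffs_theta] that by (auto simp: converse_converse)
  qed (use jacobi_coeffs_transfer S.jacobi_coeffs_transfer in auto)
qed

definition jacobi_iso :: "int \<Rightarrow> (complex \<times> (complex ^ 'a) \<Rightarrow> complex) \<Rightarrow> complex \<times> (complex ^ 'b) \<Rightarrow> complex" where
  "jacobi_iso h = M.jacobi_series \<circ> transfer \<circ> L.coefficients (h + 3 * int (card L.I))"

lemma jacobi_iso_series:
  "L.theta_coeffs (h + 3 * int (card L.I)) C \<Longrightarrow> jacobi_iso h (L.jacobi_series C) = M.jacobi_series (transfer C)"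
  by (simp add: jacobi_iso_def L.coefficients_jacobi_series)

lemma floor_weight: "\<lfloor>2 * (k + of_nat n / 2)\<rfloor> = \<lfloor>2 * k :: rat\<rfloor> + int n"
proof -
  have "2 * (k + of_nat n / 2) = 2 * k + of_int (int n)" by simp
  then show ?thesis by (simp only: floor_add_int)
qed

theorem complex_linear_iso_jacobi_iso:
  "complex_linear_iso
     (jacobi_forms L (k + of_nat (rank_of L) / 2) (h + 3 * int (rank_of L)))
     (jacobi_forms M (k + of_nat (rank_of M) / 2) (h + 3 * int (rank_of M))) (jacobi_iso h)"
  unfolding complex_linear_iso_def
proof (intro conjI ballI allI)
  let ?hL = "h + 3 * int (card L.I)"
  let ?V = "jacobi_forms L (k + of_nat (rank_of L) / 2) (h + 3 * int (rank_of L))"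
  show "bij_betw (jacobi_iso h) ?V (jacobi_forms M (k + of_nat (rank_of M) / 2) (h + 3 * int (rank_of M)))"
    unfolding jacobi_iso_def rank_of_def
    using bij_betw_trans[OF bij_betw_trans[OF L.bij_betw_coefficients[of ?hL "k + of_nat (card L.I) / 2", unfolded floor_weight]
        bij_betw_transfer] M.bij_betw_jacobi_series[where k = "k + of_nat (card M.I) / 2", unfolded floor_weight]]
    by (simp only: comp_assoc)
  have E: "\<exists>C. L.theta_coeffs ?hL C \<and> f = L.jacobi_series C" if "f \<in> ?V" for f
    using that unfolding rank_of_def by (elim L.jacobi_formE) (blast intro: L.jacobi_coeffs_theta)
  have lin: "jacobi_iso h (\<lambda>p. a * L.jacobi_series C p + L.jacobi_series C' p)
      = (\<lambda>p. a * jacobi_iso h (L.jacobi_series C) p + jacobi_iso h (L.jacobi_series C') p)"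
    if C: "L.theta_coeffs ?hL C" and C': "L.theta_coeffs ?hL C'" for a C C'
    unfolding jacobi_iso_series[OF C] jacobi_iso_series[OF C'] L.jacobi_series_linear[OF C C', symmetric]
      jacobi_iso_series[OF L.theta_coeffs_linear[OF C C']] transfer_linear
    by (rule M.jacobi_series_linear[OF theta_coeffs_transfer[OF C] theta_coeffs_transfer[OF C']])
  show "jacobi_iso h (\<lambda>p. f p + g p) = (\<lambda>p. jacobi_iso h f p + jacobi_iso h g p)" if "f \<in> ?V" "g \<in> ?V" for f g
    using E[OF that(1)] E[OF that(2)] lin[of _ _ 1] by auto
  show "jacobi_iso h (\<lambda>p. a * f p) = (\<lambda>p. a * jacobi_iso h f p)" if f: "f \<in> ?V" for a f
  proof -
    have "jacobi_iso h (\<lambda>p. 0) = (\<lambda>p. 0)"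
      using jacobi_iso_series[OF L.theta_coeffs_zero] by (simp add: transfer_zero L.jacobi_series_zero M.jacobi_series_zero)
    moreover obtain C where "L.theta_coeffs ?hL C" "f = L.jacobi_series C" using E[OF f] by blast
    ultimately show ?thesis using lin[of C "\<lambda>D r. 0" a] by (simp add: L.theta_coeffs_zero L.jacobi_series_zero)
  qed
qed

lemma jacobi_iso_coefficients:
  assumes \<phi>: "\<phi> \<in> jacobi_forms L (k + of_nat (rank_of L) / 2) (h + 3 * int (rank_of L))"
    and c: "fourier_expansion L (h + 3 * int (rank_of L)) \<phi> c"
    and c': "fourier_expansion M (h + 3 * int (rank_of M)) (jacobi_iso h \<phi>) c'"
    and p: "partners r s" and i: "(D + qf L r, r) \<in> fourier_index L (h + 3 * int (rank_of L))"
  shows "c' (D + qf M s) s = twist r s * c (D + qf L r) r"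
proof -
  let ?hL = "h + 3 * int (card L.I)" and ?hM = "h + 3 * int (card M.I)"
  define C where "C = L.coeffs_of ?hL c"
  have tc: "L.theta_coeffs ?hL C" and eq: "\<phi> = L.jacobi_series C"
    using L.jacobi_form_coeffs[OF \<phi> c] L.jacobi_coeffs_theta unfolding C_def rank_of_def by blast+
  have C': "M.coeffs_of ?hM c' = transfer C"
    using c' by (intro M.coeffs_unique[OF _ theta_coeffs_transfer[OF tc], of "jacobi_iso h \<phi>"])
      (simp_all add: eq jacobi_iso_series[OF tc] rank_of_def)
  have i': "(D + qf L r, r) \<in> fourier_index L ?hL" using i by (simp add: rank_of_def)
  then have "(D + qf M s, s) \<in> fourier_index M ?hM"
    using partners_shadow[OF p] fourier_index_partners[OF p] unfolding L.fourier_index_iff M.fourier_index_iff by blast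
  then have "c' (D + qf M s) s = M.coeffs_of ?hM c' D s" by (simp add: M.coeffs_of_def)
  also have "\<dots> = twist r s * C D r" unfolding C' by (rule transfer_eq[OF tc p])
  also have "C D r = c (D + qf L r) r" using i' by (simp add: C_def L.coeffs_of_def)
  finally show ?thesis .
qed

end

section \<open>The isomorphism attached to an isomorphism of bilinear modules\<close>

theorem theorem2p5:
  fixes L1 :: "'m::finite int_lattice" and L2 :: "'n::finite int_lattice"
    and \<gamma> :: "(rat ^ 'm) set \<Rightarrow> (rat ^ 'n) set"
  assumes "symmetric_form L1" and "positive_definite L1"
    and "symmetric_form L2" and "positive_definite L2"
    and "bilinear_module_iso L1 L2 \<gamma>"
  shows "\<exists>\<rho>\<in>glue_shadow L1 L2 \<gamma>. \<forall>(k::rat) (h::int). 2 * k \<in> \<int> \<longrightarrow>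
    (\<exists>\<Phi>. complex_linear_iso
            (jacobi_forms L1 (k + of_nat (rank_of L1) / 2) (h + 3 * int (rank_of L1)))
            (jacobi_forms L2 (k + of_nat (rank_of L2) / 2) (h + 3 * int (rank_of L2))) \<Phi> \<and>
         induced_by L1 L2 \<gamma> \<rho> (k + of_nat (rank_of L1) / 2)
            (h + 3 * int (rank_of L1)) (h + 3 * int (rank_of L2)) \<Phi>)"
proof -
  interpret glued_lattices L1 L2 "glue L1 L2 \<gamma>"
    by (rule glued_lattices_glue) (use assms in \<open>auto simp: definite_lattice_def\<close>)
  obtain r0 s0 where rs: "r0 \<in> scalars L1" "s0 \<in> scalars L2"
    "\<forall>(x, y)\<in>glue L1 L2 \<gamma>. (bil L1 r0 x - bil L2 s0 y) - (qf L1 x - qf L2 y) \<in> \<int>"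
    using unimodular_shadow_exists by blast
  interpret glued_shadow L1 L2 "glue L1 L2 \<gamma>" r0 s0
    by unfold_locales (use rs in auto)
  show ?thesis
  proof (intro bexI[of _ "(r0, s0)"] allI impI exI conjI)
    fix k :: rat and h :: int
    show "complex_linear_iso
            (jacobi_forms L1 (k + of_nat (rank_of L1) / 2) (h + 3 * int (rank_of L1)))
            (jacobi_forms L2 (k + of_nat (rank_of L2) / 2) (h + 3 * int (rank_of L2))) (jacobi_iso h)"
      by (rule complex_linear_iso_jacobi_iso)
    show "induced_by L1 L2 \<gamma> (r0, s0) (k + of_nat (rank_of L1) / 2)
            (h + 3 * int (rank_of L1)) (h + 3 * int (rank_of L2)) (jacobi_iso h)"
      unfolding induced_by_def Let_def
    proof (intro ballI allI impI, clarify)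
      fix \<phi> c c' x y D
      assume as: "\<phi> \<in> jacobi_forms L1 (k + of_nat (rank_of L1) / 2) (h + 3 * int (rank_of L1))"
        "fourier_expansion L1 (h + 3 * int (rank_of L1)) \<phi> c"
        "fourier_expansion L2 (h + 3 * int (rank_of L2)) (jacobi_iso h \<phi>) c'"
        "(x, y) \<in> glue L1 L2 \<gamma>"
        "(D + qf L1 (fst (r0, s0) + x), fst (r0, s0) + x) \<in> fourier_index L1 (h + 3 * int (rank_of L1))"
      then have "partners (r0 + x) (s0 + y)" by (simp add: partners_def)
      from jacobi_iso_coefficients[OF as(1-3) this] as(5)
      show "c' (D + qf L2 (snd (r0, s0) + y)) (snd (r0, s0) + y)
        = ee (of_rat (qf L1 x - qf L2 y)) * c (D + qf L1 (fst (r0, s0) + x)) (fst (r0, s0) + x)"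
        by (simp add: twist_def)
    qed
  qed (use rs in \<open>auto simp: glue_shadow_def\<close>)
qed

end
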